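(* (i) Let $\left((F,\nu,M),[\,,]_{F},\rho\right)$ be a Lie algebroid over $M$, $(E,\pi,M)$ a vector bundle with dual $\varpi:E^{*}\to M$, and $\rho\Gamma$ a $\rho$-connection for $E^{*}$. Let $\mathring D$ be a distinguished linear $\rho$-connection for the generalized tangent bundle $\rho TE^{*}\to E^{*}$ with components $(\rho\mathring H^{\alpha}_{\beta\gamma},\rho\mathring H^{a}_{b\gamma},\rho\mathring V^{\alpha c}_{\beta},\rho\mathring V^{ac}_{b})$ and let $G=g_{\alpha\beta}\,d\tilde z^{\alpha}\otimes d\tilde z^{\beta}+g^{ab}\,\delta\tilde p_a\otimes\delta\tilde p_b$ be a (pseudo)metrical structure. Then the local functions $$\begin{aligned} \rho H^{\alpha}_{\beta\gamma}&=\rho\mathring H^{\alpha}_{\beta\gamma}+\tfrac12\tilde g^{\alpha\varepsilon}\,g_{\varepsilon\beta\overset{0}{|}\gamma},& \rho H^{a}_{b\gamma}&=\rho\mathring H^{a}_{b\gamma}+\tfrac12\tilde g_{be}\,g^{ea}{}_{\overset{0}{|}\gamma},\\ \rho V^{\alpha c}_{\beta}&=\rho\mathring V^{\alpha c}_{\beta}+\tfrac12\tilde g^{\alpha\varepsilon}\,g_{\varepsilon\beta}\overset{0}{|}{}^{c},& \rho V^{ac}_{b}&=\rho\mathring V^{ac}_{b}+\tfrac12\tilde g_{be}\,g^{ea}\overset{0}{|}{}^{c} \end{aligned}$$ are the components of a distinguished linear $\rho$-connection $D$ with $D_XG=0$ for every section $X$ of $\rho TE^{*}$. (ii) In the classical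 case $F=TM$, $\rho=\mathrm{Id}_{TM}$, with the coordinate frames $\partial/\partial x^{i}$ of $TM$, where $\rho TE^{*}$ is identified with $TE^{*}$, these formulas become $$\begin{aligned} H^{i}_{jk}&=\mathring H^{i}_{jk}+\tfrac12\tilde g^{il}\,g_{lj\overset{0}{|}k},& H^{a}_{bk}&=\mathring H^{a}_{bk}+\tfrac12\tilde g_{be}\,g^{ea}{}_{\overset{0}{|}k},\\ V^{ic}_{j}&=\mathring V^{ic}_{j}+\tfrac12\tilde g^{il}\,g_{lj}\overset{0}{|}{}^{c},& V^{ac}_{b}&=\mathring V^{ac}_{b}+\tfrac12\tilde g_{be}\,g^{ea}\overset{0}{|}{}^{c}, \end{aligned}$$ and they are the components of a distinguished linear connection $D$ on $TE^{*}$ with $D_XG=0$ for every vector field $X$ on $E^{*}$.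
   Context: All manifolds, bundles and maps are smooth; repeated indices are summed. Local data: $(t_\alpha)$ is a local frame of the Lie algebroid $F$, $\rho(t_\alpha)=\rho^{i}_{\alpha}\frac{\partial}{\partial x^{i}}$. $(x^i,p_a)$ are vector bundle coordinates on $E^{*}$. $T_\alpha$ is the local frame of $\varpi^{*}F\to E^{*}$ induced by $t_\alpha$. Greek indices run over $1,\dots,\mathrm{rank}\,F$, $i,j,k,l$ over $1,\dots,\dim M$, and $a,b,c,d,e$ over $1,\dots,\mathrm{rank}\,E$. Generalized tangent bundle: $\rho TE^{*}$ is the vector subbundle of $\varpi^{*}F\oplus TE^{*}$ locally generated by the linearly independent sections $\tilde\partial_\alpha=T_\alpha\oplus(\rho^{i}_{\alpha}\circ\varpi)\frac{\partial}{\partial x^{i}}$ and $\dot{\tilde\partial}{}^{a}=0\oplus\frac{\partial}{\partial p_a}$. Its anchor $\tilde\rho:\rho TE^{*}\to TE^{*}$ is $\tilde\rho(Z^{\alpha}\tilde\partial_\alpha+Y_a\dot{\tilde\partial}{}^{a})=Z^{\alpha}(\rho^{i}_{\alpha}\circ\varpi)\frac{\partial}{\partial x^{i}}+Y_a\frac{\partial}{\partial p_a}$. The vertical subbundle is locally spanned by the $\dot{\tilde\partial}{}^{a}$. $\rho$-connection: a vector bundle morphism $\rho\Gamma$ over $\mathrm{Id}_{E^*}$ from $\rho TE^{*}$ to its vertical subbundle restricting to the identity on the vertical subbundle, written locally $Z^{\alpha}\tilde\partial_\alpha+Y_b\dot{\tilde\partial}{}^{b}\mapsto(Y_b-\rho\Gamma_{b\alpha}Z^{\alpha})\dot{\tilde\partial}{}^{b}$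 (components $\Gamma_{bi}$ in the classical case). Its kernel is the horizontal subbundle, locally spanned by $\tilde\delta_\alpha=\tilde\partial_\alpha+\rho\Gamma_{b\alpha}\dot{\tilde\partial}{}^{b}$ (in the classical case $\delta_i=\frac{\partial}{\partial x^i}+\Gamma_{bi}\frac{\partial}{\partial p_b}$). $(\tilde\delta_\alpha,\dot{\tilde\partial}{}^{a})$ is the adapted base; $(d\tilde z^{\alpha},\delta\tilde p_a)$ denotes its dual frame. Distinguished linear $\rho$-connection: a covariant derivative $(X,T)\mapsto D_XT$ on the tensor algebra of $\rho TE^{*}$, $X\in\Gamma(\rho TE^{*})$ ($C^\infty(E^* )$-linear in $X$, additive in $T$, $D_Xf=\tilde\rho(X)f$ on functions, a derivation of the tensor product commuting with contractions), such that $D_X$ maps horizontal sections to horizontal sections and vertical sections to vertical sections. Its components are defined by $D_{\tilde\delta_\gamma}\tilde\delta_\beta=\rho H^{\alpha}_{\beta\gamma}\tilde\delta_\alpha$, $D_{\tilde\delta_\gamma}\dot{\tilde\partial}{}^{a}=\rho H^{a}_{b\gamma}\dot{\tilde\partial}{}^{b}$, $D_{\dot{\tilde\partial}{}^{c}}\tilde\delta_\beta=\rho V^{\alpha c}_{\beta}\tilde\delta_\alpha$, $D_{\dot{\tilde\partial}{}^{c}}\dot{\tilde\partial}{}^{a}=\rho V^{ac}_{b}\dot{\tilde\partial}{}^{b}$; in the classical case they are written $H^{i}_{jk},H^{a}_{bk},V^{ic}_{j},V^{ac}_{b}$ and $D$ is called a distinguished linear connection. That given local functions (one family for each choice of charts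 and frames) "are the components" of such a connection means that there is a globally defined $D$ having these components in every choice. Pseudometrical structure: a tensor field $G=g_{\alpha\beta}\,d\tilde z^{\alpha}\otimes d\tilde z^{\beta}+g^{ab}\,\delta\tilde p_a\otimes\delta\tilde p_b$ with symmetric components and with $\|g_{\alpha\beta}\|$ and $\|g^{ab}\|$ nondegenerate at every point of $E^*$; it is a metrical structure if moreover these matrices have constant signature. "(Pseudo)" means that the statement holds both for pseudometrical and for metrical structures. $\|\tilde g^{\alpha\beta}\|=\|g_{\alpha\beta}\|^{-1}$ and $\|\tilde g_{ab}\|=\|g^{ab}\|^{-1}$. Covariant derivatives with respect to $\mathring D$: $g_{\varepsilon\beta\overset{0}{|}\gamma}=\tilde\rho(\tilde\delta_\gamma)g_{\varepsilon\beta}-\rho\mathring H^{\theta}_{\varepsilon\gamma}g_{\theta\beta}-\rho\mathring H^{\theta}_{\beta\gamma}g_{\varepsilon\theta}$; $g^{ea}{}_{\overset{0}{|}\gamma}=\tilde\rho(\tilde\delta_\gamma)g^{ea}-\rho\mathring H^{e}_{d\gamma}g^{da}-\rho\mathring H^{a}_{d\gamma}g^{ed}$; $g_{\varepsilon\beta}\overset{0}{|}{}^{c}=\tilde\rho(\dot{\tilde\partial}{}^{c})g_{\varepsilon\beta}-\rho\mathring V^{\theta c}_{\varepsilon}g_{\theta\beta}-\rho\mathring V^{\theta c}_{\beta}g_{\varepsilon\theta}$; $g^{ea}\overset{0}{|}{}^{c}=\tilde\rho(\dot{\tilde\partial}{}^{c})g^{ea}-\rho\mathring V^{ec}_{d}g^{da}-\rho\mathring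 V^{ac}_{d}g^{ed}$; and likewise with Latin indices in the classical case. *)

theory Defs
  imports "HOL-Analysis.Analysis" "HOL-Library.Function_Algebras"
begin

subsection \<open>Functions as a real vector space\<close>

text \<open>Covectors and tangent vectors are represented by real-valued functions, so the pointwise
  vector space structure on functions is needed.\<close>

instantiation "fun" :: (type, scaleR) scaleR
begin

definition scaleR_fun_def: "c *\<^sub>R f = (\<lambda>x. c *\<^sub>R f x)"

instance ..

end

instance "fun" :: (type, real_vector) real_vector
  by standard (simp_all add: scaleR_fun_def plus_fun_def scaleR_add_right scaleR_add_left)


subsection \<open>Smooth functions on open subsets of Euclidean space\<close>

text \<open>Points of n-dimensional Euclidean space are functions on the naturals that vanish from
  index n on, as in the library's \<^const>\<open>Euclidean_space\<close>. All index ranges start at 0;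
  dimensions and ranks may be 0. A function is of class C k on an open set if its iterated
  partial derivatives up to order k exist and are continuous.\<close>

definition partial_deriv :: "nat \<Rightarrow> ((nat \<Rightarrow> real) \<Rightarrow> real) \<Rightarrow> (nat \<Rightarrow> real) \<Rightarrow> real" where
  "partial_deriv i f y = deriv (\<lambda>t. f (y(i := t))) (y i)"

fun Ck_on :: "nat \<Rightarrow> nat \<Rightarrow> (nat \<Rightarrow> real) set \<Rightarrow> ((nat \<Rightarrow> real) \<Rightarrow> real) \<Rightarrow> bool" where
  "Ck_on n 0 S f \<longleftrightarrow> continuous_on S f"
| "Ck_on n (Suc k) S f \<longleftrightarrow> continuous_on S f \<and>
     (\<forall>i<n. (\<forall>y\<in>S. (\<lambda>t. f (y(i := t))) differentiable at (y i)) \<and>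
            Ck_on n k S (partial_deriv i f))"

definition smooth_on :: "nat \<Rightarrow> (nat \<Rightarrow> real) set \<Rightarrow> ((nat \<Rightarrow> real) \<Rightarrow> real) \<Rightarrow> bool" where
  "smooth_on n S f \<longleftrightarrow> (\<forall>k. Ck_on n k S f)"


subsection \<open>Smooth manifolds\<close>

text \<open>A chart is a pair of its domain and its coordinate map. The points and the topology of a
  manifold are determined by its atlas.\<close>

type_synonym 'm chart = "'m set \<times> ('m \<Rightarrow> nat \<Rightarrow> real)"

record 'm mfd =
  mdim :: nat
  charts :: "'m chart set"

definition pts :: "'m mfd \<Rightarrow> 'm set" where
  "pts M = \<Union> (fst ` charts M)"

definition in_chart :: "'m chart \<Rightarrow> ('m \<Rightarrow> real) \<Rightarrow> (nat \<Rightarrow> real) \<Rightarrow> real" where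
  "in_chart c f = (\<lambda>y. f (inv_into (fst c) (snd c) y))"

definition is_chart :: "nat \<Rightarrow> 'm chart \<Rightarrow> bool" where
  "is_chart n c \<longleftrightarrow> inj_on (snd c) (fst c) \<and> openin (Euclidean_space n) (snd c ` fst c)"

definition chart_compat :: "nat \<Rightarrow> 'm chart \<Rightarrow> 'm chart \<Rightarrow> bool" where
  "chart_compat n c d \<longleftrightarrow>
     openin (Euclidean_space n) (snd c ` (fst c \<inter> fst d)) \<and>
     (\<forall>i<n. smooth_on n (snd c ` (fst c \<inter> fst d)) (in_chart c (\<lambda>x. snd d x i)))"

definition mtop :: "'m mfd \<Rightarrow> 'm topology" where
  "mtop M = topology (\<lambda>W. W \<subseteq> pts M \<and>
     (\<forall>c\<in>charts M. openin (Euclidean_space (mdim M)) (snd c ` (W \<inter> fst c))))"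

text \<open>The atlas is required to be maximal, so that \<^term>\<open>charts M\<close> consists of all charts
  of the smooth structure.\<close>

definition smooth_manifold :: "'m mfd \<Rightarrow> bool" where
  "smooth_manifold M \<longleftrightarrow>
     (\<forall>c\<in>charts M. is_chart (mdim M) c) \<and>
     (\<forall>c\<in>charts M. \<forall>d\<in>charts M. chart_compat (mdim M) c d) \<and>
     (\<forall>c. is_chart (mdim M) c \<and> fst c \<subseteq> pts M \<and>
        (\<forall>d\<in>charts M. chart_compat (mdim M) c d \<and> chart_compat (mdim M) d c) \<longrightarrow> c \<in> charts M) \<and>
     Hausdorff_space (mtop M) \<and> second_countable (mtop M)"

definition smooth_fun :: "'m mfd \<Rightarrow> 'm set \<Rightarrow> ('m \<Rightarrow> real) \<Rightarrow> bool" where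
  "smooth_fun M W f \<longleftrightarrow>
     (\<forall>c\<in>charts M. smooth_on (mdim M) (snd c ` (W \<inter> fst c)) (in_chart c f))"

definition smooth_near :: "'m mfd \<Rightarrow> 'm \<Rightarrow> ('m \<Rightarrow> real) \<Rightarrow> bool" where
  "smooth_near M x f \<longleftrightarrow> (\<exists>W. openin (mtop M) W \<and> x \<in> W \<and> smooth_fun M W f)"

definition eq_near :: "'m mfd \<Rightarrow> 'm \<Rightarrow> ('m \<Rightarrow> 'a) \<Rightarrow> ('m \<Rightarrow> 'a) \<Rightarrow> bool" where
  "eq_near M x u v \<longleftrightarrow> (\<exists>W. openin (mtop M) W \<and> x \<in> W \<and> (\<forall>z\<in>W. u z = v z))"

text \<open>A tangent vector at a point is a directional derivative, acting on the functions that are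
  defined and smooth near the point (and 0 on all other functions, to make the representation
  unique).\<close>

type_synonym 'm tvec = "('m \<Rightarrow> real) \<Rightarrow> real"

definition coord_vec :: "'m mfd \<Rightarrow> 'm chart \<Rightarrow> nat \<Rightarrow> 'm \<Rightarrow> 'm tvec" where
  "coord_vec M c i x =
     (\<lambda>f. if smooth_near M x f then partial_deriv i (in_chart c f) (snd c x) else 0)"

definition tspace :: "'m mfd \<Rightarrow> 'm \<Rightarrow> 'm tvec set" where
  "tspace M x = span {coord_vec M c i x | c i. c \<in> charts M \<and> x \<in> fst c \<and> i < mdim M}"


subsection \<open>Vector bundles\<close>

text \<open>The fibres of a vector bundle are subspaces of one ambient vector space type, which need not
  be finite-dimensional and carries no topology (any vector bundle is of this form, e.g. inside the
  direct sum of its fibres). The smooth structure is the set of all smooth local frames; a local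
  frame is a pair of its domain and the family of its sections.\<close>

type_synonym ('m, 'v) frame = "'m set \<times> (nat \<Rightarrow> 'm \<Rightarrow> 'v)"

record ('m, 'v) vbundle =
  rank :: nat
  fib :: "'m \<Rightarrow> 'v set"
  frames :: "('m, 'v) frame set"

definition local_frame ::
  "'m mfd \<Rightarrow> nat \<Rightarrow> ('m \<Rightarrow> 'v::real_vector set) \<Rightarrow> ('m, 'v) frame \<Rightarrow> bool" where
  "local_frame M R V f \<longleftrightarrow> openin (mtop M) (fst f) \<and>
     (\<forall>x\<in>fst f. inj_on (\<lambda>a. snd f a x) {..<R} \<and>
        independent ((\<lambda>a. snd f a x) ` {..<R}) \<and> span ((\<lambda>a. snd f a x) ` {..<R}) = V x)"

text \<open>The dual frame: \<open>coframe R s a x v\<close> is the a-th coordinate of v in the basis s at x.\<close>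

definition coframe :: "nat \<Rightarrow> (nat \<Rightarrow> 'm \<Rightarrow> 'v::real_vector) \<Rightarrow> nat \<Rightarrow> 'm \<Rightarrow> 'v \<Rightarrow> real" where
  "coframe R s a x v = representation ((\<lambda>b. s b x) ` {..<R}) v (s a x)"

definition frame_compat ::
  "'m mfd \<Rightarrow> nat \<Rightarrow> ('m, 'v::real_vector) frame \<Rightarrow> ('m, 'v) frame \<Rightarrow> bool" where
  "frame_compat M R f g \<longleftrightarrow>
     (\<forall>a<R. \<forall>b<R. smooth_fun M (fst f \<inter> fst g) (\<lambda>x. coframe R (snd f) a x (snd g b x)))"

text \<open>All local frames that are smoothly related to a generating set of local frames.\<close>

definition gen_frames ::
  "'m mfd \<Rightarrow> nat \<Rightarrow> ('m \<Rightarrow> 'v::real_vector set) \<Rightarrow> ('m, 'v) frame set \<Rightarrow> ('m, 'v) frame set" where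
  "gen_frames M R V \<F> =
     {f. local_frame M R V f \<and> (\<forall>g\<in>\<F>. frame_compat M R f g \<and> frame_compat M R g f)}"

definition vector_bundle :: "'m mfd \<Rightarrow> ('m, 'v::real_vector) vbundle \<Rightarrow> bool" where
  "vector_bundle M B \<longleftrightarrow>
     \<Union> (fst ` frames B) = pts M \<and>
     (\<forall>f\<in>frames B. local_frame M (rank B) (fib B) f) \<and>
     (\<forall>f\<in>frames B. \<forall>g\<in>frames B. frame_compat M (rank B) f g) \<and>
     gen_frames M (rank B) (fib B) (frames B) \<subseteq> frames B"

definition smooth_section ::
  "'m mfd \<Rightarrow> ('m, 'v::real_vector) vbundle \<Rightarrow> 'm set \<Rightarrow> ('m \<Rightarrow> 'v) \<Rightarrow> bool" where
  "smooth_section M B W u \<longleftrightarrow> (\<forall>x\<in>W. u x \<in> fib B x) \<and>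
     (\<forall>f\<in>frames B. \<forall>a<rank B.
        smooth_fun M (W \<inter> fst f) (\<lambda>x. coframe (rank B) (snd f) a x (u x)))"

text \<open>Global sections; they are set to 0 outside the manifold so that equality of sections is
  equality of functions.\<close>

definition sections :: "'m mfd \<Rightarrow> ('m, 'v::real_vector) vbundle \<Rightarrow> ('m \<Rightarrow> 'v) set" where
  "sections M B = {u. smooth_section M B (pts M) u \<and> (\<forall>x. x \<notin> pts M \<longrightarrow> u x = 0)}"

text \<open>Vector bundle morphisms over the identity.\<close>

definition vb_morphism ::
  "'m mfd \<Rightarrow> ('m, 'v::real_vector) vbundle \<Rightarrow> ('m, 'w::real_vector) vbundle \<Rightarrow>
   ('m \<Rightarrow> 'v \<Rightarrow> 'w) \<Rightarrow> bool" where
  "vb_morphism M B B' h \<longleftrightarrow>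
     (\<forall>x\<in>pts M. (\<forall>v\<in>fib B x. h x v \<in> fib B' x) \<and>
        (\<forall>v\<in>fib B x. \<forall>w\<in>fib B x. h x (v + w) = h x v + h x w) \<and>
        (\<forall>v\<in>fib B x. \<forall>c. h x (c *\<^sub>R v) = c *\<^sub>R h x v)) \<and>
     (\<forall>f\<in>frames B. \<forall>a<rank B. smooth_section M B' (fst f) (\<lambda>x. h x (snd f a x)))"

definition tangent_bundle :: "'m mfd \<Rightarrow> ('m, 'm tvec) vbundle" where
  "tangent_bundle M = \<lparr>rank = mdim M, fib = tspace M,
     frames = gen_frames M (mdim M) (tspace M) {(fst c, coord_vec M c) | c. c \<in> charts M}\<rparr>"

definition lie_algebroid ::
  "'m mfd \<Rightarrow> ('m, 'f::real_vector) vbundle \<Rightarrow> (('m \<Rightarrow> 'f) \<Rightarrow> ('m \<Rightarrow> 'f) \<Rightarrow> 'm \<Rightarrow> 'f) \<Rightarrow>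
   ('m \<Rightarrow> 'f \<Rightarrow> 'm tvec) \<Rightarrow> bool" where
  "lie_algebroid M F br \<rho> \<longleftrightarrow>
     vector_bundle M F \<and> vb_morphism M F (tangent_bundle M) \<rho> \<and>
     (\<forall>u\<in>sections M F. \<forall>v\<in>sections M F. br u v \<in> sections M F) \<and>
     (\<forall>u\<in>sections M F. \<forall>v\<in>sections M F. \<forall>w\<in>sections M F. \<forall>c::real.
        br (u + w) v = br u v + br w v \<and> br (c *\<^sub>R u) v = c *\<^sub>R br u v) \<and>
     (\<forall>u\<in>sections M F. \<forall>v\<in>sections M F. br u v = - br v u) \<and>
     (\<forall>u\<in>sections M F. \<forall>v\<in>sections M F. \<forall>w\<in>sections M F.
        br u (br v w) + br v (br w u) + br w (br u v) = 0) \<and>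
     (\<forall>u\<in>sections M F. \<forall>v\<in>sections M F. \<forall>f. smooth_fun M (pts M) f \<longrightarrow>
        br u (\<lambda>x. f x *\<^sub>R v x) = (\<lambda>x. f x *\<^sub>R br u v x + \<rho> x (u x) f *\<^sub>R v x)) \<and>
     (\<forall>u\<in>sections M F. \<forall>v\<in>sections M F. \<forall>f. smooth_fun M (pts M) f \<longrightarrow>
        (\<forall>x\<in>pts M. \<rho> x (br u v x) f =
           \<rho> x (u x) (\<lambda>y. \<rho> y (v y) f) - \<rho> x (v x) (\<lambda>y. \<rho> y (u y) f)))"


subsection \<open>The total space of the dual bundle\<close>

text \<open>A covector on V is extended by 0 outside V, to make the representation unique.\<close>

definition dual_space :: "'v::real_vector set \<Rightarrow> ('v \<Rightarrow> real) set" where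
  "dual_space V = {\<omega>. (\<forall>v\<in>V. \<forall>w\<in>V. \<omega> (v + w) = \<omega> v + \<omega> w) \<and>
     (\<forall>v\<in>V. \<forall>c. \<omega> (c *\<^sub>R v) = c * \<omega> v) \<and> (\<forall>v. v \<notin> V \<longrightarrow> \<omega> v = 0)}"

type_synonym ('m, 'v) copt = "'m \<times> ('v \<Rightarrow> real)"

text \<open>Vector bundle coordinates: the coordinate with index i < dim M is \<open>x\<^sup>i\<close>, the one with
  index dim M + a is \<open>p\<^sub>a\<close>.\<close>

definition dual_chart ::
  "'m mfd \<Rightarrow> ('m, 'v::real_vector) vbundle \<Rightarrow> 'm chart \<Rightarrow> ('m, 'v) frame \<Rightarrow> ('m, 'v) copt chart" where
  "dual_chart M E c e =
     ({(x, \<omega>). x \<in> fst c \<inter> fst e \<and> \<omega> \<in> dual_space (fib E x)},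
      \<lambda>(x, \<omega>) k. if k < mdim M then snd c x k
                 else if k < mdim M + rank E then \<omega> (snd e (k - mdim M) x) else 0)"

text \<open>The bundle charts form a smooth atlas, not a maximal one; the notions used below do not
  depend on the choice of the atlas within the smooth structure.\<close>

definition dual_mfd :: "'m mfd \<Rightarrow> ('m, 'v::real_vector) vbundle \<Rightarrow> ('m, 'v) copt mfd" where
  "dual_mfd M E = \<lparr>mdim = mdim M + rank E,
     charts = {dual_chart M E c e | c e. c \<in> charts M \<and> e \<in> frames E}\<rparr>"


subsection \<open>The generalized tangent bundle\<close>

text \<open>The following record collects what is used of \<open>\<rho>TE\<^sup>*\<close>, and of \<open>TE\<^sup>*\<close> in the
  classical case: a vector bundle over \<open>E\<^sup>*\<close>, its anchor to \<open>TE\<^sup>*\<close>, the numbers of Greek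
  (\<open>hrank\<close>) and Latin (\<open>vrank\<close>) indices, and, for every choice of charts and frames, the domain
  together with the two families of natural base sections.\<close>

type_synonym ('q, 'w) nat_base = "'q set \<times> (nat \<Rightarrow> 'q \<Rightarrow> 'w) \<times> (nat \<Rightarrow> 'q \<Rightarrow> 'w)"

record ('q, 'w) gen_tangent =
  base :: "'q mfd"
  gbundle :: "('q, 'w) vbundle"
  anchor :: "'w \<Rightarrow> 'q tvec"
  hrank :: nat
  vrank :: nat
  nat_bases :: "('q, 'w) nat_base set"

definition ndom :: "('q, 'w) nat_base \<Rightarrow> 'q set" where
  "ndom N = fst N"

definition del_h :: "('q, 'w) nat_base \<Rightarrow> nat \<Rightarrow> 'q \<Rightarrow> 'w" where
  "del_h N = fst (snd N)"

definition del_v :: "('q, 'w) nat_base \<Rightarrow> nat \<Rightarrow> 'q \<Rightarrow> 'w" where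
  "del_v N = snd (snd N)"

definition join_frame :: "nat \<Rightarrow> (nat \<Rightarrow> 'q \<Rightarrow> 'w) \<Rightarrow> (nat \<Rightarrow> 'q \<Rightarrow> 'w) \<Rightarrow> nat \<Rightarrow> 'q \<Rightarrow> 'w" where
  "join_frame m h v k = (if k < m then h k else v (k - m))"

definition anchor_comp ::
  "('m \<Rightarrow> 'f \<Rightarrow> 'm tvec) \<Rightarrow> 'm chart \<Rightarrow> ('m, 'f) frame \<Rightarrow> nat \<Rightarrow> nat \<Rightarrow> 'm \<Rightarrow> real" where
  "anchor_comp \<rho> c t \<alpha> i x = \<rho> x (snd t \<alpha> x) (\<lambda>y. snd c y i)"

definition gtb_base ::
  "'m mfd \<Rightarrow> ('m, 'v::real_vector) vbundle \<Rightarrow> ('m \<Rightarrow> 'f::real_vector \<Rightarrow> 'm tvec) \<Rightarrow>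
   'm chart \<Rightarrow> ('m, 'v) frame \<Rightarrow> ('m, 'f) frame \<Rightarrow>
   (('m, 'v) copt, 'f \<times> ('m, 'v) copt tvec) nat_base" where
  "gtb_base M E \<rho> c e t =
     ({q \<in> fst (dual_chart M E c e). fst q \<in> fst t},
      \<lambda>\<alpha> q. (snd t \<alpha> (fst q),
             \<Sum>i<mdim M. anchor_comp \<rho> c t \<alpha> i (fst q) *\<^sub>R
                coord_vec (dual_mfd M E) (dual_chart M E c e) i q),
      \<lambda>a q. (0, coord_vec (dual_mfd M E) (dual_chart M E c e) (mdim M + a) q))"

definition gtb_bases ::
  "'m mfd \<Rightarrow> ('m, 'v::real_vector) vbundle \<Rightarrow> ('m, 'f::real_vector) vbundle \<Rightarrow>
   ('m \<Rightarrow> 'f \<Rightarrow> 'm tvec) \<Rightarrow> (('m, 'v) copt, 'f \<times> ('m, 'v) copt tvec) nat_base set" where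
  "gtb_bases M E F \<rho> =
     {gtb_base M E \<rho> c e t | c e t. c \<in> charts M \<and> e \<in> frames E \<and> t \<in> frames F}"

text \<open>The span over all choices of charts and frames at q equals the span for any one of them.\<close>

definition gtb_fib ::
  "'m mfd \<Rightarrow> ('m, 'v::real_vector) vbundle \<Rightarrow> ('m, 'f::real_vector) vbundle \<Rightarrow>
   ('m \<Rightarrow> 'f \<Rightarrow> 'm tvec) \<Rightarrow> ('m, 'v) copt \<Rightarrow> ('f \<times> ('m, 'v) copt tvec) set" where
  "gtb_fib M E F \<rho> q =
     span ({del_h N \<alpha> q | N \<alpha>. N \<in> gtb_bases M E F \<rho> \<and> q \<in> ndom N \<and> \<alpha> < rank F} \<union>
           {del_v N a q | N a. N \<in> gtb_bases M E F \<rho> \<and> q \<in> ndom N \<and> a < rank E})"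

text \<open>\<open>\<rho>TE\<^sup>*\<close>. By the formula for the base sections its anchor
  \<open>Z\<^sup>\<alpha>\<partial>\<^sub>\<alpha> + Y\<^sub>a\<partial>\<^sup>a \<mapsto> Z\<^sup>\<alpha>\<rho>\<^sup>i\<^sub>\<alpha> \<partial>/\<partial>x\<^sup>i + Y\<^sub>a \<partial>/\<partial>p\<^sub>a\<close>
  is the projection to the second summand.\<close>

definition gtb ::
  "'m mfd \<Rightarrow> ('m, 'v::real_vector) vbundle \<Rightarrow> ('m, 'f::real_vector) vbundle \<Rightarrow>
   ('m \<Rightarrow> 'f \<Rightarrow> 'm tvec) \<Rightarrow> (('m, 'v) copt, 'f \<times> ('m, 'v) copt tvec) gen_tangent" where
  "gtb M E F \<rho> =
     \<lparr>base = dual_mfd M E,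
      gbundle = \<lparr>rank = rank F + rank E, fib = gtb_fib M E F \<rho>,
        frames = gen_frames (dual_mfd M E) (rank F + rank E) (gtb_fib M E F \<rho>)
          {(ndom N, join_frame (rank F) (del_h N) (del_v N)) | N. N \<in> gtb_bases M E F \<rho>}\<rparr>,
      anchor = snd,
      hrank = rank F, vrank = rank E,
      nat_bases = gtb_bases M E F \<rho>\<rparr>"

text \<open>\<open>TE\<^sup>*\<close> with the natural bases \<open>\<partial>/\<partial>x\<^sup>i\<close>, \<open>\<partial>/\<partial>p\<^sub>a\<close> of the
  bundle charts.\<close>

definition classical_base ::
  "'m mfd \<Rightarrow> ('m, 'v::real_vector) vbundle \<Rightarrow> 'm chart \<Rightarrow> ('m, 'v) frame \<Rightarrow>
   (('m, 'v) copt, ('m, 'v) copt tvec) nat_base" where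
  "classical_base M E c e =
     (fst (dual_chart M E c e),
      \<lambda>i. coord_vec (dual_mfd M E) (dual_chart M E c e) i,
      \<lambda>a. coord_vec (dual_mfd M E) (dual_chart M E c e) (mdim M + a))"

definition classical_tb ::
  "'m mfd \<Rightarrow> ('m, 'v::real_vector) vbundle \<Rightarrow> (('m, 'v) copt, ('m, 'v) copt tvec) gen_tangent" where
  "classical_tb M E =
     \<lparr>base = dual_mfd M E, gbundle = tangent_bundle (dual_mfd M E), anchor = (\<lambda>w. w),
      hrank = mdim M, vrank = rank E,
      nat_bases = {classical_base M E c e | c e. c \<in> charts M \<and> e \<in> frames E}\<rparr>"


subsection \<open>Connections and the adapted base\<close>

definition vfib :: "('q, 'w::real_vector) gen_tangent \<Rightarrow> 'q \<Rightarrow> 'w set" where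
  "vfib S q = span {del_v N a q | N a. N \<in> nat_bases S \<and> q \<in> ndom N \<and> a < vrank S}"

definition vertical_bundle :: "('q, 'w::real_vector) gen_tangent \<Rightarrow> ('q, 'w) vbundle" where
  "vertical_bundle S = \<lparr>rank = vrank S, fib = vfib S,
     frames = gen_frames (base S) (vrank S) (vfib S) {(ndom N, del_v N) | N. N \<in> nat_bases S}\<rparr>"

definition rho_connection ::
  "('q, 'w::real_vector) gen_tangent \<Rightarrow> ('q \<Rightarrow> 'w \<Rightarrow> 'w) \<Rightarrow> bool" where
  "rho_connection S \<Gamma> \<longleftrightarrow> vb_morphism (base S) (gbundle S) (vertical_bundle S) \<Gamma> \<and>
     (\<forall>q\<in>pts (base S). \<forall>v\<in>vfib S q. \<Gamma> q v = v)"

text \<open>The component \<open>\<Gamma>\<^sub>b\<^sub>\<alpha>\<close>, from \<open>\<partial>\<^sub>\<alpha> \<mapsto> - \<Gamma>\<^sub>b\<^sub>\<alpha> \<partial>\<^sup>b\<close>.\<close>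

definition conn_comp ::
  "('q, 'w::real_vector) gen_tangent \<Rightarrow> ('q \<Rightarrow> 'w \<Rightarrow> 'w) \<Rightarrow> ('q, 'w) nat_base \<Rightarrow>
   nat \<Rightarrow> nat \<Rightarrow> 'q \<Rightarrow> real" where
  "conn_comp S \<Gamma> N b \<alpha> q =
     - coframe (vrank S) (del_v N) b q (\<Gamma> q (del_h N \<alpha> q))"

definition delta ::
  "('q, 'w::real_vector) gen_tangent \<Rightarrow> ('q \<Rightarrow> 'w \<Rightarrow> 'w) \<Rightarrow> ('q, 'w) nat_base \<Rightarrow>
   nat \<Rightarrow> 'q \<Rightarrow> 'w" where
  "delta S \<Gamma> N \<alpha> q = del_h N \<alpha> q + (\<Sum>b<vrank S. conn_comp S \<Gamma> N b \<alpha> q *\<^sub>R del_v N b q)"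

text \<open>The dual \<open>(dz\<^sup>\<alpha>, \<delta>p\<^sub>a)\<close> of the adapted base.\<close>

definition dz ::
  "('q, 'w::real_vector) gen_tangent \<Rightarrow> ('q \<Rightarrow> 'w \<Rightarrow> 'w) \<Rightarrow> ('q, 'w) nat_base \<Rightarrow>
   nat \<Rightarrow> 'q \<Rightarrow> 'w \<Rightarrow> real" where
  "dz S \<Gamma> N \<alpha> =
     coframe (hrank S + vrank S) (join_frame (hrank S) (delta S \<Gamma> N) (del_v N)) \<alpha>"

definition dp ::
  "('q, 'w::real_vector) gen_tangent \<Rightarrow> ('q \<Rightarrow> 'w \<Rightarrow> 'w) \<Rightarrow> ('q, 'w) nat_base \<Rightarrow>
   nat \<Rightarrow> 'q \<Rightarrow> 'w \<Rightarrow> real" where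
  "dp S \<Gamma> N a =
     coframe (hrank S + vrank S) (join_frame (hrank S) (delta S \<Gamma> N) (del_v N)) (hrank S + a)"

definition hsections :: "('q, 'w::real_vector) gen_tangent \<Rightarrow> ('q \<Rightarrow> 'w \<Rightarrow> 'w) \<Rightarrow> ('q \<Rightarrow> 'w) set" where
  "hsections S \<Gamma> = {Y \<in> sections (base S) (gbundle S). \<forall>q\<in>pts (base S). \<Gamma> q (Y q) = 0}"

definition vsections :: "('q, 'w::real_vector) gen_tangent \<Rightarrow> ('q \<Rightarrow> 'w) set" where
  "vsections S = {Y \<in> sections (base S) (gbundle S). \<forall>q\<in>pts (base S). Y q \<in> vfib S q}"


subsection \<open>Tensor fields\<close>

text \<open>A tensor of type (k,l) on V is a multilinear function of k covectors and l vectors, given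
  as two lists, and 0 on all other arguments.\<close>

type_synonym ('q, 'w) tfield = "'q \<Rightarrow> ('w \<Rightarrow> real) list \<Rightarrow> 'w list \<Rightarrow> real"

definition tensor_on ::
  "'w::real_vector set \<Rightarrow> nat \<Rightarrow> nat \<Rightarrow> (('w \<Rightarrow> real) list \<Rightarrow> 'w list \<Rightarrow> real) \<Rightarrow> bool" where
  "tensor_on V k l \<tau> \<longleftrightarrow> (\<forall>ws vs.
     if length ws = k \<and> set ws \<subseteq> dual_space V \<and> length vs = l \<and> set vs \<subseteq> V
     then (\<forall>i<k. \<forall>\<omega>\<in>dual_space V. \<forall>\<eta>\<in>dual_space V. \<forall>c.
             \<tau> (ws[i := c *\<^sub>R \<omega> + \<eta>]) vs = c * \<tau> (ws[i := \<omega>]) vs + \<tau> (ws[i := \<eta>]) vs) \<and>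
          (\<forall>j<l. \<forall>v\<in>V. \<forall>w\<in>V. \<forall>c.
             \<tau> ws (vs[j := c *\<^sub>R v + w]) = c * \<tau> ws (vs[j := v]) + \<tau> ws (vs[j := w]))
     else \<tau> ws vs = 0)"

definition tensor_fields ::
  "'q mfd \<Rightarrow> ('q, 'w::real_vector) vbundle \<Rightarrow> nat \<Rightarrow> nat \<Rightarrow> ('q, 'w) tfield set" where
  "tensor_fields Q B k l = {T.
     (\<forall>q\<in>pts Q. tensor_on (fib B q) k l (T q)) \<and>
     (\<forall>q. q \<notin> pts Q \<longrightarrow> T q = 0) \<and>
     (\<forall>f\<in>frames B. \<forall>I J. length I = k \<and> set I \<subseteq> {..<rank B} \<and> length J = l \<and> set J \<subseteq> {..<rank B} \<longrightarrow>
        smooth_fun Q (fst f)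
          (\<lambda>q. T q (map (\<lambda>i. coframe (rank B) (snd f) i q) I) (map (\<lambda>j. snd f j q) J)))}"

definition fun_tensor :: "'q mfd \<Rightarrow> ('q \<Rightarrow> real) \<Rightarrow> ('q, 'w) tfield" where
  "fun_tensor Q f = (\<lambda>q ws vs. if q \<in> pts Q \<and> ws = [] \<and> vs = [] then f q else 0)"

definition sec_tensor :: "('q, 'w::real_vector) vbundle \<Rightarrow> ('q \<Rightarrow> 'w) \<Rightarrow> ('q, 'w) tfield" where
  "sec_tensor B Y = (\<lambda>q ws vs.
     if length ws = 1 \<and> set ws \<subseteq> dual_space (fib B q) \<and> vs = [] then hd ws (Y q) else 0)"

text \<open>The product of a field T of type (k,l) with a field T'.\<close>

definition tensor_prod ::
  "nat \<Rightarrow> nat \<Rightarrow> ('q, 'w) tfield \<Rightarrow> ('q, 'w) tfield \<Rightarrow> ('q, 'w) tfield" where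
  "tensor_prod k l T T' =
     (\<lambda>q ws vs. T q (take k ws) (take l vs) * T' q (drop k ws) (drop l vs))"

definition insert_at :: "nat \<Rightarrow> 'a \<Rightarrow> 'a list \<Rightarrow> 'a list" where
  "insert_at i x xs = take i xs @ x # drop i xs"

text \<open>Contraction of the i-th contravariant with the j-th covariant slot; the value does not
  depend on the basis of the fibre.\<close>

definition contract ::
  "('q, 'w::real_vector) vbundle \<Rightarrow> nat \<Rightarrow> nat \<Rightarrow> ('q, 'w) tfield \<Rightarrow> ('q, 'w) tfield" where
  "contract B i j T = (\<lambda>q ws vs.
     let \<B> = (SOME \<B>. independent \<B> \<and> span \<B> = fib B q)
     in \<Sum>b\<in>\<B>. T q (insert_at i (\<lambda>v. representation \<B> v b) ws) (insert_at j b vs))"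


subsection \<open>Distinguished linear connections\<close>

text \<open>\<open>D k l X T\<close> is the covariant derivative of a tensor field T of type (k,l).\<close>

type_synonym ('q, 'w) cov_deriv =
  "nat \<Rightarrow> nat \<Rightarrow> ('q \<Rightarrow> 'w) \<Rightarrow> ('q, 'w) tfield \<Rightarrow> ('q, 'w) tfield"

definition covariant_derivative ::
  "('q, 'w::real_vector) gen_tangent \<Rightarrow> ('q, 'w) cov_deriv \<Rightarrow> bool" where
  "covariant_derivative S D \<longleftrightarrow>
     (let Q = base S; B = gbundle S; \<X> = sections Q B; \<T> = tensor_fields Q B in
      (\<forall>k l. \<forall>X\<in>\<X>. \<forall>T\<in>\<T> k l. D k l X T \<in> \<T> k l) \<and>
      (\<forall>k l. \<forall>X\<in>\<X>. \<forall>Y\<in>\<X>. \<forall>T\<in>\<T> k l. D k l (X + Y) T = D k l X T + D k l Y T) \<and>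
      (\<forall>k l. \<forall>X\<in>\<X>. \<forall>T\<in>\<T> k l. \<forall>f. smooth_fun Q (pts Q) f \<longrightarrow>
         D k l (\<lambda>q. f q *\<^sub>R X q) T = (\<lambda>q. f q *\<^sub>R D k l X T q)) \<and>
      (\<forall>k l. \<forall>X\<in>\<X>. \<forall>T\<in>\<T> k l. \<forall>T'\<in>\<T> k l. D k l X (T + T') = D k l X T + D k l X T') \<and>
      (\<forall>X\<in>\<X>. \<forall>f. smooth_fun Q (pts Q) f \<longrightarrow>
         D 0 0 X (fun_tensor Q f) = fun_tensor Q (\<lambda>q. anchor S (X q) f)) \<and>
      (\<forall>k l k' l'. \<forall>X\<in>\<X>. \<forall>T\<in>\<T> k l. \<forall>T'\<in>\<T> k' l'.
         D (k + k') (l + l') X (tensor_prod k l T T') =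
           tensor_prod k l (D k l X T) T' + tensor_prod k l T (D k' l' X T')) \<and>
      (\<forall>k l. \<forall>i\<le>k. \<forall>j\<le>l. \<forall>X\<in>\<X>. \<forall>T\<in>\<T> (Suc k) (Suc l).
         D k l X (contract B i j T) = contract B i j (D (Suc k) (Suc l) X T)))"

text \<open>The derivative of a section, as a section.\<close>

definition cov_sec ::
  "('q, 'w::real_vector) gen_tangent \<Rightarrow> ('q, 'w) cov_deriv \<Rightarrow> ('q \<Rightarrow> 'w) \<Rightarrow> ('q \<Rightarrow> 'w) \<Rightarrow> 'q \<Rightarrow> 'w" where
  "cov_sec S D X Y = (THE Z. Z \<in> sections (base S) (gbundle S) \<and>
     D 1 0 X (sec_tensor (gbundle S) Y) = sec_tensor (gbundle S) Z)"

definition distinguished_connection ::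
  "('q, 'w::real_vector) gen_tangent \<Rightarrow> ('q \<Rightarrow> 'w \<Rightarrow> 'w) \<Rightarrow> ('q, 'w) cov_deriv \<Rightarrow> bool" where
  "distinguished_connection S \<Gamma> D \<longleftrightarrow> covariant_derivative S D \<and>
     (\<forall>X\<in>sections (base S) (gbundle S).
        (\<forall>Y\<in>hsections S \<Gamma>. cov_sec S D X Y \<in> hsections S \<Gamma>) \<and>
        (\<forall>Y\<in>vsections S. cov_sec S D X Y \<in> vsections S))"

text \<open>D acts on global sections; \<open>D\<^sub>x y = z\<close> at q for local sections x, y means that the
  value at q is z for all global sections agreeing with x and y near q. Such sections exist (cut
  off by a bump function) and the value does not depend on them.\<close>

definition local_cov ::
  "('q, 'w::real_vector) gen_tangent \<Rightarrow> ('q, 'w) cov_deriv \<Rightarrow> ('q \<Rightarrow> 'w) \<Rightarrow> ('q \<Rightarrow> 'w) \<Rightarrow>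
   'q \<Rightarrow> 'w \<Rightarrow> bool" where
  "local_cov S D x y q z \<longleftrightarrow>
     (\<forall>X\<in>sections (base S) (gbundle S). \<forall>Y\<in>sections (base S) (gbundle S).
        eq_near (base S) q X x \<and> eq_near (base S) q Y y \<longrightarrow> cov_sec S D X Y q = z)"

text \<open>Argument order: \<open>Hh \<alpha> \<beta> \<gamma>\<close> is \<open>H\<^sup>\<alpha>\<^sub>\<beta>\<^sub>\<gamma>\<close>, \<open>Hv a b \<gamma>\<close> is
  \<open>H\<^sup>a\<^sub>b\<^sub>\<gamma>\<close>, \<open>Vh \<alpha> \<beta> c\<close> is \<open>V\<^sup>\<alpha>\<^sup>c\<^sub>\<beta>\<close> and \<open>Vv a b c\<close> is
  \<open>V\<^sup>a\<^sup>c\<^sub>b\<close>.\<close>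

type_synonym 'q comps = "nat \<Rightarrow> nat \<Rightarrow> nat \<Rightarrow> 'q \<Rightarrow> real"

definition components ::
  "('q, 'w::real_vector) gen_tangent \<Rightarrow> ('q \<Rightarrow> 'w \<Rightarrow> 'w) \<Rightarrow> ('q, 'w) cov_deriv \<Rightarrow>
   ('q, 'w) nat_base \<Rightarrow> 'q comps \<Rightarrow> 'q comps \<Rightarrow> 'q comps \<Rightarrow> 'q comps \<Rightarrow> bool" where
  "components S \<Gamma> D N Hh Hv Vh Vv \<longleftrightarrow>
     (let m = hrank S; r = vrank S; \<delta> = delta S \<Gamma> N; dv = del_v N in
      \<forall>q\<in>ndom N.
        (\<forall>\<gamma><m. \<forall>\<beta><m. local_cov S D (\<delta> \<gamma>) (\<delta> \<beta>) q (\<Sum>\<alpha><m. Hh \<alpha> \<beta> \<gamma> q *\<^sub>R \<delta> \<alpha> q)) \<and>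
        (\<forall>\<gamma><m. \<forall>a<r. local_cov S D (\<delta> \<gamma>) (dv a) q (\<Sum>b<r. Hv a b \<gamma> q *\<^sub>R dv b q)) \<and>
        (\<forall>c<r. \<forall>\<beta><m. local_cov S D (dv c) (\<delta> \<beta>) q (\<Sum>\<alpha><m. Vh \<alpha> \<beta> c q *\<^sub>R \<delta> \<alpha> q)) \<and>
        (\<forall>c<r. \<forall>a<r. local_cov S D (dv c) (dv a) q (\<Sum>b<r. Vv a b c q *\<^sub>R dv b q)))"


subsection \<open>(Pseudo)metrical structures\<close>

definition mat_inverse :: "nat \<Rightarrow> (nat \<Rightarrow> nat \<Rightarrow> real) \<Rightarrow> (nat \<Rightarrow> nat \<Rightarrow> real) \<Rightarrow> bool" where
  "mat_inverse m g h \<longleftrightarrow> (\<forall>i<m. \<forall>j<m.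
     (\<Sum>k<m. g i k * h k j) = (if i = j then 1 else 0) \<and>
     (\<Sum>k<m. h i k * g k j) = (if i = j then 1 else 0))"

text \<open>By Sylvester's law of inertia: signature (k, m - k).\<close>

definition has_signature :: "nat \<Rightarrow> (nat \<Rightarrow> nat \<Rightarrow> real) \<Rightarrow> nat \<Rightarrow> bool" where
  "has_signature m g k \<longleftrightarrow> k \<le> m \<and> (\<exists>P P'. mat_inverse m P P' \<and>
     (\<forall>i<m. \<forall>j<m. (\<Sum>a<m. \<Sum>b<m. P a i * g a b * P b j) =
        (if i = j then if i < k then 1 else - 1 else 0)))"

text \<open>\<open>gh \<alpha> \<beta>\<close> and \<open>gv a b\<close> are the local components \<open>g\<^sub>\<alpha>\<^sub>\<beta>\<close>, \<open>g\<^sup>a\<^sup>b\<close> of G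
  in the base N.\<close>

definition metric_comps ::
  "('q, 'w::real_vector) gen_tangent \<Rightarrow> ('q \<Rightarrow> 'w \<Rightarrow> 'w) \<Rightarrow> ('q, 'w) tfield \<Rightarrow> ('q, 'w) nat_base \<Rightarrow>
   (nat \<Rightarrow> nat \<Rightarrow> 'q \<Rightarrow> real) \<Rightarrow> (nat \<Rightarrow> nat \<Rightarrow> 'q \<Rightarrow> real) \<Rightarrow> bool" where
  "metric_comps S \<Gamma> G N gh gv \<longleftrightarrow>
     (\<forall>q\<in>ndom N. \<forall>v\<in>fib (gbundle S) q. \<forall>w\<in>fib (gbundle S) q.
        G q [] [v, w] =
          (\<Sum>\<alpha><hrank S. \<Sum>\<beta><hrank S. gh \<alpha> \<beta> q * dz S \<Gamma> N \<alpha> q v * dz S \<Gamma> N \<beta> q w) +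
          (\<Sum>a<vrank S. \<Sum>b<vrank S. gv a b q * dp S \<Gamma> N a q v * dp S \<Gamma> N b q w))"

definition pseudometrical ::
  "('q, 'w::real_vector) gen_tangent \<Rightarrow> ('q \<Rightarrow> 'w \<Rightarrow> 'w) \<Rightarrow> ('q, 'w) tfield \<Rightarrow> bool" where
  "pseudometrical S \<Gamma> G \<longleftrightarrow> G \<in> tensor_fields (base S) (gbundle S) 0 2 \<and>
     (\<forall>N\<in>nat_bases S. \<exists>gh gv. metric_comps S \<Gamma> G N gh gv \<and>
        (\<forall>q\<in>ndom N.
           (\<forall>\<alpha><hrank S. \<forall>\<beta><hrank S. gh \<alpha> \<beta> q = gh \<beta> \<alpha> q) \<and>
           (\<forall>a<vrank S. \<forall>b<vrank S. gv a b q = gv b a q) \<and>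
           (\<exists>h. mat_inverse (hrank S) (\<lambda>\<alpha> \<beta>. gh \<alpha> \<beta> q) h) \<and>
           (\<exists>h. mat_inverse (vrank S) (\<lambda>a b. gv a b q) h)))"

definition metrical ::
  "('q, 'w::real_vector) gen_tangent \<Rightarrow> ('q \<Rightarrow> 'w \<Rightarrow> 'w) \<Rightarrow> ('q, 'w) tfield \<Rightarrow> bool" where
  "metrical S \<Gamma> G \<longleftrightarrow> pseudometrical S \<Gamma> G \<and>
     (\<exists>k k'. \<forall>N\<in>nat_bases S. \<forall>gh gv. metric_comps S \<Gamma> G N gh gv \<longrightarrow>
        (\<forall>q\<in>ndom N. has_signature (hrank S) (\<lambda>\<alpha> \<beta>. gh \<alpha> \<beta> q) k \<and>
                    has_signature (vrank S) (\<lambda>a b. gv a b q) k'))"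

text \<open>Covariant derivatives of the components of G: \<open>x\<close> is the differentiating local section
  (\<open>\<delta>\<^sub>\<gamma>\<close> or \<open>\<partial>\<^sup>c\<close>), \<open>C\<close> the matching connection coefficients with their last index
  fixed; \<open>cov_gh\<close> is for \<open>g\<^sub>\<epsilon>\<^sub>\<beta>\<close>, \<open>cov_gv\<close> for \<open>g\<^sup>e\<^sup>a\<close>.\<close>

definition cov_gh ::
  "('q, 'w) gen_tangent \<Rightarrow> ('q \<Rightarrow> 'w) \<Rightarrow> (nat \<Rightarrow> nat \<Rightarrow> 'q \<Rightarrow> real) \<Rightarrow>
   (nat \<Rightarrow> nat \<Rightarrow> 'q \<Rightarrow> real) \<Rightarrow> nat \<Rightarrow> nat \<Rightarrow> 'q \<Rightarrow> real" where
  "cov_gh S x C g \<epsilon> \<beta> q = anchor S (x q) (g \<epsilon> \<beta>)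
     - (\<Sum>\<theta><hrank S. C \<theta> \<epsilon> q * g \<theta> \<beta> q) - (\<Sum>\<theta><hrank S. C \<theta> \<beta> q * g \<epsilon> \<theta> q)"

definition cov_gv ::
  "('q, 'w) gen_tangent \<Rightarrow> ('q \<Rightarrow> 'w) \<Rightarrow> (nat \<Rightarrow> nat \<Rightarrow> 'q \<Rightarrow> real) \<Rightarrow>
   (nat \<Rightarrow> nat \<Rightarrow> 'q \<Rightarrow> real) \<Rightarrow> nat \<Rightarrow> nat \<Rightarrow> 'q \<Rightarrow> real" where
  "cov_gv S x C g e a q = anchor S (x q) (g e a)
     - (\<Sum>d<vrank S. C e d q * g d a q) - (\<Sum>d<vrank S. C a d q * g e d q)"

end

theory Submission
  imports Defs "Jordan_Normal_Form.Determinant"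
begin

text \<open>Let \<open>A\<^sub>X\<close> be the endomorphism field given by \<open>G(A\<^sub>X Y, Z) = 1/2 (D0\<^sub>X G)(Y, Z)\<close>. The
  connection is \<open>D\<^sub>X = D0\<^sub>X + A\<^sub>X\<close>, where \<open>A\<^sub>X\<close> acts on tensors as a derivation: as \<open>D0\<^sub>X G\<close> is
  symmetric, \<open>(A\<^sub>X G)(Y, Z) = - G(A\<^sub>X Y, Z) - G(Y, A\<^sub>X Z) = - (D0\<^sub>X G)(Y, Z)\<close>. The components follow by
  evaluating on global sections that agree with the adapted base near a point, and \<open>A\<^sub>X\<close> is smooth
  by Cramer's rule.\<close>

text \<open>That the local formulas are components of a connection means that one global connection
  has them in every choice of charts and frames. Instead of checking transformation laws, the
  correction is fixed by a condition that mentions only the given connection and G; its global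
  existence is then automatic, and the formulas appear when the condition is solved in the adapted
  base. The factor 1/2 comes from the two slots of G, which contribute equally. A connection has to
  act on the whole tensor algebra, but the correction is algebraic at each point, so the axioms
  reduce to multilinear algebra in one fibre. Derivatives are defined on global sections only; hence
  local computations need cutoff functions, and these need smooth calculus and the Hausdorff
  property of the total space. The argument is carried out for an abstract bundle with natural
  bases, of which the generalized and the ordinary tangent bundle are instances.\<close>

hide_const (open) Gauss_Jordan_Elimination.mat_inverse

section \<open>Smooth functions\<close>

lemma tendsto_fun_iff:
  fixes f :: "'a \<Rightarrow> nat \<Rightarrow> real"
  shows "(f \<longlongrightarrow> l) F \<longleftrightarrow> (\<forall>i. ((\<lambda>x. f x i) \<longlongrightarrow> l i) F)"
proof -
  have "limitin (powertop_real UNIV) f l F \<longleftrightarrow> (\<forall>i. limitin euclideanreal (\<lambda>x. f x i) (l i) F)"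
    by (simp add: limitin_componentwise)
  then show ?thesis
    by (simp add: euclidean_product_topology)
qed

lemma openin_Euclidean_space_iff:
  "openin (Euclidean_space n) S \<longleftrightarrow> (\<exists>T. open T \<and> S = T \<inter> {y. \<forall>i\<ge>n. y i = 0})"
  by (simp add: Euclidean_space_def openin_subtopology euclidean_product_topology)

lemma openin_Euclidean_spaceD:
  "openin (Euclidean_space n) S \<Longrightarrow> y \<in> S \<Longrightarrow> i \<ge> n \<Longrightarrow> y i = 0"
  by (auto simp: openin_Euclidean_space_iff)

text \<open>Points of the space vanish from index n on, so in a basic open set of the product
  topology only the first n factors constrain them, and the least of n radii serves for all.\<close>

lemma openin_Euclidean_space_box:
  assumes "openin (Euclidean_space n) S" "y \<in> S"
  obtains e where "e > 0"
    "\<And>z. (\<And>i. i \<ge> n \<Longrightarrow> z i = 0) \<Longrightarrow> (\<And>i. i < n \<Longrightarrow> \<bar>z i - y i\<bar> < e) \<Longrightarrow> z \<in> S"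
proof -
  obtain T where T: "open T" "S = T \<inter> {y. \<forall>i\<ge>n. y i = 0}"
    using assms by (auto simp: openin_Euclidean_space_iff)
  then have "openin (powertop_real UNIV) T" "y \<in> T"
    using assms by (auto simp: euclidean_product_topology)
  from product_topology_open_contains_basis[OF this]
  obtain X where X: "y \<in> (\<Pi>\<^sub>E i\<in>UNIV. X i)" "\<And>i. open (X i)" "(\<Pi>\<^sub>E i\<in>UNIV. X i) \<subseteq> T"
    by auto
  have "\<exists>e>0. \<forall>t. \<bar>t - y i\<bar> < e \<longrightarrow> t \<in> X i" for i
    using X(1) X(2)[of i] by (auto simp: open_dist dist_real_def PiE_iff)
  then obtain e where e: "\<And>i. e i > 0" "\<And>i t. \<bar>t - y i\<bar> < e i \<Longrightarrow> t \<in> X i"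
    by metis
  \<comment> \<open>The extra element 1 keeps the set nonempty when n = 0.\<close>
  define d where "d = Min (insert 1 (e ` {..<n}))"
  have "d > 0" unfolding d_def using e by (subst Min_gr_iff) auto
  moreover have "z \<in> S" if z: "\<And>i. i \<ge> n \<Longrightarrow> z i = 0" "\<And>i. i < n \<Longrightarrow> \<bar>z i - y i\<bar> < d" for z
  proof -
    have "z i \<in> X i" for i
    proof (cases "i < n")
      case True
      then have "d \<le> e i" unfolding d_def by (intro Min_le) auto
      then show ?thesis using z(2)[OF True] e(2)[of "z i" i] by linarith
    next
      case False
      then have "z i = y i" using z(1)[of i] openin_Euclidean_spaceD[OF assms, of i] by simp
      then show ?thesis using X(1) by (auto simp: PiE_iff)
    qed
    then have "z \<in> T" using X(3) by (auto simp: PiE_iff)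
    then show ?thesis using T z by auto
  qed
  ultimately show ?thesis using that by blast
qed

text \<open>Derivatives in \<open>Ck_on\<close> are taken along coordinate lines. An open set
  contains a piece of each such line through its points, so these derivatives depend only on the
  values on the set.\<close>

lemma eventually_line_in:
  assumes S: "openin (Euclidean_space n) S" and y: "y \<in> S" and i: "i < n"
  shows "eventually (\<lambda>t. y(i := t) \<in> S) (nhds (y i))"
proof -
  obtain e where e: "e > 0"
    "\<And>z. (\<And>i. i \<ge> n \<Longrightarrow> z i = 0) \<Longrightarrow> (\<And>i. i < n \<Longrightarrow> \<bar>z i - y i\<bar> < e) \<Longrightarrow> z \<in> S"
    using openin_Euclidean_space_box[OF S y] by metis
  have "y(i := t) \<in> S" if "dist t (y i) < e" for t
    using that i e(1) openin_Euclidean_spaceD[OF S y]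
    by (intro e(2)) (auto simp: dist_real_def)
  then show ?thesis
    using e(1) eventually_nhds_metric by blast
qed

lemma continuous_on_local_cong:
  fixes f :: "'a::topological_space \<Rightarrow> 'b::topological_space"
  assumes "\<And>y. y \<in> S \<Longrightarrow> \<exists>T. open T \<and> y \<in> T \<and> continuous_on (S \<inter> T) f"
  shows "continuous_on S f"
  unfolding continuous_on_def
proof
  fix y assume y: "y \<in> S"
  then obtain T where T: "open T" "y \<in> T" "continuous_on (S \<inter> T) f"
    using assms by blast
  have "at y within (S \<inter> T) = at y within S"
    using T(1,2) by (intro at_within_nhd[of y T]) auto
  then show "(f \<longlongrightarrow> f y) (at y within S)"
    using T(2,3) y unfolding continuous_on_def by (metis IntI)
qed

section \<open>Calculus of C^k functions in terms of partial derivatives\<close>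

lemma Ck_on_subset: "Ck_on n k S f \<Longrightarrow> S' \<subseteq> S \<Longrightarrow> Ck_on n k S' f"
  by (induction k arbitrary: f) (auto intro: continuous_on_subset)

lemma Ck_on_continuous: "Ck_on n k S f \<Longrightarrow> continuous_on S f"
  by (cases k) auto

lemma Ck_on_Suc_imp: "Ck_on n (Suc k) S f \<Longrightarrow> Ck_on n k S f"
  by (induction k arbitrary: f) auto

lemma Ck_on_line_deriv:
  assumes "Ck_on n (Suc k) S f" "y \<in> S" "i < n"
  shows "((\<lambda>t. f (y(i := t))) has_real_derivative partial_deriv i f y) (at (y i))"
  using assms by (simp add: partial_deriv_def DERIV_deriv_iff_real_differentiable)

lemma Ck_on_SucI:
  assumes "continuous_on S f"
    and "\<And>i y. i < n \<Longrightarrow> y \<in> S \<Longrightarrow> ((\<lambda>t. f (y(i := t))) has_real_derivative f' i y) (at (y i))"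
    and "\<And>i. i < n \<Longrightarrow> Ck_on n k S (partial_deriv i f)"
  shows "Ck_on n (Suc k) S f"
  using assms by (auto simp: real_differentiable_def)

lemma Ck_on_cong:
  assumes S: "openin (Euclidean_space n) S" and "\<And>y. y \<in> S \<Longrightarrow> f y = g y"
  shows "Ck_on n k S f \<longleftrightarrow> Ck_on n k S g"
  using assms(2)
proof (induction k arbitrary: f g)
  case 0
  then show ?case by (simp cong: continuous_on_cong)
next
  case (Suc k)
  have ev: "eventually (\<lambda>t. f (y(i := t)) = g (y(i := t))) (nhds (y i))" if "y \<in> S" "i < n" for y i
    using eventually_line_in[OF S that] by eventually_elim (use Suc.prems in auto)
  have "partial_deriv i f y = partial_deriv i g y" if "y \<in> S" "i < n" for y i
    unfolding partial_deriv_def by (intro deriv_cong_ev ev that) auto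
  moreover have "(\<lambda>t. f (y(i := t))) differentiable at (y i) \<longleftrightarrow>
      (\<lambda>t. g (y(i := t))) differentiable at (y i)" if "y \<in> S" "i < n" for y i
    unfolding real_differentiable_def
    using DERIV_cong_ev[OF refl ev[OF that] refl] by auto
  ultimately show ?case
    using Suc.IH[of "partial_deriv _ f" "partial_deriv _ g"] Suc.prems
    by (simp cong: continuous_on_cong)
qed

text \<open>On an open set, any functions that agree there with the partial derivatives may stand
  for them. This turns the closure properties below into a formula for the derivative and an
  induction on the order.\<close>

lemma Ck_on_SucI':
  assumes S: "openin (Euclidean_space n) S" and "continuous_on S f"
    and d: "\<And>i y. i < n \<Longrightarrow> y \<in> S \<Longrightarrow> ((\<lambda>t. f (y(i := t))) has_real_derivative f' i y) (at (y i))"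
    and "\<And>i. i < n \<Longrightarrow> Ck_on n k S (f' i)"
  shows "Ck_on n (Suc k) S f"
proof -
  have "partial_deriv i f y = f' i y" if "i < n" "y \<in> S" for i y
    unfolding partial_deriv_def using d[OF that] by (simp add: DERIV_imp_deriv)
  then show ?thesis
    using assms Ck_on_cong[OF S, of "partial_deriv _ f" "f' _"] by (intro Ck_on_SucI[of S f n f']) auto
qed

text \<open>Continuity and differentiability at a point are decided near it. In the induction step
  one neighbourhood serves f and all its partial derivatives; the lower class of f itself is carried
  along because it yields the continuity of f on all of S.\<close>

lemma Ck_on_local:
  assumes S: "openin (Euclidean_space n) S"
    and "\<And>y. y \<in> S \<Longrightarrow> \<exists>U. openin (Euclidean_space n) U \<and> y \<in> U \<and> Ck_on n k (S \<inter> U) f"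
  shows "Ck_on n k S f"
  using assms(2)
proof (induction k arbitrary: f)
  case 0
  have "\<exists>T. open T \<and> y \<in> T \<and> continuous_on (S \<inter> T) f" if y: "y \<in> S" for y
  proof -
    obtain U where "openin (Euclidean_space n) U" "y \<in> U" "Ck_on n 0 (S \<inter> U) f"
      using 0[OF y] by blast
    moreover then obtain T where T: "open T" "U = T \<inter> {y. \<forall>i\<ge>n. y i = 0}"
      by (auto simp: openin_Euclidean_space_iff)
    moreover have "S \<inter> T = S \<inter> U"
      using T(2) openin_Euclidean_spaceD[OF S] by auto
    ultimately show ?thesis by auto
  qed
  then show ?case by (auto intro: continuous_on_local_cong)
next
  case (Suc k)
  have U: "\<exists>U. openin (Euclidean_space n) U \<and> y \<in> U \<and> Ck_on n k (S \<inter> U) f \<and>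
      (\<forall>i<n. (\<lambda>t. f (y(i := t))) differentiable at (y i) \<and> Ck_on n k (S \<inter> U) (partial_deriv i f))"
    if y: "y \<in> S" for y
  proof -
    obtain U where U: "openin (Euclidean_space n) U" "y \<in> U" "Ck_on n (Suc k) (S \<inter> U) f"
      using Suc.prems[OF y] by blast
    then show ?thesis
      using y Ck_on_Suc_imp[OF U(3)] by (intro exI[of _ U]) simp
  qed
  have "Ck_on n k S f"
    by (rule Suc.IH) (use U in blast)
  moreover have "Ck_on n k S (partial_deriv i f)" if "i < n" for i
    by (rule Suc.IH) (use U that in blast)
  ultimately show ?case
    using U by (simp add: Ck_on_continuous) blast
qed

lemma Ck_on_const: "openin (Euclidean_space n) S \<Longrightarrow> Ck_on n k S (\<lambda>_. c)"
proof (induction k arbitrary: c)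
  case (Suc k)
  then show ?case
    by (intro Ck_on_SucI'[where f' = "\<lambda>_ _. 0"]) (auto intro!: derivative_eq_intros)
qed auto

lemma continuous_on_coordinate: "continuous_on S (\<lambda>y::nat \<Rightarrow> real. y j)"
  by (rule continuous_on_subset[OF continuous_on_product_coordinates]) auto

lemma Ck_on_coordinate: "openin (Euclidean_space n) S \<Longrightarrow> Ck_on n k S (\<lambda>y. y j)"
proof (cases k)
  case (Suc l)
  assume S: "openin (Euclidean_space n) S"
  show ?thesis
    unfolding Suc
    by (rule Ck_on_SucI'[OF S continuous_on_coordinate, where f' = "\<lambda>i _. if i = j then 1 else 0"])
      (auto intro!: derivative_eq_intros Ck_on_const S)
qed (auto intro: continuous_on_coordinate)

lemma Ck_on_add:
  "openin (Euclidean_space n) S \<Longrightarrow> Ck_on n k S f \<Longrightarrow> Ck_on n k S g \<Longrightarrow> Ck_on n k S (\<lambda>y. f y + g y)"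
proof (induction k arbitrary: f g)
  case (Suc k)
  show ?case
    by (rule Ck_on_SucI'[OF _ _ DERIV_add[OF Ck_on_line_deriv[OF Suc.prems(2)] Ck_on_line_deriv[OF Suc.prems(3)]]])
      (use Suc in \<open>auto intro!: continuous_intros\<close>)
qed (auto intro: continuous_intros)

lemma Ck_on_mult:
  "openin (Euclidean_space n) S \<Longrightarrow> Ck_on n k S f \<Longrightarrow> Ck_on n k S g \<Longrightarrow> Ck_on n k S (\<lambda>y. f y * g y)"
proof (induction k arbitrary: f g)
  case (Suc k)
  have fg: "Ck_on n k S f" "Ck_on n k S g"
    using Suc.prems(2,3) by (blast dest: Ck_on_Suc_imp)+
  have d: "((\<lambda>t. f (y(i := t)) * g (y(i := t))) has_real_derivative
      partial_deriv i f y * g y + partial_deriv i g y * f y) (at (y i))" if "i < n" "y \<in> S" for i y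
    using DERIV_mult[OF Ck_on_line_deriv[OF Suc.prems(2) that(2,1)] Ck_on_line_deriv[OF Suc.prems(3) that(2,1)]]
    by (simp only: fun_upd_triv)
  show ?case
    by (rule Ck_on_SucI'[OF Suc.prems(1) _ d])
      (use Suc fg in \<open>auto intro!: Ck_on_add continuous_intros\<close>)
qed (auto intro: continuous_intros)

lemma Ck_on_sum:
  "openin (Euclidean_space n) S \<Longrightarrow> (\<And>j. j \<in> J \<Longrightarrow> Ck_on n k S (f j)) \<Longrightarrow>
   Ck_on n k S (\<lambda>y. \<Sum>j\<in>J. f j y)"
  by (induction J rule: infinite_finite_induct) (auto intro: Ck_on_const Ck_on_add)

lemma Ck_on_prod:
  "openin (Euclidean_space n) S \<Longrightarrow> (\<And>j. j \<in> J \<Longrightarrow> Ck_on n k S (f j)) \<Longrightarrow>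
   Ck_on n k S (\<lambda>y. \<Prod>j\<in>J. f j y)"
  by (induction J rule: infinite_finite_induct) (auto intro: Ck_on_const Ck_on_mult)

text \<open>The derivative of 1/f contains 1/f again, but only in the class of one order less, which
  is the induction hypothesis.\<close>

lemma Ck_on_inverse:
  assumes S: "openin (Euclidean_space n) S" and nz: "\<And>y. y \<in> S \<Longrightarrow> f y \<noteq> 0"
  shows "Ck_on n k S f \<Longrightarrow> Ck_on n k S (\<lambda>y. inverse (f y))"
proof (induction k)
  case (Suc k)
  note d = Ck_on_line_deriv[OF Suc.prems(1)]
  have f: "Ck_on n k S f" by (rule Ck_on_Suc_imp[OF Suc.prems])
  note c = Ck_on_continuous[OF Suc.prems]
  show ?case
  \<comment> \<open>The factor \<open>- 1\<close> in place of a unary minus lets the rules for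
    products and constants apply.\<close>
  proof (rule Ck_on_SucI'[OF S, where f' = "\<lambda>i y. - 1 * (partial_deriv i f y * (inverse (f y) * inverse (f y)))"])
    show "((\<lambda>t. inverse (f (y(i := t)))) has_real_derivative
       - 1 * (partial_deriv i f y * (inverse (f y) * inverse (f y)))) (at (y i))" if "i < n" "y \<in> S" for i y
      using DERIV_inverse_fun[OF d[OF that(2,1)]] nz[OF that(2)]
      by (simp only: fun_upd_triv power_Suc power_0 numeral_2_eq_2 mult_1_right inverse_mult_distrib
        mult_minus_left mult_1_left not_False_eq_True)
  next
    show "Ck_on n k S (\<lambda>y. - 1 * (partial_deriv i f y * (inverse (f y) * inverse (f y))))" if "i < n" for i
      using Suc.prems that Suc.IH[OF f] by (intro Ck_on_mult Ck_on_const S) auto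
  qed (use c nz in \<open>auto intro!: continuous_intros\<close>)
qed (auto intro!: continuous_intros nz)

text \<open>\<open>h j\<close> is the j-th derivative of \<open>h 0\<close>. Differentiating the
  composite leads from \<open>h j\<close> to \<open>h (Suc j)\<close>, so the induction runs over
  all j at once.\<close>

lemma Ck_on_real_compose:
  assumes S: "openin (Euclidean_space n) S"
    and h: "\<And>j t. (h j has_real_derivative h (Suc j) t) (at t)"
  shows "Ck_on n k S f \<Longrightarrow> Ck_on n k S (\<lambda>y. h j (f y))"
proof (induction k arbitrary: j)
  case 0
  have "continuous_on UNIV (h j)"
    using h by (meson DERIV_continuous_on has_field_derivative_at_within)
  then show ?case using 0 continuous_on_compose2[of UNIV "h j" S f] by auto
next
  case (Suc k)
  have "continuous_on UNIV (h j)"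
    using h by (meson DERIV_continuous_on has_field_derivative_at_within)
  then have c: "continuous_on S (\<lambda>y. h j (f y))"
    using Suc.prems continuous_on_compose2[of UNIV "h j" S f] by auto
  have f: "Ck_on n k S f" by (rule Ck_on_Suc_imp[OF Suc.prems])
  show ?case
  proof (rule Ck_on_SucI'[OF S c, where f' = "\<lambda>i y. h (Suc j) (f y) * partial_deriv i f y"])
    show "((\<lambda>t. h j (f (y(i := t)))) has_real_derivative h (Suc j) (f y) * partial_deriv i f y) (at (y i))"
      if "i < n" "y \<in> S" for i y
      using DERIV_chain2[OF h Ck_on_line_deriv[OF Suc.prems that(2,1)], of j]
      by (simp only: fun_upd_triv)
  next
    show "Ck_on n k S (\<lambda>y. h (Suc j) (f y) * partial_deriv i f y)" if "i < n" for i
      using Suc.prems that Suc.IH[OF f] by (intro Ck_on_mult S) auto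
  qed
qed

text \<open>Of g only continuous partial derivatives are known, not total differentiability. The
  increment of g along the curve is therefore split into m increments in one coordinate each, and
  each of them is treated by the mean value theorem.\<close>

lemma chain_rule_curve:
  assumes T: "openin (Euclidean_space m) T" and g: "Ck_on m (Suc k) T g"
    and c0: "c t0 \<in> T" and z: "\<And>t j. j \<ge> m \<Longrightarrow> c t j = 0"
    and c: "\<And>j. j < m \<Longrightarrow> ((\<lambda>t. c t j) has_real_derivative c' j) (at t0)"
  shows "((\<lambda>t. g (c t)) has_real_derivative (\<Sum>j<m. partial_deriv j g (c t0) * c' j)) (at t0)"
proof -
  \<comment> \<open>The first l coordinates have moved to time t, the others still wait at time t0.
    So \<open>p 0\<close> is constant and \<open>p m\<close> is the curve itself.\<close>
  define p where "p l t = (\<lambda>j. if j < l then c t j else c t0 j)" for l t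
  obtain e where e: "e > 0"
    "\<And>z. (\<And>i. i \<ge> m \<Longrightarrow> z i = 0) \<Longrightarrow> (\<And>i. i < m \<Longrightarrow> \<bar>z i - c t0 i\<bar> < e) \<Longrightarrow> z \<in> T"
    using openin_Euclidean_space_box[OF T c0] by metis
  have cont: "((\<lambda>t. c t j) \<longlongrightarrow> c t0 j) (at t0)" for j
    by (cases "j < m") (use DERIV_isCont[OF c[of j]] z in \<open>auto simp: isCont_def\<close>)
  have near: "eventually (\<lambda>t. \<forall>j<m. \<bar>c t j - c t0 j\<bar> < e) (at t0)"
  proof -
    have "eventually (\<lambda>t. \<forall>j\<in>{..<m}. \<bar>c t j - c t0 j\<bar> < e) (at t0)"
      by (subst eventually_ball_finite_distrib) (use tendstoD[OF cont e(1)] in \<open>auto simp: dist_real_def\<close>)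
    then show ?thesis by (simp add: Ball_def)
  qed
  have step: "((\<lambda>t. g (p (Suc l) t) - g (p l t)) has_real_derivative partial_deriv l g (c t0) * c' l) (at t0)"
    if l: "l < m" for l
  proof -
    \<comment> \<open>Passing from \<open>p l t\<close> to \<open>p (Suc l) t\<close> changes
      coordinate l only. The intermediate value may lie on either side of \<open>c t0 l\<close>,
      according to the sign of the increment, and is the endpoint itself if there is none.\<close>
    have mvt: "\<exists>s. \<bar>s - c t0 l\<bar> \<le> \<bar>c t l - c t0 l\<bar> \<and> (p l t)(l := s) \<in> T \<and>
        g (p (Suc l) t) - g (p l t) = partial_deriv l g ((p l t)(l := s)) * (c t l - c t0 l)"
      if t: "\<forall>j<m. \<bar>c t j - c t0 j\<bar> < e" for t
    proof -
      define a where "a = c t0 l"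
      define b where "b = c t l"
      have pl: "p l t = (p l t)(l := a)" "p (Suc l) t = (p l t)(l := b)"
        unfolding p_def a_def b_def by (auto simp: fun_eq_iff less_Suc_eq)
      have seg: "(p l t)(l := s) \<in> T" if "\<bar>s - a\<bar> \<le> \<bar>b - a\<bar>" for s
      proof (rule e(2))
        fix i assume "i < m"
        then show "\<bar>((p l t)(l := s)) i - c t0 i\<bar> < e"
          using that t l e(1) unfolding a_def b_def p_def by (cases "i = l") (auto intro: le_less_trans)
      qed (use z l p_def in auto)
      have D: "((\<lambda>s. g ((p l t)(l := s))) has_real_derivative partial_deriv l g ((p l t)(l := s))) (at s)"
        if "\<bar>s - a\<bar> \<le> \<bar>b - a\<bar>" for s
        using Ck_on_line_deriv[OF g seg[OF that] l] by simp
      consider "a = b" | "a < b" | "b < a" by linarith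
      then obtain s where s: "\<bar>s - a\<bar> \<le> \<bar>b - a\<bar>"
        "g ((p l t)(l := b)) - g ((p l t)(l := a)) = partial_deriv l g ((p l t)(l := s)) * (b - a)"
      proof cases
        case 1
        then show ?thesis using that[of a] by simp
      next
        case 2
        obtain s where "a < s" "s < b"
          "g ((p l t)(l := b)) - g ((p l t)(l := a)) = (b - a) * partial_deriv l g ((p l t)(l := s))"
          using MVT2[of a b "\<lambda>s. g ((p l t)(l := s))" "\<lambda>s. partial_deriv l g ((p l t)(l := s))"] D 2 by fastforce
        then show ?thesis using that[of s] by (auto simp: algebra_simps)
      next
        case 3
        obtain s where "b < s" "s < a"
          "g ((p l t)(l := a)) - g ((p l t)(l := b)) = (a - b) * partial_deriv l g ((p l t)(l := s))"
          using MVT2[of b a "\<lambda>s. g ((p l t)(l := s))" "\<lambda>s. partial_deriv l g ((p l t)(l := s))"] D 3 by fastforce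
        then show ?thesis using that[of s] by (auto simp: algebra_simps)
      qed
      then show ?thesis
        using seg[OF s(1)] pl unfolding a_def b_def by metis
    qed
    then obtain s where s: "\<And>t. \<forall>j<m. \<bar>c t j - c t0 j\<bar> < e \<Longrightarrow> \<bar>s t - c t0 l\<bar> \<le> \<bar>c t l - c t0 l\<bar> \<and>
        (p l t)(l := s t) \<in> T \<and>
        g (p (Suc l) t) - g (p l t) = partial_deriv l g ((p l t)(l := s t)) * (c t l - c t0 l)"
      by metis
    \<comment> \<open>The intermediate value is squeezed to \<open>c t0 l\<close>. Hence the
      intermediate point tends to \<open>c t0\<close>, where the continuity of the partial
      derivative applies.\<close>
    have "((\<lambda>t. s t - c t0 l) \<longlongrightarrow> 0) (at t0)"
    proof (rule Lim_null_comparison)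
      show "eventually (\<lambda>t. norm (s t - c t0 l) \<le> \<bar>c t l - c t0 l\<bar>) (at t0)"
        using near by eventually_elim (use s in auto)
      show "((\<lambda>t. \<bar>c t l - c t0 l\<bar>) \<longlongrightarrow> 0) (at t0)"
        using tendsto_rabs_zero[OF LIM_zero[OF cont[of l]]] by simp
    qed
    then have s0: "(s \<longlongrightarrow> c t0 l) (at t0)"
      by (simp add: LIM_zero_iff)
    have "((\<lambda>t. (p l t)(l := s t)) \<longlongrightarrow> c t0) (at t0)"
      unfolding tendsto_fun_iff
    proof
      fix i
      show "((\<lambda>t. ((p l t)(l := s t)) i) \<longlongrightarrow> c t0 i) (at t0)"
        by (cases "i = l"; cases "i < l") (use s0 cont in \<open>auto simp: p_def\<close>)
    qed
    moreover have "eventually (\<lambda>t. (p l t)(l := s t) \<in> T) (at t0)"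
      using near by eventually_elim (use s in blast)
    moreover have "continuous_on T (partial_deriv l g)"
      using g l by (auto dest: Ck_on_continuous)
    ultimately have lim: "((\<lambda>t. partial_deriv l g ((p l t)(l := s t))) \<longlongrightarrow> partial_deriv l g (c t0)) (at t0)"
      using c0 by (intro continuous_on_tendsto_compose[of T "partial_deriv l g"])
    have "((\<lambda>t. partial_deriv l g ((p l t)(l := s t)) * ((c t l - c t0 l) / (t - t0)))
        \<longlongrightarrow> partial_deriv l g (c t0) * c' l) (at t0)"
      using lim c[OF l] by (intro tendsto_mult) (auto simp: has_field_derivative_iff)
    moreover have "eventually (\<lambda>t. partial_deriv l g ((p l t)(l := s t)) * ((c t l - c t0 l) / (t - t0)) =
        ((g (p (Suc l) t) - g (p l t)) - (g (p (Suc l) t0) - g (p l t0))) / (t - t0)) (at t0)"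
      using near
    proof eventually_elim
      case (elim t)
      have "p (Suc l) t0 = p l t0" by (auto simp: p_def fun_eq_iff)
      then show ?case using s[OF elim] by simp
    qed
    ultimately have "((\<lambda>t. ((g (p (Suc l) t) - g (p l t)) - (g (p (Suc l) t0) - g (p l t0))) / (t - t0))
        \<longlongrightarrow> partial_deriv l g (c t0) * c' l) (at t0)"
      by (rule Lim_transform_eventually)
    then show ?thesis
      unfolding has_field_derivative_iff by simp
  qed
  have "((\<lambda>t. g (p l t)) has_real_derivative (\<Sum>j<l. partial_deriv j g (c t0) * c' j)) (at t0)" if "l \<le> m" for l
    using that
  proof (induction l)
    case 0
    then show ?case by (simp add: p_def)
  next
    case (Suc l)
    have "((\<lambda>t. g (p l t) + (g (p (Suc l) t) - g (p l t))) has_real_derivative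
        (\<Sum>j<l. partial_deriv j g (c t0) * c' j) + partial_deriv l g (c t0) * c' l) (at t0)"
      using Suc by (intro DERIV_add step) auto
    then show ?case by simp
  qed
  from this[of m] show ?thesis
  proof -
    have "p m t = c t" for t using z by (auto simp: p_def fun_eq_iff)
    then show ?thesis using \<open>\<And>l. l \<le> m \<Longrightarrow> _\<close>[of m] by simp
  qed
qed

lemma partial_deriv_compose:
  assumes S: "openin (Euclidean_space n) S" and T: "openin (Euclidean_space m) T"
    and g: "Ck_on m (Suc k) T g" and F: "\<And>j. j < m \<Longrightarrow> Ck_on n (Suc l) S (\<lambda>y. F y j)"
    and FT: "\<And>y. y \<in> S \<Longrightarrow> F y \<in> T" and i: "i < n" and y: "y \<in> S"
  shows "((\<lambda>t. g (F (y(i := t)))) has_real_derivative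
    (\<Sum>j<m. partial_deriv j g (F y) * partial_deriv i (\<lambda>y. F y j) y)) (at (y i))"
proof -
  \<comment> \<open>Outside S the curve is set to 0, because the chain rule along curves asks for
    vanishing coordinates from m on at all times. Near \<open>y i\<close> nothing changes.\<close>
  define c where "c t = (if y(i := t) \<in> S then F (y(i := t)) else 0)" for t
  have ev: "eventually (\<lambda>t. y(i := t) \<in> S) (nhds (y i))"
    by (rule eventually_line_in[OF S y i])
  have "((\<lambda>t. g (c t)) has_real_derivative
    (\<Sum>j<m. partial_deriv j g (c (y i)) * partial_deriv i (\<lambda>y. F y j) y)) (at (y i))"
  proof (rule chain_rule_curve[OF T g])
    show "c (y i) \<in> T" using y FT by (simp add: c_def)
    show "c t j = 0" if "j \<ge> m" for t j
      using openin_Euclidean_spaceD[OF T FT that] by (auto simp: c_def)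
    fix j assume j: "j < m"
    have "eventually (\<lambda>t. c t j = F (y(i := t)) j) (nhds (y i))"
      using ev by eventually_elim (auto simp: c_def)
    then show "((\<lambda>t. c t j) has_real_derivative partial_deriv i (\<lambda>y. F y j) y) (at (y i))"
      using Ck_on_line_deriv[OF F[OF j] y i] by (subst DERIV_cong_ev[OF refl _ refl]) auto
  qed
  moreover have "eventually (\<lambda>t. g (c t) = g (F (y(i := t)))) (nhds (y i))"
    using ev by eventually_elim (auto simp: c_def)
  moreover have "c (y i) = F y" using y by (simp add: c_def)
  ultimately show ?thesis by (subst (asm) DERIV_cong_ev[OF refl _ refl]) auto
qed

text \<open>A partial derivative of the composite is a sum of products of partial derivatives of g,
  again composed with F, and partial derivatives of F. Hence the induction is over all g, while the
  order required of F drops with k.\<close>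

lemma Ck_on_compose:
  assumes S: "openin (Euclidean_space n) S" and T: "openin (Euclidean_space m) T"
    and FT: "\<And>y. y \<in> S \<Longrightarrow> F y \<in> T"
  shows "Ck_on m k T g \<Longrightarrow> (\<And>j. j < m \<Longrightarrow> Ck_on n k S (\<lambda>y. F y j)) \<Longrightarrow> Ck_on n k S (\<lambda>y. g (F y))"
proof (induction k arbitrary: g)
  case (Suc k)
  have 0: "\<And>j. j < m \<Longrightarrow> Ck_on n k S (\<lambda>y. F y j)"
    using Suc.prems(2) Ck_on_Suc_imp by blast
  have IH: "Ck_on n k S (\<lambda>y. g' (F y))" if "Ck_on m k T g'" for g'
    using Suc.IH[OF that 0] .
  have g: "Ck_on m k T g" using Suc.prems(1) Ck_on_Suc_imp by blast
  show ?case
  proof (rule Ck_on_SucI'[OF S _ partial_deriv_compose[OF S T Suc.prems FT]])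
    show "continuous_on S (\<lambda>y. g (F y))"
      using IH[OF g] by (rule Ck_on_continuous)
    show "Ck_on n k S (\<lambda>y. \<Sum>j<m. partial_deriv j g (F y) * partial_deriv i (\<lambda>y. F y j) y)" if "i < n" for i
      using Suc.prems that by (intro Ck_on_sum Ck_on_mult S IH) auto
  qed
next
  case 0
  \<comment> \<open>The hypothesis covers the coordinates below m; the others vanish because F maps
    into T.\<close>
  have "continuous_on S (\<lambda>y. F y j)" for j
  proof (cases "j < m")
    case False
    then have "\<And>y. y \<in> S \<Longrightarrow> F y j = 0" using openin_Euclidean_spaceD[OF T FT] by simp
    then show ?thesis by (simp cong: continuous_on_cong)
  qed (use 0 in auto)
  then have "continuous_on S F" by (rule continuous_on_coordinatewise_then_product)
  then show ?case using 0 FT by (auto intro!: continuous_on_compose2[of T g S F])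
qed

section \<open>Flat functions and plateau functions on Euclidean space\<close>

text \<open>The functions p(1/t) exp(-1/t), extended by 0 to t \<le> 0. This family is closed under
  differentiation, which yields all derivatives of the extension of exp(-1/t) at once.\<close>

definition flat_poly :: "real poly \<Rightarrow> real \<Rightarrow> real" where
  "flat_poly p t = (if t > 0 then poly p (inverse t) * exp (- inverse t) else 0)"

lemma poly_times_exp_minus_tendsto_0: "((\<lambda>x::real. poly p x * exp (- x)) \<longlongrightarrow> 0) at_top"
proof -
  have "((\<lambda>x::real. \<Sum>i\<le>degree p. coeff p i * (x ^ i / exp x)) \<longlongrightarrow> (\<Sum>i\<le>degree p. coeff p i * 0)) at_top"
    by (intro tendsto_sum tendsto_mult tendsto_const tendsto_power_div_exp_0)
  moreover have "(\<Sum>i\<le>degree p. coeff p i * (x ^ i / exp x)) = poly p x * exp (- x)" for x :: real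
    unfolding poly_altdef sum_distrib_right exp_minus divide_inverse mult.assoc ..
  ultimately show ?thesis by simp
qed

text \<open>With x = 1/t one has dx/dt = -x^2, so p(x) exp(-x) has the derivative x^2 (p(x) - p'(x))
  exp(-x). At 0 the exponential beats every polynomial.\<close>

lemma flat_poly_deriv:
  "(flat_poly p has_real_derivative flat_poly (monom 1 2 * (p - pderiv p)) t) (at t)"
proof -
  consider "t > 0" | "t < 0" | "t = 0" by linarith
  then show ?thesis
  proof cases
    case 1
    have ev: "eventually (\<lambda>s. flat_poly p s = poly p (inverse s) * exp (- inverse s)) (nhds t)"
      using eventually_nhds_in_open[of "{0<..}" t] 1
      by (auto elim!: eventually_mono simp: flat_poly_def)
    have "((\<lambda>s. poly p (inverse s) * exp (- inverse s)) has_real_derivative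
        flat_poly (monom 1 2 * (p - pderiv p)) t) (at t)"
      using 1 by (auto intro!: derivative_eq_intros
        simp: flat_poly_def poly_monom power2_eq_square field_simps)
    then show ?thesis using DERIV_cong_ev[OF refl ev refl] by simp
  next
    case 2
    then have ev: "eventually (\<lambda>s. flat_poly p s = 0) (nhds t)"
      using eventually_nhds_in_open[of "{..<0}" t] 2
      by (auto elim!: eventually_mono simp: flat_poly_def)
    moreover have "flat_poly (monom 1 2 * (p - pderiv p)) t = 0"
      using 2 by (simp add: flat_poly_def)
    ultimately show ?thesis using DERIV_cong_ev[OF refl ev refl, of 0] DERIV_const by metis
  next
    case 3
    have "((\<lambda>h. flat_poly p h / h) \<longlongrightarrow> 0) (at_right 0)"
    proof (rule Lim_transform_eventually)
      \<comment> \<open>\<open>pCons 0 p\<close> is the polynomial x p(x); the extra factor x is the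
        1/h of the difference quotient.\<close>
      show "((\<lambda>h::real. poly (pCons 0 p) (inverse h) * exp (- inverse h)) \<longlongrightarrow> 0) (at_right 0)"
        using filterlim_compose[OF poly_times_exp_minus_tendsto_0 filterlim_inverse_at_top_right] .
      show "eventually (\<lambda>h. poly (pCons 0 p) (inverse h) * exp (- inverse h) = flat_poly p h / h) (at_right 0)"
        by (rule eventually_at_rightI[of 0 1]) (auto simp: flat_poly_def field_simps)
    qed
    moreover have "((\<lambda>h. flat_poly p h / h) \<longlongrightarrow> 0) (at_left 0)"
      by (rule Lim_transform_eventually[OF tendsto_const])
        (auto intro!: eventually_at_leftI[of "-1"] simp: flat_poly_def)
    ultimately have "((\<lambda>h. flat_poly p h / h) \<longlongrightarrow> 0) (at 0)"
      by (simp add: filterlim_split_at)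
    then show ?thesis
      unfolding has_field_derivative_iff 3 by (simp add: flat_poly_def)
  qed
qed

lemma Ck_on_flat:
  "openin (Euclidean_space n) S \<Longrightarrow> Ck_on n k S f \<Longrightarrow> Ck_on n k S (\<lambda>y. flat_poly 1 (f y))"
  using Ck_on_real_compose[of n S "\<lambda>j. flat_poly (((\<lambda>p. monom 1 2 * (p - pderiv p)) ^^ j) 1)" k f 0]
  by (simp add: flat_poly_deriv)

text \<open>In each coordinate, u is positive exactly at distance less than e from
  \<open>a i\<close>, and v exactly at distance greater than e / 2. So u + v never vanishes, and u /
  (u + v) is 1 where v is 0 and 0 where u is 0. The product over the coordinates is a plateau
  function of a box.\<close>

lemma smooth_plateau:
  assumes "0 < e"
  obtains \<phi> :: "(nat \<Rightarrow> real) \<Rightarrow> real" where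
    "\<And>S. openin (Euclidean_space n) S \<Longrightarrow> smooth_on n S \<phi>"
    "\<And>y. (\<And>i. i < n \<Longrightarrow> \<bar>y i - a i\<bar> \<le> e / 2) \<Longrightarrow> \<phi> y = 1"
    "\<And>y i. i < n \<Longrightarrow> \<bar>y i - a i\<bar> \<ge> e \<Longrightarrow> \<phi> y = 0"
proof -
  define s where "s i y = (y i + - a i) * (y i + - a i)" for i and y :: "nat \<Rightarrow> real"
  define u where "u i y = flat_poly 1 (e\<^sup>2 + - 1 * s i y)" for i and y :: "nat \<Rightarrow> real"
  define v where "v i y = flat_poly 1 (s i y + - (e / 2)\<^sup>2)" for i and y :: "nat \<Rightarrow> real"
  have nn: "u i y \<ge> 0" "v i y \<ge> 0" for i y
    by (auto simp: u_def v_def flat_poly_def)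
  have pos: "u i y + v i y > 0" for i y
  proof (cases "s i y < e\<^sup>2")
    case True
    then have "u i y > 0" by (simp add: u_def flat_poly_def)
    then show ?thesis using nn[of i y] by linarith
  next
    case False
    moreover have "(e / 2)\<^sup>2 < e\<^sup>2" using assms by (simp add: power_divide)
    ultimately have "v i y > 0" by (simp add: v_def flat_poly_def)
    then show ?thesis using nn[of i y] by linarith
  qed
  define \<phi> where "\<phi> y = (\<Prod>i<n. u i y * inverse (u i y + v i y))" for y
  show ?thesis
  proof
    show "smooth_on n S \<phi>" if "openin (Euclidean_space n) S" for S
    proof -
      have s: "Ck_on n k S (s i)" for k i
        unfolding s_def by (intro Ck_on_add Ck_on_mult Ck_on_const Ck_on_coordinate that)
      have u: "Ck_on n k S (u i)" for k i
        unfolding u_def using that by (rule Ck_on_flat) (intro Ck_on_add Ck_on_mult Ck_on_const s that)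
      have v: "Ck_on n k S (v i)" for k i
        unfolding v_def using that by (rule Ck_on_flat) (intro Ck_on_add Ck_on_const s that)
      have nz: "u i y + v i y \<noteq> 0" for i y
        using pos[of i y] by simp
      have "Ck_on n k S (\<lambda>y. inverse (u i y + v i y))" for k i
        by (rule Ck_on_inverse[OF that nz Ck_on_add[OF that u v]])
      then have "Ck_on n k S \<phi>" for k
        unfolding \<phi>_def by (intro Ck_on_prod Ck_on_mult u that)
      then show ?thesis
        unfolding smooth_on_def by blast
    qed
  next
    fix y assume y: "\<And>i. i < n \<Longrightarrow> \<bar>y i - a i\<bar> \<le> e / 2"
    have "v i y = 0" if "i < n" for i
      using power_mono[OF y[OF that], of 2] by (simp add: v_def flat_poly_def s_def power2_eq_square)
    then have "u i y * inverse (u i y + v i y) = 1" if "i < n" for i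
      using pos[of i y] that by simp
    then show "\<phi> y = 1" unfolding \<phi>_def by simp
  next
    fix y i assume i: "i < n" "\<bar>y i - a i\<bar> \<ge> e"
    have "u i y = 0"
      using power_mono[OF i(2), of 2] assms by (simp add: u_def flat_poly_def s_def power2_eq_square)
    then show "\<phi> y = 0" unfolding \<phi>_def using i(1) by auto
  qed
qed

lemma sum_apply_fun: "(\<Sum>j\<in>J. f j) x = (\<Sum>j\<in>J. f j x)"
  for f :: "'j \<Rightarrow> 'a \<Rightarrow> 'b::comm_monoid_add"
  by (induction J rule: infinite_finite_induct) auto

section \<open>Manifolds\<close>

lemma smooth_on_subset: "smooth_on n S f \<Longrightarrow> S' \<subseteq> S \<Longrightarrow> smooth_on n S' f"
  by (auto simp: smooth_on_def intro: Ck_on_subset)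

lemma smooth_on_compose:
  assumes "openin (Euclidean_space n) S" "openin (Euclidean_space m) T"
    "\<And>y. y \<in> S \<Longrightarrow> F y \<in> T" "smooth_on m T g" "\<And>j. j < m \<Longrightarrow> smooth_on n S (\<lambda>y. F y j)"
  shows "smooth_on n S (\<lambda>y. g (F y))"
  using assms Ck_on_compose[of n S m T F] by (simp add: smooth_on_def)

lemma smooth_on_cong:
  "openin (Euclidean_space n) S \<Longrightarrow> (\<And>y. y \<in> S \<Longrightarrow> f y = g y) \<Longrightarrow> smooth_on n S f \<longleftrightarrow> smooth_on n S g"
  using Ck_on_cong[of n S f g] by (simp add: smooth_on_def)

lemma smooth_on_partial_deriv: "smooth_on n S f \<Longrightarrow> i < n \<Longrightarrow> smooth_on n S (partial_deriv i f)"
  unfolding smooth_on_def using Ck_on.simps(2) by blast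

text \<open>\<open>mtop\<close> is defined through \<open>topology\<close>, whose open sets are
  known only once the defining predicate is seen to be closed under intersections and unions. Images
  under a chart respect intersections because charts are injective.\<close>

lemma openin_mtop_aux:
  assumes "\<And>c. c \<in> charts M \<Longrightarrow> inj_on (snd c) (fst c)"
  shows "openin (mtop M) W \<longleftrightarrow> W \<subseteq> pts M \<and>
     (\<forall>c\<in>charts M. openin (Euclidean_space (mdim M)) (snd c ` (W \<inter> fst c)))"
proof -
  have "istopology (\<lambda>W. W \<subseteq> pts M \<and>
     (\<forall>c\<in>charts M. openin (Euclidean_space (mdim M)) (snd c ` (W \<inter> fst c))))"
    unfolding istopology_def
  proof (intro conjI allI impI ballI)
    fix S T c
    assume ST: "S \<subseteq> pts M \<and> (\<forall>c\<in>charts M. openin (Euclidean_space (mdim M)) (snd c ` (S \<inter> fst c)))"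
      "T \<subseteq> pts M \<and> (\<forall>c\<in>charts M. openin (Euclidean_space (mdim M)) (snd c ` (T \<inter> fst c)))"
      and c: "c \<in> charts M"
    have "snd c ` (S \<inter> T \<inter> fst c) = snd c ` (S \<inter> fst c) \<inter> snd c ` (T \<inter> fst c)"
      using assms[OF c] by (auto simp: inj_on_def)
    then show "openin (Euclidean_space (mdim M)) (snd c ` (S \<inter> T \<inter> fst c))"
      using ST c by (auto intro: openin_Int)
  next
    fix \<K> c
    assume K: "\<forall>K\<in>\<K>. K \<subseteq> pts M \<and> (\<forall>c\<in>charts M. openin (Euclidean_space (mdim M)) (snd c ` (K \<inter> fst c)))"
      and c: "c \<in> charts M"
    have "snd c ` (\<Union>\<K> \<inter> fst c) = \<Union> ((\<lambda>K. snd c ` (K \<inter> fst c)) ` \<K>)" by blast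
    then show "openin (Euclidean_space (mdim M)) (snd c ` (\<Union>\<K> \<inter> fst c))"
      using K c by (auto intro!: openin_Union)
  qed auto
  then show ?thesis
    unfolding mtop_def by simp
qed

text \<open>Just the axioms of an atlas: the total space of the dual bundle is given by its bundle
  charts, and these do not form a maximal atlas.\<close>

locale atlas =
  fixes Q :: "'q mfd"
  assumes is_chart: "c \<in> charts Q \<Longrightarrow> is_chart (mdim Q) c"
    and compat: "c \<in> charts Q \<Longrightarrow> d \<in> charts Q \<Longrightarrow> chart_compat (mdim Q) c d"
begin

lemma chart_inj: "c \<in> charts Q \<Longrightarrow> inj_on (snd c) (fst c)"
  using is_chart by (auto simp: is_chart_def)

lemma openin_mtop: "openin (mtop Q) W \<longleftrightarrow> W \<subseteq> pts Q \<and>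
     (\<forall>c\<in>charts Q. openin (Euclidean_space (mdim Q)) (snd c ` (W \<inter> fst c)))"
  by (rule openin_mtop_aux) (rule chart_inj)

lemma chart_subset_pts: "c \<in> charts Q \<Longrightarrow> fst c \<subseteq> pts Q"
  by (auto simp: pts_def)

lemma openin_chart: "c \<in> charts Q \<Longrightarrow> openin (mtop Q) (fst c)"
  unfolding openin_mtop
  using compat chart_subset_pts by (auto simp: chart_compat_def Int_commute)

lemma openin_image: "openin (mtop Q) W \<Longrightarrow> c \<in> charts Q \<Longrightarrow>
    openin (Euclidean_space (mdim Q)) (snd c ` (W \<inter> fst c))"
  by (simp add: openin_mtop)

lemma openin_subset_pts: "openin (mtop Q) W \<Longrightarrow> W \<subseteq> pts Q"
  by (simp add: openin_mtop)

lemma openin_pts: "openin (mtop Q) (pts Q)"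
  unfolding pts_def by (intro openin_Union) (auto intro: openin_chart)

lemma topspace_mtop: "topspace (mtop Q) = pts Q"
  using openin_pts openin_subset openin_topspace openin_subset_pts by blast

lemma inv_chart: "c \<in> charts Q \<Longrightarrow> x \<in> fst c \<Longrightarrow> inv_into (fst c) (snd c) (snd c x) = x"
  using chart_inj by (simp add: inv_into_f_f)

lemma in_chart_eq: "c \<in> charts Q \<Longrightarrow> x \<in> fst c \<Longrightarrow> in_chart c f (snd c x) = f x"
  by (simp add: in_chart_def inv_chart)

lemma chart_eq_0: "c \<in> charts Q \<Longrightarrow> x \<in> fst c \<Longrightarrow> i \<ge> mdim Q \<Longrightarrow> snd c x i = 0"
  using openin_Euclidean_spaceD[of "mdim Q" "snd c ` fst c" "snd c x" i] is_chart
  by (auto simp: is_chart_def)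

lemma transition_smooth:
  assumes "c \<in> charts Q" "d \<in> charts Q" "i < mdim Q"
  shows "smooth_on (mdim Q) (snd c ` (fst c \<inter> fst d)) (in_chart c (\<lambda>x. snd d x i))"
  using compat[OF assms(1,2)] assms(3) by (simp add: chart_compat_def)

text \<open>Seen in another chart, the set is the preimage of U under the transition map, which is
  continuous because its coordinates are.\<close>

lemma openin_chart_preimage:
  assumes c: "c \<in> charts Q" and U: "openin (Euclidean_space (mdim Q)) U"
  shows "openin (mtop Q) {x \<in> fst c. snd c x \<in> U}"
  unfolding openin_mtop
proof (intro conjI ballI)
  fix d assume d: "d \<in> charts Q"
  define S where "S = snd d ` (fst d \<inter> fst c)"
  define F where "F y = snd c (inv_into (fst d) (snd d) y)" for y
  have S: "openin (Euclidean_space (mdim Q)) S"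
    unfolding S_def using compat[OF d c] by (simp add: chart_compat_def)
  have SS: "S \<subseteq> topspace (Euclidean_space (mdim Q))" by (rule openin_subset[OF S])
  have F: "F (snd d x) = snd c x" if "x \<in> fst d" for x
    using that d by (simp add: F_def inv_chart)
  have top: "subtopology (Euclidean_space (mdim Q)) S = top_of_set S"
    using SS unfolding Euclidean_space_def topspace_Euclidean_space
    by (simp add: subtopology_subtopology euclidean_product_topology Int_absorb1)
  have "continuous_on S (\<lambda>y. F y i)" if i: "i < mdim Q" for i
    using transition_smooth[OF d c i] Ck_on.simps(1)[of "mdim Q"]
    unfolding S_def F_def smooth_on_def in_chart_def by metis
  \<comment> \<open>Continuity into Euclidean space is tested on truncated maps. F is its own
    truncation, since charts vanish from the dimension on.\<close>
  then have "continuous_map (subtopology (Euclidean_space (mdim Q)) S) (Euclidean_space (mdim Q))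
      (\<lambda>y i. if i < mdim Q then F y i else 0)"
    unfolding continuous_map_componentwise_Euclidean_space top by simp
  then have "continuous_map (subtopology (Euclidean_space (mdim Q)) S) (Euclidean_space (mdim Q)) F"
  proof (rule continuous_map_eq)
    fix y assume "y \<in> topspace (subtopology (Euclidean_space (mdim Q)) S)"
    then obtain x where "x \<in> fst d" "x \<in> fst c" "y = snd d x" by (auto simp: S_def)
    then show "(\<lambda>i. if i < mdim Q then F y i else 0) = F y"
      using chart_eq_0[OF c, of x] F[of x] by (intro ext) simp
  qed
  from openin_continuous_map_preimage[OF this U]
  have "openin (subtopology (Euclidean_space (mdim Q)) S) {y \<in> S. F y \<in> U}"
    using SS by (simp add: Int_absorb1)
  then have "openin (Euclidean_space (mdim Q)) {y \<in> S. F y \<in> U}"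
    using S by (rule openin_trans_full)
  moreover have "snd d ` ({x \<in> fst c. snd c x \<in> U} \<inter> fst d) = {y \<in> S. F y \<in> U}"
    using F by (auto simp: S_def)
  ultimately show "openin (Euclidean_space (mdim Q)) (snd d ` ({x \<in> fst c. snd c x \<in> U} \<inter> fst d))"
    by simp
qed (use chart_subset_pts[OF c] in auto)

lemma smooth_fun_in_chart:
  "smooth_fun Q W f \<Longrightarrow> c \<in> charts Q \<Longrightarrow> smooth_on (mdim Q) (snd c ` (W \<inter> fst c)) (in_chart c f)"
  by (simp add: smooth_fun_def)

lemma smooth_fun_subset: "smooth_fun Q W f \<Longrightarrow> U \<subseteq> W \<Longrightarrow> smooth_fun Q U f"
  unfolding smooth_fun_def by (blast intro: smooth_on_subset)

lemma smooth_fun_cong: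
  assumes "openin (mtop Q) W" "\<And>x. x \<in> W \<Longrightarrow> f x = g x"
  shows "smooth_fun Q W f \<longleftrightarrow> smooth_fun Q W g"
proof -
  have "smooth_on (mdim Q) (snd c ` (W \<inter> fst c)) (in_chart c f) \<longleftrightarrow>
      smooth_on (mdim Q) (snd c ` (W \<inter> fst c)) (in_chart c g)" if "c \<in> charts Q" for c
    by (rule smooth_on_cong[OF openin_image[OF assms(1) that]])
      (use that assms(2) in \<open>auto simp: in_chart_eq\<close>)
  then show ?thesis by (simp add: smooth_fun_def)
qed

lemma smooth_fun_local:
  assumes W: "openin (mtop Q) W"
    and "\<And>x. x \<in> W \<Longrightarrow> \<exists>U. openin (mtop Q) U \<and> x \<in> U \<and> smooth_fun Q (W \<inter> U) f"
  shows "smooth_fun Q W f"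
  unfolding smooth_fun_def smooth_on_def
proof (intro ballI allI)
  fix c k assume c: "c \<in> charts Q"
  show "Ck_on (mdim Q) k (snd c ` (W \<inter> fst c)) (in_chart c f)"
  proof (rule Ck_on_local[OF openin_image[OF W c]])
    fix y assume "y \<in> snd c ` (W \<inter> fst c)"
    then obtain x where x: "x \<in> W" "x \<in> fst c" "y = snd c x" by blast
    then obtain U where U: "openin (mtop Q) U" "x \<in> U" "smooth_fun Q (W \<inter> U) f"
      using assms(2) by blast
    have "snd c ` (W \<inter> fst c) \<inter> snd c ` (U \<inter> fst c) = snd c ` (W \<inter> U \<inter> fst c)"
      using chart_inj[OF c] by (auto simp: inj_on_def)
    then show "\<exists>V. openin (Euclidean_space (mdim Q)) V \<and> y \<in> V \<and>
        Ck_on (mdim Q) k (snd c ` (W \<inter> fst c) \<inter> V) (in_chart c f)"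
      using openin_image[OF U(1) c] smooth_fun_in_chart[OF U(3) c] U x
      by (intro exI[of _ "snd c ` (U \<inter> fst c)"]) (auto simp: smooth_on_def)
  qed
qed

text \<open>One chart containing W suffices: in any other chart the function is its expression in
  the first one composed with a smooth transition map.\<close>

lemma smooth_funI_chart:
  assumes W: "openin (mtop Q) W" and c: "c \<in> charts Q" and "W \<subseteq> fst c"
    and f: "smooth_on (mdim Q) (snd c ` W) (in_chart c f)"
  shows "smooth_fun Q W f"
  unfolding smooth_fun_def
proof
  fix d assume d: "d \<in> charts Q"
  have cW: "openin (Euclidean_space (mdim Q)) (snd c ` W)"
    using openin_image[OF W c] \<open>W \<subseteq> fst c\<close> by (simp add: Int_absorb2)
  have S: "openin (Euclidean_space (mdim Q)) (snd d ` (W \<inter> fst d))"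
    by (rule openin_image[OF W d])
  have "smooth_on (mdim Q) (snd d ` (W \<inter> fst d))
      (\<lambda>y. in_chart c f (\<lambda>i. in_chart d (\<lambda>x. snd c x i) y))"
  proof (rule smooth_on_compose[OF S cW _ f])
    fix j assume "j < mdim Q"
    then show "smooth_on (mdim Q) (snd d ` (W \<inter> fst d)) (in_chart d (\<lambda>x. snd c x j))"
      by (rule smooth_on_subset[OF transition_smooth[OF d c]]) (use \<open>W \<subseteq> fst c\<close> in auto)
  qed (use d in \<open>auto simp: in_chart_eq\<close>)
  then show "smooth_on (mdim Q) (snd d ` (W \<inter> fst d)) (in_chart d f)"
    by (rule smooth_on_cong[OF S, THEN iffD1, rotated])
      (use d c \<open>W \<subseteq> fst c\<close> in \<open>auto simp: in_chart_eq subset_iff\<close>)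
qed

lemma smooth_fun_coordinate: "c \<in> charts Q \<Longrightarrow> smooth_fun Q (fst c) (\<lambda>x. snd c x i)"
proof (rule smooth_funI_chart[OF openin_chart])
  assume c: "c \<in> charts Q"
  have S: "openin (Euclidean_space (mdim Q)) (snd c ` fst c)"
    using is_chart[OF c] by (simp add: is_chart_def)
  have "smooth_on (mdim Q) (snd c ` fst c) (\<lambda>y. y i)"
    unfolding smooth_on_def using Ck_on_coordinate[OF S] by blast
  then show "smooth_on (mdim Q) (snd c ` fst c) (in_chart c (\<lambda>x. snd c x i))"
    by (rule smooth_on_cong[OF S, THEN iffD1, rotated]) (use c in \<open>auto simp: in_chart_eq\<close>)
qed auto

lemma smooth_fun_const: "openin (mtop Q) W \<Longrightarrow> smooth_fun Q W (\<lambda>_. a)"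
  unfolding smooth_fun_def smooth_on_def in_chart_def by (blast intro: Ck_on_const openin_image)

lemma smooth_fun_add:
  "openin (mtop Q) W \<Longrightarrow> smooth_fun Q W f \<Longrightarrow> smooth_fun Q W g \<Longrightarrow> smooth_fun Q W (\<lambda>x. f x + g x)"
  unfolding smooth_fun_def smooth_on_def in_chart_def by (intro ballI allI Ck_on_add openin_image) blast+

lemma smooth_fun_mult:
  "openin (mtop Q) W \<Longrightarrow> smooth_fun Q W f \<Longrightarrow> smooth_fun Q W g \<Longrightarrow> smooth_fun Q W (\<lambda>x. f x * g x)"
  unfolding smooth_fun_def smooth_on_def in_chart_def by (intro ballI allI Ck_on_mult openin_image) blast+

lemma smooth_fun_uminus:
  "openin (mtop Q) W \<Longrightarrow> smooth_fun Q W f \<Longrightarrow> smooth_fun Q W (\<lambda>x. - f x)"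
  using smooth_fun_mult[OF _ smooth_fun_const[of W "-1"], of f] by simp

lemma smooth_fun_diff:
  "openin (mtop Q) W \<Longrightarrow> smooth_fun Q W f \<Longrightarrow> smooth_fun Q W g \<Longrightarrow> smooth_fun Q W (\<lambda>x. f x - g x)"
  using smooth_fun_add[OF _ _ smooth_fun_uminus, of W f g] by simp

lemma smooth_fun_inverse:
  assumes W: "openin (mtop Q) W" and "smooth_fun Q W f" and "\<And>x. x \<in> W \<Longrightarrow> f x \<noteq> 0"
  shows "smooth_fun Q W (\<lambda>x. inverse (f x))"
  unfolding smooth_fun_def smooth_on_def
proof (intro ballI allI)
  fix c k assume c: "c \<in> charts Q"
  have "Ck_on (mdim Q) k (snd c ` (W \<inter> fst c)) (\<lambda>y. inverse (in_chart c f y))"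
    by (rule Ck_on_inverse[OF openin_image[OF W c]])
      (use assms c in_chart_eq[OF c] in \<open>auto simp: smooth_fun_def smooth_on_def\<close>)
  then show "Ck_on (mdim Q) k (snd c ` (W \<inter> fst c)) (in_chart c (\<lambda>x. inverse (f x)))"
    by (simp add: in_chart_def)
qed

lemma smooth_fun_sum:
  "openin (mtop Q) W \<Longrightarrow> (\<And>j. j \<in> J \<Longrightarrow> smooth_fun Q W (f j)) \<Longrightarrow> smooth_fun Q W (\<lambda>x. \<Sum>j\<in>J. f j x)"
  unfolding smooth_fun_def smooth_on_def in_chart_def by (intro ballI allI Ck_on_sum openin_image) blast+

lemma smooth_fun_prod:
  "openin (mtop Q) W \<Longrightarrow> (\<And>j. j \<in> J \<Longrightarrow> smooth_fun Q W (f j)) \<Longrightarrow> smooth_fun Q W (\<lambda>x. \<Prod>j\<in>J. f j x)"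
  unfolding smooth_fun_def smooth_on_def in_chart_def by (intro ballI allI Ck_on_prod openin_image) blast+

section \<open>Germs of functions and coordinate vectors\<close>

lemma eq_near_sym: "eq_near Q x f g \<Longrightarrow> eq_near Q x g f"
  unfolding eq_near_def by auto

lemma eq_near_imp_eq: "eq_near Q x f g \<Longrightarrow> f x = g x"
  unfolding eq_near_def by auto

lemma smooth_near_cong: "eq_near Q x f g \<Longrightarrow> smooth_near Q x f \<longleftrightarrow> smooth_near Q x g"
proof -
  have "smooth_near Q x g" if fg: "eq_near Q x f g" and f: "smooth_near Q x f" for f g
  proof -
    obtain U where U: "openin (mtop Q) U" "x \<in> U" "\<forall>z\<in>U. f z = g z"
      using fg by (auto simp: eq_near_def)
    obtain W where W: "openin (mtop Q) W" "x \<in> W" "smooth_fun Q W f"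
      using f by (auto simp: smooth_near_def)
    have "smooth_fun Q (W \<inter> U) g"
      by (rule smooth_fun_cong[OF openin_Int[OF W(1) U(1)], THEN iffD1, OF _ smooth_fun_subset[OF W(3)]])
        (use U in auto)
    then show ?thesis using U W unfolding smooth_near_def by (blast intro: openin_Int)
  qed
  then show "eq_near Q x f g \<Longrightarrow> ?thesis" using eq_near_sym by blast
qed

lemma coord_vec_cong:
  assumes "eq_near Q x f g" "c \<in> charts Q" "x \<in> fst c" "i < mdim Q"
  shows "coord_vec Q c i x f = coord_vec Q c i x g"
proof -
  obtain U where U: "openin (mtop Q) U" "x \<in> U" "\<forall>z\<in>U. f z = g z"
    using assms(1) by (auto simp: eq_near_def)
  have "eventually (\<lambda>t. (snd c x)(i := t) \<in> snd c ` (U \<inter> fst c)) (nhds (snd c x i))"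
    by (rule eventually_line_in[OF openin_image[OF U(1) assms(2)]]) (use assms U in auto)
  then have "eventually (\<lambda>t. in_chart c f ((snd c x)(i := t)) = in_chart c g ((snd c x)(i := t))) (nhds (snd c x i))"
  proof eventually_elim
    case (elim t)
    then obtain z where "z \<in> U" "z \<in> fst c" "(snd c x)(i := t) = snd c z" by blast
    then show ?case using U(3) assms(2) by (simp add: in_chart_eq)
  qed
  then show ?thesis
    using smooth_near_cong[OF assms(1)]
    by (simp add: coord_vec_def partial_deriv_def deriv_cong_ev)
qed

text \<open>The chain rule for a function that factors through Euclidean space near x. With F
  another chart it gives the change of coordinates; with F the coordinates of the base point it
  gives the derivatives of functions pulled back to the total space of a bundle.\<close>

lemma coord_vec_chain:
  assumes c: "c \<in> charts Q" "x \<in> fst c" and i: "i < mdim Q"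
    and W: "openin (mtop Q) W" "x \<in> W" and N: "openin (Euclidean_space N) T" "smooth_on N T g"
    and F: "\<And>j. j < N \<Longrightarrow> smooth_fun Q W (\<lambda>z. F z j)" "\<And>z. z \<in> W \<Longrightarrow> F z \<in> T"
    and f: "smooth_near Q x f" and fg: "\<And>z. z \<in> W \<Longrightarrow> f z = g (F z)"
  shows "coord_vec Q c i x f = (\<Sum>j<N. partial_deriv j g (F x) * coord_vec Q c i x (\<lambda>z. F z j))"
proof -
  define S where "S = snd c ` (W \<inter> fst c)"
  have S: "openin (Euclidean_space (mdim Q)) S" "snd c x \<in> S"
    unfolding S_def using openin_image[OF W(1) c(1)] W c by auto
  define F' where "F' y = F (inv_into (fst c) (snd c) y)" for y
  have F': "F' (snd c z) = F z" if "z \<in> fst c" for z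
    using that c by (simp add: F'_def inv_chart)
  have "((\<lambda>t. g (F' ((snd c x)(i := t)))) has_real_derivative
    (\<Sum>j<N. partial_deriv j g (F' (snd c x)) * partial_deriv i (\<lambda>y. F' y j) (snd c x))) (at (snd c x i))"
  proof (rule partial_deriv_compose[OF S(1) N(1) _ _ _ i S(2), where k = 0 and l = 0])
    show "Ck_on N (Suc 0) T g" using N(2) unfolding smooth_on_def by blast
    show "Ck_on (mdim Q) (Suc 0) S (\<lambda>y. F' y j)" if "j < N" for j
      using smooth_fun_in_chart[OF F(1)[OF that] c(1)]
      unfolding S_def F'_def in_chart_def smooth_on_def by blast
    show "F' y \<in> T" if "y \<in> S" for y
      using that F(2) F' unfolding S_def by auto
  qed
  moreover have "partial_deriv i (in_chart c f) (snd c x) = deriv (\<lambda>t. g (F' ((snd c x)(i := t)))) (snd c x i)"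
    unfolding partial_deriv_def
  proof (rule deriv_cong_ev)
    show "eventually (\<lambda>t. in_chart c f ((snd c x)(i := t)) = g (F' ((snd c x)(i := t)))) (nhds (snd c x i))"
      using eventually_line_in[OF S i]
    proof eventually_elim
      case (elim t)
      then obtain z where "z \<in> W" "z \<in> fst c" "(snd c x)(i := t) = snd c z" unfolding S_def by blast
      then show ?case using fg c F' by (simp add: in_chart_eq)
    qed
  qed simp
  moreover have "partial_deriv i (\<lambda>y. F' y j) (snd c x) = coord_vec Q c i x (\<lambda>z. F z j)" if "j < N" for j
    using F(1)[OF that] W unfolding coord_vec_def smooth_near_def in_chart_def F'_def by auto
  ultimately show ?thesis
    using f c by (simp add: coord_vec_def DERIV_imp_deriv F')
qed

lemma smooth_near_coordinate: "c \<in> charts Q \<Longrightarrow> x \<in> fst c \<Longrightarrow> smooth_near Q x (\<lambda>x. snd c x i)"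
  unfolding smooth_near_def using smooth_fun_coordinate openin_chart by blast

lemma coord_vec_transform:
  assumes c: "c \<in> charts Q" "x \<in> fst c" and d: "d \<in> charts Q" "x \<in> fst d" and i: "i < mdim Q"
  shows "coord_vec Q c i x = (\<Sum>j<mdim Q. coord_vec Q c i x (\<lambda>z. snd d z j) *\<^sub>R coord_vec Q d j x)"
proof
  fix f
  show "coord_vec Q c i x f = (\<Sum>j<mdim Q. coord_vec Q c i x (\<lambda>z. snd d z j) *\<^sub>R coord_vec Q d j x) f"
  proof (cases "smooth_near Q x f")
    case True
    then obtain W where W: "openin (mtop Q) W" "x \<in> W" "smooth_fun Q W f"
      by (auto simp: smooth_near_def)
    have W': "openin (mtop Q) (W \<inter> fst d)" using W(1) openin_chart[OF d(1)] by (rule openin_Int)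
    have "coord_vec Q c i x f = (\<Sum>j<mdim Q. partial_deriv j (in_chart d f) (snd d x) * coord_vec Q c i x (\<lambda>z. snd d z j))"
      by (rule coord_vec_chain[OF c i W' _ openin_image[OF W(1) d(1)] smooth_fun_in_chart[OF W(3) d(1)]])
        (use d W True in \<open>auto simp: in_chart_eq intro!: smooth_fun_subset[OF smooth_fun_coordinate[OF d(1)]]\<close>)
    then show ?thesis
      using True by (simp add: sum_apply_fun scaleR_fun_def coord_vec_def[of Q d] mult.commute)
  next
    \<comment> \<open>Both sides are 0 by the convention for functions that are not smooth near
      x.\<close>
    case False
    then show ?thesis by (simp add: sum_apply_fun scaleR_fun_def coord_vec_def)
  qed
qed

lemma coord_vec_coordinate:
  assumes c: "c \<in> charts Q" "x \<in> fst c" and i: "i < mdim Q"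
  shows "coord_vec Q c i x (\<lambda>z. snd c z j) = (if i = j then 1 else 0)"
proof -
  have S: "openin (Euclidean_space (mdim Q)) (snd c ` fst c)"
    using is_chart[OF c(1)] by (simp add: is_chart_def)
  have "coord_vec Q c i x (\<lambda>z. snd c z j) = deriv (\<lambda>t. ((snd c x)(i := t)) j) (snd c x i)"
    using smooth_near_coordinate[OF c, of j] unfolding coord_vec_def partial_deriv_def
  proof (simp, intro deriv_cong_ev)
    have "eventually (\<lambda>t. (snd c x)(i := t) \<in> snd c ` fst c) (nhds (snd c x i))"
      by (rule eventually_line_in[OF S _ i]) (use c in auto)
    then show "eventually (\<lambda>t. in_chart c (\<lambda>z. snd c z j) ((snd c x)(i := t)) =
        (if j = i then t else snd c x j)) (nhds (snd c x i))"
    proof eventually_elim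
      case (elim t)
      then obtain z where z: "z \<in> fst c" "(snd c x)(i := t) = snd c z" by blast
      show ?case unfolding z(2) in_chart_eq[OF c(1) z(1)] using z(2)[symmetric] by simp
    qed
  qed simp
  also have "\<dots> = (if i = j then 1 else 0)"
    by (cases "i = j") (auto intro!: DERIV_imp_deriv)
  finally show ?thesis .
qed

lemma smooth_fun_coord_vec:
  assumes c: "c \<in> charts Q" and f: "smooth_fun Q W f" and W: "openin (mtop Q) W" and i: "i < mdim Q"
  shows "smooth_fun Q (W \<inter> fst c) (\<lambda>x. coord_vec Q c i x f)"
proof (rule smooth_funI_chart[OF openin_Int[OF W openin_chart[OF c]] c])
  have "smooth_on (mdim Q) (snd c ` (W \<inter> fst c)) (partial_deriv i (in_chart c f))"
    by (rule smooth_on_partial_deriv[OF smooth_fun_in_chart[OF f c] i])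
  then show "smooth_on (mdim Q) (snd c ` (W \<inter> fst c)) (in_chart c (\<lambda>x. coord_vec Q c i x f))"
    by (rule smooth_on_cong[OF openin_image[OF W c], THEN iffD1, rotated])
      (use c f W in \<open>auto simp: in_chart_eq coord_vec_def smooth_near_def\<close>)
qed auto

end

section \<open>Cutoff functions on Hausdorff manifolds\<close>

locale hausdorff_atlas = atlas Q for Q :: "'q mfd" +
  assumes hausdorff: "Hausdorff_space (mtop Q)"
begin

text \<open>The box is compact, so is its image under the inverse chart, and compact sets of a
  Hausdorff space are closed. In a non-Hausdorff space a function supported in the box could fail to
  be smooth after extension by 0.\<close>

lemma closedin_chart_box:
  assumes c: "c \<in> charts Q"
    and K: "{y. (\<forall>i<mdim Q. \<bar>y i - a i\<bar> \<le> e) \<and> (\<forall>i\<ge>mdim Q. y i = 0)} \<subseteq> snd c ` fst c" (is "?K \<subseteq> _")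
  shows "closedin (mtop Q) {x \<in> fst c. snd c x \<in> ?K}"
proof -
  \<comment> \<open>The box is a product of compact intervals and, from the dimension on, of the
    singleton {0}, so a product of compact sets.\<close>
  have "compactin (powertop_real UNIV) (\<Pi>\<^sub>E i\<in>UNIV. if i < mdim Q then {a i - e..a i + e} else {0})"
    unfolding compactin_PiE by (auto simp: compactin_euclidean_iff)
  moreover have "y i \<in> (if i < mdim Q then {a i - e..a i + e} else {0}) \<longleftrightarrow>
      (i < mdim Q \<longrightarrow> \<bar>y i - a i\<bar> \<le> e) \<and> (i \<ge> mdim Q \<longrightarrow> y i = 0)" for y i
    by auto
  then have "(\<Pi>\<^sub>E i\<in>UNIV. if i < mdim Q then {a i - e..a i + e} else {0}) = ?K"
    unfolding PiE_iff set_eq_iff extensional_UNIV by blast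
  ultimately have "compactin (Euclidean_space (mdim Q)) ?K"
    by (auto simp: Euclidean_space_def compactin_subtopology)
  then have "compactin (subtopology (Euclidean_space (mdim Q)) (snd c ` fst c)) ?K"
    using K by (simp add: compactin_subtopology)
  moreover have "continuous_map (subtopology (Euclidean_space (mdim Q)) (snd c ` fst c)) (mtop Q)
      (inv_into (fst c) (snd c))"
    unfolding continuous_map_def
  proof (intro conjI allI impI funcsetI)
    fix y assume "y \<in> topspace (subtopology (Euclidean_space (mdim Q)) (snd c ` fst c))"
    then show "inv_into (fst c) (snd c) y \<in> topspace (mtop Q)"
      using chart_subset_pts[OF c] inv_into_into[of y "snd c" "fst c"] by (auto simp: topspace_mtop)
  next
    fix U assume U: "openin (mtop Q) U"
    have "snd c ` fst c \<subseteq> topspace (Euclidean_space (mdim Q))"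
      using is_chart[OF c] by (auto simp: is_chart_def dest: openin_subset)
    then have "{y \<in> topspace (subtopology (Euclidean_space (mdim Q)) (snd c ` fst c)).
        inv_into (fst c) (snd c) y \<in> U} = snd c ` (U \<inter> fst c)"
      using inv_chart[OF c] by auto
    then show "openin (subtopology (Euclidean_space (mdim Q)) (snd c ` fst c))
        {y \<in> topspace (subtopology (Euclidean_space (mdim Q)) (snd c ` fst c)).
          inv_into (fst c) (snd c) y \<in> U}"
      using openin_image[OF U c] is_chart[OF c] by (auto simp: is_chart_def openin_open_subtopology)
  qed
  ultimately have "compactin (mtop Q) (inv_into (fst c) (snd c) ` ?K)"
    by (rule image_compactin)
  moreover have "inv_into (fst c) (snd c) ` ?K = {x \<in> fst c. snd c x \<in> ?K}"
  proof
    show "{x \<in> fst c. snd c x \<in> ?K} \<subseteq> inv_into (fst c) (snd c) ` ?K"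
    proof
      fix x assume "x \<in> {x \<in> fst c. snd c x \<in> ?K}"
      then show "x \<in> inv_into (fst c) (snd c) ` ?K"
        using inv_chart[OF c, of x] by (intro image_eqI[of _ _ "snd c x"]) auto
    qed
  next
    show "inv_into (fst c) (snd c) ` ?K \<subseteq> {x \<in> fst c. snd c x \<in> ?K}"
    proof
      fix x assume "x \<in> inv_into (fst c) (snd c) ` ?K"
      then obtain y where y: "y \<in> ?K" "x = inv_into (fst c) (snd c) y" by blast
      then have "y \<in> snd c ` fst c" using K by blast
      then have "x \<in> fst c" "snd c x = y" unfolding y(2) by (rule inv_into_into, rule f_inv_into_f)
      then show "x \<in> {x \<in> fst c. snd c x \<in> ?K}" using y(1) by blast
    qed
  qed
  ultimately show ?thesis
    by (intro compactin_imp_closedin[OF hausdorff]) simp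
qed

text \<open>The plateau function of a coordinate box is transported to the manifold and extended by
  0. Besides the neighbourhood U where it is 1, a closed set K inside W is supplied off which it
  vanishes; it allows products with sections over W to be extended smoothly by 0.\<close>

lemma bump_function:
  assumes W: "openin (mtop Q) W" "x \<in> W"
  obtains \<phi> U K where "smooth_fun Q (pts Q) \<phi>" "openin (mtop Q) U" "x \<in> U" "U \<subseteq> W"
    "\<And>z. z \<in> U \<Longrightarrow> \<phi> z = 1" "closedin (mtop Q) K" "K \<subseteq> W" "\<And>z. z \<notin> K \<Longrightarrow> \<phi> z = 0"
proof -
  obtain c where c: "c \<in> charts Q" "x \<in> fst c"
    using W openin_subset_pts unfolding pts_def by blast
  define n where "n = mdim Q"
  obtain e0 where e0: "e0 > 0" "\<And>z. (\<And>i. i \<ge> n \<Longrightarrow> z i = 0) \<Longrightarrow>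
      (\<And>i. i < n \<Longrightarrow> \<bar>z i - snd c x i\<bar> < e0) \<Longrightarrow> z \<in> snd c ` (W \<inter> fst c)"
    unfolding n_def
    by (rule openin_Euclidean_space_box[OF openin_image[OF W(1) c(1)], of "snd c x"]) (use W c in auto)
  \<comment> \<open>Half the radius, so that even the closed box lies in the image of W.\<close>
  define e where "e = e0 / 2"
  have e: "0 < e" "e < e0" using e0(1) by (auto simp: e_def)
  obtain \<psi> where \<psi>: "\<And>S. openin (Euclidean_space n) S \<Longrightarrow> smooth_on n S \<psi>"
    "\<And>y. (\<And>i. i < n \<Longrightarrow> \<bar>y i - snd c x i\<bar> \<le> e / 2) \<Longrightarrow> \<psi> y = 1"
    "\<And>y i. i < n \<Longrightarrow> \<bar>y i - snd c x i\<bar> \<ge> e \<Longrightarrow> \<psi> y = 0"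
    by (rule smooth_plateau[OF e(1), where n = n and a = "snd c x"]) blast
  define B where "B = {y. (\<forall>i<n. \<bar>y i - snd c x i\<bar> \<le> e) \<and> (\<forall>i\<ge>n. y i = 0)}"
  define K where "K = {z \<in> fst c. snd c z \<in> B}"
  define \<phi> where "\<phi> z = (if z \<in> fst c then \<psi> (snd c z) else 0)" for z
  have B: "B \<subseteq> snd c ` (W \<inter> fst c)"
  proof
    fix y assume "y \<in> B"
    then show "y \<in> snd c ` (W \<inter> fst c)"
      using e(2) by (intro e0(2)) (auto simp: B_def intro: le_less_trans)
  qed
  have K: "closedin (mtop Q) K"
    unfolding K_def B_def n_def
    by (rule closedin_chart_box[OF c(1)]) (use B in \<open>auto simp: B_def n_def\<close>)
  have KW: "K \<subseteq> W"
    using B chart_inj[OF c(1)] by (auto simp: K_def inj_on_def subset_iff image_iff)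
  have out: "\<phi> z = 0" if "z \<notin> K" for z
  proof (cases "z \<in> fst c")
    case True
    then have "snd c z \<notin> B" using that by (simp add: K_def)
    moreover have "snd c z i = 0" if "i \<ge> n" for i
      using chart_eq_0[OF c(1) True] that by (simp add: n_def)
    ultimately obtain i where "i < n" "\<not> \<bar>snd c z i - snd c x i\<bar> \<le> e" by (auto simp: B_def)
    then show ?thesis using \<psi>(3)[of i "snd c z"] True by (simp add: \<phi>_def)
  qed (simp add: \<phi>_def)
  have S: "openin (Euclidean_space n) (snd c ` fst c)"
    using is_chart[OF c(1)] by (simp add: is_chart_def n_def)
  have 1: "smooth_fun Q (fst c) \<phi>"
  proof (rule smooth_funI_chart[OF openin_chart[OF c(1)] c(1)])
    have "in_chart c \<phi> y = \<psi> y" if "y \<in> snd c ` fst c" for y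
      using that in_chart_eq[OF c(1)] by (auto simp: \<phi>_def)
    from smooth_on_cong[OF S this]
    show "smooth_on (mdim Q) (snd c ` fst c) (in_chart c \<phi>)"
      using \<psi>(1)[OF S] by (simp add: n_def)
  qed auto
  \<comment> \<open>The chart domain and the complement of K are open and cover the manifold; the
    function is smooth on the former and 0 on the latter.\<close>
  have opc: "openin (mtop Q) (pts Q - K)"
    using K by (simp add: closedin_def topspace_mtop)
  have 2: "smooth_fun Q (pts Q - K) \<phi>"
    using smooth_fun_cong[OF opc, of \<phi> "\<lambda>_. 0"] smooth_fun_const[OF opc] out by auto
  have "smooth_fun Q (pts Q) \<phi>"
  proof (rule smooth_fun_local[OF openin_pts])
    fix z assume z: "z \<in> pts Q"
    show "\<exists>U. openin (mtop Q) U \<and> z \<in> U \<and> smooth_fun Q (pts Q \<inter> U) \<phi>"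
    proof (cases "z \<in> K")
      case True
      then show ?thesis
        using openin_chart[OF c(1)] smooth_fun_subset[OF 1] by (intro exI[of _ "fst c"]) (auto simp: K_def)
    next
      case False
      then show ?thesis
        using opc smooth_fun_subset[OF 2] z by (intro exI[of _ "pts Q - K"]) auto
    qed
  qed
  moreover
  define V where "V = {y. (\<forall>i<n. \<bar>y i - snd c x i\<bar> < e / 2) \<and> (\<forall>i\<ge>n. y i = 0)}"
  have "openin (Euclidean_space n) V"
  proof -
    have "open (\<Pi>\<^sub>E i\<in>UNIV. if i < n then {snd c x i - e / 2 <..< snd c x i + e / 2} else UNIV)"
      by (rule open_PiE) (auto intro: finite_subset[of _ "{..<n}"])
    moreover have "y i \<in> (if i < n then {snd c x i - e / 2 <..< snd c x i + e / 2} else UNIV) \<longleftrightarrow>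
        (i < n \<longrightarrow> \<bar>y i - snd c x i\<bar> < e / 2)" for y i
      unfolding abs_less_iff by (cases "i < n") (simp_all, linarith)
    then have "V = (\<Pi>\<^sub>E i\<in>UNIV. if i < n then {snd c x i - e / 2 <..< snd c x i + e / 2} else UNIV) \<inter> {y. \<forall>i\<ge>n. y i = 0}"
      unfolding V_def PiE_iff set_eq_iff extensional_UNIV by blast
    ultimately show ?thesis unfolding openin_Euclidean_space_iff by blast
  qed
  then have "openin (mtop Q) {z \<in> fst c. snd c z \<in> V}"
    unfolding n_def by (rule openin_chart_preimage[OF c(1)])
  moreover have "x \<in> {z \<in> fst c. snd c z \<in> V}"
    using c e(1) chart_eq_0[OF c] by (auto simp: V_def n_def)
  moreover have "{z \<in> fst c. snd c z \<in> V} \<subseteq> W"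
    using KW e(1) by (force simp: K_def B_def V_def)
  moreover have "\<phi> z = 1" if "z \<in> {z \<in> fst c. snd c z \<in> V}" for z
    using that \<psi>(2)[of "snd c z"] by (auto simp: \<phi>_def V_def intro: less_imp_le)
  ultimately show ?thesis using that K KW out by blast
qed

end

section \<open>Finite bases\<close>

definition is_basis :: "nat \<Rightarrow> (nat \<Rightarrow> 'w::real_vector) \<Rightarrow> 'w set \<Rightarrow> bool" where
  "is_basis R b V \<longleftrightarrow> inj_on b {..<R} \<and> independent (b ` {..<R}) \<and> span (b ` {..<R}) = V"

definition dual_basis :: "nat \<Rightarrow> (nat \<Rightarrow> 'w::real_vector) \<Rightarrow> nat \<Rightarrow> 'w \<Rightarrow> real" where
  "dual_basis R b a v = representation (b ` {..<R}) v (b a)"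

lemma coframe_eq: "coframe R s a x = dual_basis R (\<lambda>b. s b x) a"
  by (simp add: coframe_def dual_basis_def fun_eq_iff)

lemma local_frame_iff:
  "local_frame M R V f \<longleftrightarrow> openin (mtop M) (fst f) \<and> (\<forall>x\<in>fst f. is_basis R (\<lambda>a. snd f a x) (V x))"
  by (simp add: local_frame_def is_basis_def)

text \<open>Linear independence of the indexed family also excludes repetitions, so injectivity
  comes with it.\<close>

lemma is_basisI:
  assumes V: "V = span (b ` {..<R})"
    and indep: "\<And>c a. (\<Sum>a<R. c a *\<^sub>R b a) = 0 \<Longrightarrow> a < R \<Longrightarrow> c a = 0"
  shows "is_basis R b V"
proof -
  have inj: "inj_on b {..<R}"
  proof (rule inj_onI, rule ccontr)
    fix i j assume ij: "i \<in> {..<R}" "j \<in> {..<R}" "b i = b j" "i \<noteq> j"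
    \<comment> \<open>A repetition would give the nontrivial relation with coefficient 1 at i and -1
      at j.\<close>
    have "(\<Sum>a<R. (if a = i then 1 else if a = j then -1 else 0) *\<^sub>R b a) =
        (\<Sum>a\<in>{i, j}. (if a = i then 1 else if a = j then -1 else 0) *\<^sub>R b a)"
      using ij by (intro sum.mono_neutral_right) auto
    then have "(if i = i then 1 else if i = j then -1 else 0) = (0::real)"
      using ij by (intro indep[of "\<lambda>a. if a = i then 1 else if a = j then -1 else 0" i]) auto
    then show False by simp
  qed
  moreover have "independent (b ` {..<R})"
  proof
    assume "dependent (b ` {..<R})"
    then obtain u v where u: "v \<in> b ` {..<R}" "u v \<noteq> 0" "(\<Sum>v\<in>b ` {..<R}. u v *\<^sub>R v) = 0"
      by (auto simp: dependent_finite)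
    then have "(\<Sum>a<R. u (b a) *\<^sub>R b a) = 0"
      using inj by (simp add: sum.reindex)
    then show False using u indep[of "\<lambda>a. u (b a)"] by auto
  qed
  ultimately show ?thesis using V by (simp add: is_basis_def)
qed

locale basis =
  fixes R :: nat and b :: "nat \<Rightarrow> 'w::real_vector" and V :: "'w set"
  assumes is_basis: "is_basis R b V"
begin

lemma inj: "inj_on b {..<R}" and indep: "independent (b ` {..<R})" and span: "span (b ` {..<R}) = V"
  using is_basis by (simp_all add: is_basis_def)

lemma subspace: "subspace V"
  unfolding span[symmetric] by (rule subspace_span)

lemma basis_mem: "a < R \<Longrightarrow> b a \<in> V"
  unfolding span[symmetric] by (rule span_base) simp

lemma sum_mem: "(\<And>a. a \<in> A \<Longrightarrow> f a \<in> V) \<Longrightarrow> (\<Sum>a\<in>A. c a *\<^sub>R f a) \<in> V"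
  using subspace by (intro subspace_sum subspace_scale)

lemma expand: "v \<in> V \<Longrightarrow> (\<Sum>a<R. dual_basis R b a v *\<^sub>R b a) = v"
  using sum_representation_eq[of "b ` {..<R}" v "b ` {..<R}"] inj indep span
  by (simp add: dual_basis_def sum.reindex)

lemma dual_basis_basis: "a < R \<Longrightarrow> c < R \<Longrightarrow> dual_basis R b a (b c) = (if a = c then 1 else 0)"
  using representation_basis[OF indep, of "b c"] inj
  by (simp add: dual_basis_def inj_on_def)

lemma dual_basis_add: "v \<in> V \<Longrightarrow> w \<in> V \<Longrightarrow> dual_basis R b a (v + w) = dual_basis R b a v + dual_basis R b a w"
  using indep span by (simp add: dual_basis_def representation_add)

lemma dual_basis_scale: "v \<in> V \<Longrightarrow> dual_basis R b a (c *\<^sub>R v) = c * dual_basis R b a v"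
  using indep span by (simp add: dual_basis_def representation_scale)

lemma dual_basis_outside: "v \<notin> V \<Longrightarrow> dual_basis R b a v = 0"
  using span by (simp add: dual_basis_def representation_def)

text \<open>\<open>representation\<close> is 0 outside the span, which is the convention of
  \<open>dual_space\<close> as well. So the coordinate functions are covectors as they
  stand.\<close>

lemma dual_basis_mem: "dual_basis R b a \<in> dual_space V"
  by (simp add: dual_space_def dual_basis_add dual_basis_scale dual_basis_outside)

lemma dual_basis_sum:
  "(\<And>a. a \<in> A \<Longrightarrow> f a \<in> V) \<Longrightarrow> dual_basis R b i (\<Sum>a\<in>A. c a *\<^sub>R f a) = (\<Sum>a\<in>A. c a * dual_basis R b i (f a))"
proof (induction A rule: infinite_finite_induct)
  case (insert x A)
  then show ?case
    using sum_mem[of A f c] subspace_scale[OF subspace]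
    by (simp add: dual_basis_add dual_basis_scale)
qed (use dual_basis_scale[of 0 i 0] subspace_0[OF subspace] in auto)

lemma dual_basis_unique: "i < R \<Longrightarrow> dual_basis R b i (\<Sum>a<R. c a *\<^sub>R b a) = c i"
  by (subst dual_basis_sum) (auto simp: basis_mem dual_basis_basis if_distrib sum.delta cong: if_cong)

lemma eqI: "v \<in> V \<Longrightarrow> w \<in> V \<Longrightarrow> (\<And>a. a < R \<Longrightarrow> dual_basis R b a v = dual_basis R b a w) \<Longrightarrow> v = w"
  by (subst expand[of v, symmetric], assumption, subst expand[of w, symmetric]) (auto intro!: sum.cong)

end

lemma dual_space_0:
  assumes "\<omega> \<in> dual_space V"
  shows "\<omega> 0 = 0"
proof (cases "0 \<in> V")
  case True
  then have "\<omega> (0 *\<^sub>R 0) = 0 * \<omega> 0" using assms unfolding dual_space_def by blast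
  then show ?thesis by simp
qed (use assms in \<open>auto simp: dual_space_def\<close>)

lemma dual_space_sum:
  assumes "\<omega> \<in> dual_space V" "subspace V"
  shows "(\<And>a. a \<in> A \<Longrightarrow> f a \<in> V) \<Longrightarrow> \<omega> (\<Sum>a\<in>A. c a *\<^sub>R f a) = (\<Sum>a\<in>A. c a * \<omega> (f a))"
proof (induction A rule: infinite_finite_induct)
  case (insert x A)
  have "c x *\<^sub>R f x \<in> V" "(\<Sum>a\<in>A. c a *\<^sub>R f a) \<in> V"
    using insert assms(2) by (auto intro!: subspace_scale subspace_sum)
  then show ?case
    using insert assms by (simp add: dual_space_def)
qed (use dual_space_0[OF assms(1)] in auto)

lemma dual_space_subspace: "subspace (dual_space V)"
  by (auto simp: subspace_def dual_space_def scaleR_fun_def algebra_simps)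

lemma (in basis) dual_expand:
  assumes "\<omega> \<in> dual_space V"
  shows "\<omega> = (\<Sum>a<R. \<omega> (b a) *\<^sub>R dual_basis R b a)"
proof
  fix v
  show "\<omega> v = (\<Sum>a<R. \<omega> (b a) *\<^sub>R dual_basis R b a) v"
  proof (cases "v \<in> V")
    case True
    have "\<omega> v = \<omega> (\<Sum>a<R. dual_basis R b a v *\<^sub>R b a)" using expand[OF True] by simp
    also have "\<dots> = (\<Sum>a<R. dual_basis R b a v * \<omega> (b a))"
      by (rule dual_space_sum[OF assms subspace]) (simp add: basis_mem)
    finally show ?thesis by (simp add: sum_apply_fun scaleR_fun_def mult.commute)
  next
    case False
    then show ?thesis
      using assms by (simp add: sum_apply_fun scaleR_fun_def dual_basis_outside) (simp add: dual_space_def)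
  qed
qed

lemma (in basis) dual_space_ext:
  "\<omega> \<in> dual_space V \<Longrightarrow> \<eta> \<in> dual_space V \<Longrightarrow> (\<And>a. a < R \<Longrightarrow> \<omega> (b a) = \<eta> (b a)) \<Longrightarrow> \<omega> = \<eta>"
  by (subst dual_expand, assumption, subst (2) dual_expand) (auto intro!: sum.cong)

section \<open>Tensors on a vector space\<close>

text \<open>The condition under which \<open>tensor_on\<close> demands multilinearity; on all other
  arguments a tensor is 0.\<close>

definition valid_args :: "'w::real_vector set \<Rightarrow> nat \<Rightarrow> nat \<Rightarrow> ('w \<Rightarrow> real) list \<Rightarrow> 'w list \<Rightarrow> bool" where
  "valid_args V k l ws vs \<longleftrightarrow> length ws = k \<and> set ws \<subseteq> dual_space V \<and> length vs = l \<and> set vs \<subseteq> V"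

lemma set_list_update_subset: "set xs \<subseteq> A \<Longrightarrow> x \<in> A \<Longrightarrow> set (xs[i := x]) \<subseteq> A"
  using set_update_subset_insert[of xs i x] by blast

lemma valid_args_update_cov:
  "valid_args V k l ws vs \<Longrightarrow> \<omega> \<in> dual_space V \<Longrightarrow> valid_args V k l (ws[i := \<omega>]) vs"
  by (simp add: valid_args_def set_list_update_subset)

lemma valid_args_update_vec:
  "valid_args V k l ws vs \<Longrightarrow> v \<in> V \<Longrightarrow> valid_args V k l ws (vs[i := v])"
  by (simp add: valid_args_def set_list_update_subset)

lemma valid_args_nth:
  "valid_args V k l ws vs \<Longrightarrow> i < k \<Longrightarrow> ws ! i \<in> dual_space V"
  "valid_args V k l ws vs \<Longrightarrow> j < l \<Longrightarrow> vs ! j \<in> V"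
  by (auto simp: valid_args_def dest: nth_mem)

lemma tensor_on_iff:
  "tensor_on V k l \<tau> \<longleftrightarrow> (\<forall>ws vs. (\<not> valid_args V k l ws vs \<longrightarrow> \<tau> ws vs = 0) \<and>
     (valid_args V k l ws vs \<longrightarrow>
       (\<forall>i<k. \<forall>\<omega>\<in>dual_space V. \<forall>\<eta>\<in>dual_space V. \<forall>c.
             \<tau> (ws[i := c *\<^sub>R \<omega> + \<eta>]) vs = c * \<tau> (ws[i := \<omega>]) vs + \<tau> (ws[i := \<eta>]) vs) \<and>
       (\<forall>j<l. \<forall>v\<in>V. \<forall>w\<in>V. \<forall>c.
             \<tau> ws (vs[j := c *\<^sub>R v + w]) = c * \<tau> ws (vs[j := v]) + \<tau> ws (vs[j := w]))))"
  unfolding tensor_on_def valid_args_def if_bool_eq_conj by (intro iff_allI conj_commute)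

lemma tensor_onI:
  assumes "\<And>ws vs. \<not> valid_args V k l ws vs \<Longrightarrow> \<tau> ws vs = 0"
    and "\<And>ws vs i \<omega> \<eta> c. valid_args V k l ws vs \<Longrightarrow> i < k \<Longrightarrow> \<omega> \<in> dual_space V \<Longrightarrow> \<eta> \<in> dual_space V \<Longrightarrow>
      \<tau> (ws[i := c *\<^sub>R \<omega> + \<eta>]) vs = c * \<tau> (ws[i := \<omega>]) vs + \<tau> (ws[i := \<eta>]) vs"
    and "\<And>ws vs j v w c. valid_args V k l ws vs \<Longrightarrow> j < l \<Longrightarrow> v \<in> V \<Longrightarrow> w \<in> V \<Longrightarrow>
      \<tau> ws (vs[j := c *\<^sub>R v + w]) = c * \<tau> ws (vs[j := v]) + \<tau> ws (vs[j := w])"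
  shows "tensor_on V k l \<tau>"
  unfolding tensor_on_iff using assms by blast

lemma tensor_on_outside: "tensor_on V k l \<tau> \<Longrightarrow> \<not> valid_args V k l ws vs \<Longrightarrow> \<tau> ws vs = 0"
  unfolding tensor_on_iff by blast

lemma tensor_on_cov:
  "tensor_on V k l \<tau> \<Longrightarrow> valid_args V k l ws vs \<Longrightarrow> i < k \<Longrightarrow> \<omega> \<in> dual_space V \<Longrightarrow> \<eta> \<in> dual_space V \<Longrightarrow>
     \<tau> (ws[i := c *\<^sub>R \<omega> + \<eta>]) vs = c * \<tau> (ws[i := \<omega>]) vs + \<tau> (ws[i := \<eta>]) vs"
  unfolding tensor_on_iff by blast

lemma tensor_on_vec:
  "tensor_on V k l \<tau> \<Longrightarrow> valid_args V k l ws vs \<Longrightarrow> j < l \<Longrightarrow> v \<in> V \<Longrightarrow> w \<in> V \<Longrightarrow>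
     \<tau> ws (vs[j := c *\<^sub>R v + w]) = c * \<tau> ws (vs[j := v]) + \<tau> ws (vs[j := w])"
  unfolding tensor_on_iff by blast

lemma linear_sum_expand:
  fixes g :: "'a::real_vector \<Rightarrow> real"
  assumes V: "subspace V" and g: "\<And>v w c. v \<in> V \<Longrightarrow> w \<in> V \<Longrightarrow> g (c *\<^sub>R v + w) = c * g v + g w"
  shows "(\<And>a. a \<in> A \<Longrightarrow> f a \<in> V) \<Longrightarrow> g (\<Sum>a\<in>A. c a *\<^sub>R f a) = (\<Sum>a\<in>A. c a * g (f a))"
proof -
  have 0: "g 0 = 0" using g[of 0 0 1] subspace_0[OF V] by simp
  show "(\<And>a. a \<in> A \<Longrightarrow> f a \<in> V) \<Longrightarrow> g (\<Sum>a\<in>A. c a *\<^sub>R f a) = (\<Sum>a\<in>A. c a * g (f a))"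
  proof (induction A rule: infinite_finite_induct)
    case (insert x A)
    have "(\<Sum>a\<in>A. c a *\<^sub>R f a) \<in> V"
      using insert V by (auto intro!: subspace_scale subspace_sum)
    then show ?case using insert g by simp
  qed (use 0 in auto)
qed

lemma tensor_on_cov_sum:
  assumes "tensor_on V k l \<tau>" "valid_args V k l ws vs" "i < k" "\<And>a. a \<in> A \<Longrightarrow> f a \<in> dual_space V"
  shows "\<tau> (ws[i := \<Sum>a\<in>A. c a *\<^sub>R f a]) vs = (\<Sum>a\<in>A. c a * \<tau> (ws[i := f a]) vs)"
  by (rule linear_sum_expand[OF dual_space_subspace tensor_on_cov[OF assms(1-3)] assms(4)])

lemma tensor_on_vec_sum:
  assumes "tensor_on V k l \<tau>" "subspace V" "valid_args V k l ws vs" "j < l" "\<And>a. a \<in> A \<Longrightarrow> f a \<in> V"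
  shows "\<tau> ws (vs[j := \<Sum>a\<in>A. c a *\<^sub>R f a]) = (\<Sum>a\<in>A. c a * \<tau> ws (vs[j := f a]))"
  by (rule linear_sum_expand[OF assms(2) tensor_on_vec[OF assms(1,3,4)] assms(5)])

section \<open>Inserted arguments, traces and contraction\<close>

lemma length_insert_at: "length (insert_at i x xs) = Suc (length xs)"
  by (simp add: insert_at_def)

lemma set_insert_at: "set (insert_at i x xs) = insert x (set xs)"
proof -
  have "set (take i xs) \<union> set (drop i xs) = set xs"
    by (metis append_take_drop_id set_append)
  then show ?thesis by (auto simp: insert_at_def)
qed

lemma valid_args_insert_at:
  "valid_args V (Suc k) (Suc l) (insert_at i \<omega> ws) (insert_at j v vs) \<longleftrightarrow>
    valid_args V k l ws vs \<and> \<omega> \<in> dual_space V \<and> v \<in> V"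
  by (auto simp: valid_args_def length_insert_at set_insert_at)

lemma insert_at_update: "i \<le> length xs \<Longrightarrow> insert_at i x xs = (insert_at i y xs)[i := x]"
  by (simp add: insert_at_def list_update_append)

text \<open>The new position of entry p after an insertion at position i.\<close>

definition skip :: "nat \<Rightarrow> nat \<Rightarrow> nat" where
  "skip i p = (if p < i then p else Suc p)"

lemma insert_at_nth: "i \<le> length xs \<Longrightarrow> insert_at i x xs ! i = x"
  by (simp add: insert_at_def nth_append)

lemma insert_at_nth_skip: "i \<le> length xs \<Longrightarrow> p < length xs \<Longrightarrow> insert_at i x xs ! skip i p = xs ! p"
  by (auto simp: insert_at_def nth_append skip_def min_def nth_Cons')

lemma insert_at_update_skip:
  "i \<le> length xs \<Longrightarrow> p < length xs \<Longrightarrow> (insert_at i x xs)[skip i p := y] = insert_at i x (xs[p := y])"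
  by (auto simp: insert_at_def skip_def list_update_append take_update_swap drop_update_swap min_def
    Suc_diff_le list_update_beyond split: nat.splits)

lemma sum_skip: "i \<le> k \<Longrightarrow> (\<Sum>p<Suc k. f p) = f i + (\<Sum>p<k. f (skip i p))"
  for f :: "nat \<Rightarrow> 'a::comm_monoid_add"
proof -
  assume i: "i \<le> k"
  have "{..<Suc k} = insert i (skip i ` {..<k})"
  proof
    show "{..<Suc k} \<subseteq> insert i (skip i ` {..<k})"
    proof
      fix p assume p: "p \<in> {..<Suc k}"
      consider "p < i" | "p = i" | "p > i" by linarith
      then show "p \<in> insert i (skip i ` {..<k})"
      proof cases
        case 1 then show ?thesis using i by (auto simp: skip_def intro!: image_eqI[of _ _ p])
      next
        case 3 then show ?thesis using p by (auto simp: skip_def intro!: image_eqI[of _ _ "p - 1"])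
      qed simp
    qed
  qed (use i in \<open>auto simp: skip_def\<close>)
  moreover have "inj_on (skip i) {..<k}" "i \<notin> skip i ` {..<k}"
    by (auto simp: skip_def inj_on_def split: if_splits)
  ultimately show ?thesis by (simp add: sum.reindex)
qed

text \<open>Write each vector of the first basis in the second, exchange the sums, and collect the
  coefficients into the covectors dual to the second basis. The two sizes are kept apart, because
  their equality is not presupposed.\<close>

lemma trace_basis_change:
  fixes \<beta> :: "('w::real_vector \<Rightarrow> real) \<Rightarrow> 'w \<Rightarrow> real"
  assumes b: "is_basis R b V" and b': "is_basis R' b' V"
    and \<beta>1: "\<And>\<omega> \<eta> c v. \<omega> \<in> dual_space V \<Longrightarrow> \<eta> \<in> dual_space V \<Longrightarrow> v \<in> V \<Longrightarrow> \<beta> (c *\<^sub>R \<omega> + \<eta>) v = c * \<beta> \<omega> v + \<beta> \<eta> v"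
    and \<beta>2: "\<And>\<omega> c v w. \<omega> \<in> dual_space V \<Longrightarrow> v \<in> V \<Longrightarrow> w \<in> V \<Longrightarrow> \<beta> \<omega> (c *\<^sub>R v + w) = c * \<beta> \<omega> v + \<beta> \<omega> w"
  shows "(\<Sum>a<R. \<beta> (dual_basis R b a) (b a)) = (\<Sum>a<R'. \<beta> (dual_basis R' b' a) (b' a))"
proof -
  interpret b: basis R b V by standard (rule b)
  interpret b': basis R' b' V by standard (rule b')
  have "(\<Sum>a<R. \<beta> (dual_basis R b a) (b a)) =
      (\<Sum>a<R. \<Sum>c<R'. dual_basis R' b' c (b a) * \<beta> (dual_basis R b a) (b' c))"
  proof (rule sum.cong[OF refl])
    fix a assume a: "a \<in> {..<R}"
    have "\<beta> (dual_basis R b a) (b a) = \<beta> (dual_basis R b a) (\<Sum>c<R'. dual_basis R' b' c (b a) *\<^sub>R b' c)"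
      using b'.expand b.basis_mem a by simp
    also have "\<dots> = (\<Sum>c<R'. dual_basis R' b' c (b a) * \<beta> (dual_basis R b a) (b' c))"
      by (rule linear_sum_expand[OF b.subspace \<beta>2]) (auto simp: b.dual_basis_mem b'.basis_mem)
    finally show "\<beta> (dual_basis R b a) (b a) = \<dots>" .
  qed
  also have "\<dots> = (\<Sum>c<R'. \<Sum>a<R. dual_basis R' b' c (b a) * \<beta> (dual_basis R b a) (b' c))"
    by (rule sum.swap)
  also have "\<dots> = (\<Sum>c<R'. \<beta> (dual_basis R' b' c) (b' c))"
  proof (rule sum.cong[OF refl])
    fix c assume c: "c \<in> {..<R'}"
    have "\<beta> (dual_basis R' b' c) (b' c) = \<beta> (\<Sum>a<R. dual_basis R' b' c (b a) *\<^sub>R dual_basis R b a) (b' c)"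
      using b.dual_expand[OF b'.dual_basis_mem[of c]] by simp
    also have "\<dots> = (\<Sum>a<R. dual_basis R' b' c (b a) * \<beta> (dual_basis R b a) (b' c))"
      using c by (intro linear_sum_expand[OF dual_space_subspace, where g = "\<lambda>\<omega>. \<beta> \<omega> (b' c)"] \<beta>1)
        (auto simp: b.dual_basis_mem b'.basis_mem)
    finally show "(\<Sum>a<R. dual_basis R' b' c (b a) * \<beta> (dual_basis R b a) (b' c)) = \<beta> (dual_basis R' b' c) (b' c)"
      by simp
  qed
  finally show ?thesis .
qed

text \<open>The value 0 outside V makes the composite of a covector with A again a covector in the
  sense of \<open>dual_space\<close>.\<close>

definition endo :: "'w::real_vector set \<Rightarrow> ('w \<Rightarrow> 'w) \<Rightarrow> bool" where
  "endo V A \<longleftrightarrow> (\<forall>v\<in>V. A v \<in> V) \<and> (\<forall>v\<in>V. \<forall>w\<in>V. \<forall>c. A (c *\<^sub>R v + w) = c *\<^sub>R A v + A w) \<and> (\<forall>v. v \<notin> V \<longrightarrow> A v = 0)"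

lemma endo_dual:
  assumes "endo V A" "subspace V" "\<omega> \<in> dual_space V"
  shows "\<omega> \<circ> A \<in> dual_space V"
proof -
  have lin: "A (c *\<^sub>R v + w) = c *\<^sub>R A v + A w" if "v \<in> V" "w \<in> V" for v w c
    using assms(1) that by (auto simp: endo_def)
  have A: "A v \<in> V" if "v \<in> V" for v using assms(1) that by (auto simp: endo_def)
  have 0: "A 0 = 0" using lin[of 0 0 1] subspace_0[OF assms(2)] by simp
  have add: "\<omega> (v + w) = \<omega> v + \<omega> w" if "v \<in> V" "w \<in> V" for v w
    using assms(3) that by (simp add: dual_space_def)
  have scale: "\<omega> (c *\<^sub>R v) = c * \<omega> v" if "v \<in> V" for v c
    using assms(3) that by (simp add: dual_space_def)
  have "A (v + w) = A v + A w" if "v \<in> V" "w \<in> V" for v w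
    using lin[of v w 1] that by simp
  moreover have "A (c *\<^sub>R v) = c *\<^sub>R A v" if "v \<in> V" for v c
    using lin[of v 0 c] that subspace_0[OF assms(2)] 0 by simp
  moreover have "A v = 0" if "v \<notin> V" for v using assms(1) that by (auto simp: endo_def)
  ultimately show ?thesis
    using dual_space_0[OF assms(3)] A add scale by (simp add: dual_space_def)
qed

text \<open>Both sides are the same double sum over the matrix entries of A, since the dual basis
  composed with A expands by the same matrix as A on the basis. Under a trace, A may thus be moved
  from the covector to the vector.\<close>

lemma trace_endo:
  fixes \<beta> :: "('w::real_vector \<Rightarrow> real) \<Rightarrow> 'w \<Rightarrow> real"
  assumes b: "is_basis R b V" and A: "endo V A"
    and \<beta>1: "\<And>\<omega> \<eta> c v. \<omega> \<in> dual_space V \<Longrightarrow> \<eta> \<in> dual_space V \<Longrightarrow> v \<in> V \<Longrightarrow> \<beta> (c *\<^sub>R \<omega> + \<eta>) v = c * \<beta> \<omega> v + \<beta> \<eta> v"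
    and \<beta>2: "\<And>\<omega> c v w. \<omega> \<in> dual_space V \<Longrightarrow> v \<in> V \<Longrightarrow> w \<in> V \<Longrightarrow> \<beta> \<omega> (c *\<^sub>R v + w) = c * \<beta> \<omega> v + \<beta> \<omega> w"
  shows "(\<Sum>a<R. \<beta> (dual_basis R b a \<circ> A) (b a)) = (\<Sum>a<R. \<beta> (dual_basis R b a) (A (b a)))"
proof -
  interpret b: basis R b V by standard (rule b)
  have AV: "A (b a) \<in> V" if "a < R" for a using A b.basis_mem[OF that] by (auto simp: endo_def)
  have "(\<Sum>a<R. \<beta> (dual_basis R b a \<circ> A) (b a)) =
      (\<Sum>a<R. \<Sum>c<R. dual_basis R b a (A (b c)) * \<beta> (dual_basis R b c) (b a))"
  proof (rule sum.cong[OF refl])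
    fix a assume a: "a \<in> {..<R}"
    have "dual_basis R b a \<circ> A = (\<Sum>c<R. dual_basis R b a (A (b c)) *\<^sub>R dual_basis R b c)"
      using b.dual_expand[OF endo_dual[OF A b.subspace b.dual_basis_mem[of a]]] by simp
    then show "\<beta> (dual_basis R b a \<circ> A) (b a) = (\<Sum>c<R. dual_basis R b a (A (b c)) * \<beta> (dual_basis R b c) (b a))"
      using a linear_sum_expand[OF dual_space_subspace, where g = "\<lambda>\<omega>. \<beta> \<omega> (b a)" and V1 = V,
        of "{..<R}" "dual_basis R b" "\<lambda>c. dual_basis R b a (A (b c))"]
      by (simp add: \<beta>1 b.basis_mem b.dual_basis_mem)
  qed
  also have "\<dots> = (\<Sum>c<R. \<Sum>a<R. dual_basis R b a (A (b c)) * \<beta> (dual_basis R b c) (b a))"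
    by (rule sum.swap)
  also have "\<dots> = (\<Sum>c<R. \<beta> (dual_basis R b c) (A (b c)))"
  proof (rule sum.cong[OF refl])
    fix c assume c: "c \<in> {..<R}"
    have "\<beta> (dual_basis R b c) (A (b c)) = \<beta> (dual_basis R b c) (\<Sum>a<R. dual_basis R b a (A (b c)) *\<^sub>R b a)"
      using b.expand[OF AV] c by simp
    also have "\<dots> = (\<Sum>a<R. dual_basis R b a (A (b c)) * \<beta> (dual_basis R b c) (b a))"
      by (rule linear_sum_expand[OF b.subspace \<beta>2]) (auto simp: b.dual_basis_mem b.basis_mem)
    finally show "(\<Sum>a<R. dual_basis R b a (A (b c)) * \<beta> (dual_basis R b c) (b a)) = \<beta> (dual_basis R b c) (A (b c))"
      by simp
  qed
  finally show ?thesis .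
qed

lemma tensor_on_insert_bilinear:
  assumes \<tau>: "tensor_on V (Suc k) (Suc l) \<tau>" and v: "valid_args V k l ws vs" and ij: "i \<le> k" "j \<le> l"
  shows "\<omega> \<in> dual_space V \<Longrightarrow> \<eta> \<in> dual_space V \<Longrightarrow> x \<in> V \<Longrightarrow>
      \<tau> (insert_at i (c *\<^sub>R \<omega> + \<eta>) ws) (insert_at j x vs) =
        c * \<tau> (insert_at i \<omega> ws) (insert_at j x vs) + \<tau> (insert_at i \<eta> ws) (insert_at j x vs)"
    and "\<omega> \<in> dual_space V \<Longrightarrow> x \<in> V \<Longrightarrow> y \<in> V \<Longrightarrow>
      \<tau> (insert_at i \<omega> ws) (insert_at j (c *\<^sub>R x + y) vs) =
        c * \<tau> (insert_at i \<omega> ws) (insert_at j x vs) + \<tau> (insert_at i \<omega> ws) (insert_at j y vs)"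
proof -
  have len: "i \<le> length ws" "j \<le> length vs" using v ij by (auto simp: valid_args_def)
  show "\<omega> \<in> dual_space V \<Longrightarrow> \<eta> \<in> dual_space V \<Longrightarrow> x \<in> V \<Longrightarrow>
      \<tau> (insert_at i (c *\<^sub>R \<omega> + \<eta>) ws) (insert_at j x vs) =
        c * \<tau> (insert_at i \<omega> ws) (insert_at j x vs) + \<tau> (insert_at i \<eta> ws) (insert_at j x vs)"
    using tensor_on_cov[OF \<tau>, of "insert_at i \<omega> ws" "insert_at j x vs" i \<omega> \<eta> c] v ij
      insert_at_update[OF len(1), of _ \<omega>] by (metis le_imp_less_Suc valid_args_insert_at)
  show "\<omega> \<in> dual_space V \<Longrightarrow> x \<in> V \<Longrightarrow> y \<in> V \<Longrightarrow>
      \<tau> (insert_at i \<omega> ws) (insert_at j (c *\<^sub>R x + y) vs) =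
        c * \<tau> (insert_at i \<omega> ws) (insert_at j x vs) + \<tau> (insert_at i \<omega> ws) (insert_at j y vs)"
    using tensor_on_vec[OF \<tau>, of "insert_at i \<omega> ws" "insert_at j x vs" j x y c] v ij
      insert_at_update[OF len(2), of _ x] by (metis le_imp_less_Suc valid_args_insert_at)
qed

text \<open>\<open>contract\<close> uses a basis picked by choice, known only to be independent and
  to span the fibre. Replacing it by a given frame makes contractions computable and their
  smoothness visible.\<close>

lemma contract_basis:
  assumes b: "is_basis R b (fib B q)" and \<tau>: "tensor_on (fib B q) (Suc k) (Suc l) (T q)"
    and ij: "i \<le> k" "j \<le> l"
  shows "contract B i j T q ws vs =
    (\<Sum>a<R. T q (insert_at i (dual_basis R b a) ws) (insert_at j (b a) vs))"
proof -
  interpret b: basis R b "fib B q" by standard (rule b)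
  define \<B> where "\<B> = (SOME \<B>. independent \<B> \<and> span \<B> = fib B q)"
  have "independent \<B> \<and> span \<B> = fib B q"
    unfolding \<B>_def by (rule someI[of _ "b ` {..<R}"]) (use b in \<open>simp add: is_basis_def\<close>)
  then have \<B>: "independent \<B>" "span \<B> = fib B q" by auto
  \<comment> \<open>The chosen basis is finite because it is an independent set in the span of R
    vectors; an enumeration turns it into an indexed basis.\<close>
  have "finite \<B> \<and> card \<B> \<le> card (b ` {..<R})"
    by (rule independent_span_bound[OF _ \<B>(1)]) (use b \<B>(2) span_superset[of \<B>] in \<open>auto simp: is_basis_def\<close>)
  then obtain b' where "bij_betw b' {0..<card \<B>} \<B>" using ex_bij_betw_nat_finite by blast
  then have b': "bij_betw b' {..<card \<B>} \<B>" by (simp add: lessThan_atLeast0)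
  have bas: "is_basis (card \<B>) b' (fib B q)"
    using b' \<B> by (auto simp: is_basis_def bij_betw_def)
  have "contract B i j T q ws vs =
      (\<Sum>v\<in>\<B>. T q (insert_at i (\<lambda>w. representation \<B> w v) ws) (insert_at j v vs))"
    by (simp add: contract_def Let_def \<B>_def)
  also have "\<dots> = (\<Sum>a<card \<B>. T q (insert_at i (dual_basis (card \<B>) b' a) ws) (insert_at j (b' a) vs))"
  proof -
    have "dual_basis (card \<B>) b' a = (\<lambda>w. representation \<B> w (b' a))" for a
      using b' by (simp add: dual_basis_def fun_eq_iff bij_betw_def)
    then show ?thesis by (simp add: sum.reindex_bij_betw[OF b', symmetric])
  qed
  also have "\<dots> = (\<Sum>a<R. T q (insert_at i (dual_basis R b a) ws) (insert_at j (b a) vs))"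
  proof (cases "valid_args (fib B q) k l ws vs")
    case True
    show ?thesis
      by (rule trace_basis_change[OF bas b, where \<beta> = "\<lambda>\<omega> v. T q (insert_at i \<omega> ws) (insert_at j v vs)"];
        erule (2) tensor_on_insert_bilinear[OF \<tau> True ij])
  next
    case False
    then show ?thesis
      using tensor_on_outside[OF \<tau>] by (simp add: valid_args_insert_at)
  qed
  finally show ?thesis .
qed

section \<open>The derivation of the tensor algebra induced by an endomorphism\<close>

text \<open>The derivation of the tensor algebra extending A: its transpose acts in the covector
  slots with sign +, A itself in the vector slots with sign -. With these signs a section Y, viewed
  as a tensor of type (1,0), goes to A Y, and contractions are respected.\<close>

definition act :: "'w::real_vector set \<Rightarrow> ('w \<Rightarrow> 'w) \<Rightarrow> nat \<Rightarrow> nat \<Rightarrow>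
    (('w \<Rightarrow> real) list \<Rightarrow> 'w list \<Rightarrow> real) \<Rightarrow> ('w \<Rightarrow> real) list \<Rightarrow> 'w list \<Rightarrow> real" where
  "act V A k l \<tau> ws vs = (if valid_args V k l ws vs
     then (\<Sum>i<k. \<tau> (ws[i := ws ! i \<circ> A]) vs) - (\<Sum>j<l. \<tau> ws (vs[j := A (vs ! j)])) else 0)"

lemma endoD:
  assumes "endo V A"
  shows "v \<in> V \<Longrightarrow> A v \<in> V" "v \<in> V \<Longrightarrow> w \<in> V \<Longrightarrow> A (c *\<^sub>R v + w) = c *\<^sub>R A v + A w"
  using assms by (auto simp: endo_def)

lemma dual_comp_linear: "(c *\<^sub>R \<omega> + \<eta>) \<circ> A = c *\<^sub>R (\<omega> \<circ> A) + (\<eta> \<circ> A)"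
  for \<omega> \<eta> :: "'w \<Rightarrow> real"
  by (simp add: fun_eq_iff scaleR_fun_def)

lemma tensor_on_act:
  assumes V: "subspace V" and A: "endo V A" and \<tau>: "tensor_on V k l \<tau>"
  shows "tensor_on V k l (act V A k l \<tau>)"
proof (rule tensor_onI)
  fix ws vs i \<omega> \<eta> and c :: real
  assume v: "valid_args V k l ws vs" and i: "i < k" and \<omega>: "\<omega> \<in> dual_space V" and \<eta>: "\<eta> \<in> dual_space V"
  have mem: "c *\<^sub>R \<omega> + \<eta> \<in> dual_space V"
    using dual_space_subspace \<omega> \<eta> by (intro subspace_add subspace_scale)
  note vu = valid_args_update_cov[OF v \<omega>] valid_args_update_cov[OF v \<eta>] valid_args_update_cov[OF v mem]
  \<comment> \<open>If p is the slot under consideration, linearity is applied to the covectors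
    composed with A; otherwise the two updates commute.\<close>
  have 1: "\<tau> (ws[i := c *\<^sub>R \<omega> + \<eta>, p := (ws[i := c *\<^sub>R \<omega> + \<eta>]) ! p \<circ> A]) vs =
      c * \<tau> (ws[i := \<omega>, p := (ws[i := \<omega>]) ! p \<circ> A]) vs + \<tau> (ws[i := \<eta>, p := (ws[i := \<eta>]) ! p \<circ> A]) vs"
    if p: "p < k" for p
  proof (cases "p = i")
    case True
    have "i < length ws" using v i by (simp add: valid_args_def)
    then show ?thesis
      using tensor_on_cov[OF \<tau> v i endo_dual[OF A V \<omega>] endo_dual[OF A V \<eta>]] True
      by (simp add: dual_comp_linear)
  next
    case False
    have "valid_args V k l (ws[p := ws ! p \<circ> A]) vs"
      by (rule valid_args_update_cov[OF v endo_dual[OF A V valid_args_nth(1)[OF v p]]])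
    then show ?thesis
      using tensor_on_cov[OF \<tau> _ i \<omega> \<eta>] False
      by (simp add: list_update_swap[OF False[symmetric], of ws _ "ws ! p \<circ> A"])
  qed
  have 2: "\<tau> (ws[i := c *\<^sub>R \<omega> + \<eta>]) (vs[j := A (vs ! j)]) =
      c * \<tau> (ws[i := \<omega>]) (vs[j := A (vs ! j)]) + \<tau> (ws[i := \<eta>]) (vs[j := A (vs ! j)])" if "j < l" for j
    by (rule tensor_on_cov[OF \<tau> valid_args_update_vec[OF v] i \<omega> \<eta>])
      (use endoD[OF A] valid_args_nth(2)[OF v that] in auto)
  show "act V A k l \<tau> (ws[i := c *\<^sub>R \<omega> + \<eta>]) vs =
      c * act V A k l \<tau> (ws[i := \<omega>]) vs + act V A k l \<tau> (ws[i := \<eta>]) vs"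
    by (simp only: act_def vu if_True) (simp add: 1 2 sum.distrib sum_distrib_left right_diff_distrib)
next
  fix ws vs j x y and c :: real
  assume v: "valid_args V k l ws vs" and j: "j < l" and x: "x \<in> V" and y: "y \<in> V"
  have mem: "c *\<^sub>R x + y \<in> V"
    using V x y by (intro subspace_add subspace_scale)
  note vu = valid_args_update_vec[OF v x] valid_args_update_vec[OF v y] valid_args_update_vec[OF v mem]
  have 1: "\<tau> ws (vs[j := c *\<^sub>R x + y, p := A ((vs[j := c *\<^sub>R x + y]) ! p)]) =
      c * \<tau> ws (vs[j := x, p := A ((vs[j := x]) ! p)]) + \<tau> ws (vs[j := y, p := A ((vs[j := y]) ! p)])"
    if p: "p < l" for p
  proof (cases "p = j")
    case True
    have "j < length vs" using v j by (simp add: valid_args_def)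
    then show ?thesis
      using tensor_on_vec[OF \<tau> v j endoD(1)[OF A x] endoD(1)[OF A y]] True endoD(2)[OF A x y]
      by simp
  next
    case False
    have "valid_args V k l ws (vs[p := A (vs ! p)])"
      by (rule valid_args_update_vec[OF v endoD(1)[OF A valid_args_nth(2)[OF v p]]])
    then show ?thesis
      using tensor_on_vec[OF \<tau> _ j x y] False
      by (simp add: list_update_swap[OF False[symmetric], of vs _ "A (vs ! p)"])
  qed
  have 2: "\<tau> (ws[i := ws ! i \<circ> A]) (vs[j := c *\<^sub>R x + y]) =
      c * \<tau> (ws[i := ws ! i \<circ> A]) (vs[j := x]) + \<tau> (ws[i := ws ! i \<circ> A]) (vs[j := y])" if "i < k" for i
    by (rule tensor_on_vec[OF \<tau> valid_args_update_cov[OF v endo_dual[OF A V valid_args_nth(1)[OF v that]]] j x y])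
  show "act V A k l \<tau> ws (vs[j := c *\<^sub>R x + y]) =
      c * act V A k l \<tau> ws (vs[j := x]) + act V A k l \<tau> ws (vs[j := y])"
    by (simp only: act_def vu if_True) (simp add: 1 2 sum.distrib sum_distrib_left right_diff_distrib)
qed (simp add: act_def)

text \<open>In the inserted pair, the term with the transpose and the term with A have equal traces
  and opposite signs, so they cancel. What remains are the slots of the contracted tensor.\<close>

lemma act_contract:
  assumes b: "is_basis R b V" and A: "endo V A" and \<tau>: "tensor_on V (Suc k) (Suc l) \<tau>"
    and ij: "i \<le> k" "j \<le> l"
  shows "act V A k l (\<lambda>ws vs. \<Sum>a<R. \<tau> (insert_at i (dual_basis R b a) ws) (insert_at j (b a) vs)) ws vs =
    (\<Sum>a<R. act V A (Suc k) (Suc l) \<tau> (insert_at i (dual_basis R b a) ws) (insert_at j (b a) vs))"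
proof (cases "valid_args V k l ws vs")
  case True
  interpret b: basis R b V by standard (rule b)
  have len: "length ws = k" "length vs = l" using True by (auto simp: valid_args_def)
  define W where "W a = insert_at i (dual_basis R b a) ws" for a
  define U where "U a = insert_at j (b a) vs" for a
  have valid: "valid_args V (Suc k) (Suc l) (W a) (U a)" if "a < R" for a
    using True that by (simp add: W_def U_def valid_args_insert_at b.dual_basis_mem b.basis_mem)
  have "(\<Sum>p<Suc k. \<tau> ((W a)[p := W a ! p \<circ> A]) (U a)) =
      \<tau> (insert_at i (dual_basis R b a \<circ> A) ws) (U a) +
      (\<Sum>p<k. \<tau> (insert_at i (dual_basis R b a) (ws[p := ws ! p \<circ> A])) (U a))" for a
    using ij len by (subst sum_skip[OF ij(1)])
      (simp add: W_def insert_at_nth insert_at_nth_skip insert_at_update_skip insert_at_update[symmetric])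
  moreover have "(\<Sum>p<Suc l. \<tau> (W a) ((U a)[p := A (U a ! p)])) =
      \<tau> (W a) (insert_at j (A (b a)) vs) +
      (\<Sum>p<l. \<tau> (W a) (insert_at j (b a) (vs[p := A (vs ! p)])))" for a
    using ij len by (subst sum_skip[OF ij(2)])
      (simp add: U_def insert_at_nth insert_at_nth_skip insert_at_update_skip insert_at_update[symmetric])
  moreover have "(\<Sum>a<R. \<tau> (insert_at i (dual_basis R b a \<circ> A) ws) (U a)) =
      (\<Sum>a<R. \<tau> (W a) (insert_at j (A (b a)) vs))"
    unfolding W_def U_def
    by (rule trace_endo[OF b A, where \<beta> = "\<lambda>\<omega> v. \<tau> (insert_at i \<omega> ws) (insert_at j v vs)"];
      erule (2) tensor_on_insert_bilinear[OF \<tau> True ij])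
  ultimately have "(\<Sum>a<R. act V A (Suc k) (Suc l) \<tau> (W a) (U a)) =
      (\<Sum>a<R. \<Sum>p<k. \<tau> (insert_at i (dual_basis R b a) (ws[p := ws ! p \<circ> A])) (U a)) -
      (\<Sum>a<R. \<Sum>p<l. \<tau> (W a) (insert_at j (b a) (vs[p := A (vs ! p)])))"
    using valid by (simp add: act_def sum_subtractf sum.distrib del: sum.lessThan_Suc)
  then show ?thesis
    using True by (subst (asm) (1 2) sum.swap) (simp add: act_def W_def U_def)
next
  case False
  then show ?thesis by (simp add: act_def valid_args_insert_at)
qed

lemma valid_args_append:
  "valid_args V (k + k') (l + l') ws vs \<longleftrightarrow>
    valid_args V k l (take k ws) (take l vs) \<and> valid_args V k' l' (drop k ws) (drop l vs)"
proof -
  have "set ws = set (take k ws) \<union> set (drop k ws)" "set vs = set (take l vs) \<union> set (drop l vs)"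
    by (metis append_take_drop_id set_append)+
  then show ?thesis by (auto simp: valid_args_def)
qed

lemma sum_lessThan_add: "(\<Sum>p<k + k'. f p) = (\<Sum>p<k. f p) + (\<Sum>p<k'. f (k + p))"
  for f :: "nat \<Rightarrow> 'a::comm_monoid_add"
  by (induction k') (simp_all add: add.assoc)

text \<open>Every slot belongs to exactly one factor, and acting there leaves the other factor
  alone.\<close>

lemma act_prod:
  assumes \<tau>: "tensor_on V k l \<tau>" and \<tau>': "tensor_on V k' l' \<tau>'"
  shows "act V A (k + k') (l + l') (\<lambda>ws vs. \<tau> (take k ws) (take l vs) * \<tau>' (drop k ws) (drop l vs)) ws vs =
    act V A k l \<tau> (take k ws) (take l vs) * \<tau>' (drop k ws) (drop l vs) +
    \<tau> (take k ws) (take l vs) * act V A k' l' \<tau>' (drop k ws) (drop l vs)"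
proof (cases "valid_args V (k + k') (l + l') ws vs")
  case True
  then have len: "length ws = k + k'" "length vs = l + l'" by (auto simp: valid_args_def)
  show ?thesis
    using True unfolding valid_args_append
    by (simp add: act_def valid_args_append sum_lessThan_add take_update_swap drop_update_swap len
      list_update_beyond sum_distrib_left sum_distrib_right algebra_simps sum.distrib)
next
  case False
  then show ?thesis
    using tensor_on_outside[OF \<tau>] tensor_on_outside[OF \<tau>'] by (auto simp: act_def valid_args_append)
qed

lemma tensor_on_prod:
  assumes V: "subspace V" and \<tau>: "tensor_on V k l \<tau>" and \<tau>': "tensor_on V k' l' \<tau>'"
  shows "tensor_on V (k + k') (l + l') (\<lambda>ws vs. \<tau> (take k ws) (take l vs) * \<tau>' (drop k ws) (drop l vs))"
proof (rule tensor_onI)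
  fix ws vs i \<omega> \<eta> and c :: real
  assume v: "valid_args V (k + k') (l + l') ws vs" and i: "i < k + k'"
    and \<omega>: "\<omega> \<in> dual_space V" and \<eta>: "\<eta> \<in> dual_space V"
  have v1: "valid_args V k l (take k ws) (take l vs)" and v2: "valid_args V k' l' (drop k ws) (drop l vs)"
    using v by (auto simp: valid_args_append)
  show "\<tau> (take k (ws[i := c *\<^sub>R \<omega> + \<eta>])) (take l vs) * \<tau>' (drop k (ws[i := c *\<^sub>R \<omega> + \<eta>])) (drop l vs) =
      c * (\<tau> (take k (ws[i := \<omega>])) (take l vs) * \<tau>' (drop k (ws[i := \<omega>])) (drop l vs)) +
      \<tau> (take k (ws[i := \<eta>])) (take l vs) * \<tau>' (drop k (ws[i := \<eta>])) (drop l vs)"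
  proof (cases "i < k")
    case True
    then show ?thesis
      using tensor_on_cov[OF \<tau> v1 True \<omega> \<eta>] by (simp add: take_update_swap algebra_simps)
  next
    case False
    then have "i - k < k'" using i by simp
    from tensor_on_cov[OF \<tau>' v2 this \<omega> \<eta>] show ?thesis
      using False by (simp add: drop_update_swap algebra_simps)
  qed
next
  fix ws vs i x y and c :: real
  assume v: "valid_args V (k + k') (l + l') ws vs" and i: "i < l + l'" and x: "x \<in> V" and y: "y \<in> V"
  have v1: "valid_args V k l (take k ws) (take l vs)" and v2: "valid_args V k' l' (drop k ws) (drop l vs)"
    using v by (auto simp: valid_args_append)
  show "\<tau> (take k ws) (take l (vs[i := c *\<^sub>R x + y])) * \<tau>' (drop k ws) (drop l (vs[i := c *\<^sub>R x + y])) =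
      c * (\<tau> (take k ws) (take l (vs[i := x])) * \<tau>' (drop k ws) (drop l (vs[i := x]))) +
      \<tau> (take k ws) (take l (vs[i := y])) * \<tau>' (drop k ws) (drop l (vs[i := y]))"
  proof (cases "i < l")
    case True
    then show ?thesis
      using tensor_on_vec[OF \<tau> v1 True x y] by (simp add: take_update_swap algebra_simps)
  next
    case False
    then have "i - l < l'" using i by simp
    from tensor_on_vec[OF \<tau>' v2 this x y] show ?thesis
      using False by (simp add: drop_update_swap algebra_simps)
  qed
qed (use tensor_on_outside[OF \<tau>] tensor_on_outside[OF \<tau>'] in \<open>auto simp: valid_args_append\<close>)

lemma tensor_on_contract:
  assumes b: "is_basis R b V" and \<tau>: "tensor_on V (Suc k) (Suc l) \<tau>" and ij: "i \<le> k" "j \<le> l"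
  shows "tensor_on V k l (\<lambda>ws vs. \<Sum>a<R. \<tau> (insert_at i (dual_basis R b a) ws) (insert_at j (b a) vs))"
proof (rule tensor_onI)
  interpret b: basis R b V by standard (rule b)
  fix ws vs p \<omega> \<eta> and c :: real
  assume v: "valid_args V k l ws vs" and p: "p < k"
    and \<omega>: "\<omega> \<in> dual_space V" and \<eta>: "\<eta> \<in> dual_space V"
  have "\<tau> (insert_at i (dual_basis R b a) (ws[p := c *\<^sub>R \<omega> + \<eta>])) (insert_at j (b a) vs) =
      c * \<tau> (insert_at i (dual_basis R b a) (ws[p := \<omega>])) (insert_at j (b a) vs) +
      \<tau> (insert_at i (dual_basis R b a) (ws[p := \<eta>])) (insert_at j (b a) vs)" if a: "a < R" for a
  proof -
    have len: "i \<le> length ws" "p < length ws" using v p ij by (auto simp: valid_args_def)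
    have "skip i p < Suc k" using p by (simp add: skip_def)
    from tensor_on_cov[OF \<tau> _ this \<omega> \<eta>, of "insert_at i (dual_basis R b a) ws" "insert_at j (b a) vs" c]
    show ?thesis
      using v a by (simp add: insert_at_update_skip[OF len] valid_args_insert_at b.dual_basis_mem b.basis_mem)
  qed
  then show "(\<Sum>a<R. \<tau> (insert_at i (dual_basis R b a) (ws[p := c *\<^sub>R \<omega> + \<eta>])) (insert_at j (b a) vs)) =
      c * (\<Sum>a<R. \<tau> (insert_at i (dual_basis R b a) (ws[p := \<omega>])) (insert_at j (b a) vs)) +
      (\<Sum>a<R. \<tau> (insert_at i (dual_basis R b a) (ws[p := \<eta>])) (insert_at j (b a) vs))"
    by (simp add: sum.distrib sum_distrib_left)
next
  interpret b: basis R b V by standard (rule b)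
  fix ws vs p x y and c :: real
  assume v: "valid_args V k l ws vs" and p: "p < l" and x: "x \<in> V" and y: "y \<in> V"
  have "\<tau> (insert_at i (dual_basis R b a) ws) (insert_at j (b a) (vs[p := c *\<^sub>R x + y])) =
      c * \<tau> (insert_at i (dual_basis R b a) ws) (insert_at j (b a) (vs[p := x])) +
      \<tau> (insert_at i (dual_basis R b a) ws) (insert_at j (b a) (vs[p := y]))" if a: "a < R" for a
  proof -
    have len: "j \<le> length vs" "p < length vs" using v p ij by (auto simp: valid_args_def)
    have "skip j p < Suc l" using p by (simp add: skip_def)
    from tensor_on_vec[OF \<tau> _ this x y, of "insert_at i (dual_basis R b a) ws" "insert_at j (b a) vs" c]
    show ?thesis
      using v a by (simp add: insert_at_update_skip[OF len] valid_args_insert_at b.dual_basis_mem b.basis_mem)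
  qed
  then show "(\<Sum>a<R. \<tau> (insert_at i (dual_basis R b a) ws) (insert_at j (b a) (vs[p := c *\<^sub>R x + y]))) =
      c * (\<Sum>a<R. \<tau> (insert_at i (dual_basis R b a) ws) (insert_at j (b a) (vs[p := x]))) +
      (\<Sum>a<R. \<tau> (insert_at i (dual_basis R b a) ws) (insert_at j (b a) (vs[p := y])))"
    by (simp add: sum.distrib sum_distrib_left)
qed (use tensor_on_outside[OF \<tau>] in \<open>simp add: valid_args_insert_at\<close>)

section \<open>Smoothness of the inverse matrix\<close>

context atlas
begin

lemma smooth_fun_eqI:
  "openin (mtop Q) W \<Longrightarrow> smooth_fun Q W g \<Longrightarrow> (\<And>x. x \<in> W \<Longrightarrow> f x = g x) \<Longrightarrow> smooth_fun Q W f"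
  using smooth_fun_cong[of W f g] by simp

text \<open>By the Leibniz formula the determinant is a polynomial in the entries.\<close>

lemma smooth_fun_det:
  assumes W: "openin (mtop Q) W" and a: "\<And>i j. i < k \<Longrightarrow> j < k \<Longrightarrow> smooth_fun Q W (a i j)"
  shows "smooth_fun Q W (\<lambda>x. Determinant.det (mat k k (\<lambda>(i, j). a i j x)))"
proof -
  have "Determinant.det (mat k k (\<lambda>(i, j). a i j x)) =
      (\<Sum>p\<in>{p. p permutes {0..<k}}. signof p * (\<Prod>i=0..<k. a i (p i) x))" for x
    unfolding det_def'[OF mat_carrier]
    by (intro sum.cong refl arg_cong2[where f = "(*)"] prod.cong) (auto dest: permutes_in_image)
  moreover have "smooth_fun Q W (\<lambda>x. \<Sum>p\<in>{p. p permutes {0..<k}}. signof p * (\<Prod>i=0..<k. a i (p i) x))"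
    by (intro smooth_fun_sum smooth_fun_mult smooth_fun_prod smooth_fun_const W a)
      (auto dest: permutes_in_image)
  ultimately show ?thesis by simp
qed

text \<open>The inverse is given point by point, and nothing is presupposed about how h varies. Its
  entries are cofactors of g over the determinant of g.\<close>

lemma smooth_fun_mat_inverse:
  assumes W: "openin (mtop Q) W" and g: "\<And>i j. i < k \<Longrightarrow> j < k \<Longrightarrow> smooth_fun Q W (g i j)"
    and h: "\<And>x. x \<in> W \<Longrightarrow> mat_inverse k (\<lambda>i j. g i j x) (\<lambda>i j. h i j x)"
    and ij: "i < k" "j < k"
  shows "smooth_fun Q W (h i j)"
proof -
  define G where "G x = mat k k (\<lambda>(i, j). g i j x)" for x
  define H where "H x = mat k k (\<lambda>(i, j). h i j x)" for x
  have GH: "G x \<in> carrier_mat k k" "H x \<in> carrier_mat k k" for x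
    by (auto simp: G_def H_def)
  have inv: "G x * H x = 1\<^sub>m k" "H x * G x = 1\<^sub>m k" if "x \<in> W" for x
    using h[OF that] unfolding Defs.mat_inverse_def
    by (auto intro!: eq_matI simp: G_def H_def scalar_prod_def lessThan_atLeast0)
  have det: "Determinant.det (G x) \<noteq> 0" if "x \<in> W" for x
  proof
    assume "Determinant.det (G x) = 0"
    then have "Determinant.det (G x * H x) = 0" using det_mult[OF GH] by simp
    then show False using inv(1)[OF that] by simp
  qed
  have eq: "h i j x = inverse (Determinant.det (G x)) * ((-1) ^ (j + i) * Determinant.det (mat_delete (G x) j i))"
    if x: "x \<in> W" for x
  proof -
    have adj: "adj_mat (G x) \<in> carrier_mat k k" by (rule adj_mat(1)[OF GH(1)])
    \<comment> \<open>The product of G with its adjugate is det G times the identity; multiplying by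
      H from the left shows that the adjugate is det G times H.\<close>
    have "adj_mat (G x) = (H x * G x) * adj_mat (G x)"
      using adj inv(2)[OF x] by simp
    also have "\<dots> = H x * (G x * adj_mat (G x))"
      by (rule assoc_mult_mat[OF GH(2) GH(1) adj])
    also have "\<dots> = H x * (Determinant.det (G x) \<cdot>\<^sub>m 1\<^sub>m k)"
      by (simp only: adj_mat(2)[OF GH(1)])
    also have "\<dots> = Determinant.det (G x) \<cdot>\<^sub>m H x"
      by (subst mult_smult_distrib[OF GH(2) one_carrier_mat]) (simp add: right_mult_one_mat[OF GH(2)])
    finally have "adj_mat (G x) $$ (i, j) = (Determinant.det (G x) \<cdot>\<^sub>m H x) $$ (i, j)"
      by simp
    then have "Determinant.det (G x) * h i j x = cofactor (G x) j i"
      using ij by (simp add: adj_mat_def G_def H_def)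
    then show ?thesis
      using det[OF x] by (simp add: cofactor_def field_simps)
  qed
  \<comment> \<open>Deleting row j and column i shifts the indices beyond them, so the minor is
    again the determinant of a matrix with smooth entries. The order j, i reflects the transposition
    in the adjugate.\<close>
  have "mat_delete (G x) j i = mat (k - 1) (k - 1) (\<lambda>(i', j').
      g (if i' < j then i' else Suc i') (if j' < i then j' else Suc j') x)" for x
    using ij by (auto simp: mat_delete_def G_def intro!: eq_matI)
  moreover have "smooth_fun Q W (\<lambda>x. Determinant.det (mat (k - 1) (k - 1) (\<lambda>(i', j').
      g (if i' < j then i' else Suc i') (if j' < i then j' else Suc j') x)))"
    by (rule smooth_fun_det[OF W]) (rule g; auto)
  ultimately have del: "smooth_fun Q W (\<lambda>x. Determinant.det (mat_delete (G x) j i))"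
    by simp
  have "smooth_fun Q W (\<lambda>x. Determinant.det (G x))"
    unfolding G_def using g by (rule smooth_fun_det[OF W])
  then have "smooth_fun Q W (\<lambda>x. inverse (Determinant.det (G x)) * ((-1) ^ (j + i) * Determinant.det (mat_delete (G x) j i)))"
    using det by (intro smooth_fun_mult[OF W] smooth_fun_inverse[OF W] smooth_fun_const[OF W] del)
  then show ?thesis
    by (rule smooth_fun_cong[OF W, THEN iffD2, rotated]) (rule eq)
qed

end

section \<open>Sections and tensor fields\<close>

locale vec_bundle = hausdorff_atlas Q for Q :: "'q mfd" +
  fixes B :: "('q, 'w::real_vector) vbundle"
  assumes frame: "f \<in> frames B \<Longrightarrow> local_frame Q (rank B) (fib B) f"
    and frame_cover: "q \<in> pts Q \<Longrightarrow> \<exists>f\<in>frames B. q \<in> fst f"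
begin

abbreviation cf :: "('q, 'w) frame \<Rightarrow> nat \<Rightarrow> 'q \<Rightarrow> 'w \<Rightarrow> real" where
  "cf f a q \<equiv> dual_basis (rank B) (\<lambda>b. snd f b q) a"

lemma frame_basis: "f \<in> frames B \<Longrightarrow> q \<in> fst f \<Longrightarrow> is_basis (rank B) (\<lambda>a. snd f a q) (fib B q)"
  using frame by (auto simp: local_frame_iff)

lemma frame_open: "f \<in> frames B \<Longrightarrow> openin (mtop Q) (fst f)"
  using frame by (auto simp: local_frame_iff)

lemma frame_subset_pts: "f \<in> frames B \<Longrightarrow> q \<in> fst f \<Longrightarrow> q \<in> pts Q"
  using frame_open openin_subset_pts by blast

lemma pts_basis:
  assumes "q \<in> pts Q"
  obtains f where "f \<in> frames B" "q \<in> fst f" "is_basis (rank B) (\<lambda>a. snd f a q) (fib B q)"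
  using frame_cover[OF assms] frame_basis by blast

lemma fib_subspace: "q \<in> pts Q \<Longrightarrow> subspace (fib B q)"
  by (meson pts_basis basis.subspace basis.intro)

definition tcomp :: "('q, 'w) frame \<Rightarrow> ('q, 'w) tfield \<Rightarrow> nat list \<Rightarrow> nat list \<Rightarrow> 'q \<Rightarrow> real" where
  "tcomp f T I J q = T q (map (\<lambda>i. cf f i q) I) (map (\<lambda>j. snd f j q) J)"

definition tindex :: "nat \<Rightarrow> nat list \<Rightarrow> bool" where
  "tindex k I \<longleftrightarrow> length I = k \<and> set I \<subseteq> {..<rank B}"

lemma tensor_fields_iff:
  "T \<in> tensor_fields Q B k l \<longleftrightarrow>
     (\<forall>q\<in>pts Q. tensor_on (fib B q) k l (T q)) \<and> (\<forall>q. q \<notin> pts Q \<longrightarrow> T q = 0) \<and>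
     (\<forall>f\<in>frames B. \<forall>I J. tindex k I \<and> tindex l J \<longrightarrow> smooth_fun Q (fst f) (tcomp f T I J))"
proof -
  have "(\<lambda>q. T q (map (\<lambda>i. coframe (rank B) (snd f) i q) I) (map (\<lambda>j. snd f j q) J)) = tcomp f T I J" for f I J
    by (simp add: tcomp_def fun_eq_iff coframe_eq)
  then show ?thesis
    by (simp add: tensor_fields_def tindex_def conj_assoc)
qed

lemma tensor_fieldsD:
  assumes "T \<in> tensor_fields Q B k l"
  shows "q \<in> pts Q \<Longrightarrow> tensor_on (fib B q) k l (T q)" "q \<notin> pts Q \<Longrightarrow> T q = 0"
    "f \<in> frames B \<Longrightarrow> tindex k I \<Longrightarrow> tindex l J \<Longrightarrow> smooth_fun Q (fst f) (tcomp f T I J)"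
  using assms unfolding tensor_fields_iff by blast+

lemma tensor_fieldsI:
  assumes "\<And>q. q \<in> pts Q \<Longrightarrow> tensor_on (fib B q) k l (T q)" "\<And>q. q \<notin> pts Q \<Longrightarrow> T q = 0"
    "\<And>f I J. f \<in> frames B \<Longrightarrow> tindex k I \<Longrightarrow> tindex l J \<Longrightarrow> smooth_fun Q (fst f) (tcomp f T I J)"
  shows "T \<in> tensor_fields Q B k l"
  unfolding tensor_fields_iff using assms by blast

lemma tindex_update: "tindex k I \<Longrightarrow> b < rank B \<Longrightarrow> tindex k (I[i := b])"
  by (auto simp: tindex_def dest!: set_update_subset_insert[THEN subsetD])

lemma tindex_nth: "tindex k I \<Longrightarrow> i < k \<Longrightarrow> I ! i < rank B"
  by (auto simp: tindex_def dest: nth_mem)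

lemma valid_frame_args:
  assumes "f \<in> frames B" "q \<in> fst f" "tindex k I" "tindex l J"
  shows "valid_args (fib B q) k l (map (\<lambda>i. cf f i q) I) (map (\<lambda>j. snd f j q) J)"
proof -
  interpret b: basis "rank B" "\<lambda>a. snd f a q" "fib B q"
    by standard (rule frame_basis[OF assms(1,2)])
  show ?thesis
    using assms(3,4) b.basis_mem b.dual_basis_mem by (auto simp: valid_args_def tindex_def)
qed

lemma tensor_fields_add:
  assumes T: "T \<in> tensor_fields Q B k l" and T': "T' \<in> tensor_fields Q B k l"
  shows "T + T' \<in> tensor_fields Q B k l"
proof (rule tensor_fieldsI)
  fix q assume q: "q \<in> pts Q"
  note t = tensor_fieldsD(1)[OF T q] and t' = tensor_fieldsD(1)[OF T' q]
  show "tensor_on (fib B q) k l ((T + T') q)"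
    by (rule tensor_onI)
      (simp_all add: tensor_on_outside[OF t] tensor_on_outside[OF t'] tensor_on_cov[OF t] tensor_on_cov[OF t']
        tensor_on_vec[OF t] tensor_on_vec[OF t'] distrib_left)
next
  fix f I J assume *: "f \<in> frames B" "tindex k I" "tindex l J"
  have "tcomp f (T + T') I J = (\<lambda>q. tcomp f T I J q + tcomp f T' I J q)"
    by (simp add: tcomp_def fun_eq_iff)
  then show "smooth_fun Q (fst f) (tcomp f (T + T') I J)"
    using smooth_fun_add[OF frame_open] tensor_fieldsD(3)[OF T] tensor_fieldsD(3)[OF T'] * by simp
qed (use tensor_fieldsD(2)[OF T] tensor_fieldsD(2)[OF T'] in \<open>simp add: fun_eq_iff\<close>)

lemma tensor_fields_prod:
  assumes T: "T \<in> tensor_fields Q B k l" and T': "T' \<in> tensor_fields Q B k' l'"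
  shows "tensor_prod k l T T' \<in> tensor_fields Q B (k + k') (l + l')"
proof (rule tensor_fieldsI)
  fix q assume q: "q \<in> pts Q"
  show "tensor_on (fib B q) (k + k') (l + l') (tensor_prod k l T T' q)"
    unfolding tensor_prod_def
    by (rule tensor_on_prod[OF fib_subspace[OF q] tensor_fieldsD(1)[OF T q] tensor_fieldsD(1)[OF T' q]])
next
  fix f I J assume *: "f \<in> frames B" "tindex (k + k') I" "tindex (l + l') J"
  have "tindex k (take k I)" "tindex k' (drop k I)" "tindex l (take l J)" "tindex l' (drop l J)"
    using *(2,3) by (auto simp: tindex_def dest: in_set_takeD in_set_dropD)
  moreover have "tcomp f (tensor_prod k l T T') I J =
      (\<lambda>q. tcomp f T (take k I) (take l J) q * tcomp f T' (drop k I) (drop l J) q)"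
    by (simp add: tcomp_def tensor_prod_def fun_eq_iff take_map drop_map)
  ultimately show "smooth_fun Q (fst f) (tcomp f (tensor_prod k l T T') I J)"
    using smooth_fun_mult[OF frame_open] tensor_fieldsD(3)[OF T] tensor_fieldsD(3)[OF T'] * by simp
qed (use tensor_fieldsD(2)[OF T] in \<open>simp add: tensor_prod_def fun_eq_iff\<close>)

lemma map_insert_at: "map g (insert_at i x xs) = insert_at i (g x) (map g xs)"
  by (simp add: insert_at_def take_map drop_map)

lemma contract_frame:
  assumes T: "T \<in> tensor_fields Q B (Suc k) (Suc l)" and ij: "i \<le> k" "j \<le> l"
    and f: "f \<in> frames B" "q \<in> fst f"
  shows "contract B i j T q ws vs =
    (\<Sum>a<rank B. T q (insert_at i (cf f a q) ws) (insert_at j (snd f a q) vs))"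
  using contract_basis[where T = T, OF frame_basis[OF f] tensor_fieldsD(1)[OF T frame_subset_pts[OF f]] ij] .

lemma tensor_fields_contract:
  assumes T: "T \<in> tensor_fields Q B (Suc k) (Suc l)" and ij: "i \<le> k" "j \<le> l"
  shows "contract B i j T \<in> tensor_fields Q B k l"
proof (rule tensor_fieldsI)
  fix q assume q: "q \<in> pts Q"
  then obtain f where f: "f \<in> frames B" "q \<in> fst f" using frame_cover by blast
  have "contract B i j T q =
      (\<lambda>ws vs. \<Sum>a<rank B. T q (insert_at i (cf f a q) ws) (insert_at j (snd f a q) vs))"
    by (intro ext) (rule contract_frame[OF T ij f])
  then show "tensor_on (fib B q) k l (contract B i j T q)"
    using tensor_on_contract[OF frame_basis[OF f] tensor_fieldsD(1)[OF T q] ij] by simp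
next
  fix f I J assume *: "f \<in> frames B" "tindex k I" "tindex l J"
  have "smooth_fun Q (fst f) (\<lambda>q. \<Sum>a<rank B. tcomp f T (insert_at i a I) (insert_at j a J) q)"
    using * by (intro smooth_fun_sum frame_open tensor_fieldsD(3)[OF T])
      (auto simp: tindex_def length_insert_at set_insert_at)
  moreover have "tcomp f (contract B i j T) I J q = (\<Sum>a<rank B. tcomp f T (insert_at i a I) (insert_at j a J) q)"
    if "q \<in> fst f" for q
    by (simp add: tcomp_def contract_frame[OF T ij *(1) that] map_insert_at)
  ultimately show "smooth_fun Q (fst f) (tcomp f (contract B i j T) I J)"
    by (rule smooth_fun_eqI[OF frame_open[OF *(1)]])
qed (use tensor_fieldsD(2)[OF T] in \<open>simp add: contract_def Let_def fun_eq_iff\<close>)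

text \<open>Replacing one argument by its expansion in the frame costs a single sum, so the
  components of the result are polynomials in the components of T and the matrix entries of
  A.\<close>

lemma tensor_fields_act:
  assumes A: "\<And>q. q \<in> pts Q \<Longrightarrow> endo (fib B q) (A q)"
    and As: "\<And>f a b. f \<in> frames B \<Longrightarrow> a < rank B \<Longrightarrow> b < rank B \<Longrightarrow>
      smooth_fun Q (fst f) (\<lambda>q. cf f a q (A q (snd f b q)))"
    and T: "T \<in> tensor_fields Q B k l"
  shows "(\<lambda>q. act (fib B q) (A q) k l (T q)) \<in> tensor_fields Q B k l"
proof (rule tensor_fieldsI)
  fix q assume q: "q \<in> pts Q"
  show "tensor_on (fib B q) k l (act (fib B q) (A q) k l (T q))"
    by (rule tensor_on_act[OF fib_subspace[OF q] A[OF q] tensor_fieldsD(1)[OF T q]])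
next
  fix f I J assume *: "f \<in> frames B" "tindex k I" "tindex l J"
  define W where "W q = map (\<lambda>i. cf f i q) I" for q
  define U where "U q = map (\<lambda>j. snd f j q) J" for q
  have "tcomp f (\<lambda>q. act (fib B q) (A q) k l (T q)) I J q =
      (\<Sum>i<k. \<Sum>b<rank B. cf f (I ! i) q (A q (snd f b q)) * tcomp f T (I[i := b]) J q) -
      (\<Sum>j<l. \<Sum>b<rank B. cf f b q (A q (snd f (J ! j) q)) * tcomp f T I (J[j := b]) q)"
    if q: "q \<in> fst f" for q
  proof -
    interpret b: basis "rank B" "\<lambda>a. snd f a q" "fib B q"
      by standard (rule frame_basis[OF *(1) q])
    have qp: "q \<in> pts Q" by (rule frame_subset_pts[OF *(1) q])
    note t = tensor_fieldsD(1)[OF T qp]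
    have v: "valid_args (fib B q) k l (W q) (U q)"
      unfolding W_def U_def by (rule valid_frame_args[OF *(1) q *(2,3)])
    have "T q ((W q)[i := W q ! i \<circ> A q]) (U q) =
        (\<Sum>b<rank B. cf f (I ! i) q (A q (snd f b q)) * tcomp f T (I[i := b]) J q)" if i: "i < k" for i
    proof -
      have "W q ! i = cf f (I ! i) q" using i *(2) by (simp add: W_def tindex_def)
      then have "W q ! i \<circ> A q = (\<Sum>b<rank B. cf f (I ! i) q (A q (snd f b q)) *\<^sub>R cf f b q)"
        using b.dual_expand[OF endo_dual[OF A[OF qp] b.subspace b.dual_basis_mem]] by simp
      then show ?thesis
        using tensor_on_cov_sum[OF t v i, of "{..<rank B}" "\<lambda>b. cf f b q"]
        by (simp add: b.dual_basis_mem tcomp_def W_def U_def map_update)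
    qed
    moreover have "T q (W q) ((U q)[j := A q (U q ! j)]) =
        (\<Sum>b<rank B. cf f b q (A q (snd f (J ! j) q)) * tcomp f T I (J[j := b]) q)" if j: "j < l" for j
    proof -
      have "snd f (J ! j) q \<in> fib B q" using b.basis_mem tindex_nth[OF *(3) j] by simp
      then have "A q (snd f (J ! j) q) \<in> fib B q" by (rule endoD(1)[OF A[OF qp]])
      moreover have "U q ! j = snd f (J ! j) q" using j *(3) by (simp add: U_def tindex_def)
      ultimately have "A q (U q ! j) = (\<Sum>b<rank B. cf f b q (A q (snd f (J ! j) q)) *\<^sub>R snd f b q)"
        using b.expand by simp
      then show ?thesis
        using tensor_on_vec_sum[OF t b.subspace v j, of "{..<rank B}" "\<lambda>b. snd f b q"]
        by (simp add: b.basis_mem tcomp_def W_def U_def map_update)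
    qed
    ultimately show ?thesis
      using v by (simp add: tcomp_def[of f "\<lambda>q. act (fib B q) (A q) k l (T q)"] act_def W_def U_def)
  qed
  moreover have "smooth_fun Q (fst f) (\<lambda>q.
      (\<Sum>i<k. \<Sum>b<rank B. cf f (I ! i) q (A q (snd f b q)) * tcomp f T (I[i := b]) J q) -
      (\<Sum>j<l. \<Sum>b<rank B. cf f b q (A q (snd f (J ! j) q)) * tcomp f T I (J[j := b]) q))"
    using * by (intro smooth_fun_diff smooth_fun_sum smooth_fun_mult frame_open As tensor_fieldsD(3)[OF T]
      tindex_update tindex_nth) auto
  ultimately show "smooth_fun Q (fst f) (tcomp f (\<lambda>q. act (fib B q) (A q) k l (T q)) I J)"
    by (rule smooth_fun_eqI[OF frame_open[OF *(1)], rotated])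
qed (use tensor_fieldsD(2)[OF T] in \<open>simp add: act_def fun_eq_iff\<close>)

lemma smooth_fun_pts:
  assumes "\<And>f. f \<in> frames B \<Longrightarrow> smooth_fun Q (fst f) u"
  shows "smooth_fun Q (pts Q) u"
proof (rule smooth_fun_local[OF openin_pts])
  fix q assume "q \<in> pts Q"
  then obtain f where "f \<in> frames B" "q \<in> fst f" using frame_cover by blast
  then show "\<exists>U. openin (mtop Q) U \<and> q \<in> U \<and> smooth_fun Q (pts Q \<inter> U) u"
    using frame_open smooth_fun_subset[OF assms] by (intro exI[of _ "fst f"]) auto
qed

lemma tensor_fields_0_0:
  assumes T: "T \<in> tensor_fields Q B 0 0"
  shows "T = fun_tensor Q (\<lambda>q. T q [] [])" "smooth_fun Q (pts Q) (\<lambda>q. T q [] [])"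
proof -
  have "T q ws vs = (if q \<in> pts Q \<and> ws = [] \<and> vs = [] then T q [] [] else 0)" for q ws vs
  proof (cases "q \<in> pts Q")
    case True
    then show ?thesis
      using tensor_on_outside[OF tensor_fieldsD(1)[OF T True], of ws vs] by (auto simp: valid_args_def)
  qed (use tensor_fieldsD(2)[OF T] in simp)
  then show "T = fun_tensor Q (\<lambda>q. T q [] [])"
    by (simp add: fun_tensor_def fun_eq_iff)
  show "smooth_fun Q (pts Q) (\<lambda>q. T q [] [])"
  proof (rule smooth_fun_pts)
    fix f assume f: "f \<in> frames B"
    have "tcomp f T [] [] = (\<lambda>q. T q [] [])" by (simp add: tcomp_def fun_eq_iff)
    then show "smooth_fun Q (fst f) (\<lambda>q. T q [] [])"
      using tensor_fieldsD(3)[OF T f, of "[]" "[]"] by (simp add: tindex_def)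
  qed
qed

section \<open>Sections, also viewed as tensor fields of type (1,0)\<close>

lemma sections_iff:
  "Y \<in> sections Q B \<longleftrightarrow> (\<forall>q\<in>pts Q. Y q \<in> fib B q) \<and> (\<forall>q. q \<notin> pts Q \<longrightarrow> Y q = 0) \<and>
    (\<forall>f\<in>frames B. \<forall>a<rank B. smooth_fun Q (fst f) (\<lambda>q. cf f a q (Y q)))"
proof -
  have "pts Q \<inter> fst f = fst f" if "f \<in> frames B" for f
    using frame_subset_pts[OF that] by blast
  then show ?thesis
    by (auto simp: sections_def smooth_section_def coframe_eq)
qed

lemma sec_tensor_tensor_field:
  assumes Y: "Y \<in> sections Q B"
  shows "sec_tensor B Y \<in> tensor_fields Q B 1 0"
proof (rule tensor_fieldsI)
  fix q assume q: "q \<in> pts Q"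
  have Yq: "Y q \<in> fib B q" using Y q by (simp add: sections_iff)
  show "tensor_on (fib B q) 1 0 (sec_tensor B Y q)"
  proof (rule tensor_onI)
    fix ws vs i \<omega> \<eta> and c :: real
    assume *: "valid_args (fib B q) 1 0 ws vs" "i < (1::nat)" "\<omega> \<in> dual_space (fib B q)" "\<eta> \<in> dual_space (fib B q)"
    then obtain w where "ws = [w]" by (auto simp: valid_args_def length_Suc_conv)
    moreover have "c *\<^sub>R \<omega> + \<eta> \<in> dual_space (fib B q)"
      using dual_space_subspace *(3,4) by (intro subspace_add subspace_scale)
    ultimately show "sec_tensor B Y q (ws[i := c *\<^sub>R \<omega> + \<eta>]) vs =
        c * sec_tensor B Y q (ws[i := \<omega>]) vs + sec_tensor B Y q (ws[i := \<eta>]) vs"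
      using * by (simp add: sec_tensor_def valid_args_def scaleR_fun_def)
  qed (auto simp: sec_tensor_def valid_args_def)
next
  fix q assume "q \<notin> pts Q"
  then have "Y q = 0" using Y by (simp add: sections_iff)
  then have "sec_tensor B Y q ws vs = 0" for ws vs
    by (cases ws) (auto simp: sec_tensor_def intro: dual_space_0)
  then show "sec_tensor B Y q = 0" by (simp add: fun_eq_iff)
next
  fix f I J assume *: "f \<in> frames B" "tindex 1 I" "tindex 0 J"
  then obtain a where a: "I = [a]" "a < rank B" by (auto simp: tindex_def length_Suc_conv)
  have "tcomp f (sec_tensor B Y) I J q = cf f a q (Y q)" if q: "q \<in> fst f" for q
  proof -
    interpret b: basis "rank B" "\<lambda>a. snd f a q" "fib B q"
      by standard (rule frame_basis[OF *(1) q])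
    show ?thesis using a *(3) b.dual_basis_mem by (simp add: tcomp_def sec_tensor_def tindex_def)
  qed
  then show "smooth_fun Q (fst f) (tcomp f (sec_tensor B Y) I J)"
    using smooth_fun_cong[OF frame_open[OF *(1)], of "tcomp f (sec_tensor B Y) I J" "\<lambda>q. cf f a q (Y q)"]
      Y a * by (simp add: sections_iff)
qed

lemma sec_tensor_cf:
  "f \<in> frames B \<Longrightarrow> q \<in> fst f \<Longrightarrow> sec_tensor B Y q [cf f a q] [] = cf f a q (Y q)"
  using basis.dual_basis_mem[OF basis.intro[OF frame_basis]] by (simp add: sec_tensor_def)

lemma sec_tensor_inj:
  assumes Y: "Y \<in> sections Q B" and Z: "Z \<in> sections Q B" and eq: "sec_tensor B Y = sec_tensor B Z"
  shows "Y = Z"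
proof
  fix q
  show "Y q = Z q"
  proof (cases "q \<in> pts Q")
    case True
    then obtain f where f: "f \<in> frames B" "q \<in> fst f" using frame_cover by blast
    interpret b: basis "rank B" "\<lambda>a. snd f a q" "fib B q"
      by standard (rule frame_basis[OF f])
    show ?thesis
      using Y Z True sec_tensor_cf[OF f, of Y] sec_tensor_cf[OF f, of Z] eq
      by (intro b.eqI) (auto simp: sections_iff)
  qed (use Y Z in \<open>simp add: sections_iff\<close>)
qed

text \<open>In finite dimension a linear form on covectors is evaluation at a vector. A frame chosen
  at each point only serves to name this vector; smoothness is checked in an arbitrary frame, where
  the coordinates of Z are the components of T.\<close>

lemma tensor_field_1_0_section:
  assumes T: "T \<in> tensor_fields Q B 1 0"
  obtains Z where "Z \<in> sections Q B" "T = sec_tensor B Z"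
proof -
  define F where "F q = (SOME f. f \<in> frames B \<and> q \<in> fst f)" for q
  have F: "F q \<in> frames B" "q \<in> fst (F q)" if "q \<in> pts Q" for q
    using someI_ex[of "\<lambda>f. f \<in> frames B \<and> q \<in> fst f"] frame_cover[OF that] unfolding F_def by blast+
  define Z where "Z q = (if q \<in> pts Q then \<Sum>a<rank B. T q [cf (F q) a q] [] *\<^sub>R snd (F q) a q else 0)" for q
  have *: "Z q \<in> fib B q" "\<And>\<omega>. \<omega> \<in> dual_space (fib B q) \<Longrightarrow> T q [\<omega>] [] = \<omega> (Z q)" if q: "q \<in> pts Q" for q
  proof -
    interpret b: basis "rank B" "\<lambda>a. snd (F q) a q" "fib B q"
      by standard (rule frame_basis[OF F[OF q]])
    show "Z q \<in> fib B q" using q by (auto simp: Z_def intro!: b.sum_mem b.basis_mem)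
    fix \<omega> assume \<omega>: "\<omega> \<in> dual_space (fib B q)"
    have v: "valid_args (fib B q) 1 0 [\<omega>] []" using \<omega> by (simp add: valid_args_def)
    have "T q [\<omega>] [] = T q ([\<omega>][0 := \<Sum>a<rank B. \<omega> (snd (F q) a q) *\<^sub>R cf (F q) a q]) []"
      using b.dual_expand[OF \<omega>] by simp
    also have "\<dots> = (\<Sum>a<rank B. \<omega> (snd (F q) a q) * T q [cf (F q) a q] [])"
      using tensor_on_cov_sum[OF tensor_fieldsD(1)[OF T q] v, of 0 "{..<rank B}" "\<lambda>a. cf (F q) a q"]
      by (simp add: b.dual_basis_mem)
    also have "\<dots> = \<omega> (Z q)"
      using dual_space_sum[OF \<omega> b.subspace, of "{..<rank B}" "\<lambda>a. snd (F q) a q"] q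
      by (simp add: Z_def b.basis_mem mult.commute)
    finally show "T q [\<omega>] [] = \<omega> (Z q)" .
  qed
  have "Z \<in> sections Q B"
    unfolding sections_iff
  proof (intro conjI ballI allI impI)
    fix f a assume f: "f \<in> frames B" and a: "a < rank B"
    have "tcomp f T [a] [] q = cf f a q (Z q)" if "q \<in> fst f" for q
    proof -
      interpret b: basis "rank B" "\<lambda>a. snd f a q" "fib B q"
        by standard (rule frame_basis[OF f that])
      show ?thesis using *(2)[OF frame_subset_pts[OF f that] b.dual_basis_mem] by (simp add: tcomp_def)
    qed
    then show "smooth_fun Q (fst f) (\<lambda>q. cf f a q (Z q))"
      using smooth_fun_cong[OF frame_open[OF f], of "tcomp f T [a] []" "\<lambda>q. cf f a q (Z q)"]
        tensor_fieldsD(3)[OF T f, of "[a]" "[]"] a by (simp add: tindex_def)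
  qed (use * in \<open>auto simp: Z_def\<close>)
  moreover have "T q ws vs = sec_tensor B Z q ws vs" for q ws vs
  proof (cases "q \<in> pts Q")
    case True
    show ?thesis
    proof (cases "valid_args (fib B q) 1 0 ws vs")
      case True': True
      then obtain w where "ws = [w]" by (auto simp: valid_args_def length_Suc_conv)
      then show ?thesis using True' *(2)[OF True] by (simp add: sec_tensor_def valid_args_def)
    next
      case False
      then show ?thesis
        using tensor_on_outside[OF tensor_fieldsD(1)[OF T True] False] by (auto simp: sec_tensor_def valid_args_def)
    qed
  next
    case False
    then have "Z q = 0" by (simp add: Z_def)
    then have "sec_tensor B Z q ws vs = 0"
      by (cases ws) (auto simp: sec_tensor_def intro: dual_space_0)
    then show ?thesis using tensor_fieldsD(2)[OF T False] by simp
  qed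
  ultimately show ?thesis using that by blast
qed

text \<open>A cutoff function times s. The last conclusion, that Z is at each point 0 or a multiple
  of s, lets every fibrewise linear condition on s, such as being horizontal or vertical, pass to
  Z.\<close>

lemma extend_section:
  assumes W: "openin (mtop Q) W" "q \<in> W" and s: "\<And>z. z \<in> W \<Longrightarrow> s z \<in> fib B z"
    and smooth: "\<And>f a. f \<in> frames B \<Longrightarrow> a < rank B \<Longrightarrow> smooth_fun Q (W \<inter> fst f) (\<lambda>z. cf f a z (s z))"
  obtains Z where "Z \<in> sections Q B" "eq_near Q q Z s"
    "\<And>z. (\<exists>c. z \<in> W \<and> Z z = c *\<^sub>R s z) \<or> Z z = 0"
proof -
  obtain \<phi> U K where \<phi>: "smooth_fun Q (pts Q) \<phi>" "openin (mtop Q) U" "q \<in> U" "U \<subseteq> W"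
    "\<And>z. z \<in> U \<Longrightarrow> \<phi> z = 1" "closedin (mtop Q) K" "K \<subseteq> W" "\<And>z. z \<notin> K \<Longrightarrow> \<phi> z = 0"
    by (rule bump_function[OF W]) blast
  define Z where "Z z = (if z \<in> W then \<phi> z *\<^sub>R s z else 0)" for z
  have Wp: "W \<subseteq> pts Q" by (rule openin_subset_pts[OF W(1)])
  have Kc: "openin (mtop Q) (pts Q - K)" using \<phi>(6) by (simp add: closedin_def topspace_mtop)
  have "Z \<in> sections Q B"
    unfolding sections_iff
  proof (intro conjI ballI allI impI)
    fix z assume "z \<in> pts Q"
    then show "Z z \<in> fib B z"
      using s subspace_scale[OF fib_subspace] subspace_0[OF fib_subspace] by (simp add: Z_def)
  next
    fix f a assume f: "f \<in> frames B" and a: "a < rank B"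
    have lin: "cf f a z (Z z) = (if z \<in> W then \<phi> z * cf f a z (s z) else 0)" if "z \<in> fst f" for z
    proof -
      interpret b: basis "rank B" "\<lambda>a. snd f a z" "fib B z"
        by standard (rule frame_basis[OF f that])
      show ?thesis using s dual_space_0[OF b.dual_basis_mem] by (simp add: Z_def b.dual_basis_scale)
    qed
    show "smooth_fun Q (fst f) (\<lambda>z. cf f a z (Z z))"
    proof (rule smooth_fun_local[OF frame_open[OF f]])
      fix z assume z: "z \<in> fst f"
      have zp: "z \<in> pts Q" by (rule frame_subset_pts[OF f z])
      \<comment> \<open>Near points of K, which lies in W, the section is a product of smooth data;
        on the open complement of K it is 0.\<close>
      show "\<exists>V. openin (mtop Q) V \<and> z \<in> V \<and> smooth_fun Q (fst f \<inter> V) (\<lambda>z. cf f a z (Z z))"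
      proof (cases "z \<in> K")
        case True
        have o: "openin (mtop Q) (W \<inter> fst f)" by (rule openin_Int[OF W(1) frame_open[OF f]])
        have "smooth_fun Q (W \<inter> fst f) (\<lambda>z. \<phi> z * cf f a z (s z))"
          by (rule smooth_fun_mult[OF o smooth_fun_subset[OF \<phi>(1)] smooth[OF f a]]) (use Wp in auto)
        then have "smooth_fun Q (W \<inter> fst f) (\<lambda>z. cf f a z (Z z))"
          by (rule smooth_fun_cong[OF o, THEN iffD1, rotated]) (simp add: lin)
        then show ?thesis
          using True \<phi>(7) W(1) by (intro exI[of _ W]) (auto simp: Int_commute)
      next
        case False
        have o: "openin (mtop Q) (fst f \<inter> (pts Q - K))" by (rule openin_Int[OF frame_open[OF f] Kc])
        have "smooth_fun Q (fst f \<inter> (pts Q - K)) (\<lambda>z. cf f a z (Z z))"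
          by (rule smooth_fun_cong[OF o, THEN iffD1, OF _ smooth_fun_const[OF o, of 0]]) (auto simp: lin \<phi>(8))
        then show ?thesis
          using False Kc zp by (intro exI[of _ "pts Q - K"]) auto
      qed
    qed
  qed (use Wp in \<open>auto simp: Z_def\<close>)
  moreover have "eq_near Q q Z s"
    unfolding eq_near_def using \<phi>(2-5) by (intro exI[of _ U]) (auto simp: Z_def)
  moreover have "(\<exists>c. z \<in> W \<and> Z z = c *\<^sub>R s z) \<or> Z z = 0" for z
    by (auto simp: Z_def)
  ultimately show ?thesis using that by blast
qed

end

section \<open>Covariant derivatives\<close>

lemma covariant_derivativeD:
  fixes S :: "('q, 'w::real_vector) gen_tangent"
  assumes "covariant_derivative S D" "X \<in> sections (base S) (gbundle S)"
  shows "T \<in> tensor_fields (base S) (gbundle S) k l \<Longrightarrow> D k l X T \<in> tensor_fields (base S) (gbundle S) k l"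
    "Y \<in> sections (base S) (gbundle S) \<Longrightarrow> T \<in> tensor_fields (base S) (gbundle S) k l \<Longrightarrow>
      D k l (X + Y) T = D k l X T + D k l Y T"
    "T \<in> tensor_fields (base S) (gbundle S) k l \<Longrightarrow> smooth_fun (base S) (pts (base S)) u \<Longrightarrow>
      D k l (\<lambda>q. u q *\<^sub>R X q) T = (\<lambda>q. u q *\<^sub>R D k l X T q)"
    "T \<in> tensor_fields (base S) (gbundle S) k l \<Longrightarrow> T' \<in> tensor_fields (base S) (gbundle S) k l \<Longrightarrow>
      D k l X (T + T') = D k l X T + D k l X T'"
    "smooth_fun (base S) (pts (base S)) u \<Longrightarrow>
      D 0 0 X (fun_tensor (base S) u) = fun_tensor (base S) (\<lambda>q. anchor S (X q) u)"
    "T \<in> tensor_fields (base S) (gbundle S) k l \<Longrightarrow> T' \<in> tensor_fields (base S) (gbundle S) k' l' \<Longrightarrow>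
      D (k + k') (l + l') X (tensor_prod k l T T') =
        tensor_prod k l (D k l X T) T' + tensor_prod k l T (D k' l' X T')"
    "T \<in> tensor_fields (base S) (gbundle S) (Suc k) (Suc l) \<Longrightarrow> i \<le> k \<Longrightarrow> j \<le> l \<Longrightarrow>
      D k l X (contract (gbundle S) i j T) = contract (gbundle S) i j (D (Suc k) (Suc l) X T)"
proof -
  note D = assms(1)[unfolded covariant_derivative_def Let_def]
  show "T \<in> tensor_fields (base S) (gbundle S) k l \<Longrightarrow> D k l X T \<in> tensor_fields (base S) (gbundle S) k l"
    by (rule D[THEN conjunct1, rule_format, OF assms(2)])
  show "Y \<in> sections (base S) (gbundle S) \<Longrightarrow> T \<in> tensor_fields (base S) (gbundle S) k l \<Longrightarrow>
      D k l (X + Y) T = D k l X T + D k l Y T"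
    by (rule D[THEN conjunct2, THEN conjunct1, rule_format, OF assms(2)])
  show "T \<in> tensor_fields (base S) (gbundle S) k l \<Longrightarrow> smooth_fun (base S) (pts (base S)) u \<Longrightarrow>
      D k l (\<lambda>q. u q *\<^sub>R X q) T = (\<lambda>q. u q *\<^sub>R D k l X T q)"
    by (rule D[THEN conjunct2, THEN conjunct2, THEN conjunct1, rule_format, OF assms(2)])
  show "T \<in> tensor_fields (base S) (gbundle S) k l \<Longrightarrow> T' \<in> tensor_fields (base S) (gbundle S) k l \<Longrightarrow>
      D k l X (T + T') = D k l X T + D k l X T'"
    by (rule D[THEN conjunct2, THEN conjunct2, THEN conjunct2, THEN conjunct1, rule_format, OF assms(2)])
  show "smooth_fun (base S) (pts (base S)) u \<Longrightarrow>
      D 0 0 X (fun_tensor (base S) u) = fun_tensor (base S) (\<lambda>q. anchor S (X q) u)"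
    by (rule D[THEN conjunct2, THEN conjunct2, THEN conjunct2, THEN conjunct2, THEN conjunct1, rule_format, OF assms(2)])
  show "T \<in> tensor_fields (base S) (gbundle S) k l \<Longrightarrow> T' \<in> tensor_fields (base S) (gbundle S) k' l' \<Longrightarrow>
      D (k + k') (l + l') X (tensor_prod k l T T') =
        tensor_prod k l (D k l X T) T' + tensor_prod k l T (D k' l' X T')"
    by (rule D[THEN conjunct2, THEN conjunct2, THEN conjunct2, THEN conjunct2, THEN conjunct2, THEN conjunct1, rule_format, OF assms(2)])
  show "T \<in> tensor_fields (base S) (gbundle S) (Suc k) (Suc l) \<Longrightarrow> i \<le> k \<Longrightarrow> j \<le> l \<Longrightarrow>
      D k l X (contract (gbundle S) i j T) = contract (gbundle S) i j (D (Suc k) (Suc l) X T)"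
    by (rule D[THEN conjunct2, THEN conjunct2, THEN conjunct2, THEN conjunct2, THEN conjunct2, THEN conjunct2, rule_format, OF _ _ assms(2)])
qed

lemma join_frame_simps [simp]:
  "k < m \<Longrightarrow> join_frame m h v k = h k" "join_frame m h v (m + b) = v b"
  by (auto simp: join_frame_def)

definition nat_frame :: "('q, 'w::real_vector) gen_tangent \<Rightarrow> ('q, 'w) nat_base \<Rightarrow> ('q, 'w) frame" where
  "nat_frame S N = (ndom N, join_frame (hrank S) (del_h N) (del_v N))"

text \<open>The properties common to the generalized tangent bundle and to the tangent bundle of the
  total space, from which the metric connection is constructed. \<open>nat_vertical\<close> makes
  the vertical subbundle independent of the natural base, and \<open>anchor_local\<close> says that
  the anchor sees only germs of functions.\<close>

locale gen_tangent_bundle = hausdorff_atlas "base S" for S :: "('q, 'w::real_vector) gen_tangent" +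
  assumes gb_rank: "rank (gbundle S) = hrank S + vrank S"
    and gb_frames: "frames (gbundle S) = gen_frames (base S) (hrank S + vrank S) (fib (gbundle S))
      (nat_frame S ` nat_bases S)"
    and nat_local_frame: "N \<in> nat_bases S \<Longrightarrow>
      local_frame (base S) (hrank S + vrank S) (fib (gbundle S)) (nat_frame S N)"
    and nat_compat: "N \<in> nat_bases S \<Longrightarrow> N' \<in> nat_bases S \<Longrightarrow>
      frame_compat (base S) (hrank S + vrank S) (nat_frame S N) (nat_frame S N')"
    and nat_vertical: "N \<in> nat_bases S \<Longrightarrow> N' \<in> nat_bases S \<Longrightarrow> q \<in> ndom N \<Longrightarrow> q \<in> ndom N' \<Longrightarrow>
      \<alpha> < hrank S \<Longrightarrow> b < vrank S \<Longrightarrow>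
      coframe (hrank S + vrank S) (snd (nat_frame S N)) \<alpha> q (del_v N' b q) = 0"
    and nat_cover: "q \<in> pts (base S) \<Longrightarrow> \<exists>N\<in>nat_bases S. q \<in> ndom N"
    and anchor_local: "q \<in> pts (base S) \<Longrightarrow> w \<in> fib (gbundle S) q \<Longrightarrow> eq_near (base S) q u u' \<Longrightarrow>
      anchor S w u = anchor S w u'"
begin

abbreviation "Q \<equiv> base S"
abbreviation "B \<equiv> gbundle S"
abbreviation "m \<equiv> hrank S"
abbreviation "r \<equiv> vrank S"

lemma nat_frame_in_frames: "N \<in> nat_bases S \<Longrightarrow> nat_frame S N \<in> frames B"
  unfolding gb_frames gen_frames_def using nat_local_frame nat_compat by blast

lemma nat_frame_sel [simp]: "fst (nat_frame S N) = ndom N"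
  "snd (nat_frame S N) = join_frame m (del_h N) (del_v N)"
  by (simp_all add: nat_frame_def)

sublocale vec_bundle "base S" "gbundle S"
proof
  show "local_frame Q (rank B) (fib B) f" if "f \<in> frames B" for f
    using that unfolding gb_frames gen_frames_def gb_rank by blast
  show "\<exists>f\<in>frames B. q \<in> fst f" if "q \<in> pts Q" for q
    using nat_cover[OF that] nat_frame_in_frames nat_frame_sel by blast
qed

abbreviation jb :: "('q, 'w) nat_base \<Rightarrow> 'q \<Rightarrow> nat \<Rightarrow> 'w" where
  "jb N q \<equiv> \<lambda>a. join_frame m (del_h N) (del_v N) a q"

lemma ndom_open: "N \<in> nat_bases S \<Longrightarrow> openin (mtop Q) (ndom N)"
  using frame_open[OF nat_frame_in_frames] by simp

lemma ndom_pts: "N \<in> nat_bases S \<Longrightarrow> q \<in> ndom N \<Longrightarrow> q \<in> pts Q"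
  using frame_subset_pts[OF nat_frame_in_frames] by simp

lemma jb_basis: "N \<in> nat_bases S \<Longrightarrow> q \<in> ndom N \<Longrightarrow> is_basis (m + r) (jb N q) (fib B q)"
  using frame_basis[OF nat_frame_in_frames, of N q] by (simp add: gb_rank)

lemma frame_compat_nat:
  assumes f: "f \<in> frames B" and N: "N \<in> nat_bases S" and ab: "a < m + r" "b < m + r"
  shows "smooth_fun Q (ndom N \<inter> fst f) (\<lambda>q. cf f a q (jb N q b))"
proof -
  have "frame_compat Q (m + r) f (nat_frame S N)"
    using f N unfolding gb_frames gen_frames_def by blast
  then show ?thesis
    using ab by (simp add: frame_compat_def coframe_eq gb_rank Int_commute)
qed

lemma del_v_mem_fib: "N \<in> nat_bases S \<Longrightarrow> q \<in> ndom N \<Longrightarrow> b < r \<Longrightarrow> del_v N b q \<in> fib B q"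
  using basis.basis_mem[OF basis.intro[OF jb_basis], of N q "m + b"] by simp

lemma del_h_mem_fib: "N \<in> nat_bases S \<Longrightarrow> q \<in> ndom N \<Longrightarrow> \<alpha> < m \<Longrightarrow> del_h N \<alpha> q \<in> fib B q"
  using basis.basis_mem[OF basis.intro[OF jb_basis], of N q \<alpha>] by simp

text \<open>\<open>vfib\<close> is the span of the vertical vectors of all natural bases at once.
  Those of another base have no horizontal coordinates in the given one, so the given vertical
  vectors already span it.\<close>

lemma del_v_basis:
  assumes N: "N \<in> nat_bases S" and q: "q \<in> ndom N"
  shows "is_basis r (\<lambda>b. del_v N b q) (vfib S q)"
proof -
  interpret jb: basis "m + r" "jb N q" "fib B q" by standard (rule jb_basis[OF N q])
  have "del_v N' b q \<in> span ((\<lambda>b. del_v N b q) ` {..<r})" if "N' \<in> nat_bases S" "q \<in> ndom N'" "b < r" for N' b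
  proof -
    have "del_v N' b q = (\<Sum>a<m + r. dual_basis (m + r) (jb N q) a (del_v N' b q) *\<^sub>R jb N q a)"
      by (rule jb.expand[symmetric, OF del_v_mem_fib[OF that]])
    also have "\<dots> = (\<Sum>a<r. dual_basis (m + r) (jb N q) (m + a) (del_v N' b q) *\<^sub>R del_v N a q)"
      using nat_vertical[OF N that(1) q that(2) _ that(3)] by (simp add: sum_lessThan_add coframe_eq)
    also have "\<dots> \<in> span ((\<lambda>b. del_v N b q) ` {..<r})"
      by (intro span_sum span_scale span_base) auto
    finally show ?thesis .
  qed
  then have "vfib S q \<subseteq> span ((\<lambda>b. del_v N b q) ` {..<r})"
    unfolding vfib_def by (intro span_minimal subspace_span) blast
  moreover have "span ((\<lambda>b. del_v N b q) ` {..<r}) \<subseteq> vfib S q"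
    unfolding vfib_def using N q by (intro span_mono) blast
  ultimately show ?thesis
  proof (intro is_basisI)
    fix c a assume c: "(\<Sum>a<r. c a *\<^sub>R del_v N a q) = 0" and a: "a < r"
    have "(\<Sum>a<m + r. (if a < m then 0 else c (a - m)) *\<^sub>R jb N q a) = 0"
      using c by (simp add: sum_lessThan_add)
    then show "c a = 0"
      using jb.dual_basis_unique[of "m + a" "\<lambda>a. if a < m then 0 else c (a - m)"] a
        dual_space_0[OF jb.dual_basis_mem] by simp
  qed auto
qed

lemma vfib_subset_fib: "q \<in> pts Q \<Longrightarrow> vfib S q \<subseteq> fib B q"
  unfolding vfib_def using del_v_mem_fib by (intro span_minimal fib_subspace) auto

text \<open>Vertical coordinates may be computed in the full natural base, for which smooth
  compatibility is assumed.\<close>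

lemma dual_del_v:
  assumes N: "N \<in> nat_bases S" and q: "q \<in> ndom N" and v: "v \<in> vfib S q" and b: "b < r"
  shows "dual_basis (m + r) (jb N q) (m + b) v = dual_basis r (\<lambda>b. del_v N b q) b v"
proof -
  interpret jb: basis "m + r" "jb N q" "fib B q" by standard (rule jb_basis[OF N q])
  interpret v: basis r "\<lambda>b. del_v N b q" "vfib S q" by standard (rule del_v_basis[OF N q])
  have "dual_basis (m + r) (jb N q) (m + b) (\<Sum>a<m + r. (if a < m then 0 else dual_basis r (\<lambda>b. del_v N b q) (a - m) v) *\<^sub>R jb N q a) =
      dual_basis r (\<lambda>b. del_v N b q) b v"
    using b by (subst jb.dual_basis_unique) auto
  then show ?thesis
    using v.expand[OF v] by (simp add: sum_lessThan_add)
qed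

text \<open>Smoothness of a connection is tested in frames of the vertical bundle; this provides the
  frames in which its components are defined.\<close>

lemma vertical_frame:
  assumes N: "N \<in> nat_bases S"
  shows "(ndom N, del_v N) \<in> frames (vertical_bundle S)"
proof -
  have "smooth_fun Q (ndom N \<inter> ndom N') (\<lambda>q. dual_basis r (\<lambda>b. del_v N b q) a (del_v N' b q))"
    if N: "N \<in> nat_bases S" and N': "N' \<in> nat_bases S" and ab: "a < r" "b < r" for N N' a b
  proof (rule smooth_fun_eqI[OF openin_Int[OF ndom_open[OF N] ndom_open[OF N']]])
    show "smooth_fun Q (ndom N \<inter> ndom N') (\<lambda>q. dual_basis (m + r) (jb N q) (m + a) (del_v N' b q))"
      using frame_compat_nat[OF nat_frame_in_frames[OF N] N', of "m + a" "m + b"] ab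
      by (simp add: gb_rank Int_commute)
    fix q assume q: "q \<in> ndom N \<inter> ndom N'"
    then have "del_v N' b q \<in> vfib S q"
      unfolding vfib_def by (intro span_base) (use N' ab q in blast)
    then show "dual_basis r (\<lambda>b. del_v N b q) a (del_v N' b q) = dual_basis (m + r) (jb N q) (m + a) (del_v N' b q)"
      using dual_del_v[OF N _ _ ab(1)] q by simp
  qed
  then have "frame_compat Q r (ndom N, del_v N) (ndom N', del_v N')"
    if "N \<in> nat_bases S" "N' \<in> nat_bases S" for N N'
    using that by (simp add: frame_compat_def coframe_eq)
  moreover have "local_frame Q r (vfib S) (ndom N, del_v N)"
    by (simp add: local_frame_iff ndom_open[OF N] del_v_basis[OF N])
  ultimately show ?thesis
    using N unfolding vertical_bundle_def gen_frames_def by simp blast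
qed

text \<open>The derivative of a tensor of type (1,0) is of type (1,0) and so comes from exactly one
  section; the definite description in \<open>cov_sec\<close> rests on this.\<close>

lemma cov_sec_mem:
  assumes D: "covariant_derivative S D" and X: "X \<in> sections Q B" and Y: "Y \<in> sections Q B"
  shows "cov_sec S D X Y \<in> sections Q B" "D 1 0 X (sec_tensor B Y) = sec_tensor B (cov_sec S D X Y)"
proof -
  obtain Z where Z: "Z \<in> sections Q B" "D 1 0 X (sec_tensor B Y) = sec_tensor B Z"
    using tensor_field_1_0_section[OF covariant_derivativeD(1)[OF D X sec_tensor_tensor_field[OF Y]]] .
  have "cov_sec S D X Y = Z"
    unfolding cov_sec_def by (rule the_equality) (use Z sec_tensor_inj in auto)
  then show "cov_sec S D X Y \<in> sections Q B" "D 1 0 X (sec_tensor B Y) = sec_tensor B (cov_sec S D X Y)"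
    using Z by auto
qed

text \<open>\<open>K(Y,Z)\<close> is a double contraction of the tensor product of K, Y and Z.\<close>

lemma contract_contract:
  assumes K: "K \<in> tensor_fields Q B 0 2" and T: "T \<in> tensor_fields Q B 1 0" and T': "T' \<in> tensor_fields Q B 1 0"
    and f: "f \<in> frames B" "q \<in> fst f"
  shows "contract B 0 0 (contract B 0 0 (tensor_prod 0 2 K (tensor_prod 1 0 T T'))) q [] [] =
    (\<Sum>a<rank B. \<Sum>b<rank B. K q [] [snd f b q, snd f a q] * (T q [cf f b q] [] * T' q [cf f a q] []))"
proof -
  \<comment> \<open>The types are left as sums, in the form in which the rule for products delivers
    them.\<close>
  have "tensor_prod 0 2 K (tensor_prod 1 0 T T') \<in> tensor_fields Q B (0 + (1 + 1)) (2 + (0 + 0))"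
    by (intro tensor_fields_prod K T T')
  then have 2: "tensor_prod 0 2 K (tensor_prod 1 0 T T') \<in> tensor_fields Q B (Suc 1) (Suc 1)"
    by (simp add: numeral_2_eq_2)
  then have 1: "contract B 0 0 (tensor_prod 0 2 K (tensor_prod 1 0 T T')) \<in> tensor_fields Q B (Suc 0) (Suc 0)"
    using tensor_fields_contract by (metis One_nat_def le0)
  show ?thesis
    unfolding contract_frame[OF 1 le_refl le_refl f] contract_frame[OF 2 le0 le0 f]
    by (simp add: insert_at_def tensor_prod_def)
qed

text \<open>The axioms of a covariant derivative speak of whole tensor fields, so K(Y,Z) is reached
  as a double contraction of the product of K, Y and Z. The derivative commutes with the
  contractions, obeys the product rule, and acts through the anchor on the resulting
  function.\<close>

lemma Leibniz_metric:
  assumes D: "covariant_derivative S D" and X: "X \<in> sections Q B"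
    and Y: "Y \<in> sections Q B" and Z: "Z \<in> sections Q B" and K: "K \<in> tensor_fields Q B 0 2" and q: "q \<in> pts Q"
  shows "anchor S (X q) (\<lambda>q. K q [] [Y q, Z q]) =
    D 0 2 X K q [] [Y q, Z q] + K q [] [cov_sec S D X Y q, Z q] + K q [] [Y q, cov_sec S D X Z q]"
    and "smooth_fun Q (pts Q) (\<lambda>q. K q [] [Y q, Z q])"
proof -
  define P where "P K Y Z = tensor_prod 0 2 K (tensor_prod 1 0 (sec_tensor B Y) (sec_tensor B Z))" for K Y Z
  define C where "C T = contract B 0 0 (contract B 0 0 T)" for T :: "('q, 'w) tfield"
  have sec: "sec_tensor B Y \<in> tensor_fields Q B 1 0" if "Y \<in> sections Q B" for Y
    using that by (rule sec_tensor_tensor_field)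
  have P: "P K Y Z \<in> tensor_fields Q B (Suc 1) (Suc 1)"
    if "K \<in> tensor_fields Q B 0 2" "Y \<in> sections Q B" "Z \<in> sections Q B" for K Y Z
  proof -
    have "P K Y Z \<in> tensor_fields Q B (0 + (1 + 1)) (2 + (0 + 0))"
      unfolding P_def by (intro tensor_fields_prod that sec)
    then show ?thesis by (simp add: numeral_2_eq_2)
  qed
  \<comment> \<open>Expanding Y and Z in a frame turns the value of K into the double sum of the
    contraction.\<close>
  have CP: "C (P K Y Z) q [] [] = K q [] [Y q, Z q]"
    if K: "K \<in> tensor_fields Q B 0 2" and Y: "Y \<in> sections Q B" and Z: "Z \<in> sections Q B" and q: "q \<in> pts Q" for K Y Z q
  proof -
    obtain f where f: "f \<in> frames B" "q \<in> fst f" using frame_cover[OF q] by blast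
    interpret b: basis "rank B" "\<lambda>a. snd f a q" "fib B q" by standard (rule frame_basis[OF f])
    have mem: "Y q \<in> fib B q" "Z q \<in> fib B q" using Y Z q by (auto simp: sections_iff)
    note t = tensor_fieldsD(1)[OF K q]
    have "K q [] [Y q, Z q] = K q [] ([Y q, Z q][1 := \<Sum>a<rank B. cf f a q (Z q) *\<^sub>R snd f a q])"
      using b.expand[OF mem(2)] by simp
    also have "\<dots> = (\<Sum>a<rank B. cf f a q (Z q) * K q [] ([Y q, Z q][1 := snd f a q]))"
      by (rule tensor_on_vec_sum[OF t b.subspace]) (use mem b.basis_mem in \<open>auto simp: valid_args_def\<close>)
    also have "\<dots> = (\<Sum>a<rank B. cf f a q (Z q) * K q [] ([Y q, snd f a q][0 := \<Sum>b<rank B. cf f b q (Y q) *\<^sub>R snd f b q]))"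
      using b.expand[OF mem(1)] by simp
    also have "\<dots> = (\<Sum>a<rank B. cf f a q (Z q) * (\<Sum>b<rank B. cf f b q (Y q) * K q [] ([Y q, snd f a q][0 := snd f b q])))"
      by (intro sum.cong refl arg_cong2[where f = "(*)"] tensor_on_vec_sum[OF t b.subspace])
        (use mem b.basis_mem in \<open>auto simp: valid_args_def\<close>)
    also have "\<dots> = C (P K Y Z) q [] []"
      unfolding C_def P_def contract_contract[OF K sec[OF Y] sec[OF Z] f]
      by (simp add: sum_distrib_left sec_tensor_cf[OF f] algebra_simps)
    finally show ?thesis by simp
  qed
  have 1: "contract B 0 0 (P K Y Z) \<in> tensor_fields Q B (Suc 0) (Suc 0)"
    using tensor_fields_contract[OF P[OF K Y Z], of 0 0] by simp
  then have 0: "C (P K Y Z) \<in> tensor_fields Q B 0 0"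
    unfolding C_def by (rule tensor_fields_contract[OF _ le0 le0])
  define u where "u = (\<lambda>q. C (P K Y Z) q [] [])"
  have u: "C (P K Y Z) = fun_tensor Q u" "smooth_fun Q (pts Q) u"
    unfolding u_def using tensor_fields_0_0[OF 0] by auto
  show "smooth_fun Q (pts Q) (\<lambda>q. K q [] [Y q, Z q])"
    by (rule smooth_fun_eqI[OF openin_pts u(2)]) (simp add: u_def CP[OF K Y Z])
  have Xq: "X q \<in> fib B q" using X q by (simp add: sections_iff)
  \<comment> \<open>The two functions agree on the whole manifold, hence near q, and the anchor
    depends on the germ only.\<close>
  have "anchor S (X q) (\<lambda>q. K q [] [Y q, Z q]) = anchor S (X q) u"
    by (rule anchor_local[OF q Xq])
      (unfold eq_near_def, intro exI[of _ "pts Q"], use openin_pts q CP[OF K Y Z] in \<open>auto simp: u_def\<close>)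
  also have "\<dots> = D 0 0 X (C (P K Y Z)) q [] []"
    using covariant_derivativeD(5)[OF D X u(2)] q by (simp add: u(1) fun_tensor_def)
  also have "D 0 0 X (C (P K Y Z)) = C (D (Suc 1) (Suc 1) X (P K Y Z))"
    unfolding C_def using covariant_derivativeD(7)[OF D X 1, of 0 0] covariant_derivativeD(7)[OF D X P[OF K Y Z], of 0 0]
    by simp
  also have "D (Suc 1) (Suc 1) X (P K Y Z) = P (D 0 2 X K) Y Z + (P K (cov_sec S D X Y) Z + P K Y (cov_sec S D X Z))"
  proof -
    have "D (1 + 1) (0 + 0) X (tensor_prod 1 0 (sec_tensor B Y) (sec_tensor B Z)) =
        tensor_prod 1 0 (sec_tensor B (cov_sec S D X Y)) (sec_tensor B Z) +
        tensor_prod 1 0 (sec_tensor B Y) (sec_tensor B (cov_sec S D X Z))"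
      using covariant_derivativeD(6)[OF D X sec[OF Y] sec[OF Z]] cov_sec_mem(2)[OF D X] Y Z by simp
    moreover have "tensor_prod 0 2 K (T + T') = tensor_prod 0 2 K T + tensor_prod 0 2 K T'" for T T' :: "('q, 'w) tfield"
      by (simp add: tensor_prod_def fun_eq_iff algebra_simps)
    ultimately have "D (0 + (1 + 1)) (2 + (0 + 0)) X (P K Y Z) =
        P (D 0 2 X K) Y Z + (P K (cov_sec S D X Y) Z + P K Y (cov_sec S D X Z))"
      unfolding P_def by (subst covariant_derivativeD(6)[OF D X K tensor_fields_prod[OF sec[OF Y] sec[OF Z]]]) simp
    then show ?thesis by (simp add: numeral_2_eq_2)
  qed
  also have "C (P (D 0 2 X K) Y Z + (P K (cov_sec S D X Y) Z + P K Y (cov_sec S D X Z))) q [] [] =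
      C (P (D 0 2 X K) Y Z) q [] [] + C (P K (cov_sec S D X Y) Z) q [] [] + C (P K Y (cov_sec S D X Z)) q [] []"
    by (simp add: C_def contract_def Let_def sum.distrib)
  also have "\<dots> = D 0 2 X K q [] [Y q, Z q] + K q [] [cov_sec S D X Y q, Z q] + K q [] [Y q, cov_sec S D X Z q]"
    using CP[OF covariant_derivativeD(1)[OF D X K] Y Z q] CP[OF K cov_sec_mem(1)[OF D X Y] Z q]
      CP[OF K Y cov_sec_mem(1)[OF D X Z] q] by simp
  finally show "anchor S (X q) (\<lambda>q. K q [] [Y q, Z q]) =
    D 0 2 X K q [] [Y q, Z q] + K q [] [cov_sec S D X Y q, Z q] + K q [] [Y q, cov_sec S D X Z q]" .
qed

end

section \<open>The adapted base\<close>

locale rho_connection_on = gen_tangent_bundle S for S :: "('q, 'w::real_vector) gen_tangent" +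
  fixes \<Gamma> :: "'q \<Rightarrow> 'w \<Rightarrow> 'w"
  assumes rho_connection: "rho_connection S \<Gamma>"
begin

lemma \<Gamma>_mem: "q \<in> pts Q \<Longrightarrow> v \<in> fib B q \<Longrightarrow> \<Gamma> q v \<in> vfib S q"
  and \<Gamma>_add: "q \<in> pts Q \<Longrightarrow> v \<in> fib B q \<Longrightarrow> w \<in> fib B q \<Longrightarrow> \<Gamma> q (v + w) = \<Gamma> q v + \<Gamma> q w"
  and \<Gamma>_scale: "q \<in> pts Q \<Longrightarrow> v \<in> fib B q \<Longrightarrow> \<Gamma> q (c *\<^sub>R v) = c *\<^sub>R \<Gamma> q v"
  and \<Gamma>_vertical: "q \<in> pts Q \<Longrightarrow> v \<in> vfib S q \<Longrightarrow> \<Gamma> q v = v"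
  using rho_connection unfolding rho_connection_def vb_morphism_def
  by (auto simp: vertical_bundle_def)

lemma \<Gamma>_sum:
  assumes q: "q \<in> pts Q"
  shows "(\<And>a. a \<in> A \<Longrightarrow> f a \<in> fib B q) \<Longrightarrow> \<Gamma> q (\<Sum>a\<in>A. c a *\<^sub>R f a) = (\<Sum>a\<in>A. c a *\<^sub>R \<Gamma> q (f a))"
proof (induction A rule: infinite_finite_induct)
  case (insert x A)
  have "c x *\<^sub>R f x \<in> fib B q" "(\<Sum>a\<in>A. c a *\<^sub>R f a) \<in> fib B q"
    using insert fib_subspace[OF q] by (auto intro!: subspace_scale subspace_sum)
  then show ?case using insert q by (simp add: \<Gamma>_add \<Gamma>_scale)
qed (use \<Gamma>_scale[OF q subspace_0[OF fib_subspace[OF q]], of 0] in auto)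

abbreviation ad :: "('q, 'w) nat_base \<Rightarrow> 'q \<Rightarrow> nat \<Rightarrow> 'w" where
  "ad N q \<equiv> \<lambda>a. join_frame m (delta S \<Gamma> N) (del_v N) a q"

lemma delta_mem_fib:
  assumes "N \<in> nat_bases S" "q \<in> ndom N" "\<alpha> < m"
  shows "delta S \<Gamma> N \<alpha> q \<in> fib B q"
  unfolding delta_def using fib_subspace[OF ndom_pts[OF assms(1,2)]] del_h_mem_fib[OF assms]
    del_v_mem_fib[OF assms(1,2)]
  by (intro subspace_add subspace_sum subspace_scale) auto

lemma del_v_mem_vfib: "N \<in> nat_bases S \<Longrightarrow> q \<in> ndom N \<Longrightarrow> b < r \<Longrightarrow> del_v N b q \<in> vfib S q"
  unfolding vfib_def by (intro span_base) blast

text \<open>\<open>conn_comp\<close> carries a minus sign, so the correction in \<open>delta\<close>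
  is the negative of the vertical part of \<open>del_h\<close>.\<close>

lemma \<Gamma>_delta:
  assumes N: "N \<in> nat_bases S" and q: "q \<in> ndom N" and \<alpha>: "\<alpha> < m"
  shows "\<Gamma> q (delta S \<Gamma> N \<alpha> q) = 0"
proof -
  interpret v: basis r "\<lambda>b. del_v N b q" "vfib S q" by standard (rule del_v_basis[OF N q])
  have qp: "q \<in> pts Q" by (rule ndom_pts[OF N q])
  have sub: "(\<Sum>b<r. conn_comp S \<Gamma> N b \<alpha> q *\<^sub>R del_v N b q) \<in> vfib S q"
    by (rule v.sum_mem) (simp add: v.basis_mem)
  have "\<Gamma> q (delta S \<Gamma> N \<alpha> q) = \<Gamma> q (del_h N \<alpha> q) + (\<Sum>b<r. conn_comp S \<Gamma> N b \<alpha> q *\<^sub>R del_v N b q)"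
    unfolding delta_def
    using \<Gamma>_add[OF qp del_h_mem_fib[OF N q \<alpha>]] \<Gamma>_vertical[OF qp sub] sub vfib_subset_fib[OF qp] by auto
  also have "\<dots> = \<Gamma> q (del_h N \<alpha> q) - (\<Sum>b<r. dual_basis r (\<lambda>b. del_v N b q) b (\<Gamma> q (del_h N \<alpha> q)) *\<^sub>R del_v N b q)"
    by (simp add: conn_comp_def coframe_eq sum_negf)
  also have "\<dots> = 0"
    using v.expand[OF \<Gamma>_mem[OF qp del_h_mem_fib[OF N q \<alpha>]]] by simp
  finally show ?thesis .
qed

lemma ad_mem_fib: "N \<in> nat_bases S \<Longrightarrow> q \<in> ndom N \<Longrightarrow> k < m + r \<Longrightarrow> ad N q k \<in> fib B q"
  using delta_mem_fib del_v_mem_fib by (auto simp: join_frame_def)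

text \<open>The change from the natural to the adapted base is unitriangular: vertical vectors stay,
  and each horizontal one receives a vertical correction.\<close>

lemma ad_basis:
  assumes N: "N \<in> nat_bases S" and q: "q \<in> ndom N"
  shows "is_basis (m + r) (ad N q) (fib B q)"
proof (rule is_basisI)
  interpret jb: basis "m + r" "jb N q" "fib B q" by standard (rule jb_basis[OF N q])
  have qp: "q \<in> pts Q" by (rule ndom_pts[OF N q])
  have ve: "del_v N b q \<in> span (ad N q ` {..<m + r})" if "b < r" for b
    using that by (intro span_base image_eqI[of _ _ "m + b"]) auto
  have "del_h N \<alpha> q \<in> span (ad N q ` {..<m + r})" if "\<alpha> < m" for \<alpha>
  proof -
    have "delta S \<Gamma> N \<alpha> q \<in> span (ad N q ` {..<m + r})"
      using that by (intro span_base image_eqI[of _ _ \<alpha>]) auto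
    then have "delta S \<Gamma> N \<alpha> q - (\<Sum>b<r. conn_comp S \<Gamma> N b \<alpha> q *\<^sub>R del_v N b q) \<in> span (ad N q ` {..<m + r})"
      using ve by (intro span_diff span_sum span_scale) auto
    then show ?thesis by (simp add: delta_def)
  qed
  then have "jb N q k \<in> span (ad N q ` {..<m + r})" if "k < m + r" for k
    using that ve by (auto simp: join_frame_def)
  then have "fib B q \<subseteq> span (ad N q ` {..<m + r})"
    unfolding jb.span[symmetric] by (intro span_minimal subspace_span) blast
  moreover have "span (ad N q ` {..<m + r}) \<subseteq> fib B q"
    using ad_mem_fib[OF N q] by (intro span_minimal fib_subspace[OF qp]) blast
  ultimately show "fib B q = span (ad N q ` {..<m + r})" by blast
  fix c a assume c: "(\<Sum>a<m + r. c a *\<^sub>R ad N q a) = 0" and a: "a < m + r"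
  \<comment> \<open>The coefficients of the same vector in the natural base: the horizontal ones are
    unchanged, the vertical ones collect the corrections.\<close>
  define c' where "c' a = (if a < m then c a else c a + (\<Sum>\<alpha><m. c \<alpha> * conn_comp S \<Gamma> N (a - m) \<alpha> q))" for a
  have "(\<Sum>a<m + r. c' a *\<^sub>R jb N q a) = (\<Sum>\<alpha><m. c \<alpha> *\<^sub>R del_h N \<alpha> q) +
      ((\<Sum>b<r. c (m + b) *\<^sub>R del_v N b q) + (\<Sum>b<r. \<Sum>\<alpha><m. (c \<alpha> * conn_comp S \<Gamma> N b \<alpha> q) *\<^sub>R del_v N b q))"
    by (simp add: sum_lessThan_add c'_def scaleR_left_distrib sum.distrib scaleR_sum_left)
  also have "(\<Sum>b<r. \<Sum>\<alpha><m. (c \<alpha> * conn_comp S \<Gamma> N b \<alpha> q) *\<^sub>R del_v N b q) =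
      (\<Sum>\<alpha><m. c \<alpha> *\<^sub>R (\<Sum>b<r. conn_comp S \<Gamma> N b \<alpha> q *\<^sub>R del_v N b q))"
    by (subst sum.swap) (simp add: scaleR_sum_right)
  also have "(\<Sum>\<alpha><m. c \<alpha> *\<^sub>R del_h N \<alpha> q) + ((\<Sum>b<r. c (m + b) *\<^sub>R del_v N b q) + \<dots>) =
      (\<Sum>a<m + r. c a *\<^sub>R ad N q a)"
    by (simp add: sum_lessThan_add delta_def scaleR_right_distrib sum.distrib)
  finally have "(\<Sum>a<m + r. c' a *\<^sub>R jb N q a) = 0" using c by simp
  then have c': "c' a = 0" if "a < m + r" for a
    using jb.dual_basis_unique[OF that, of c'] dual_space_0[OF jb.dual_basis_mem] by simp
  then have "c \<alpha> = 0" if "\<alpha> < m" for \<alpha> using c'[of \<alpha>] that by (simp add: c'_def)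
  then show "c a = 0" using c'[OF a] by (simp add: c'_def split: if_splits)
qed

lemma conn_comp_smooth:
  assumes N: "N \<in> nat_bases S" and \<alpha>: "\<alpha> < m" and b: "b < r"
  shows "smooth_fun Q (ndom N) (\<lambda>q. conn_comp S \<Gamma> N b \<alpha> q)"
proof -
  have "smooth_section Q (vertical_bundle S) (fst f) (\<lambda>x. \<Gamma> x (snd f a x))"
    if "f \<in> frames B" "a < rank B" for f a
    using rho_connection that unfolding rho_connection_def vb_morphism_def by blast
  from this[OF nat_frame_in_frames[OF N], of \<alpha>]
  have "smooth_section Q (vertical_bundle S) (ndom N) (\<lambda>x. \<Gamma> x (del_h N \<alpha> x))"
    using \<alpha> by (simp add: gb_rank)
  then have "smooth_fun Q (ndom N) (\<lambda>q. coframe r (del_v N) b q (\<Gamma> q (del_h N \<alpha> q)))"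
    using vertical_frame[OF N] b unfolding smooth_section_def by (fastforce simp: vertical_bundle_def)
  then show ?thesis
    unfolding conn_comp_def by (rule smooth_fun_uminus[OF ndom_open[OF N]])
qed

lemma ad_smooth:
  assumes f: "f \<in> frames B" and N: "N \<in> nat_bases S" and a: "a < m + r" and k: "k < m + r"
  shows "smooth_fun Q (ndom N \<inter> fst f) (\<lambda>q. cf f a q (ad N q k))"
proof (cases "k < m")
  case True
  have o: "openin (mtop Q) (ndom N \<inter> fst f)"
    by (rule openin_Int[OF ndom_open[OF N] frame_open[OF f]])
  show ?thesis
  proof (rule smooth_fun_eqI[OF o])
    show "smooth_fun Q (ndom N \<inter> fst f) (\<lambda>q. cf f a q (jb N q k) + (\<Sum>b<r. conn_comp S \<Gamma> N b k q * cf f a q (jb N q (m + b))))"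
      by (intro smooth_fun_add smooth_fun_sum smooth_fun_mult o frame_compat_nat[OF f N]
        smooth_fun_subset[OF conn_comp_smooth[OF N True]] a) (use k in auto)
    fix q assume q: "q \<in> ndom N \<inter> fst f"
    interpret b: basis "rank B" "\<lambda>a. snd f a q" "fib B q"
      by standard (rule frame_basis[OF f], use q in simp)
    have dv: "del_v N b q \<in> fib B q" if "b \<in> {..<r}" for b
      using del_v_mem_fib[OF N, of q b] q that by simp
    have "(\<Sum>b<r. conn_comp S \<Gamma> N b k q *\<^sub>R del_v N b q) \<in> fib B q"
      by (rule b.sum_mem[OF dv])
    then have "cf f a q (delta S \<Gamma> N k q) = cf f a q (del_h N k q) + cf f a q (\<Sum>b<r. conn_comp S \<Gamma> N b k q *\<^sub>R del_v N b q)"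
      unfolding delta_def using q del_h_mem_fib[OF N _ True] by (intro b.dual_basis_add) auto
    also have "cf f a q (\<Sum>b<r. conn_comp S \<Gamma> N b k q *\<^sub>R del_v N b q) = (\<Sum>b<r. conn_comp S \<Gamma> N b k q * cf f a q (del_v N b q))"
      by (rule b.dual_basis_sum[OF dv])
    finally show "cf f a q (ad N q k) = cf f a q (jb N q k) + (\<Sum>b<r. conn_comp S \<Gamma> N b k q * cf f a q (jb N q (m + b)))"
      using True by simp
  qed
next
  case False
  then show ?thesis using frame_compat_nat[OF f N a k] by (simp add: join_frame_def)
qed

text \<open>The connection kills the vectors \<open>delta\<close> and fixes the vertical ones, so it
  is the projection onto the vertical part in the adapted base.\<close>

lemma \<Gamma>_expand:
  assumes N: "N \<in> nat_bases S" and q: "q \<in> ndom N" and v: "v \<in> fib B q"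
  shows "\<Gamma> q v = (\<Sum>b<r. dual_basis (m + r) (ad N q) (m + b) v *\<^sub>R del_v N b q)"
proof -
  interpret ad: basis "m + r" "ad N q" "fib B q" by standard (rule ad_basis[OF N q])
  have qp: "q \<in> pts Q" by (rule ndom_pts[OF N q])
  have "\<Gamma> q v = \<Gamma> q (\<Sum>a<m + r. dual_basis (m + r) (ad N q) a v *\<^sub>R ad N q a)"
    using ad.expand[OF v] by simp
  also have "\<dots> = (\<Sum>a<m + r. dual_basis (m + r) (ad N q) a v *\<^sub>R \<Gamma> q (ad N q a))"
    by (rule \<Gamma>_sum[OF qp]) (simp add: ad.basis_mem)
  also have "\<dots> = (\<Sum>b<r. dual_basis (m + r) (ad N q) (m + b) v *\<^sub>R del_v N b q)"
    using \<Gamma>_delta[OF N q] \<Gamma>_vertical[OF qp del_v_mem_vfib[OF N q]] by (simp add: sum_lessThan_add)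
  finally show ?thesis .
qed

lemma horizontal_iff:
  assumes N: "N \<in> nat_bases S" and q: "q \<in> ndom N" and v: "v \<in> fib B q"
  shows "\<Gamma> q v = 0 \<longleftrightarrow> (\<forall>b<r. dual_basis (m + r) (ad N q) (m + b) v = 0)"
proof
  interpret vb: basis r "\<lambda>b. del_v N b q" "vfib S q" by standard (rule del_v_basis[OF N q])
  assume "\<Gamma> q v = 0"
  then show "\<forall>b<r. dual_basis (m + r) (ad N q) (m + b) v = 0"
    using vb.dual_basis_unique[of _ "\<lambda>b. dual_basis (m + r) (ad N q) (m + b) v"]
      dual_space_0[OF vb.dual_basis_mem] \<Gamma>_expand[OF N q v] by simp
qed (simp add: \<Gamma>_expand[OF N q v])

lemma vertical_iff:
  assumes N: "N \<in> nat_bases S" and q: "q \<in> ndom N" and v: "v \<in> fib B q"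
  shows "v \<in> vfib S q \<longleftrightarrow> (\<forall>\<alpha><m. dual_basis (m + r) (ad N q) \<alpha> v = 0)"
proof
  interpret ad: basis "m + r" "ad N q" "fib B q" by standard (rule ad_basis[OF N q])
  interpret vb: basis r "\<lambda>b. del_v N b q" "vfib S q" by standard (rule del_v_basis[OF N q])
  {
    assume "v \<in> vfib S q"
    then have "v = (\<Sum>b<r. dual_basis r (\<lambda>b. del_v N b q) b v *\<^sub>R ad N q (m + b))"
      using vb.expand by simp
    moreover have "dual_basis (m + r) (ad N q) \<alpha> \<dots> = 0" if "\<alpha> < m" for \<alpha>
      using that by (subst ad.dual_basis_sum) (auto simp: ad_mem_fib[OF N q] ad.dual_basis_basis simp del: join_frame_simps)
    ultimately show "\<forall>\<alpha><m. dual_basis (m + r) (ad N q) \<alpha> v = 0" by metis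
  }
  assume "\<forall>\<alpha><m. dual_basis (m + r) (ad N q) \<alpha> v = 0"
  then have "v = (\<Sum>b<r. dual_basis (m + r) (ad N q) (m + b) v *\<^sub>R del_v N b q)"
    using ad.expand[OF v] by (simp add: sum_lessThan_add)
  then show "v \<in> vfib S q"
    using vb.sum_mem[of "{..<r}" "\<lambda>b. del_v N b q"] vb.basis_mem by (metis lessThan_iff)
qed

text \<open>Derivatives are defined for global sections only. Each vector of the adapted base is
  continued to such a section, and cutting off keeps it horizontal or vertical.\<close>

lemma extend_adapted:
  assumes N: "N \<in> nat_bases S" and q: "q \<in> ndom N" and k: "k < m + r"
  obtains Z where "Z \<in> sections Q B" "eq_near Q q Z (\<lambda>z. ad N z k)"
    "k < m \<Longrightarrow> Z \<in> hsections S \<Gamma>" "k \<ge> m \<Longrightarrow> Z \<in> vsections S"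
proof -
  obtain Z where Z: "Z \<in> sections Q B" "eq_near Q q Z (\<lambda>z. ad N z k)"
    "\<And>z. (\<exists>c. z \<in> ndom N \<and> Z z = c *\<^sub>R ad N z k) \<or> Z z = 0"
    by (rule extend_section[OF ndom_open[OF N] q ad_mem_fib[OF N _ k] ad_smooth[OF _ N _ k]])
      (auto simp: gb_rank)
  have "Z \<in> hsections S \<Gamma>" if "k < m"
    unfolding hsections_def
  proof (intro CollectI conjI ballI Z(1))
    fix z assume z: "z \<in> pts Q"
    have "\<Gamma> z 0 = 0" using \<Gamma>_scale[OF z subspace_0[OF fib_subspace[OF z]], of 0] by simp
    then show "\<Gamma> z (Z z) = 0"
      using Z(3)[of z] \<Gamma>_scale[OF z delta_mem_fib[OF N _ that]] \<Gamma>_delta[OF N _ that] that by auto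
  qed
  moreover have "Z \<in> vsections S" if "k \<ge> m"
    unfolding vsections_def
  proof (intro CollectI conjI ballI Z(1))
    fix z assume z: "z \<in> pts Q"
    have "subspace (vfib S z)" unfolding vfib_def by (rule subspace_span)
    moreover have "ad N z k \<in> vfib S z" if "z \<in> ndom N"
      using del_v_mem_vfib[OF N that, of "k - m"] k \<open>k \<ge> m\<close> by (simp add: join_frame_def)
    ultimately show "Z z \<in> vfib S z"
      using Z(3)[of z] by (auto intro: subspace_scale subspace_0)
  qed
  ultimately show ?thesis using that Z(1,2) by blast
qed

end

section \<open>The metric connection\<close>

locale metric_on = rho_connection_on S \<Gamma>
  for S :: "('q, 'w::real_vector) gen_tangent" and \<Gamma> :: "'q \<Rightarrow> 'w \<Rightarrow> 'w" +
  fixes D0 :: "('q, 'w) cov_deriv" and G :: "('q, 'w) tfield"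
  assumes D0: "distinguished_connection S \<Gamma> D0" and G: "pseudometrical S \<Gamma> G"
begin

lemma D0_cov: "covariant_derivative S D0"
  using D0 by (simp add: distinguished_connection_def)

lemma G_field: "G \<in> tensor_fields Q B 0 2"
  using G by (simp add: pseudometrical_def)

abbreviation gm :: "'q \<Rightarrow> 'w \<Rightarrow> 'w \<Rightarrow> real" where "gm q v w \<equiv> G q [] [v, w]"

section \<open>Linear algebra of the metric\<close>

lemma bilinear_0_2:
  assumes K: "K \<in> tensor_fields Q B 0 2" and q: "q \<in> pts Q" and v: "v \<in> fib B q" "w \<in> fib B q" "u \<in> fib B q"
  shows "K q [] [c *\<^sub>R v + w, u] = c * K q [] [v, u] + K q [] [w, u]"
    "K q [] [u, c *\<^sub>R v + w] = c * K q [] [u, v] + K q [] [u, w]"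
  using tensor_on_vec[OF tensor_fieldsD(1)[OF K q], of "[]" "[u, u]" 0 v w c]
    tensor_on_vec[OF tensor_fieldsD(1)[OF K q], of "[]" "[u, u]" 1 v w c] v
  by (simp_all add: valid_args_def)

lemma bilinear_0_2_sum:
  assumes K: "K \<in> tensor_fields Q B 0 2" and q: "q \<in> pts Q" and f: "\<And>a. a \<in> J \<Longrightarrow> f a \<in> fib B q"
    and u: "u \<in> fib B q"
  shows "K q [] [\<Sum>a\<in>J. c a *\<^sub>R f a, u] = (\<Sum>a\<in>J. c a * K q [] [f a, u])"
    "K q [] [u, \<Sum>a\<in>J. c a *\<^sub>R f a] = (\<Sum>a\<in>J. c a * K q [] [u, f a])"
  by (rule linear_sum_expand[OF fib_subspace[OF q], where g = "\<lambda>v. K q [] [v, u]", OF bilinear_0_2(1)[OF K q _ _ u] f];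
      assumption)
    (rule linear_sum_expand[OF fib_subspace[OF q], where g = "\<lambda>v. K q [] [u, v]", OF bilinear_0_2(2)[OF K q _ _ u] f];
      assumption)

text \<open>A sum against a Kronecker delta whose index is shifted by n. The shift 0 serves the
  horizontal block, the shift m the vertical one.\<close>

lemma sum_if_eq:
  "(\<Sum>a<p. c a * (if k = n + a then 1 else 0)) = (if n \<le> k \<and> k < n + p then c (k - n) else (0::real))"
  for k n p :: nat
  by (induction p) (auto simp: less_Suc_eq)

lemma sum_sum_if_eq:
  "(\<Sum>a<p. \<Sum>b<p. c a b * (if k = n + a then 1 else 0) * (if l = n + b then 1 else 0)) =
    (if n \<le> k \<and> k < n + p \<and> n \<le> l \<and> l < n + p then c (k - n) (l - n) else (0::real))"
  for k l n p :: nat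
proof -
  have "(\<Sum>a<p. \<Sum>b<p. c a b * (if k = n + a then 1 else 0) * (if l = n + b then 1 else 0)) =
      (\<Sum>a<p. (if n \<le> l \<and> l < n + p then c a (l - n) else 0) * (if k = n + a then 1 else 0))"
    by (rule sum.cong[OF refl], subst sum_if_eq) simp
  then show ?thesis by (simp add: sum_if_eq)
qed

text \<open>Component functions of G in a given base are thereby determined by G. This links those
  whose existence is asserted by \<open>pseudometrical\<close> with any others given for the same
  base.\<close>

lemma metric_comps_eq:
  assumes N: "N \<in> nat_bases S" and gg: "metric_comps S \<Gamma> G N gh gv" and q: "q \<in> ndom N"
  shows "\<alpha> < m \<Longrightarrow> \<beta> < m \<Longrightarrow> gm q (delta S \<Gamma> N \<alpha> q) (delta S \<Gamma> N \<beta> q) = gh \<alpha> \<beta> q"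
    "a < r \<Longrightarrow> b < r \<Longrightarrow> gm q (del_v N a q) (del_v N b q) = gv a b q"
    "\<alpha> < m \<Longrightarrow> b < r \<Longrightarrow> gm q (delta S \<Gamma> N \<alpha> q) (del_v N b q) = 0"
    "\<alpha> < m \<Longrightarrow> b < r \<Longrightarrow> gm q (del_v N b q) (delta S \<Gamma> N \<alpha> q) = 0"
proof -
  interpret ad: basis "m + r" "ad N q" "fib B q" by standard (rule ad_basis[OF N q])
  have dz: "dz S \<Gamma> N \<alpha> q (ad N q k) = (if k = \<alpha> then 1 else 0)" if "\<alpha> < m" "k < m + r" for \<alpha> k
    using that by (simp add: dz_def coframe_eq ad.dual_basis_basis)
  have dp: "dp S \<Gamma> N a q (ad N q k) = (if k = m + a then 1 else 0)" if "a < r" "k < m + r" for a k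
    using that by (simp add: dp_def coframe_eq ad.dual_basis_basis)
  have "gm q (ad N q k) (ad N q l) =
      (\<Sum>\<alpha><m. \<Sum>\<beta><m. gh \<alpha> \<beta> q * (if k = \<alpha> then 1 else 0) * (if l = \<beta> then 1 else 0)) +
      (\<Sum>a<r. \<Sum>b<r. gv a b q * (if k = m + a then 1 else 0) * (if l = m + b then 1 else 0))"
    if "k < m + r" "l < m + r" for k l
    using gg q ad.basis_mem[OF that(1)] ad.basis_mem[OF that(2)] that
    unfolding metric_comps_def by (simp add: dz dp)
  moreover have "(\<Sum>\<alpha><m. \<Sum>\<beta><m. gh \<alpha> \<beta> q * (if k = \<alpha> then 1 else 0) * (if l = \<beta> then 1 else 0)) =
      (if k < m \<and> l < m then gh k l q else 0)" for k l
    using sum_sum_if_eq[of "\<lambda>a b. gh a b q" k 0 l m] by simp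
  moreover have "(\<Sum>a<r. \<Sum>b<r. gv a b q * (if k = m + a then 1 else 0) * (if l = m + b then 1 else 0)) =
      (if m \<le> k \<and> k < m + r \<and> m \<le> l \<and> l < m + r then gv (k - m) (l - m) q else 0)" for k l
    by (rule sum_sum_if_eq)
  ultimately have *: "gm q (ad N q k) (ad N q l) = (if k < m \<and> l < m then gh k l q else 0) +
      (if m \<le> k \<and> m \<le> l then gv (k - m) (l - m) q else 0)" if "k < m + r" "l < m + r" for k l
    using that by simp
  show "\<alpha> < m \<Longrightarrow> \<beta> < m \<Longrightarrow> gm q (delta S \<Gamma> N \<alpha> q) (delta S \<Gamma> N \<beta> q) = gh \<alpha> \<beta> q"
    using *[of \<alpha> \<beta>] by simp
  show "a < r \<Longrightarrow> b < r \<Longrightarrow> gm q (del_v N a q) (del_v N b q) = gv a b q"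
    using *[of "m + a" "m + b"] by simp
  show "\<alpha> < m \<Longrightarrow> b < r \<Longrightarrow> gm q (delta S \<Gamma> N \<alpha> q) (del_v N b q) = 0"
    using *[of \<alpha> "m + b"] by simp
  show "\<alpha> < m \<Longrightarrow> b < r \<Longrightarrow> gm q (del_v N b q) (delta S \<Gamma> N \<alpha> q) = 0"
    using *[of "m + b" \<alpha>] by simp
qed

lemma mat_inverse_cong:
  assumes "\<And>i j. i < p \<Longrightarrow> j < p \<Longrightarrow> g i j = g' i j"
  shows "mat_inverse p g h \<longleftrightarrow> mat_inverse p g' h"
proof -
  have "(\<Sum>k<p. g i k * h k j) = (\<Sum>k<p. g' i k * h k j)" if "i < p" for i j
    using assms that by (intro sum.cong) auto
  moreover have "(\<Sum>k<p. h i k * g k j) = (\<Sum>k<p. h i k * g' k j)" if "j < p" for i j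
    using assms that by (intro sum.cong) auto
  ultimately show ?thesis by (simp add: Defs.mat_inverse_def)
qed

text \<open>\<open>pseudometrical\<close> asserts the existence of suitable component functions;
  here its content is expressed through the values of G on the adapted base.\<close>

lemma metric_blocks:
  assumes N: "N \<in> nat_bases S" and q: "q \<in> ndom N"
  shows "\<alpha> < m \<Longrightarrow> \<beta> < m \<Longrightarrow> gm q (ad N q \<alpha>) (ad N q \<beta>) = gm q (ad N q \<beta>) (ad N q \<alpha>)"
    "a < r \<Longrightarrow> b < r \<Longrightarrow> gm q (ad N q (m + a)) (ad N q (m + b)) = gm q (ad N q (m + b)) (ad N q (m + a))"
    "\<alpha> < m \<Longrightarrow> b < r \<Longrightarrow> gm q (ad N q \<alpha>) (ad N q (m + b)) = 0"
    "\<alpha> < m \<Longrightarrow> b < r \<Longrightarrow> gm q (ad N q (m + b)) (ad N q \<alpha>) = 0"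
    "\<exists>h. mat_inverse m (\<lambda>\<alpha> \<beta>. gm q (ad N q \<alpha>) (ad N q \<beta>)) h"
    "\<exists>h. mat_inverse r (\<lambda>a b. gm q (ad N q (m + a)) (ad N q (m + b))) h"
proof -
  obtain gh gv where gg: "metric_comps S \<Gamma> G N gh gv" and all: "\<forall>q\<in>ndom N.
      (\<forall>\<alpha><m. \<forall>\<beta><m. gh \<alpha> \<beta> q = gh \<beta> \<alpha> q) \<and> (\<forall>a<r. \<forall>b<r. gv a b q = gv b a q) \<and>
      (\<exists>h. mat_inverse m (\<lambda>\<alpha> \<beta>. gh \<alpha> \<beta> q) h) \<and> (\<exists>h. mat_inverse r (\<lambda>a b. gv a b q) h)"
    using G[unfolded pseudometrical_def, THEN conjunct2, rule_format, OF N] by (elim exE conjE) (rule that)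
  note * = bspec[OF all q, THEN conjunct1] bspec[OF all q, THEN conjunct2, THEN conjunct1]
    bspec[OF all q, THEN conjunct2, THEN conjunct2, THEN conjunct1]
    bspec[OF all q, THEN conjunct2, THEN conjunct2, THEN conjunct2]
  note eq = metric_comps_eq[OF N gg q]
  show "\<alpha> < m \<Longrightarrow> \<beta> < m \<Longrightarrow> gm q (ad N q \<alpha>) (ad N q \<beta>) = gm q (ad N q \<beta>) (ad N q \<alpha>)"
    "a < r \<Longrightarrow> b < r \<Longrightarrow> gm q (ad N q (m + a)) (ad N q (m + b)) = gm q (ad N q (m + b)) (ad N q (m + a))"
    "\<alpha> < m \<Longrightarrow> b < r \<Longrightarrow> gm q (ad N q \<alpha>) (ad N q (m + b)) = 0"
    "\<alpha> < m \<Longrightarrow> b < r \<Longrightarrow> gm q (ad N q (m + b)) (ad N q \<alpha>) = 0"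
    using * by (simp_all add: eq)
  show "\<exists>h. mat_inverse m (\<lambda>\<alpha> \<beta>. gm q (ad N q \<alpha>) (ad N q \<beta>)) h"
    using *(3) by (subst mat_inverse_cong[where g' = "\<lambda>\<alpha> \<beta>. gh \<alpha> \<beta> q"]) (simp_all add: eq)
  show "\<exists>h. mat_inverse r (\<lambda>a b. gm q (ad N q (m + a)) (ad N q (m + b))) h"
    using *(4) by (subst mat_inverse_cong[where g' = "\<lambda>a b. gv a b q"]) (simp_all add: eq)
qed

lemma gm_ad_sym:
  assumes N: "N \<in> nat_bases S" and q: "q \<in> ndom N" and k: "k < m + r" "l < m + r"
  shows "gm q (ad N q k) (ad N q l) = gm q (ad N q l) (ad N q k)"
proof -
  note b = metric_blocks[OF N q]
  have "\<exists>b<r. k = m + b" if "\<not> k < m" using that k by (intro exI[of _ "k - m"]) auto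
  moreover have "\<exists>b<r. l = m + b" if "\<not> l < m" using that k by (intro exI[of _ "l - m"]) auto
  ultimately show ?thesis
    using b(1)[of k l] b(2)[of "k - m" "l - m"] b(3,4)[of k "l - m"] b(3,4)[of l "k - m"] k
    by (cases "k < m"; cases "l < m") auto
qed

text \<open>Formulated for any K with vanishing mixed blocks, since it is applied both to G and to
  the derivative of G under D0.\<close>

lemma gm_orth:
  assumes q: "q \<in> pts Q" and v: "v \<in> fib B q" "\<Gamma> q v = 0" and w: "w \<in> vfib S q"
    and K: "K \<in> tensor_fields Q B 0 2"
    and K0: "\<And>N \<alpha> b. N \<in> nat_bases S \<Longrightarrow> q \<in> ndom N \<Longrightarrow> \<alpha> < m \<Longrightarrow> b < r \<Longrightarrow>
      K q [] [ad N q \<alpha>, ad N q (m + b)] = 0 \<and> K q [] [ad N q (m + b), ad N q \<alpha>] = 0"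
  shows "K q [] [v, w] = 0" "K q [] [w, v] = 0"
proof -
  obtain N where N: "N \<in> nat_bases S" "q \<in> ndom N" using nat_cover[OF q] by blast
  interpret ad: basis "m + r" "ad N q" "fib B q" by standard (rule ad_basis[OF N])
  have w': "w \<in> fib B q" using w vfib_subset_fib[OF q] by blast
  define cv where "cv \<alpha> = dual_basis (m + r) (ad N q) \<alpha> v" for \<alpha>
  define cw where "cw b = dual_basis (m + r) (ad N q) (m + b) w" for b
  have v_eq: "(\<Sum>\<alpha><m. cv \<alpha> *\<^sub>R ad N q \<alpha>) = v"
    using ad.expand[OF v(1)] horizontal_iff[OF N v(1)] v(2) by (simp add: sum_lessThan_add cv_def)
  have w_eq: "(\<Sum>b<r. cw b *\<^sub>R ad N q (m + b)) = w"
    using ad.expand[OF w'] vertical_iff[OF N w'] w by (simp add: sum_lessThan_add cw_def)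
  have "K q [] [v, w] = (\<Sum>\<alpha><m. cv \<alpha> * (\<Sum>b<r. cw b * K q [] [ad N q \<alpha>, ad N q (m + b)]))"
    by (subst v_eq[symmetric], subst bilinear_0_2_sum(1)[OF K q ad.basis_mem w'], simp,
        subst w_eq[symmetric], intro sum.cong refl arg_cong2[where f = "(*)"] bilinear_0_2_sum(2)[OF K q])
      (auto simp: ad.basis_mem simp del: join_frame_simps)
  then show "K q [] [v, w] = 0" using K0[OF N] by (simp del: join_frame_simps)
  have "K q [] [w, v] = (\<Sum>\<alpha><m. cv \<alpha> * (\<Sum>b<r. cw b * K q [] [ad N q (m + b), ad N q \<alpha>]))"
    by (subst v_eq[symmetric], subst bilinear_0_2_sum(2)[OF K q ad.basis_mem w'], simp,
        subst w_eq[symmetric], intro sum.cong refl arg_cong2[where f = "(*)"] bilinear_0_2_sum(1)[OF K q])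
      (auto simp: ad.basis_mem simp del: join_frame_simps)
  then show "K q [] [w, v] = 0" using K0[OF N] by (simp del: join_frame_simps)
qed

lemma bilinear_sym:
  assumes K: "K \<in> tensor_fields Q B 0 2"
    and K_sym: "\<And>N k l. N \<in> nat_bases S \<Longrightarrow> q \<in> ndom N \<Longrightarrow> k < m + r \<Longrightarrow> l < m + r \<Longrightarrow>
      K q [] [ad N q k, ad N q l] = K q [] [ad N q l, ad N q k]"
    and q: "q \<in> pts Q" and v: "v \<in> fib B q" and w: "w \<in> fib B q"
  shows "K q [] [v, w] = K q [] [w, v]"
proof -
  obtain N where N: "N \<in> nat_bases S" "q \<in> ndom N" using nat_cover[OF q] by blast
  interpret ad: basis "m + r" "ad N q" "fib B q" by standard (rule ad_basis[OF N])
  define cv where "cv a = dual_basis (m + r) (ad N q) a v" for a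
  define cw where "cw a = dual_basis (m + r) (ad N q) a w" for a
  have v_eq: "(\<Sum>a<m + r. cv a *\<^sub>R ad N q a) = v" unfolding cv_def by (rule ad.expand[OF v])
  have w_eq: "(\<Sum>a<m + r. cw a *\<^sub>R ad N q a) = w" unfolding cw_def by (rule ad.expand[OF w])
  have "K q [] [v, w] = (\<Sum>a<m + r. cv a * (\<Sum>b<m + r. cw b * K q [] [ad N q a, ad N q b]))"
    by (subst v_eq[symmetric], subst bilinear_0_2_sum(1)[OF K q ad.basis_mem w], simp,
        subst w_eq[symmetric], intro sum.cong refl arg_cong2[where f = "(*)"] bilinear_0_2_sum(2)[OF K q])
      (auto simp: ad.basis_mem simp del: join_frame_simps)
  also have "\<dots> = (\<Sum>a<m + r. cv a * (\<Sum>b<m + r. cw b * K q [] [ad N q b, ad N q a]))"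
    by (intro sum.cong refl arg_cong2[where f = "(*)"] K_sym[OF N]) auto
  finally have "K q [] [v, w] = (\<Sum>a<m + r. cv a * (\<Sum>b<m + r. cw b * K q [] [ad N q b, ad N q a]))" .
  moreover have "K q [] [w, v] = (\<Sum>a<m + r. cv a * (\<Sum>b<m + r. cw b * K q [] [ad N q b, ad N q a]))"
    by (subst v_eq[symmetric], subst bilinear_0_2_sum(2)[OF K q ad.basis_mem w], simp,
        subst w_eq[symmetric], intro sum.cong refl arg_cong2[where f = "(*)"] bilinear_0_2_sum(1)[OF K q])
      (auto simp: ad.basis_mem simp del: join_frame_simps)
  ultimately show ?thesis by simp
qed

lemma gm_sym: "q \<in> pts Q \<Longrightarrow> v \<in> fib B q \<Longrightarrow> w \<in> fib B q \<Longrightarrow> gm q v w = gm q w v"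
  by (rule bilinear_sym[OF G_field gm_ad_sym])

text \<open>The inverse matrix applied to t solves the linear system with matrix g and right-hand
  side t. Symmetry lets the sum run over the first index of g.\<close>

lemma mat_inverse_sum:
  assumes h: "mat_inverse p g h" and j: "j < p" and g: "\<And>k. k < p \<Longrightarrow> g k j = g j k"
  shows "(\<Sum>k<p. (\<Sum>e<p. h k e * t e) * g k j) = t j"
proof -
  have "(\<Sum>k<p. (\<Sum>e<p. h k e * t e) * g k j) = (\<Sum>k<p. \<Sum>e<p. t e * (g j k * h k e))"
    by (simp add: sum_distrib_left sum_distrib_right g mult_ac)
  also have "\<dots> = (\<Sum>e<p. t e * (\<Sum>k<p. g j k * h k e))"
    by (subst sum.swap) (simp add: sum_distrib_left)
  also have "\<dots> = (\<Sum>e<p. t e * (if j = e then 1 else 0))"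
    using h j by (intro sum.cong refl) (simp add: Defs.mat_inverse_def)
  also have "\<dots> = t j" using j by (simp add: if_distrib sum.delta cong: if_cong)
  finally show ?thesis .
qed

text \<open>As the mixed blocks vanish, a vector orthogonal to everything yields two separate
  homogeneous systems for its coordinates, each with an invertible matrix.\<close>

lemma gm_nondegenerate:
  assumes q: "q \<in> pts Q" and u: "u \<in> fib B q" and u': "u' \<in> fib B q"
    and eq: "\<And>w. w \<in> fib B q \<Longrightarrow> gm q u w = gm q u' w"
  shows "u = u'"
proof -
  obtain N where N: "N \<in> nat_bases S" "q \<in> ndom N" using nat_cover[OF q] by blast
  interpret ad: basis "m + r" "ad N q" "fib B q" by standard (rule ad_basis[OF N])
  note b = metric_blocks[OF N]
  define c where "c k = dual_basis (m + r) (ad N q) k (u - u')" for k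
  have d: "u - u' \<in> fib B q" using subspace_diff[OF fib_subspace[OF q] u u'] .
  have "gm q (u - u') w = 0" if "w \<in> fib B q" for w
    using bilinear_0_2(1)[OF G_field q u' u that, of "-1"] eq[OF that] by simp
  then have "gm q (\<Sum>k<m + r. c k *\<^sub>R ad N q k) (ad N q l) = 0" if "l < m + r" for l
    using ad.expand[OF d] ad.basis_mem[OF that] by (simp add: c_def)
  then have z: "(\<Sum>k<m + r. c k * gm q (ad N q k) (ad N q l)) = 0" if "l < m + r" for l
    using bilinear_0_2_sum(1)[OF G_field q ad.basis_mem ad.basis_mem[OF that], of "{..<m + r}" "\<lambda>k. k" c] that
    by (simp del: join_frame_simps)
  have inv0: "c' k = 0" if "mat_inverse p g h" "\<And>l. l < p \<Longrightarrow> (\<Sum>k<p. c' k * g k l) = 0" "k < p"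
    for p g h and c' :: "nat \<Rightarrow> real" and k
  proof -
    have "(\<Sum>l<p. (\<Sum>i<p. c' i * g i l) * h l k) = (\<Sum>i<p. c' i * (\<Sum>l<p. g i l * h l k))"
      by (simp add: sum_distrib_left sum_distrib_right mult_ac) (rule sum.swap)
    also have "\<dots> = (\<Sum>i<p. c' i * (if i = k then 1 else 0))"
      using that(1,3) by (intro sum.cong refl) (simp add: Defs.mat_inverse_def)
    also have "\<dots> = c' k" using that(3) by (simp add: if_distrib sum.delta cong: if_cong)
    finally show ?thesis using that(2) by simp
  qed
  have ch: "c \<alpha> = 0" if \<alpha>: "\<alpha> < m" for \<alpha>
  proof -
    obtain h where "mat_inverse m (\<lambda>\<alpha> \<beta>. gm q (ad N q \<alpha>) (ad N q \<beta>)) h" using b(5) by blast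
    moreover have "(\<Sum>k<m. c k * gm q (ad N q k) (ad N q l)) = 0" if "l < m" for l
      using z[of l] that b(4)[OF that] by (simp add: sum_lessThan_add del: join_frame_simps)
    ultimately show ?thesis using inv0[of m _ h c] \<alpha> by blast
  qed
  have cv: "c (m + a) = 0" if a: "a < r" for a
  proof -
    obtain h where "mat_inverse r (\<lambda>a b. gm q (ad N q (m + a)) (ad N q (m + b))) h" using b(6) by blast
    moreover have "(\<Sum>k<r. c (m + k) * gm q (ad N q (m + k)) (ad N q (m + l))) = 0" if "l < r" for l
      using z[of "m + l"] that b(3)[OF _ that] by (simp add: sum_lessThan_add del: join_frame_simps)
    ultimately show ?thesis using inv0[of r _ h "\<lambda>k. c (m + k)"] a by blast
  qed
  have "u - u' = 0"
    using ad.expand[OF d] ch cv by (simp add: sum_lessThan_add c_def)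
  then show ?thesis by simp
qed

text \<open>The system for the coordinates of u splits into the two blocks, and in each block the
  inverse matrix is applied to the values of the linear form on the base.\<close>

lemma riesz:
  assumes q: "q \<in> pts Q"
    and \<phi>: "\<And>v w c. v \<in> fib B q \<Longrightarrow> w \<in> fib B q \<Longrightarrow> \<phi> (c *\<^sub>R v + w) = c * \<phi> v + \<phi> w"
  obtains u where "u \<in> fib B q" "\<And>w. w \<in> fib B q \<Longrightarrow> gm q u w = \<phi> w"
proof -
  obtain N where N: "N \<in> nat_bases S" "q \<in> ndom N" using nat_cover[OF q] by blast
  interpret ad: basis "m + r" "ad N q" "fib B q" by standard (rule ad_basis[OF N])
  note b = metric_blocks[OF N]
  obtain h where h: "mat_inverse m (\<lambda>\<alpha> \<beta>. gm q (ad N q \<alpha>) (ad N q \<beta>)) h" using b(5) by blast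
  obtain h' where h': "mat_inverse r (\<lambda>a b. gm q (ad N q (m + a)) (ad N q (m + b))) h'" using b(6) by blast
  define c where "c k = (if k < m then (\<Sum>e<m. h k e * \<phi> (ad N q e)) else (\<Sum>e<r. h' (k - m) e * \<phi> (ad N q (m + e))))" for k
  define u where "u = (\<Sum>k<m + r. c k *\<^sub>R ad N q k)"
  have u: "u \<in> fib B q" unfolding u_def by (rule ad.sum_mem) (simp add: ad.basis_mem)
  have uk: "gm q u (ad N q l) = (\<Sum>k<m. c k * gm q (ad N q k) (ad N q l)) + (\<Sum>k<r. c (m + k) * gm q (ad N q (m + k)) (ad N q l))"
    if "l < m + r" for l
    unfolding u_def using bilinear_0_2_sum(1)[OF G_field q ad.basis_mem ad.basis_mem[OF that], of "{..<m + r}" "\<lambda>k. k" c] that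
    by (simp add: sum_lessThan_add del: join_frame_simps)
  have ul: "gm q u (ad N q l) = \<phi> (ad N q l)" if l: "l < m + r" for l
  proof (cases "l < m")
    case True
    have "(\<Sum>k<m. c k * gm q (ad N q k) (ad N q l)) = \<phi> (ad N q l)"
      using mat_inverse_sum[OF h True b(1)[OF _ True], of "\<lambda>e. \<phi> (ad N q e)"] by (simp add: c_def del: join_frame_simps)
    then show ?thesis unfolding uk[OF l] using b(4)[OF True] by (simp del: join_frame_simps)
  next
    case False
    define a where "a = l - m"
    have a: "a < r" "l = m + a" using False l by (auto simp: a_def)
    have "(\<Sum>k<r. c (m + k) * gm q (ad N q (m + k)) (ad N q l)) = \<phi> (ad N q l)"
      using mat_inverse_sum[OF h' a(1) b(2)[OF _ a(1)], of "\<lambda>e. \<phi> (ad N q (m + e))"] a(2) by (simp add: c_def del: join_frame_simps)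
    then show ?thesis unfolding uk[OF l] using b(3)[OF _ a(1)] a(2) by (simp del: join_frame_simps)
  qed
  have "gm q u w = \<phi> w" if w: "w \<in> fib B q" for w
  proof -
    have "gm q u w = gm q u (\<Sum>k<m + r. dual_basis (m + r) (ad N q) k w *\<^sub>R ad N q k)"
      using ad.expand[OF w] by simp
    also have "\<dots> = (\<Sum>k<m + r. dual_basis (m + r) (ad N q) k w * gm q u (ad N q k))"
      by (rule bilinear_0_2_sum(2)[OF G_field q _ u]) (simp add: ad.basis_mem)
    also have "\<dots> = (\<Sum>k<m + r. dual_basis (m + r) (ad N q) k w * \<phi> (ad N q k))"
      using ul by (intro sum.cong) auto
    also have "\<dots> = \<phi> (\<Sum>k<m + r. dual_basis (m + r) (ad N q) k w *\<^sub>R ad N q k)"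
      by (rule linear_sum_expand[OF ad.subspace \<phi>, symmetric]) (auto simp: ad.basis_mem simp del: join_frame_simps)
    also have "\<dots> = \<phi> w" using ad.expand[OF w] by simp
    finally show ?thesis .
  qed
  then show ?thesis using that u by blast
qed

section \<open>The endomorphism field that corrects D0\<close>

definition A :: "('q \<Rightarrow> 'w) \<Rightarrow> 'q \<Rightarrow> 'w \<Rightarrow> 'w" where
  "A X q v = (if q \<in> pts Q \<and> v \<in> fib B q
     then THE u. u \<in> fib B q \<and> (\<forall>w\<in>fib B q. gm q u w = 1/2 * D0 0 2 X G q [] [v, w]) else 0)"

lemma D0G_field: "X \<in> sections Q B \<Longrightarrow> D0 0 2 X G \<in> tensor_fields Q B 0 2"
  by (rule covariant_derivativeD(1)[OF D0_cov _ G_field])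

text \<open>The definite description in \<open>A\<close> denotes a vector: \<open>riesz\<close>
  provides it and \<open>gm_nondegenerate\<close> makes it unique.\<close>

lemma A_props:
  assumes X: "X \<in> sections Q B" and q: "q \<in> pts Q" and v: "v \<in> fib B q"
  shows "A X q v \<in> fib B q" "w \<in> fib B q \<Longrightarrow> gm q (A X q v) w = 1/2 * D0 0 2 X G q [] [v, w]"
proof -
  have lin: "1/2 * D0 0 2 X G q [] [v, c *\<^sub>R x + y] =
      c * (1/2 * D0 0 2 X G q [] [v, x]) + 1/2 * D0 0 2 X G q [] [v, y]"
    if "x \<in> fib B q" "y \<in> fib B q" for x y c
    unfolding bilinear_0_2(2)[OF D0G_field[OF X] q that v] by (simp add: algebra_simps)
  obtain u where u: "u \<in> fib B q" "\<And>w. w \<in> fib B q \<Longrightarrow> gm q u w = 1/2 * D0 0 2 X G q [] [v, w]"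
    by (rule riesz[OF q lin]; blast)
  have "(THE u. u \<in> fib B q \<and> (\<forall>w\<in>fib B q. gm q u w = 1/2 * D0 0 2 X G q [] [v, w])) = u"
  proof (rule the_equality)
    show "u \<in> fib B q \<and> (\<forall>w\<in>fib B q. gm q u w = 1/2 * D0 0 2 X G q [] [v, w])"
      using u by blast
    fix u' assume *: "u' \<in> fib B q \<and> (\<forall>w\<in>fib B q. gm q u' w = 1/2 * D0 0 2 X G q [] [v, w])"
    show "u' = u"
    proof (rule gm_nondegenerate[OF q conjunct1[OF *] u(1)])
      show "gm q u' w = gm q u w" if "w \<in> fib B q" for w
        using conjunct2[OF *, rule_format, OF that] u(2)[OF that] by simp
    qed
  qed
  then have "A X q v = u" using q v by (simp only: A_def simp_thms if_True)
  then show "A X q v \<in> fib B q" "w \<in> fib B q \<Longrightarrow> gm q (A X q v) w = 1/2 * D0 0 2 X G q [] [v, w]"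
    using u by auto
qed

lemma A_eqI:
  assumes X: "X \<in> sections Q B" and q: "q \<in> pts Q" and v: "v \<in> fib B q" and u: "u \<in> fib B q"
    and eq: "\<And>w. w \<in> fib B q \<Longrightarrow> gm q u w = 1/2 * D0 0 2 X G q [] [v, w]"
  shows "A X q v = u"
  by (rule gm_nondegenerate[OF q A_props(1)[OF X q v] u]) (simp add: A_props(2)[OF X q v] eq)

lemma A_endo:
  assumes X: "X \<in> sections Q B" and q: "q \<in> pts Q"
  shows "endo (fib B q) (A X q)"
  unfolding endo_def
proof (intro conjI ballI allI impI)
  fix v w and c :: real assume v: "v \<in> fib B q" and w: "w \<in> fib B q"
  have s: "c *\<^sub>R v + w \<in> fib B q" "c *\<^sub>R A X q v + A X q w \<in> fib B q"
    using fib_subspace[OF q] v w A_props(1)[OF X q] by (auto intro!: subspace_add subspace_scale)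
  show "A X q (c *\<^sub>R v + w) = c *\<^sub>R A X q v + A X q w"
  proof (rule A_eqI[OF X q s])
    fix u assume u: "u \<in> fib B q"
    show "gm q (c *\<^sub>R A X q v + A X q w) u = 1 / 2 * D0 0 2 X G q [] [c *\<^sub>R v + w, u]"
      unfolding bilinear_0_2(1)[OF G_field q A_props(1)[OF X q v] A_props(1)[OF X q w] u]
        bilinear_0_2(1)[OF D0G_field[OF X] q v w u] A_props(2)[OF X q v u] A_props(2)[OF X q w u]
      by (simp add: algebra_simps)
  qed
qed (use A_props(1)[OF X q] in \<open>auto simp: A_def\<close>)

text \<open>The frame is arbitrary and need not respect the splitting, so its Gram matrix has no
  block form. The inverse of the Gram matrix consists of the coordinates of the vectors
  \<open>u i\<close> that represent the coordinate forms of the frame.\<close>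

lemma A_smooth:
  assumes X: "X \<in> sections Q B" and f: "f \<in> frames B" and a: "a < rank B" and b: "b < rank B"
  shows "smooth_fun Q (fst f) (\<lambda>q. cf f a q (A X q (snd f b q)))"
proof -
  define R where "R = rank B"
  define g where "g i j q = gm q (snd f i q) (snd f j q)" for i j q
  define u where "u i q = (SOME u. u \<in> fib B q \<and> (\<forall>w\<in>fib B q. gm q u w = cf f i q w))" for i q
  define h where "h c i q = cf f c q (u i q)" for c i q
  have u: "u i q \<in> fib B q" "\<And>w. w \<in> fib B q \<Longrightarrow> gm q (u i q) w = cf f i q w" if qf: "q \<in> fst f" for i q
  proof -
    interpret b: basis "rank B" "\<lambda>a. snd f a q" "fib B q" by standard (rule frame_basis[OF f qf])
    obtain u' where "u' \<in> fib B q" "\<And>w. w \<in> fib B q \<Longrightarrow> gm q u' w = cf f i q w"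
      by (rule riesz[OF frame_subset_pts[OF f qf], of "cf f i q"])
        (simp add: b.dual_basis_add b.dual_basis_scale subspace_scale[OF b.subspace], blast)
    then have "\<exists>u. u \<in> fib B q \<and> (\<forall>w\<in>fib B q. gm q u w = cf f i q w)" by blast
    from someI_ex[OF this] show "u i q \<in> fib B q" "\<And>w. w \<in> fib B q \<Longrightarrow> gm q (u i q) w = cf f i q w"
      unfolding u_def by blast+
  qed
  have inv: "(\<Sum>c<R. h c i q * g c j q) = (if i = j then 1 else 0)" if "q \<in> fst f" "i < R" "j < R" for q i j
  proof -
    interpret b: basis "rank B" "\<lambda>a. snd f a q" "fib B q" by standard (rule frame_basis[OF f that(1)])
    have "(\<Sum>c<R. h c i q * g c j q) = gm q (\<Sum>c<R. h c i q *\<^sub>R snd f c q) (snd f j q)"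
      unfolding g_def using that(3)
      by (intro bilinear_0_2_sum(1)[OF G_field frame_subset_pts[OF f that(1)], symmetric]) (auto simp: b.basis_mem R_def)
    also have "(\<Sum>c<R. h c i q *\<^sub>R snd f c q) = u i q"
      unfolding h_def R_def by (rule b.expand[OF u(1)[OF that(1)]])
    finally show ?thesis
      using u(2)[OF that(1) b.basis_mem] b.dual_basis_basis that by (simp add: R_def)
  qed
  have gsym: "g i j q = g j i q" if "q \<in> fst f" "i < R" "j < R" for q i j
    unfolding g_def using that basis.basis_mem[OF basis.intro[OF frame_basis[OF f that(1)]]]
    by (intro gm_sym frame_subset_pts[OF f]) (auto simp: R_def)
  have hsym: "h i j q = h j i q" if q: "q \<in> fst f" and ij: "i < R" "j < R" for q i j
  proof -
    have "gm q (u i q) (u j q) = h i j q" "gm q (u j q) (u i q) = h j i q"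
      unfolding h_def using u[OF q] by auto
    then show ?thesis using gm_sym[OF frame_subset_pts[OF f q] u(1)[OF q] u(1)[OF q], of i j] by simp
  qed
  have mi: "mat_inverse R (\<lambda>i j. g i j q) (\<lambda>i j. h i j q)" if q: "q \<in> fst f" for q
    unfolding Defs.mat_inverse_def
  proof (intro allI impI conjI)
    fix i j assume ij: "i < R" "j < R"
    have "(\<Sum>k<R. h i k q * g k j q) = (\<Sum>k<R. h k i q * g k j q)"
      using hsym[OF q ij(1)] by (intro sum.cong) auto
    then show "(\<Sum>k<R. h i k q * g k j q) = (if i = j then 1 else 0)" using inv[OF q ij] by simp
    have "(\<Sum>k<R. g i k q * h k j q) = (\<Sum>k<R. h k j q * g k i q)"
      using gsym[OF q ij(1)] by (intro sum.cong) auto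
    then show "(\<Sum>k<R. g i k q * h k j q) = (if i = j then 1 else 0)" using inv[OF q ij(2,1)] by auto
  qed
  have K_smooth: "smooth_fun Q (fst f) (\<lambda>q. K q [] [snd f i q, snd f j q])"
    if K: "K \<in> tensor_fields Q B 0 2" and ij: "i < R" "j < R" for K i j
  proof -
    have "tcomp f K [] [i, j] = (\<lambda>q. K q [] [snd f i q, snd f j q])"
      by (simp add: tcomp_def fun_eq_iff)
    then show ?thesis
      using tensor_fieldsD(3)[OF K f, of "[]" "[i, j]"] ij by (simp add: tindex_def R_def)
  qed
  have h_smooth: "smooth_fun Q (fst f) (h i j)" if "i < R" "j < R" for i j
    by (rule smooth_fun_mat_inverse[OF frame_open[OF f] _ mi that])
      (use K_smooth[OF G_field] in \<open>simp add: g_def[abs_def]\<close>)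
  have "cf f a q (A X q (snd f b q)) = (\<Sum>e<R. h a e q * (1/2 * D0 0 2 X G q [] [snd f b q, snd f e q]))"
    if q: "q \<in> fst f" for q
  proof -
    interpret b: basis "rank B" "\<lambda>a. snd f a q" "fib B q" by standard (rule frame_basis[OF f q])
    have qp: "q \<in> pts Q" by (rule frame_subset_pts[OF f q])
    have fb: "snd f b q \<in> fib B q" by (rule b.basis_mem[OF b])
    note Av = A_props[OF X qp fb]
    \<comment> \<open>Pairing with \<open>u a\<close> reads off the a-th coordinate, and the
      defining property of \<open>A\<close> evaluates the same pairing.\<close>
    have "gm q (A X q (snd f b q)) (u a q) = cf f a q (A X q (snd f b q))"
      using u[OF q] gm_sym[OF qp Av(1)] Av(1) by simp
    moreover have "gm q (A X q (snd f b q)) (u a q) = 1/2 * D0 0 2 X G q [] [snd f b q, u a q]"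
      using Av(2) u(1)[OF q] by simp
    moreover have "D0 0 2 X G q [] [snd f b q, u a q] = (\<Sum>e<R. h e a q * D0 0 2 X G q [] [snd f b q, snd f e q])"
    proof -
      have "u a q = (\<Sum>e<R. h e a q *\<^sub>R snd f e q)"
        unfolding h_def R_def by (rule b.expand[OF u(1)[OF q], symmetric])
      then show ?thesis
        using bilinear_0_2_sum(2)[OF D0G_field[OF X] qp _ fb, of "{..<R}" "\<lambda>e. snd f e q"] b.basis_mem
        by (simp add: R_def)
    qed
    moreover have "(\<Sum>e<R. h e a q * D0 0 2 X G q [] [snd f b q, snd f e q]) =
        (\<Sum>e<R. h a e q * D0 0 2 X G q [] [snd f b q, snd f e q])"
      using hsym[OF q, of a] a by (intro sum.cong) (auto simp: R_def)
    ultimately show ?thesis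
      by (simp add: sum_distrib_left sum_divide_distrib)
  qed
  moreover have "smooth_fun Q (fst f) (\<lambda>q. \<Sum>e<R. h a e q * (1/2 * D0 0 2 X G q [] [snd f b q, snd f e q]))"
    using a b by (intro smooth_fun_sum smooth_fun_mult smooth_fun_const frame_open[OF f] h_smooth K_smooth D0G_field[OF X])
      (auto simp: R_def)
  ultimately show ?thesis by (rule smooth_fun_eqI[OF frame_open[OF f], rotated])
qed

lemma A_add:
  assumes X: "X \<in> sections Q B" and Y: "Y \<in> sections Q B" and XY: "X + Y \<in> sections Q B"
    and q: "q \<in> pts Q" and v: "v \<in> fib B q"
  shows "A (X + Y) q v = A X q v + A Y q v"
proof (rule A_eqI[OF XY q v])
  note AX = A_props[OF X q v] and AY = A_props[OF Y q v]
  show "A X q v + A Y q v \<in> fib B q" using fib_subspace[OF q] AX(1) AY(1) by (rule subspace_add)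
  fix w assume w: "w \<in> fib B q"
  show "gm q (A X q v + A Y q v) w = 1 / 2 * D0 0 2 (X + Y) G q [] [v, w]"
    using bilinear_0_2(1)[OF G_field q AX(1) AY(1) w, of 1] AX(2)[OF w] AY(2)[OF w]
      covariant_derivativeD(2)[OF D0_cov X Y G_field] by (simp add: algebra_simps)
qed

lemma A_scale:
  assumes X: "X \<in> sections Q B" and u: "smooth_fun Q (pts Q) u" and uX: "(\<lambda>q. u q *\<^sub>R X q) \<in> sections Q B"
    and q: "q \<in> pts Q" and v: "v \<in> fib B q"
  shows "A (\<lambda>q. u q *\<^sub>R X q) q v = u q *\<^sub>R A X q v"
proof (rule A_eqI[OF uX q v])
  note AX = A_props[OF X q v]
  have 0: "0 \<in> fib B q" by (rule subspace_0[OF fib_subspace[OF q]])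
  show "u q *\<^sub>R A X q v \<in> fib B q" using fib_subspace[OF q] AX(1) by (rule subspace_scale)
  fix w assume w: "w \<in> fib B q"
  have "gm q (u q *\<^sub>R A X q v) w = u q * gm q (A X q v) w"
    using bilinear_0_2(1)[OF G_field q AX(1) 0 w, of "u q"] bilinear_0_2(1)[OF G_field q 0 0 w, of 1] by simp
  then show "gm q (u q *\<^sub>R A X q v) w = 1 / 2 * D0 0 2 (\<lambda>q. u q *\<^sub>R X q) G q [] [v, w]"
    using AX(2)[OF w] covariant_derivativeD(3)[OF D0_cov X G_field u] by (simp add: scaleR_fun_def)
qed

lemma Leibniz_G:
  assumes X: "X \<in> sections Q B" and Y: "Y \<in> sections Q B" and Z: "Z \<in> sections Q B" and q: "q \<in> pts Q"
  shows "D0 0 2 X G q [] [Y q, Z q] =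
    anchor S (X q) (\<lambda>q. gm q (Y q) (Z q)) - gm q (cov_sec S D0 X Y q) (Z q) - gm q (Y q) (cov_sec S D0 X Z q)"
  using Leibniz_metric(1)[OF D0_cov X Y Z G_field q] by simp

lemma gm_orth_G:
  assumes q: "q \<in> pts Q" and v: "v \<in> fib B q" "\<Gamma> q v = 0" and w: "w \<in> vfib S q"
  shows "gm q v w = 0" "gm q w v = 0"
  by (rule gm_orth[OF q v w G_field], use metric_blocks(3,4) in blast)+

text \<open>Additivity of D0 in the tensor gives derivative 0 for the tensor 0, which in type (0,0)
  is the zero function. Linearity of the anchor is not among the axioms of the locale.\<close>

lemma anchor_0:
  assumes X: "X \<in> sections Q B" and q: "q \<in> pts Q"
  shows "anchor S (X q) (\<lambda>_. 0) = 0"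
proof -
  have z: "fun_tensor Q (\<lambda>_. 0) = (0 :: ('q, 'w) tfield)"
    by (simp add: fun_tensor_def fun_eq_iff)
  have 0: "(0 :: ('q, 'w) tfield) \<in> tensor_fields Q B 0 0"
  proof (rule tensor_fieldsI)
    fix f I J assume f: "f \<in> frames B"
    have "tcomp f 0 I J = (\<lambda>_. 0)" by (simp add: tcomp_def fun_eq_iff)
    then show "smooth_fun Q (fst f) (tcomp f 0 I J)" using smooth_fun_const[OF frame_open[OF f]] by simp
  qed (auto intro: tensor_onI)
  have "D0 0 0 X 0 + D0 0 0 X 0 = D0 0 0 X (0 :: ('q, 'w) tfield)"
    using covariant_derivativeD(4)[OF D0_cov X 0 0] by simp
  then have "D0 0 0 X 0 = 0" by simp
  then have "(fun_tensor Q (\<lambda>q. anchor S (X q) (\<lambda>_. 0)) :: ('q, 'w) tfield) q [] [] = 0"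
    using covariant_derivativeD(5)[OF D0_cov X smooth_fun_const[OF openin_pts, of 0]] z by simp
  then show ?thesis using q by (simp add: fun_tensor_def)
qed

text \<open>Extend the two base vectors to a horizontal section and a vertical one. G vanishes on
  them everywhere, and D0 preserves both kinds, so every term of the product rule is 0.\<close>

lemma D0G_hv:
  assumes X: "X \<in> sections Q B" and N: "N \<in> nat_bases S" and q: "q \<in> ndom N" and \<alpha>: "\<alpha> < m" and b: "b < r"
  shows "D0 0 2 X G q [] [ad N q \<alpha>, ad N q (m + b)] = 0"
    "D0 0 2 X G q [] [ad N q (m + b), ad N q \<alpha>] = 0"
proof -
  have qp: "q \<in> pts Q" by (rule ndom_pts[OF N q])
  obtain Y where Y: "Y \<in> sections Q B" "eq_near Q q Y (\<lambda>z. ad N z \<alpha>)" "Y \<in> hsections S \<Gamma>"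
    by (rule extend_adapted[OF N q, of \<alpha>]) (use \<alpha> in auto)
  obtain Z where Z: "Z \<in> sections Q B" "eq_near Q q Z (\<lambda>z. ad N z (m + b))" "Z \<in> vsections S"
    by (rule extend_adapted[OF N q, of "m + b"]) (use b in auto)
  have h: "V z \<in> fib B z" "\<Gamma> z (V z) = 0" if "V \<in> hsections S \<Gamma>" "z \<in> pts Q" for V z
    using that by (auto simp: hsections_def sections_iff)
  have v: "V z \<in> vfib S z" if "V \<in> vsections S" "z \<in> pts Q" for V z
    using that by (auto simp: vsections_def)
  have c: "cov_sec S D0 X Y \<in> hsections S \<Gamma>" "cov_sec S D0 X Z \<in> vsections S"
    using D0 X Y(3) Z(3) by (auto simp: distinguished_connection_def)
  have a0: "anchor S (X q) u = 0" if "\<And>z. z \<in> pts Q \<Longrightarrow> u z = 0" for u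
  proof -
    have "eq_near Q q u (\<lambda>_. 0)" unfolding eq_near_def using openin_pts qp that by blast
    moreover have "X q \<in> fib B q" using X qp by (simp add: sections_iff)
    ultimately show ?thesis using anchor_local[OF qp] anchor_0[OF X qp] by metis
  qed
  have e: "Y q = ad N q \<alpha>" "Z q = ad N q (m + b)"
    using eq_near_imp_eq[OF Y(2)] eq_near_imp_eq[OF Z(2)] by auto
  have "D0 0 2 X G q [] [Y q, Z q] = 0"
    unfolding Leibniz_G[OF X Y(1) Z(1) qp]
    using a0[of "\<lambda>z. gm z (Y z) (Z z)"] gm_orth_G(1)[OF _ h[OF Y(3)] v[OF Z(3)]]
      gm_orth_G(1)[OF qp h[OF c(1) qp] v[OF Z(3) qp]] gm_orth_G(1)[OF qp h[OF Y(3) qp] v[OF c(2) qp]] by simp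
  then show "D0 0 2 X G q [] [ad N q \<alpha>, ad N q (m + b)] = 0" by (simp only: e)
  have "D0 0 2 X G q [] [Z q, Y q] = 0"
    unfolding Leibniz_G[OF X Z(1) Y(1) qp]
    using a0[of "\<lambda>z. gm z (Z z) (Y z)"] gm_orth_G(2)[OF _ h[OF Y(3)] v[OF Z(3)]]
      gm_orth_G(2)[OF qp h[OF c(1) qp] v[OF Z(3) qp]] gm_orth_G(2)[OF qp h[OF Y(3) qp] v[OF c(2) qp]] by simp
  then show "D0 0 2 X G q [] [ad N q (m + b), ad N q \<alpha>] = 0" by (simp only: e)
qed

lemma D0G_orth:
  assumes X: "X \<in> sections Q B" and q: "q \<in> pts Q" and v: "v \<in> fib B q" "\<Gamma> q v = 0" and w: "w \<in> vfib S q"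
  shows "D0 0 2 X G q [] [v, w] = 0" "D0 0 2 X G q [] [w, v] = 0"
  by (rule gm_orth[OF q v w D0G_field[OF X]], use D0G_hv[OF X] in blast)+

text \<open>The right-hand side of the product rule is symmetric in the two sections because G is,
  and sections through the base vectors suffice.\<close>

lemma D0G_sym:
  assumes X: "X \<in> sections Q B" and q: "q \<in> pts Q" and vw: "v \<in> fib B q" "w \<in> fib B q"
  shows "D0 0 2 X G q [] [v, w] = D0 0 2 X G q [] [w, v]"
proof (rule bilinear_sym[OF D0G_field[OF X] _ q vw])
  fix N k l assume N: "N \<in> nat_bases S" "q \<in> ndom N" and kl: "k < m + r" "l < m + r"
  obtain Y where Y: "Y \<in> sections Q B" "eq_near Q q Y (\<lambda>z. ad N z k)"
    by (rule extend_adapted[OF N kl(1)])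
  obtain Z where Z: "Z \<in> sections Q B" "eq_near Q q Z (\<lambda>z. ad N z l)"
    by (rule extend_adapted[OF N kl(2)])
  have mem: "V z \<in> fib B z" if "V \<in> sections Q B" "z \<in> pts Q" for V z
    using that by (simp add: sections_iff)
  have "eq_near Q q (\<lambda>z. gm z (Y z) (Z z)) (\<lambda>z. gm z (Z z) (Y z))"
    unfolding eq_near_def using openin_pts q gm_sym[OF _ mem[OF Y(1)] mem[OF Z(1)]] by blast
  then have "anchor S (X q) (\<lambda>z. gm z (Y z) (Z z)) = anchor S (X q) (\<lambda>z. gm z (Z z) (Y z))"
    by (rule anchor_local[OF q mem[OF X q]])
  moreover have "gm q (cov_sec S D0 X Y q) (Z q) = gm q (Z q) (cov_sec S D0 X Y q)"
    "gm q (Y q) (cov_sec S D0 X Z q) = gm q (cov_sec S D0 X Z q) (Y q)"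
    by (intro gm_sym q mem cov_sec_mem(1)[OF D0_cov X] Y Z)+
  ultimately have "D0 0 2 X G q [] [Y q, Z q] = D0 0 2 X G q [] [Z q, Y q]"
    unfolding Leibniz_G[OF X Y(1) Z(1) q] Leibniz_G[OF X Z(1) Y(1) q] by simp
  then show "D0 0 2 X G q [] [ad N q k, ad N q l] = D0 0 2 X G q [] [ad N q l, ad N q k]"
    using eq_near_imp_eq[OF Y(2)] eq_near_imp_eq[OF Z(2)] by (simp del: join_frame_simps)
qed

lemma A_horizontal:
  assumes X: "X \<in> sections Q B" and q: "q \<in> pts Q" and v: "v \<in> fib B q" "\<Gamma> q v = 0"
  shows "\<Gamma> q (A X q v) = 0"
proof -
  note Av = A_props[OF X q v(1)]
  have g: "\<Gamma> q (A X q v) \<in> vfib S q" by (rule \<Gamma>_mem[OF q Av(1)])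
  then have gf: "\<Gamma> q (A X q v) \<in> fib B q" using vfib_subset_fib[OF q] by blast
  have 0: "0 \<in> fib B q" by (rule subspace_0[OF fib_subspace[OF q]])
  define h where "h = A X q v - \<Gamma> q (A X q v)"
  have h: "h \<in> fib B q" unfolding h_def by (rule subspace_diff[OF fib_subspace[OF q] Av(1) gf])
  have "\<Gamma> q h = 0"
    using \<Gamma>_add[OF q h gf] \<Gamma>_vertical[OF q g] by (simp add: h_def)
  note hh = h this
  text \<open>Both the vertical part of \<open>A\<^sub>X v\<close> and 0 are orthogonal to everything.\<close>
  show ?thesis
  proof (rule gm_nondegenerate[OF q gf 0])
    fix w assume w: "w \<in> fib B q"
    have gw: "\<Gamma> q w \<in> vfib S q" by (rule \<Gamma>_mem[OF q w])
    then have gwf: "\<Gamma> q w \<in> fib B q" using vfib_subset_fib[OF q] by blast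
    define k where "k = w - \<Gamma> q w"
    have k: "k \<in> fib B q" unfolding k_def by (rule subspace_diff[OF fib_subspace[OF q] w gwf])
    have kh: "\<Gamma> q k = 0" using \<Gamma>_add[OF q k gwf] \<Gamma>_vertical[OF q gw] by (simp add: k_def)
    have "gm q (\<Gamma> q (A X q v)) w = gm q (\<Gamma> q (A X q v)) k + gm q (\<Gamma> q (A X q v)) (\<Gamma> q w)"
      using bilinear_0_2(2)[OF G_field q k gwf gf, of 1] by (simp add: k_def)
    also have "gm q (\<Gamma> q (A X q v)) k = 0" by (rule gm_orth_G(2)[OF q k kh g])
    also have "gm q (\<Gamma> q (A X q v)) (\<Gamma> q w) = gm q (A X q v) (\<Gamma> q w) - gm q h (\<Gamma> q w)"
      using bilinear_0_2(1)[OF G_field q h gf gwf, of 1] by (simp add: h_def)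
    also have "gm q h (\<Gamma> q w) = 0" by (rule gm_orth_G(1)[OF q hh gw])
    also have "gm q (A X q v) (\<Gamma> q w) = 0"
      using Av(2)[OF gwf] D0G_orth(1)[OF X q v gw] by simp
    finally show "gm q (\<Gamma> q (A X q v)) w = gm q 0 w"
      using bilinear_0_2(1)[OF G_field q 0 0 w, of 1] by simp
  qed
qed

text \<open>The horizontal part of A v is orthogonal to vertical vectors because the mixed blocks of
  G vanish, and to horizontal ones because those of the derivative of G vanish too. By nondegeneracy
  it is 0.\<close>

lemma A_vertical:
  assumes X: "X \<in> sections Q B" and q: "q \<in> pts Q" and v: "v \<in> vfib S q"
  shows "A X q v \<in> vfib S q"
proof -
  have vf: "v \<in> fib B q" using v vfib_subset_fib[OF q] by blast
  note Av = A_props[OF X q vf]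
  have g: "\<Gamma> q (A X q v) \<in> vfib S q" by (rule \<Gamma>_mem[OF q Av(1)])
  then have gf: "\<Gamma> q (A X q v) \<in> fib B q" using vfib_subset_fib[OF q] by blast
  have "A X q v = \<Gamma> q (A X q v)"
  proof (rule gm_nondegenerate[OF q Av(1) gf])
    fix w assume w: "w \<in> fib B q"
    have gw: "\<Gamma> q w \<in> vfib S q" by (rule \<Gamma>_mem[OF q w])
    then have gwf: "\<Gamma> q w \<in> fib B q" using vfib_subset_fib[OF q] by blast
    define k where "k = w - \<Gamma> q w"
    define h where "h = A X q v - \<Gamma> q (A X q v)"
    have k: "k \<in> fib B q" unfolding k_def by (rule subspace_diff[OF fib_subspace[OF q] w gwf])
    have kh: "\<Gamma> q k = 0" using \<Gamma>_add[OF q k gwf] \<Gamma>_vertical[OF q gw] by (simp add: k_def)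
    have h: "h \<in> fib B q" unfolding h_def by (rule subspace_diff[OF fib_subspace[OF q] Av(1) gf])
    have hh: "\<Gamma> q h = 0" using \<Gamma>_add[OF q h gf] \<Gamma>_vertical[OF q g] by (simp add: h_def)
    have "gm q h w = gm q h k + gm q h (\<Gamma> q w)"
      using bilinear_0_2(2)[OF G_field q k gwf h, of 1] by (simp add: k_def)
    also have "gm q h (\<Gamma> q w) = 0" by (rule gm_orth_G(1)[OF q h hh gw])
    also have "gm q h k = gm q (A X q v) k - gm q (\<Gamma> q (A X q v)) k"
      using bilinear_0_2(1)[OF G_field q h gf k, of 1] by (simp add: h_def)
    also have "gm q (\<Gamma> q (A X q v)) k = 0" by (rule gm_orth_G(2)[OF q k kh g])
    also have "gm q (A X q v) k = 0"
      using Av(2)[OF k] D0G_orth(2)[OF X q k kh v] by simp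
    finally show "gm q (A X q v) w = gm q (\<Gamma> q (A X q v)) w"
      using bilinear_0_2(1)[OF G_field q h gf w, of 1] by (simp add: h_def)
  qed
  then show ?thesis using g by simp
qed

section \<open>The corrected connection\<close>

definition D :: "('q, 'w) cov_deriv" where
  "D k l X T = D0 k l X T + (\<lambda>q. act (fib B q) (A X q) k l (T q))"

lemma act_field:
  assumes X: "X \<in> sections Q B" and T: "T \<in> tensor_fields Q B k l"
  shows "(\<lambda>q. act (fib B q) (A X q) k l (T q)) \<in> tensor_fields Q B k l"
  by (rule tensor_fields_act[OF A_endo[OF X] A_smooth[OF X] T])

lemma act_outside: "T \<in> tensor_fields Q B k l \<Longrightarrow> q \<notin> pts Q \<Longrightarrow> act V A' k l (T q) = 0"
  using tensor_fieldsD(2)[of T k l q] by (simp add: act_def fun_eq_iff)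

lemma act_add_endo:
  assumes V: "subspace V" and A: "endo V A1" "endo V A2" and \<tau>: "tensor_on V k l \<tau>"
    and A3: "\<And>v. v \<in> V \<Longrightarrow> A3 v = A1 v + A2 v" "endo V A3"
  shows "act V A3 k l \<tau> ws vs = act V A1 k l \<tau> ws vs + act V A2 k l \<tau> ws vs"
proof (cases "valid_args V k l ws vs")
  case True
  \<comment> \<open>The factor 1 brings the sum into the form in which \<open>tensor_on_cov\<close>
    states linearity.\<close>
  have d: "\<omega> \<circ> A3 = 1 *\<^sub>R (\<omega> \<circ> A1) + (\<omega> \<circ> A2)" if \<omega>: "\<omega> \<in> dual_space V" for \<omega>
  proof
    fix v
    show "(\<omega> \<circ> A3) v = (1 *\<^sub>R (\<omega> \<circ> A1) + (\<omega> \<circ> A2)) v"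
    proof (cases "v \<in> V")
      case True
      have "\<omega> (A1 v + A2 v) = \<omega> (A1 v) + \<omega> (A2 v)"
        using \<omega> endoD(1)[OF A(1) True] endoD(1)[OF A(2) True] by (simp add: dual_space_def)
      then show ?thesis using A3(1)[OF True] by simp
    next
      case False
      then show ?thesis using A A3(2) dual_space_0[OF \<omega>] by (simp add: endo_def)
    qed
  qed
  have 1: "\<tau> (ws[i := ws ! i \<circ> A3]) vs = \<tau> (ws[i := ws ! i \<circ> A1]) vs + \<tau> (ws[i := ws ! i \<circ> A2]) vs"
    if i: "i < k" for i
  proof -
    note w = valid_args_nth(1)[OF True i]
    show ?thesis
      unfolding d[OF w] using tensor_on_cov[OF \<tau> True i endo_dual[OF A(1) V w] endo_dual[OF A(2) V w], of 1] by simp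
  qed
  have 2: "\<tau> ws (vs[j := A3 (vs ! j)]) = \<tau> ws (vs[j := A1 (vs ! j)]) + \<tau> ws (vs[j := A2 (vs ! j)])"
    if j: "j < l" for j
  proof -
    note v = valid_args_nth(2)[OF True j]
    show ?thesis
      unfolding A3(1)[OF v]
      using tensor_on_vec[OF \<tau> True j endoD(1)[OF A(1) v] endoD(1)[OF A(2) v], of 1] by simp
  qed
  show ?thesis by (simp add: act_def True 1 2 sum.distrib)
qed (simp add: act_def)

lemma act_scale_endo:
  assumes V: "subspace V" and A: "endo V A1" and \<tau>: "tensor_on V k l \<tau>"
    and A3: "\<And>v. v \<in> V \<Longrightarrow> A3 v = c *\<^sub>R A1 v" "endo V A3"
  shows "act V A3 k l \<tau> ws vs = c * act V A1 k l \<tau> ws vs"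
proof (cases "valid_args V k l ws vs")
  case True
  \<comment> \<open>A sum with a single term, so that linearity for sums covers multiplication by a
    scalar.\<close>
  have d: "\<omega> \<circ> A3 = (\<Sum>a\<in>{0::nat}. c *\<^sub>R (\<omega> \<circ> A1))" if \<omega>: "\<omega> \<in> dual_space V" for \<omega>
  proof
    fix v
    show "(\<omega> \<circ> A3) v = (\<Sum>a\<in>{0::nat}. c *\<^sub>R (\<omega> \<circ> A1)) v"
    proof (cases "v \<in> V")
      case True
      have "\<omega> (c *\<^sub>R A1 v) = c * \<omega> (A1 v)"
        using \<omega> endoD(1)[OF A(1) True] by (simp add: dual_space_def)
      then show ?thesis using A3(1)[OF True] by (simp add: scaleR_fun_def)
    next
      case False
      then show ?thesis using A A3(2) dual_space_0[OF \<omega>] by (simp add: endo_def scaleR_fun_def)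
    qed
  qed
  have 1: "\<tau> (ws[i := ws ! i \<circ> A3]) vs = c * \<tau> (ws[i := ws ! i \<circ> A1]) vs" if i: "i < k" for i
    unfolding d[OF valid_args_nth(1)[OF True i]]
    by (subst tensor_on_cov_sum[OF \<tau> True i]) (simp_all add: endo_dual[OF A V valid_args_nth(1)[OF True i]])
  have 2: "\<tau> ws (vs[j := A3 (vs ! j)]) = c * \<tau> ws (vs[j := A1 (vs ! j)])" if j: "j < l" for j
  proof -
    note v = valid_args_nth(2)[OF True j]
    have "A3 (vs ! j) = (\<Sum>a\<in>{0::nat}. c *\<^sub>R A1 (vs ! j))" using A3(1)[OF v] by simp
    then show ?thesis
      using tensor_on_vec_sum[OF \<tau> V True j, of "{0::nat}" "\<lambda>_. A1 (vs ! j)" "\<lambda>_. c"] endoD(1)[OF A v] by simp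
  qed
  show ?thesis by (simp add: act_def True 1 2 sum_distrib_left right_diff_distrib)
qed (simp add: act_def)

lemma sections_add:
  assumes X: "X \<in> sections Q B" and Y: "Y \<in> sections Q B"
  shows "X + Y \<in> sections Q B"
  unfolding sections_iff
proof (intro conjI ballI allI impI)
  fix f a assume f: "f \<in> frames B" and a: "a < rank B"
  show "smooth_fun Q (fst f) (\<lambda>q. cf f a q ((X + Y) q))"
  proof (rule smooth_fun_eqI[OF frame_open[OF f]])
    show "smooth_fun Q (fst f) (\<lambda>q. cf f a q (X q) + cf f a q (Y q))"
      using X Y f a by (intro smooth_fun_add frame_open) (auto simp: sections_iff)
    fix q assume q: "q \<in> fst f"
    interpret b: basis "rank B" "\<lambda>a. snd f a q" "fib B q" by standard (rule frame_basis[OF f q])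
    show "cf f a q ((X + Y) q) = cf f a q (X q) + cf f a q (Y q)"
      using X Y frame_subset_pts[OF f q] by (simp add: sections_iff b.dual_basis_add)
  qed
qed (use X Y fib_subspace in \<open>auto simp: sections_iff intro: subspace_add\<close>)

lemma sections_scale:
  assumes X: "X \<in> sections Q B" and u: "smooth_fun Q (pts Q) u"
  shows "(\<lambda>q. u q *\<^sub>R X q) \<in> sections Q B"
  unfolding sections_iff
proof (intro conjI ballI allI impI)
  fix f a assume f: "f \<in> frames B" and a: "a < rank B"
  show "smooth_fun Q (fst f) (\<lambda>q. cf f a q (u q *\<^sub>R X q))"
  proof (rule smooth_fun_eqI[OF frame_open[OF f]])
    have "fst f \<subseteq> pts Q" using frame_subset_pts[OF f] by blast
    then show "smooth_fun Q (fst f) (\<lambda>q. u q * cf f a q (X q))"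
      using X f a by (intro smooth_fun_mult frame_open smooth_fun_subset[OF u]) (auto simp: sections_iff)
    fix q assume q: "q \<in> fst f"
    interpret b: basis "rank B" "\<lambda>a. snd f a q" "fib B q" by standard (rule frame_basis[OF f q])
    show "cf f a q (u q *\<^sub>R X q) = u q * cf f a q (X q)"
      using X frame_subset_pts[OF f q] by (simp add: sections_iff b.dual_basis_scale)
  qed
qed (use X fib_subspace in \<open>auto simp: sections_iff intro: subspace_scale\<close>)

text \<open>Each axiom is that of D0 plus its homogeneous counterpart for the action of
  \<open>A X\<close>: it is tensorial in X, additive in T, zero on functions, a derivation of
  products, and compatible with contractions.\<close>

lemma D_covariant_derivative: "covariant_derivative S D"
  unfolding covariant_derivative_def Let_def
proof (intro conjI allI impI ballI)
  fix k l X T assume X: "X \<in> sections Q B" and T: "T \<in> tensor_fields Q B k l"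
  show "D k l X T \<in> tensor_fields Q B k l"
    unfolding D_def by (intro tensor_fields_add covariant_derivativeD(1)[OF D0_cov X T] act_field X T)
next
  fix k l X Y T assume X: "X \<in> sections Q B" and Y: "Y \<in> sections Q B" and T: "T \<in> tensor_fields Q B k l"
  note XY = sections_add[OF X Y]
  have "act (fib B q) (A (X + Y) q) k l (T q) ws vs =
      act (fib B q) (A X q) k l (T q) ws vs + act (fib B q) (A Y q) k l (T q) ws vs" for q ws vs
  proof (cases "q \<in> pts Q")
    case True
    show ?thesis
      by (rule act_add_endo[OF fib_subspace[OF True] A_endo[OF X True] A_endo[OF Y True]
        tensor_fieldsD(1)[OF T True] A_add[OF X Y XY True] A_endo[OF XY True]])
  qed (simp add: act_outside[OF T])
  then show "D k l (X + Y) T = D k l X T + D k l Y T"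
    unfolding D_def covariant_derivativeD(2)[OF D0_cov X Y T] by (simp add: fun_eq_iff)
next
  fix k l X T u assume X: "X \<in> sections Q B" and T: "T \<in> tensor_fields Q B k l" and u: "smooth_fun Q (pts Q) u"
  note uX = sections_scale[OF X u]
  have "act (fib B q) (A (\<lambda>q. u q *\<^sub>R X q) q) k l (T q) ws vs = u q * act (fib B q) (A X q) k l (T q) ws vs" for q ws vs
  proof (cases "q \<in> pts Q")
    case True
    show ?thesis
      by (rule act_scale_endo[OF fib_subspace[OF True] A_endo[OF X True]
        tensor_fieldsD(1)[OF T True] A_scale[OF X u uX True] A_endo[OF uX True]])
  qed (simp add: act_outside[OF T])
  then show "D k l (\<lambda>q. u q *\<^sub>R X q) T = (\<lambda>q. u q *\<^sub>R D k l X T q)"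
    unfolding D_def covariant_derivativeD(3)[OF D0_cov X T u] by (simp add: fun_eq_iff scaleR_fun_def algebra_simps)
next
  fix k l X T T' assume X: "X \<in> sections Q B" and T: "T \<in> tensor_fields Q B k l" "T' \<in> tensor_fields Q B k l"
  show "D k l X (T + T') = D k l X T + D k l X T'"
    unfolding D_def covariant_derivativeD(4)[OF D0_cov X T]
    by (simp add: fun_eq_iff act_def sum.distrib)
next
  fix X u assume X: "X \<in> sections Q B" and u: "smooth_fun Q (pts Q) u"
  show "D 0 0 X (fun_tensor Q u) = fun_tensor Q (\<lambda>q. anchor S (X q) u)"
    unfolding D_def covariant_derivativeD(5)[OF D0_cov X u] by (simp add: fun_eq_iff act_def)
next
  fix k l k' l' X T T'
  assume X: "X \<in> sections Q B" and T: "T \<in> tensor_fields Q B k l" and T': "T' \<in> tensor_fields Q B k' l'"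
  have "act (fib B q) (A X q) (k + k') (l + l') (tensor_prod k l T T' q) ws vs =
      act (fib B q) (A X q) k l (T q) (take k ws) (take l vs) * T' q (drop k ws) (drop l vs) +
      T q (take k ws) (take l vs) * act (fib B q) (A X q) k' l' (T' q) (drop k ws) (drop l vs)" for q ws vs
  proof (cases "q \<in> pts Q")
    case True
    show ?thesis
      unfolding tensor_prod_def by (rule act_prod[OF tensor_fieldsD(1)[OF T True] tensor_fieldsD(1)[OF T' True]])
  next
    case False
    then show ?thesis
      using act_outside[OF tensor_fields_prod[OF T T'] False] act_outside[OF T False] tensor_fieldsD(2)[OF T False] by simp
  qed
  then show "D (k + k') (l + l') X (tensor_prod k l T T') =
      tensor_prod k l (D k l X T) T' + tensor_prod k l T (D k' l' X T')"
    unfolding D_def covariant_derivativeD(6)[OF D0_cov X T T']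
    by (simp add: fun_eq_iff tensor_prod_def algebra_simps)
next
  fix k l i j X T
  assume ij: "i \<le> k" "j \<le> l" and X: "X \<in> sections Q B" and T: "T \<in> tensor_fields Q B (Suc k) (Suc l)"
  have "act (fib B q) (A X q) k l (contract B i j T q) ws vs =
      contract B i j (\<lambda>q. act (fib B q) (A X q) (Suc k) (Suc l) (T q)) q ws vs" for q ws vs
  proof (cases "q \<in> pts Q")
    case True
    then obtain f where f: "f \<in> frames B" "q \<in> fst f" using frame_cover by blast
    have "contract B i j T q = (\<lambda>ws vs. \<Sum>a<rank B. T q (insert_at i (cf f a q) ws) (insert_at j (snd f a q) vs))"
      by (intro ext) (rule contract_frame[OF T ij f])
    then show ?thesis
      unfolding contract_frame[OF act_field[OF X T] ij f]
      using act_contract[OF frame_basis[OF f] A_endo[OF X True] tensor_fieldsD(1)[OF T True] ij] by simp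
  next
    case False
    then show ?thesis
      using act_outside[OF tensor_fields_contract[OF T ij] False] act_outside[OF T False]
      by (simp add: contract_def Let_def)
  qed
  then show "D k l X (contract B i j T) = contract B i j (D (Suc k) (Suc l) X T)"
    unfolding D_def covariant_derivativeD(7)[OF D0_cov X T ij]
    by (simp add: fun_eq_iff) (simp add: contract_def Let_def sum.distrib)
qed

text \<open>On a section viewed as a tensor of type (1,0), the action evaluates the composite of
  \<omega> with A at Y, that is, \<omega> at A Y; hence the plus sign.\<close>

lemma cov_sec_D:
  assumes X: "X \<in> sections Q B" and Y: "Y \<in> sections Q B" and q: "q \<in> pts Q"
  shows "cov_sec S D X Y q = cov_sec S D0 X Y q + A X q (Y q)"
proof -
  obtain f where f: "f \<in> frames B" "q \<in> fst f" using frame_cover[OF q] by blast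
  interpret b: basis "rank B" "\<lambda>a. snd f a q" "fib B q" by standard (rule frame_basis[OF f])
  have Yq: "Y q \<in> fib B q" using Y q by (simp add: sections_iff)
  note c = cov_sec_mem[OF D_covariant_derivative X Y] and c0 = cov_sec_mem[OF D0_cov X Y]
  have m: "cov_sec S D X Y q \<in> fib B q" "cov_sec S D0 X Y q \<in> fib B q"
    using c(1) c0(1) q by (auto simp: sections_iff)
  note Aq = A_props(1)[OF X q Yq]
  show ?thesis
  proof (rule b.eqI[OF m(1) subspace_add[OF b.subspace m(2) Aq]])
    fix a assume a: "a < rank B"
    have v: "valid_args (fib B q) 1 0 [cf f a q] []"
      using b.dual_basis_mem by (simp add: valid_args_def)
    have "cf f a q (cov_sec S D X Y q) = D 1 0 X (sec_tensor B Y) q [cf f a q] []"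
      unfolding c(2) by (rule sec_tensor_cf[OF f, symmetric])
    also have "\<dots> = cf f a q (cov_sec S D0 X Y q) + sec_tensor B Y q [cf f a q \<circ> A X q] []"
      unfolding D_def c0(2) using v by (simp add: sec_tensor_cf[OF f] act_def)
    also have "sec_tensor B Y q [cf f a q \<circ> A X q] [] = cf f a q (A X q (Y q))"
      using endo_dual[OF A_endo[OF X q] b.subspace b.dual_basis_mem[of a]] by (simp add: sec_tensor_def)
    finally show "cf f a q (cov_sec S D X Y q) = cf f a q (cov_sec S D0 X Y q + A X q (Y q))"
      by (simp add: b.dual_basis_add[OF m(2) Aq])
  qed
qed

lemma D_distinguished: "distinguished_connection S \<Gamma> D"
  unfolding distinguished_connection_def
proof (intro conjI ballI D_covariant_derivative)
  fix X Y assume X: "X \<in> sections Q B" and Y: "Y \<in> hsections S \<Gamma>"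
  have Y': "Y \<in> sections Q B" using Y by (simp add: hsections_def)
  have c0: "cov_sec S D0 X Y \<in> hsections S \<Gamma>" using D0 X Y by (auto simp: distinguished_connection_def)
  show "cov_sec S D X Y \<in> hsections S \<Gamma>"
    unfolding hsections_def
  proof (intro CollectI conjI ballI cov_sec_mem(1)[OF D_covariant_derivative X Y'])
    fix q assume q: "q \<in> pts Q"
    have Yq: "Y q \<in> fib B q" "\<Gamma> q (Y q) = 0" using Y q by (auto simp: hsections_def sections_iff)
    have cq: "cov_sec S D0 X Y q \<in> fib B q" "\<Gamma> q (cov_sec S D0 X Y q) = 0"
      using c0 q by (auto simp: hsections_def sections_iff)
    show "\<Gamma> q (cov_sec S D X Y q) = 0"
      using \<Gamma>_add[OF q cq(1) A_props(1)[OF X q Yq(1)]] A_horizontal[OF X q Yq] cq(2)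
      by (simp add: cov_sec_D[OF X Y' q])
  qed
next
  fix X Y assume X: "X \<in> sections Q B" and Y: "Y \<in> vsections S"
  have Y': "Y \<in> sections Q B" using Y by (simp add: vsections_def)
  have c0: "cov_sec S D0 X Y \<in> vsections S" using D0 X Y by (auto simp: distinguished_connection_def)
  show "cov_sec S D X Y \<in> vsections S"
    unfolding vsections_def
  proof (intro CollectI conjI ballI cov_sec_mem(1)[OF D_covariant_derivative X Y'])
    fix q assume q: "q \<in> pts Q"
    have sub: "subspace (vfib S q)" unfolding vfib_def by (rule subspace_span)
    have "Y q \<in> vfib S q" "cov_sec S D0 X Y q \<in> vfib S q"
      using Y c0 q by (auto simp: vsections_def)
    then show "cov_sec S D X Y q \<in> vfib S q"
      using A_vertical[OF X q] subspace_add[OF sub] by (simp add: cov_sec_D[OF X Y' q])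
  qed
qed

lemma D_metric:
  assumes X: "X \<in> sections Q B"
  shows "D 0 2 X G = 0"
proof -
  have "D 0 2 X G q ws vs = 0" for q ws vs
  proof (cases "q \<in> pts Q \<and> valid_args (fib B q) 0 2 ws vs")
    case True
    then have q: "q \<in> pts Q" and val: "valid_args (fib B q) 0 2 ws vs" by auto
    then obtain v w where vw: "ws = []" "vs = [v, w]" "v \<in> fib B q" "w \<in> fib B q"
      by (auto simp: valid_args_def numeral_2_eq_2 length_Suc_conv)
    have "act (fib B q) (A X q) 0 2 (G q) ws vs = - (gm q (A X q v) w + gm q v (A X q w))"
      using val vw by (simp add: act_def numeral_2_eq_2)
    moreover have "gm q (A X q v) w = 1/2 * D0 0 2 X G q [] [v, w]"
      using A_props(2)[OF X q] vw by simp
    moreover have "gm q v (A X q w) = 1/2 * D0 0 2 X G q [] [w, v]"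
      using A_props[OF X q vw(4)] gm_sym[OF q vw(3)] vw(3) by simp
    moreover have "D0 0 2 X G q [] [w, v] = D0 0 2 X G q [] [v, w]"
      by (rule D0G_sym[OF X q vw(4,3)])
    ultimately show ?thesis using vw by (simp add: D_def)
  next
    \<comment> \<open>Off the manifold and on arguments of wrong length or outside the fibre, tensor
      fields are 0 by convention.\<close>
    case False
    have "D 0 2 X G \<in> tensor_fields Q B 0 2"
      by (rule covariant_derivativeD(1)[OF D_covariant_derivative X G_field])
    then show ?thesis
      using False tensor_on_outside[OF tensor_fieldsD(1)[of "D 0 2 X G" 0 2 q], of ws vs] tensor_fieldsD(2)[of "D 0 2 X G" 0 2 q]
      by (cases "q \<in> pts Q") auto
  qed
  then show ?thesis by (simp add: fun_eq_iff)
qed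

section \<open>Components of the corrected connection\<close>

text \<open>\<iota> embeds a block of p indices into the adapted base: the identity for the
  horizontal block, the shift by m for the vertical one. So both pairs of formulas come from one
  computation. The hypothesis \<open>other\<close> says that the block is orthogonal to the rest of
  the base, for G and for its derivative; the factor next to \<open>g' k e\<close> is the covariant
  derivative of the component \<open>g e i\<close>.\<close>

lemma A_block:
  fixes \<iota> :: "nat \<Rightarrow> nat"
  assumes X: "X \<in> sections Q B" and N: "N \<in> nat_bases S" and q: "q \<in> ndom N" and i: "i < p"
    and \<iota>: "\<And>j. j < p \<Longrightarrow> \<iota> j < m + r"
    and other: "\<And>k j. k < m + r \<Longrightarrow> k \<notin> \<iota> ` {..<p} \<Longrightarrow> j < p \<Longrightarrow>
      gm q (ad N q (\<iota> j)) (ad N q k) = 0 \<and> D0 0 2 X G q [] [ad N q (\<iota> j), ad N q k] = 0"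
    and g: "\<And>z j l. z \<in> ndom N \<Longrightarrow> j < p \<Longrightarrow> l < p \<Longrightarrow> gm z (ad N z (\<iota> j)) (ad N z (\<iota> l)) = g j l z"
    and inv: "mat_inverse p (\<lambda>j l. g j l q) g'"
    and c: "\<And>j Z. j < p \<Longrightarrow> Z \<in> sections Q B \<Longrightarrow> eq_near Q q Z (\<lambda>z. ad N z (\<iota> j)) \<Longrightarrow>
      cov_sec S D0 X Z q = (\<Sum>k<p. c k j *\<^sub>R ad N q (\<iota> k))"
  shows "A X q (ad N q (\<iota> i)) = (\<Sum>k<p. (1/2 * (\<Sum>e<p. g' k e * (anchor S (X q) (g e i) -
      (\<Sum>\<theta><p. c \<theta> e * g \<theta> i q) - (\<Sum>\<theta><p. c \<theta> i * g e \<theta> q)))) *\<^sub>R ad N q (\<iota> k))"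
proof -
  interpret ad: basis "m + r" "ad N q" "fib B q" by standard (rule ad_basis[OF N q])
  have qp: "q \<in> pts Q" by (rule ndom_pts[OF N q])
  have Xq: "X q \<in> fib B q" using X qp by (simp add: sections_iff)
  define t where "t e = anchor S (X q) (g e i) - (\<Sum>\<theta><p. c \<theta> e * g \<theta> i q) - (\<Sum>\<theta><p. c \<theta> i * g e \<theta> q)" for e
  define u where "u = (\<Sum>k<p. (1/2 * (\<Sum>e<p. g' k e * t e)) *\<^sub>R ad N q (\<iota> k))"
  have s: "ad N q (\<iota> j) \<in> fib B q" if "j < p" for j using ad.basis_mem[OF \<iota>[OF that]] .
  have u: "u \<in> fib B q" unfolding u_def by (rule ad.sum_mem) (use s in auto)
  have gsym: "g j l z = g l j z" if "z \<in> ndom N" "j < p" "l < p" for j l z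
    using gm_ad_sym[OF N that(1) \<iota>[OF that(2)] \<iota>[OF that(3)]] g[OF that] g[OF that(1,3,2)] by simp
  \<comment> \<open>The product rule for sections that extend two base vectors. The coefficients c
    expand their derivatives, and symmetry of g brings the result to the form of t.\<close>
  have P: "D0 0 2 X G q [] [ad N q (\<iota> i), ad N q (\<iota> j)] = t j" if j: "j < p" for j
  proof -
    obtain Y where Y: "Y \<in> sections Q B" "eq_near Q q Y (\<lambda>z. ad N z (\<iota> i))"
      by (rule extend_adapted[OF N q \<iota>[OF i]])
    obtain Z where Z: "Z \<in> sections Q B" "eq_near Q q Z (\<lambda>z. ad N z (\<iota> j))"
      by (rule extend_adapted[OF N q \<iota>[OF j]])
    obtain U where U: "openin (mtop Q) U" "q \<in> U" "\<And>z. z \<in> U \<Longrightarrow> Y z = ad N z (\<iota> i)"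
      using Y(2) unfolding eq_near_def by blast
    obtain V where V: "openin (mtop Q) V" "q \<in> V" "\<And>z. z \<in> V \<Longrightarrow> Z z = ad N z (\<iota> j)"
      using Z(2) unfolding eq_near_def by blast
    have "eq_near Q q (\<lambda>z. gm z (Y z) (Z z)) (g j i)"
      unfolding eq_near_def
    proof (intro exI conjI ballI)
      show "openin (mtop Q) (U \<inter> V \<inter> ndom N)"
        by (intro openin_Int U(1) V(1) ndom_open[OF N])
      show "gm z (Y z) (Z z) = g j i z" if "z \<in> U \<inter> V \<inter> ndom N" for z
        using that g[OF _ i j] gsym[OF _ i j] U(3) V(3) by (simp del: join_frame_simps)
    qed (use U V q in auto)
    then have "anchor S (X q) (\<lambda>z. gm z (Y z) (Z z)) = anchor S (X q) (g j i)"
      by (rule anchor_local[OF qp Xq])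
    moreover have "gm q (\<Sum>k<p. c k i *\<^sub>R ad N q (\<iota> k)) (ad N q (\<iota> j)) = (\<Sum>k<p. c k i * g j k q)"
      using bilinear_0_2_sum(1)[OF G_field qp _ s[OF j], of "{..<p}" "\<lambda>k. ad N q (\<iota> k)" "\<lambda>k. c k i"] s
        g[OF q _ j] gsym[OF q j] by (simp del: join_frame_simps)
    moreover have "gm q (ad N q (\<iota> i)) (\<Sum>k<p. c k j *\<^sub>R ad N q (\<iota> k)) = (\<Sum>k<p. c k j * g k i q)"
      using bilinear_0_2_sum(2)[OF G_field qp _ s[OF i], of "{..<p}" "\<lambda>k. ad N q (\<iota> k)" "\<lambda>k. c k j"] s
        g[OF q i] gsym[OF q i] by (simp del: join_frame_simps)
    ultimately show ?thesis
      using Leibniz_G[OF X Y(1) Z(1) qp] c[OF i Y] c[OF j Z] eq_near_imp_eq[OF Y(2)] eq_near_imp_eq[OF Z(2)]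
      by (simp add: t_def del: join_frame_simps)
  qed
  have "A X q (ad N q (\<iota> i)) = u"
  proof (rule A_eqI[OF X qp s[OF i] u])
    fix w assume w: "w \<in> fib B q"
    \<comment> \<open>It suffices to test on the base. Inside the block the inverse matrix cancels
      g; outside it both sides are 0.\<close>
    have key: "gm q u (ad N q k) = 1/2 * D0 0 2 X G q [] [ad N q (\<iota> i), ad N q k]" if k: "k < m + r" for k
    proof -
      have uk: "gm q u (ad N q k) = (\<Sum>l<p. (1/2 * (\<Sum>e<p. g' l e * t e)) * gm q (ad N q (\<iota> l)) (ad N q k))"
        unfolding u_def using s by (intro bilinear_0_2_sum(1)[OF G_field qp _ ad.basis_mem[OF k]]) auto
      show ?thesis
      proof (cases "k \<in> \<iota> ` {..<p}")
        case True
        then obtain j where j: "j < p" "k = \<iota> j" by blast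
        have "gm q u (ad N q k) = (\<Sum>l<p. 1/2 * ((\<Sum>e<p. g' l e * t e) * g l j q))"
          unfolding uk using g[OF q _ j(1)] unfolding j(2)
          by (intro sum.cong refl) (simp del: join_frame_simps)
        also have "\<dots> = 1/2 * (\<Sum>l<p. (\<Sum>e<p. g' l e * t e) * g l j q)"
          by (rule sum_distrib_left[symmetric])
        also have "(\<Sum>l<p. (\<Sum>e<p. g' l e * t e) * g l j q) = t j"
          by (rule mat_inverse_sum[OF inv j(1)]) (rule gsym[OF q _ j(1)])
        finally show ?thesis using P[OF j(1)] j(2) by simp
      next
        case False
        show ?thesis unfolding uk using other[OF k False] i by (simp del: join_frame_simps)
      qed
    qed
    have "gm q u w = gm q u (\<Sum>k<m + r. dual_basis (m + r) (ad N q) k w *\<^sub>R ad N q k)"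
      using ad.expand[OF w] by simp
    also have "\<dots> = (\<Sum>k<m + r. dual_basis (m + r) (ad N q) k w * gm q u (ad N q k))"
      by (rule bilinear_0_2_sum(2)[OF G_field qp _ u]) (simp add: ad.basis_mem)
    also have "\<dots> = (\<Sum>k<m + r. dual_basis (m + r) (ad N q) k w * (1/2 * D0 0 2 X G q [] [ad N q (\<iota> i), ad N q k]))"
      using key by (intro sum.cong) auto
    also have "\<dots> = 1/2 * (\<Sum>k<m + r. dual_basis (m + r) (ad N q) k w * D0 0 2 X G q [] [ad N q (\<iota> i), ad N q k])"
      by (simp add: sum_distrib_left)
    also have "(\<Sum>k<m + r. dual_basis (m + r) (ad N q) k w * D0 0 2 X G q [] [ad N q (\<iota> i), ad N q k]) =
        D0 0 2 X G q [] [ad N q (\<iota> i), \<Sum>k<m + r. dual_basis (m + r) (ad N q) k w *\<^sub>R ad N q k]"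
      by (rule bilinear_0_2_sum(2)[OF D0G_field[OF X] qp _ s[OF i], symmetric]) (simp add: ad.basis_mem)
    also have "(\<Sum>k<m + r. dual_basis (m + r) (ad N q) k w *\<^sub>R ad N q k) = w" by (rule ad.expand[OF w])
    finally show "gm q u w = 1/2 * D0 0 2 X G q [] [ad N q (\<iota> i), w]" .
  qed
  then show ?thesis by (simp only: u_def t_def)
qed

text \<open>The passage from global to local sections: X and Y have the values of the local sections
  at q, and the anchor term depends on X only through \<open>X q\<close>.\<close>

lemma local_cov_block:
  fixes \<iota> :: "nat \<Rightarrow> nat"
  assumes N: "N \<in> nat_bases S" and q: "q \<in> ndom N" and i: "i < p"
    and \<iota>: "\<And>j. j < p \<Longrightarrow> \<iota> j < m + r"
    and other: "\<And>X k j. X \<in> sections Q B \<Longrightarrow> k < m + r \<Longrightarrow> k \<notin> \<iota> ` {..<p} \<Longrightarrow> j < p \<Longrightarrow>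
      gm q (ad N q (\<iota> j)) (ad N q k) = 0 \<and> D0 0 2 X G q [] [ad N q (\<iota> j), ad N q k] = 0"
    and g: "\<And>z j l. z \<in> ndom N \<Longrightarrow> j < p \<Longrightarrow> l < p \<Longrightarrow> gm z (ad N z (\<iota> j)) (ad N z (\<iota> l)) = g j l z"
    and inv: "mat_inverse p (\<lambda>j l. g j l q) g'"
    and c: "\<And>j. j < p \<Longrightarrow> local_cov S D0 x (\<lambda>z. ad N z (\<iota> j)) q (\<Sum>k<p. c k j *\<^sub>R ad N q (\<iota> k))"
  shows "local_cov S D x (\<lambda>z. ad N z (\<iota> i)) q (\<Sum>k<p. (c k i + 1/2 * (\<Sum>e<p. g' k e * (anchor S (x q) (g e i) -
      (\<Sum>\<theta><p. c \<theta> e * g \<theta> i q) - (\<Sum>\<theta><p. c \<theta> i * g e \<theta> q)))) *\<^sub>R ad N q (\<iota> k))"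
  unfolding local_cov_def
proof (intro ballI impI)
  fix X Y assume X: "X \<in> sections Q B" and Y: "Y \<in> sections Q B"
    and e: "eq_near Q q X x \<and> eq_near Q q Y (\<lambda>z. ad N z (\<iota> i))"
  have c': "cov_sec S D0 X Z q = (\<Sum>k<p. c k j *\<^sub>R ad N q (\<iota> k))"
    if "j < p" "Z \<in> sections Q B" "eq_near Q q Z (\<lambda>z. ad N z (\<iota> j))" for j Z
    using c[OF that(1)] X that(2,3) e unfolding local_cov_def by blast
  have Yq: "Y q = ad N q (\<iota> i)" using e eq_near_imp_eq by blast
  have Xq: "X q = x q" using e eq_near_imp_eq by blast
  have Ab: "A X q (ad N q (\<iota> i)) = (\<Sum>k<p. (1/2 * (\<Sum>e<p. g' k e * (anchor S (X q) (g e i) -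
      (\<Sum>\<theta><p. c \<theta> e * g \<theta> i q) - (\<Sum>\<theta><p. c \<theta> i * g e \<theta> q)))) *\<^sub>R ad N q (\<iota> k))"
    by (rule A_block[OF X N q i \<iota> other[OF X] g inv c'])
  show "cov_sec S D X Y q = (\<Sum>k<p. (c k i + 1/2 * (\<Sum>e<p. g' k e * (anchor S (x q) (g e i) -
      (\<Sum>\<theta><p. c \<theta> e * g \<theta> i q) - (\<Sum>\<theta><p. c \<theta> i * g e \<theta> q)))) *\<^sub>R ad N q (\<iota> k))"
    unfolding cov_sec_D[OF X Y ndom_pts[OF N q]] Yq c'[OF i Y conjunct2[OF e]] scaleR_left_distrib sum.distrib
      Ab[unfolded Xq] ..
qed

text \<open>In the auxiliary facts, x is the differentiating base vector and C a family of
  coefficients with its last index fixed. Two instances of the block formula therefore yield all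
  four families.\<close>

lemma D_components:
  assumes N: "N \<in> nat_bases S"
    and comps: "components S \<Gamma> D0 N Hh0 Hv0 Vh0 Vv0" and gg: "metric_comps S \<Gamma> G N gh gv"
    and inv: "\<And>q. q \<in> ndom N \<Longrightarrow> mat_inverse m (\<lambda>\<alpha> \<beta>. gh \<alpha> \<beta> q) (\<lambda>\<alpha> \<beta>. gh' \<alpha> \<beta> q) \<and>
      mat_inverse r (\<lambda>a b. gv a b q) (\<lambda>a b. gv' a b q)"
  shows "components S \<Gamma> D N
     (\<lambda>\<alpha> \<beta> \<gamma> q. Hh0 \<alpha> \<beta> \<gamma> q + 1/2 * (\<Sum>\<epsilon><m. gh' \<alpha> \<epsilon> q *
        cov_gh S (delta S \<Gamma> N \<gamma>) (\<lambda>\<theta> \<eta>. Hh0 \<theta> \<eta> \<gamma>) gh \<epsilon> \<beta> q))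
     (\<lambda>a b \<gamma> q. Hv0 a b \<gamma> q + 1/2 * (\<Sum>e<r. gv' b e q *
        cov_gv S (delta S \<Gamma> N \<gamma>) (\<lambda>d d'. Hv0 d d' \<gamma>) gv e a q))
     (\<lambda>\<alpha> \<beta> c q. Vh0 \<alpha> \<beta> c q + 1/2 * (\<Sum>\<epsilon><m. gh' \<alpha> \<epsilon> q *
        cov_gh S (del_v N c) (\<lambda>\<theta> \<eta>. Vh0 \<theta> \<eta> c) gh \<epsilon> \<beta> q))
     (\<lambda>a b c q. Vv0 a b c q + 1/2 * (\<Sum>e<r. gv' b e q *
        cov_gv S (del_v N c) (\<lambda>d d'. Vv0 d d' c) gv e a q))"
proof -
  note eq = metric_comps_eq[OF N gg]
  have h: "local_cov S D x (delta S \<Gamma> N \<beta>) q (\<Sum>\<alpha><m. (C \<alpha> \<beta> q + 1/2 * (\<Sum>\<epsilon><m. gh' \<alpha> \<epsilon> q * cov_gh S x C gh \<epsilon> \<beta> q)) *\<^sub>R delta S \<Gamma> N \<alpha> q)"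
    if q: "q \<in> ndom N" and \<beta>: "\<beta> < m"
      and C: "\<And>\<beta>. \<beta> < m \<Longrightarrow> local_cov S D0 x (delta S \<Gamma> N \<beta>) q (\<Sum>\<alpha><m. C \<alpha> \<beta> q *\<^sub>R delta S \<Gamma> N \<alpha> q)"
    for x q \<beta> C
  proof -
    have "local_cov S D x (\<lambda>z. ad N z (id \<beta>)) q (\<Sum>k<m. (C k \<beta> q + 1/2 * (\<Sum>e<m. gh' k e q * (anchor S (x q) (gh e \<beta>) -
      (\<Sum>\<theta><m. C \<theta> e q * gh \<theta> \<beta> q) - (\<Sum>\<theta><m. C \<theta> \<beta> q * gh e \<theta> q)))) *\<^sub>R ad N q (id k))"
    proof (rule local_cov_block[OF N q \<beta>])
      fix X k j assume X: "X \<in> sections Q B" and k: "k < m + r" "k \<notin> id ` {..<m}" and j: "j < m"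
      define b where "b = k - m"
      have b: "b < r" "k = m + b" using k by (auto simp: b_def)
      show "gm q (ad N q (id j)) (ad N q k) = 0 \<and> D0 0 2 X G q [] [ad N q (id j), ad N q k] = 0"
        unfolding b(2) id_apply using metric_blocks(3)[OF N q j b(1)] D0G_hv(1)[OF X N q j b(1)] by blast
    next
      show "mat_inverse m (\<lambda>j l. gh j l q) (\<lambda>j l. gh' j l q)" using inv[OF q] by blast
      show "local_cov S D0 x (\<lambda>z. ad N z (id j)) q (\<Sum>k<m. C k j q *\<^sub>R ad N q (id k))" if "j < m" for j
        using C[OF that] that by simp
    qed (simp_all add: eq)
    then show ?thesis using \<beta> by (simp add: cov_gh_def)
  qed
  have v: "local_cov S D x (del_v N a) q (\<Sum>b<r. (C a b q + 1/2 * (\<Sum>e<r. gv' b e q * cov_gv S x C gv e a q)) *\<^sub>R del_v N b q)"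
    if q: "q \<in> ndom N" and a: "a < r"
      and C: "\<And>a. a < r \<Longrightarrow> local_cov S D0 x (del_v N a) q (\<Sum>b<r. C a b q *\<^sub>R del_v N b q)"
    for x q a C
  proof -
    have "local_cov S D x (\<lambda>z. ad N z (m + a)) q (\<Sum>k<r. (C a k q + 1/2 * (\<Sum>e<r. gv' k e q * (anchor S (x q) (gv e a) -
      (\<Sum>\<theta><r. C e \<theta> q * gv \<theta> a q) - (\<Sum>\<theta><r. C a \<theta> q * gv e \<theta> q)))) *\<^sub>R ad N q (m + k))"
    \<comment> \<open>In the vertical families the index summed against the base is the second one,
      hence the exchanged arguments.\<close>
    proof (rule local_cov_block[OF N q a, where \<iota> = "\<lambda>k. m + k" and c = "\<lambda>k j. C j k q"])
      fix X k j assume X: "X \<in> sections Q B" and k: "k < m + r" "k \<notin> (\<lambda>k. m + k) ` {..<r}" and j: "j < r"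
      have "k < m"
      proof (rule ccontr)
        assume "\<not> k < m"
        then have "k = m + (k - m)" "k - m \<in> {..<r}" using k(1) by auto
        then show False using k(2) by blast
      qed
      then show "gm q (ad N q (m + j)) (ad N q k) = 0 \<and> D0 0 2 X G q [] [ad N q (m + j), ad N q k] = 0"
        using metric_blocks(4)[OF N q _ j] D0G_hv(2)[OF X N q _ j] by blast
    next
      show "mat_inverse r (\<lambda>j l. gv j l q) (\<lambda>j l. gv' j l q)" using inv[OF q] by blast
      show "local_cov S D0 x (\<lambda>z. ad N z (m + j)) q (\<Sum>k<r. C j k q *\<^sub>R ad N q (m + k))" if "j < r" for j
        using C[OF that] by simp
    qed (simp_all add: eq)
    then show ?thesis by (simp add: cov_gv_def)
  qed
  have c: "\<gamma> < m \<Longrightarrow> \<beta> < m \<Longrightarrow> local_cov S D0 (delta S \<Gamma> N \<gamma>) (delta S \<Gamma> N \<beta>) q (\<Sum>\<alpha><m. Hh0 \<alpha> \<beta> \<gamma> q *\<^sub>R delta S \<Gamma> N \<alpha> q)"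
    "\<gamma> < m \<Longrightarrow> a < r \<Longrightarrow> local_cov S D0 (delta S \<Gamma> N \<gamma>) (del_v N a) q (\<Sum>b<r. Hv0 a b \<gamma> q *\<^sub>R del_v N b q)"
    "c < r \<Longrightarrow> \<beta> < m \<Longrightarrow> local_cov S D0 (del_v N c) (delta S \<Gamma> N \<beta>) q (\<Sum>\<alpha><m. Vh0 \<alpha> \<beta> c q *\<^sub>R delta S \<Gamma> N \<alpha> q)"
    "c < r \<Longrightarrow> a < r \<Longrightarrow> local_cov S D0 (del_v N c) (del_v N a) q (\<Sum>b<r. Vv0 a b c q *\<^sub>R del_v N b q)"
    if "q \<in> ndom N" for q \<beta> \<gamma> a c
    using bspec[OF comps[unfolded components_def Let_def] that] by blast+
  show ?thesis
    unfolding components_def Let_def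
  proof (intro ballI conjI allI impI)
    fix q \<gamma> \<beta> assume *: "q \<in> ndom N" "\<gamma> < m" "\<beta> < m"
    show "local_cov S D (delta S \<Gamma> N \<gamma>) (delta S \<Gamma> N \<beta>) q (\<Sum>\<alpha><m. (Hh0 \<alpha> \<beta> \<gamma> q + 1/2 * (\<Sum>\<epsilon><m. gh' \<alpha> \<epsilon> q *
        cov_gh S (delta S \<Gamma> N \<gamma>) (\<lambda>\<theta> \<eta>. Hh0 \<theta> \<eta> \<gamma>) gh \<epsilon> \<beta> q)) *\<^sub>R delta S \<Gamma> N \<alpha> q)"
      by (rule h[OF *(1,3), of _ "\<lambda>\<theta> \<eta>. Hh0 \<theta> \<eta> \<gamma>"]) (rule c(1)[OF *(1,2)])
  next
    fix q \<gamma> a assume *: "q \<in> ndom N" "\<gamma> < m" "a < r"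
    show "local_cov S D (delta S \<Gamma> N \<gamma>) (del_v N a) q (\<Sum>b<r. (Hv0 a b \<gamma> q + 1/2 * (\<Sum>e<r. gv' b e q *
        cov_gv S (delta S \<Gamma> N \<gamma>) (\<lambda>d d'. Hv0 d d' \<gamma>) gv e a q)) *\<^sub>R del_v N b q)"
      by (rule v[OF *(1,3), of _ "\<lambda>d d'. Hv0 d d' \<gamma>"]) (rule c(2)[OF *(1,2)])
  next
    fix q c' \<beta> assume *: "q \<in> ndom N" "c' < r" "\<beta> < m"
    show "local_cov S D (del_v N c') (delta S \<Gamma> N \<beta>) q (\<Sum>\<alpha><m. (Vh0 \<alpha> \<beta> c' q + 1/2 * (\<Sum>\<epsilon><m. gh' \<alpha> \<epsilon> q *
        cov_gh S (del_v N c') (\<lambda>\<theta> \<eta>. Vh0 \<theta> \<eta> c') gh \<epsilon> \<beta> q)) *\<^sub>R delta S \<Gamma> N \<alpha> q)"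
      by (rule h[OF *(1,3), of _ "\<lambda>\<theta> \<eta>. Vh0 \<theta> \<eta> c'"]) (rule c(3)[OF *(1,2)])
  next
    fix q c' a assume *: "q \<in> ndom N" "c' < r" "a < r"
    show "local_cov S D (del_v N c') (del_v N a) q (\<Sum>b<r. (Vv0 a b c' q + 1/2 * (\<Sum>e<r. gv' b e q *
        cov_gv S (del_v N c') (\<lambda>d d'. Vv0 d d' c') gv e a q)) *\<^sub>R del_v N b q)"
      by (rule v[OF *(1,3), of _ "\<lambda>d d'. Vv0 d d' c'"]) (rule c(4)[OF *(1,2)])
  qed
qed

end

text \<open>Formulated for the abstract bundle, so that both parts of the result are instances. A
  metrical structure is in particular pseudometrical, which settles both alternatives for G with the
  same connection.\<close>

theorem (in gen_tangent_bundle) metric_connection_exists: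
  assumes "rho_connection S \<Gamma>" "distinguished_connection S \<Gamma> D0"
    and G: "pseudometrical S \<Gamma> G \<or> metrical S \<Gamma> G"
  shows "\<exists>D. distinguished_connection S \<Gamma> D \<and>
    (\<forall>N\<in>nat_bases S. \<forall>Hh0 Hv0 Vh0 Vv0 gh gv gh' gv'.
       components S \<Gamma> D0 N Hh0 Hv0 Vh0 Vv0 \<and> metric_comps S \<Gamma> G N gh gv \<and>
       (\<forall>q\<in>ndom N. mat_inverse m (\<lambda>\<alpha> \<beta>. gh \<alpha> \<beta> q) (\<lambda>\<alpha> \<beta>. gh' \<alpha> \<beta> q) \<and>
                   mat_inverse r (\<lambda>a b. gv a b q) (\<lambda>a b. gv' a b q)) \<longrightarrow>
       components S \<Gamma> D N
         (\<lambda>\<alpha> \<beta> \<gamma> q. Hh0 \<alpha> \<beta> \<gamma> q + 1/2 * (\<Sum>\<epsilon><m. gh' \<alpha> \<epsilon> q *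
            cov_gh S (delta S \<Gamma> N \<gamma>) (\<lambda>\<theta> \<eta>. Hh0 \<theta> \<eta> \<gamma>) gh \<epsilon> \<beta> q))
         (\<lambda>a b \<gamma> q. Hv0 a b \<gamma> q + 1/2 * (\<Sum>e<r. gv' b e q *
            cov_gv S (delta S \<Gamma> N \<gamma>) (\<lambda>d d'. Hv0 d d' \<gamma>) gv e a q))
         (\<lambda>\<alpha> \<beta> c q. Vh0 \<alpha> \<beta> c q + 1/2 * (\<Sum>\<epsilon><m. gh' \<alpha> \<epsilon> q *
            cov_gh S (del_v N c) (\<lambda>\<theta> \<eta>. Vh0 \<theta> \<eta> c) gh \<epsilon> \<beta> q))
         (\<lambda>a b c q. Vv0 a b c q + 1/2 * (\<Sum>e<r. gv' b e q *
            cov_gv S (del_v N c) (\<lambda>d d'. Vv0 d d' c) gv e a q))) \<and>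
    (\<forall>X\<in>sections Q B. D 0 2 X G = 0)"
proof -
  interpret M: metric_on S \<Gamma> D0 G
    by standard (use assms in \<open>auto simp: metrical_def\<close>)
  show ?thesis
  proof (intro exI[of _ M.D] conjI M.D_distinguished ballI M.D_metric allI impI)
    fix N Hh0 Hv0 Vh0 Vv0 gh gv gh' gv'
    assume N: "N \<in> nat_bases S" and "components S \<Gamma> D0 N Hh0 Hv0 Vh0 Vv0 \<and> metric_comps S \<Gamma> G N gh gv \<and>
       (\<forall>q\<in>ndom N. mat_inverse m (\<lambda>\<alpha> \<beta>. gh \<alpha> \<beta> q) (\<lambda>\<alpha> \<beta>. gh' \<alpha> \<beta> q) \<and>
                   mat_inverse r (\<lambda>a b. gv a b q) (\<lambda>a b. gv' a b q))"
    then show "components S \<Gamma> M.D N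
         (\<lambda>\<alpha> \<beta> \<gamma> q. Hh0 \<alpha> \<beta> \<gamma> q + 1/2 * (\<Sum>\<epsilon><m. gh' \<alpha> \<epsilon> q *
            cov_gh S (delta S \<Gamma> N \<gamma>) (\<lambda>\<theta> \<eta>. Hh0 \<theta> \<eta> \<gamma>) gh \<epsilon> \<beta> q))
         (\<lambda>a b \<gamma> q. Hv0 a b \<gamma> q + 1/2 * (\<Sum>e<r. gv' b e q *
            cov_gv S (delta S \<Gamma> N \<gamma>) (\<lambda>d d'. Hv0 d d' \<gamma>) gv e a q))
         (\<lambda>\<alpha> \<beta> c q. Vh0 \<alpha> \<beta> c q + 1/2 * (\<Sum>\<epsilon><m. gh' \<alpha> \<epsilon> q *
            cov_gh S (del_v N c) (\<lambda>\<theta> \<eta>. Vh0 \<theta> \<eta> c) gh \<epsilon> \<beta> q))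
         (\<lambda>a b c q. Vv0 a b c q + 1/2 * (\<Sum>e<r. gv' b e q *
            cov_gv S (del_v N c) (\<lambda>d d'. Vv0 d d' c) gv e a q))"
      by (elim conjE) (rule M.D_components[OF N], auto)
  qed
qed

section \<open>Tangent vectors\<close>

context atlas
begin

text \<open>Applied to a coordinate function, a linear combination of coordinate vectors returns one
  of its coefficients, which gives independence. The coordinate vectors of other charts are
  combinations by the chain rule.\<close>

lemma coord_vec_basis:
  assumes c: "c \<in> charts Q" "q \<in> fst c"
  shows "is_basis (mdim Q) (\<lambda>i. coord_vec Q c i q) (tspace Q q)"
proof (rule is_basisI)
  have "coord_vec Q d i q \<in> span ((\<lambda>i. coord_vec Q c i q) ` {..<mdim Q})"
    if "d \<in> charts Q" "q \<in> fst d" "i < mdim Q" for d i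
    by (subst coord_vec_transform[OF that(1,2) c that(3)]) (intro span_sum span_scale span_base, auto)
  then have "tspace Q q \<subseteq> span ((\<lambda>i. coord_vec Q c i q) ` {..<mdim Q})"
    unfolding tspace_def by (intro span_minimal subspace_span) blast
  moreover have "span ((\<lambda>i. coord_vec Q c i q) ` {..<mdim Q}) \<subseteq> tspace Q q"
    unfolding tspace_def using c by (intro span_mono) blast
  ultimately show "tspace Q q = span ((\<lambda>i. coord_vec Q c i q) ` {..<mdim Q})" by blast
  fix a i assume a: "(\<Sum>i<mdim Q. a i *\<^sub>R coord_vec Q c i q) = 0" and i: "i < mdim Q"
  have "(\<Sum>j<mdim Q. a j *\<^sub>R coord_vec Q c j q) (\<lambda>z. snd c z i) = 0" using a by simp
  then have "(\<Sum>j<mdim Q. a j * (if j = i then 1 else 0)) = 0"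
    using coord_vec_coordinate[OF c] by (simp add: sum_apply_fun scaleR_fun_def)
  then show "a i = 0" using i by (simp add: if_distrib sum.delta cong: if_cong)
qed

lemma tspace_subspace: "subspace (tspace Q q)"
  unfolding tspace_def by (rule subspace_span)

lemma coord_vec_mem: "c \<in> charts Q \<Longrightarrow> q \<in> fst c \<Longrightarrow> i < mdim Q \<Longrightarrow> coord_vec Q c i q \<in> tspace Q q"
  using basis.basis_mem[OF basis.intro[OF coord_vec_basis]] .

lemma tspace_expand:
  assumes c: "c \<in> charts Q" "q \<in> fst c" and w: "w \<in> tspace Q q"
  shows "w = (\<Sum>i<mdim Q. w (\<lambda>z. snd c z i) *\<^sub>R coord_vec Q c i q)"
    and "i < mdim Q \<Longrightarrow> dual_basis (mdim Q) (\<lambda>i. coord_vec Q c i q) i w = w (\<lambda>z. snd c z i)"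
proof -
  interpret b: basis "mdim Q" "\<lambda>i. coord_vec Q c i q" "tspace Q q"
    by standard (rule coord_vec_basis[OF c])
  have *: "dual_basis (mdim Q) (\<lambda>i. coord_vec Q c i q) i w = w (\<lambda>z. snd c z i)" if i: "i < mdim Q" for i
  proof -
    have "w (\<lambda>z. snd c z i) = (\<Sum>j<mdim Q. dual_basis (mdim Q) (\<lambda>i. coord_vec Q c i q) j w *\<^sub>R coord_vec Q c j q) (\<lambda>z. snd c z i)"
      using b.expand[OF w] by simp
    also have "\<dots> = (\<Sum>j<mdim Q. dual_basis (mdim Q) (\<lambda>i. coord_vec Q c i q) j w * (if j = i then 1 else 0))"
      using coord_vec_coordinate[OF c] by (simp add: sum_apply_fun scaleR_fun_def)
    finally show ?thesis using i by (simp add: if_distrib sum.delta cong: if_cong)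
  qed
  then show "i < mdim Q \<Longrightarrow> dual_basis (mdim Q) (\<lambda>i. coord_vec Q c i q) i w = w (\<lambda>z. snd c z i)" .
  show "w = (\<Sum>i<mdim Q. w (\<lambda>z. snd c z i) *\<^sub>R coord_vec Q c i q)"
    using b.expand[OF w] * by simp
qed

lemma tspace_apply:
  assumes c: "c \<in> charts Q" "q \<in> fst c" and w: "w \<in> tspace Q q"
  shows "w u = (\<Sum>i<mdim Q. w (\<lambda>z. snd c z i) * coord_vec Q c i q u)"
  by (subst tspace_expand(1)[OF c w]) (simp add: sum_apply_fun scaleR_fun_def)

lemma tspace_cong:
  assumes q: "q \<in> pts Q" and w: "w \<in> tspace Q q" and u: "eq_near Q q u u'"
  shows "w u = w u'"
proof -
  obtain c where c: "c \<in> charts Q" "q \<in> fst c" using q unfolding pts_def by blast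
  show ?thesis
    unfolding tspace_apply[OF c w, of u] tspace_apply[OF c w, of u']
    using coord_vec_cong[OF u c] by simp
qed

lemma tspace_not_smooth: "q \<in> pts Q \<Longrightarrow> w \<in> tspace Q q \<Longrightarrow> \<not> smooth_near Q q u \<Longrightarrow> w u = 0"
proof -
  assume q: "q \<in> pts Q" and w: "w \<in> tspace Q q" and u: "\<not> smooth_near Q q u"
  obtain c where c: "c \<in> charts Q" "q \<in> fst c" using q unfolding pts_def by blast
  show "w u = 0" using u by (simp add: tspace_apply[OF c w, of u] coord_vec_def)
qed

lemma tangent_local_frame: "c \<in> charts Q \<Longrightarrow> local_frame Q (mdim Q) (tspace Q) (fst c, coord_vec Q c)"
  by (simp add: local_frame_iff openin_chart coord_vec_basis)

text \<open>The transition matrix is the Jacobian of the change of coordinates.\<close>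

lemma tangent_frame_compat:
  assumes c: "c \<in> charts Q" and d: "d \<in> charts Q"
  shows "frame_compat Q (mdim Q) (fst c, coord_vec Q c) (fst d, coord_vec Q d)"
  unfolding frame_compat_def coframe_eq fst_conv snd_conv
proof (intro allI impI)
  fix a b assume ab: "a < mdim Q" "b < mdim Q"
  have o: "openin (mtop Q) (fst c \<inter> fst d)" using openin_chart c d by (intro openin_Int)
  show "smooth_fun Q (fst c \<inter> fst d) (\<lambda>x. dual_basis (mdim Q) (\<lambda>b. coord_vec Q c b x) a (coord_vec Q d b x))"
  proof (rule smooth_fun_eqI[OF o smooth_fun_coord_vec[OF d smooth_fun_coordinate[OF c] openin_chart[OF c] ab(2)]])
    fix x assume "x \<in> fst c \<inter> fst d"
    then show "dual_basis (mdim Q) (\<lambda>b. coord_vec Q c b x) a (coord_vec Q d b x) = coord_vec Q d b x (\<lambda>x. snd c x a)"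
      using tspace_expand(2)[OF c _ coord_vec_mem[OF d _ ab(2)] ab(1)] by simp
  qed
qed

lemma tangent_frame: "c \<in> charts Q \<Longrightarrow> (fst c, coord_vec Q c) \<in> frames (tangent_bundle Q)"
proof -
  assume c: "c \<in> charts Q"
  have "(fst c, coord_vec Q c) \<in> gen_frames Q (mdim Q) (tspace Q) {(fst c, coord_vec Q c) |c. c \<in> charts Q}"
    unfolding gen_frames_def
  proof (intro CollectI conjI ballI tangent_local_frame[OF c])
    fix g assume "g \<in> {(fst c, coord_vec Q c) |c. c \<in> charts Q}"
    then obtain d where d: "d \<in> charts Q" "g = (fst d, coord_vec Q d)" by blast
    show "frame_compat Q (mdim Q) (fst c, coord_vec Q c) g" "frame_compat Q (mdim Q) g (fst c, coord_vec Q c)"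
      unfolding d(2) by (intro tangent_frame_compat c d(1))+
  qed
  then show ?thesis by (simp add: tangent_bundle_def)
qed

end

section \<open>The total space of the dual bundle\<close>

locale dual_bundle =
  fixes M :: "'m mfd" and E :: "('m, 'v::real_vector) vbundle"
  assumes M: "smooth_manifold M" and E: "vector_bundle M E"
begin

sublocale M: hausdorff_atlas M
  by standard (use M in \<open>simp_all add: smooth_manifold_def\<close>)

abbreviation "Q \<equiv> dual_mfd M E"
abbreviation "n \<equiv> mdim M"
abbreviation "r \<equiv> rank E"
abbreviation "dc \<equiv> dual_chart M E"

lemma E_basis: "e \<in> frames E \<Longrightarrow> x \<in> fst e \<Longrightarrow> is_basis r (\<lambda>a. snd e a x) (fib E x)"
  and E_open: "e \<in> frames E \<Longrightarrow> openin (mtop M) (fst e)"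
  and E_cover: "\<Union> (fst ` frames E) = pts M"
  and E_compat: "e \<in> frames E \<Longrightarrow> e' \<in> frames E \<Longrightarrow> frame_compat M r e e'"
  using E by (auto simp: vector_bundle_def local_frame_iff)

lemma mdim_Q [simp]: "mdim Q = n + r" by (simp add: dual_mfd_def)

lemma charts_Q: "C \<in> charts Q \<longleftrightarrow> (\<exists>c\<in>charts M. \<exists>e\<in>frames E. C = dc c e)"
  by (auto simp: dual_mfd_def)

lemma dc_charts: "c \<in> charts M \<Longrightarrow> e \<in> frames E \<Longrightarrow> dc c e \<in> charts Q"
  unfolding charts_Q by blast

lemma fst_dc: "q \<in> fst (dc c e) \<longleftrightarrow> fst q \<in> fst c \<and> fst q \<in> fst e \<and> snd q \<in> dual_space (fib E (fst q))"
  by (auto simp: dual_chart_def)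

lemma snd_dc: "snd (dc c e) q k = (if k < n then snd c (fst q) k else if k < n + r then snd q (snd e (k - n) (fst q)) else 0)"
  by (simp add: dual_chart_def split: prod.split)

text \<open>The projection of the total space onto M, in coordinates.\<close>

definition trunc :: "(nat \<Rightarrow> real) \<Rightarrow> nat \<Rightarrow> real" where
  "trunc y = (\<lambda>k. if k < n then y k else 0)"

lemma trunc_dc: "c \<in> charts M \<Longrightarrow> fst q \<in> fst c \<Longrightarrow> trunc (snd (dc c e) q) = snd c (fst q)"
  using M.chart_eq_0[of c "fst q"] by (auto simp: trunc_def snd_dc fun_eq_iff)

text \<open>The image is the product of the image of U with all of the fibre directions: any values
  of the p_a come from a covector, because the frame is a basis of the fibre.\<close>

lemma dc_image:
  assumes c: "c \<in> charts M" and e: "e \<in> frames E" and U: "U \<subseteq> fst c \<inter> fst e"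
  shows "snd (dc c e) ` {q \<in> fst (dc c e). fst q \<in> U} = {y. (\<forall>k\<ge>n + r. y k = 0) \<and> trunc y \<in> snd c ` U}"
proof
  show "snd (dc c e) ` {q \<in> fst (dc c e). fst q \<in> U} \<subseteq> {y. (\<forall>k\<ge>n + r. y k = 0) \<and> trunc y \<in> snd c ` U}"
  proof
    fix y assume "y \<in> snd (dc c e) ` {q \<in> fst (dc c e). fst q \<in> U}"
    then obtain q where q: "q \<in> fst (dc c e)" "fst q \<in> U" "y = snd (dc c e) q" by blast
    then have "trunc y = snd c (fst q)" using trunc_dc[OF c] by (simp add: fst_dc)
    then show "y \<in> {y. (\<forall>k\<ge>n + r. y k = 0) \<and> trunc y \<in> snd c ` U}"
      using q by (simp add: snd_dc)
  qed
  show "{y. (\<forall>k\<ge>n + r. y k = 0) \<and> trunc y \<in> snd c ` U} \<subseteq> snd (dc c e) ` {q \<in> fst (dc c e). fst q \<in> U}"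
  proof
    fix y assume "y \<in> {y. (\<forall>k\<ge>n + r. y k = 0) \<and> trunc y \<in> snd c ` U}"
    then obtain x where x: "x \<in> U" "trunc y = snd c x" and y: "\<And>k. k \<ge> n + r \<Longrightarrow> y k = 0" by blast
    have xe: "x \<in> fst e" "x \<in> fst c" using x U by auto
    interpret b: basis r "\<lambda>a. snd e a x" "fib E x" by standard (rule E_basis[OF e xe(1)])
    define \<omega> where "\<omega> = (\<Sum>a<r. y (n + a) *\<^sub>R dual_basis r (\<lambda>a. snd e a x) a)"
    have \<omega>: "\<omega> \<in> dual_space (fib E x)"
      unfolding \<omega>_def by (intro subspace_sum subspace_scale dual_space_subspace b.dual_basis_mem)
    have \<omega>e: "\<omega> (snd e a x) = y (n + a)" if "a < r" for a
      using that by (simp add: \<omega>_def sum_apply_fun scaleR_fun_def b.dual_basis_basis if_distrib sum.delta cong: if_cong)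
    have "snd (dc c e) (x, \<omega>) k = y k" for k
      using fun_cong[OF x(2), of k] \<omega>e[of "k - n"] y[of k] by (auto simp: snd_dc trunc_def)
    then have "y = snd (dc c e) (x, \<omega>)" by (simp add: fun_eq_iff)
    then show "y \<in> snd (dc c e) ` {q \<in> fst (dc c e). fst q \<in> U}"
      by (rule image_eqI) (use \<omega> x xe in \<open>simp add: fst_dc\<close>)
  qed
qed

lemma continuous_trunc: "continuous_on UNIV trunc"
proof (rule continuous_on_coordinatewise_then_product)
  show "continuous_on UNIV (\<lambda>y. trunc y i)" for i
    by (cases "i < n") (simp_all add: trunc_def continuous_on_coordinate)
qed

lemma dc_image_open:
  assumes c: "c \<in> charts M" and e: "e \<in> frames E" and U: "U \<subseteq> fst c \<inter> fst e" "openin (mtop M) U"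
  shows "openin (Euclidean_space (n + r)) (snd (dc c e) ` {q \<in> fst (dc c e). fst q \<in> U})"
proof -
  have "openin (Euclidean_space n) (snd c ` U)"
    using M.openin_image[OF U(2) c] U(1) by (simp add: Int_absorb2)
  then obtain T where T: "open T" "snd c ` U = T \<inter> {y. \<forall>i\<ge>n. y i = 0}"
    by (auto simp: openin_Euclidean_space_iff)
  have "open (trunc -` T)" by (rule open_vimage[OF T(1) continuous_trunc])
  moreover have "snd (dc c e) ` {q \<in> fst (dc c e). fst q \<in> U} = trunc -` T \<inter> {y. \<forall>i\<ge>n + r. y i = 0}"
    unfolding dc_image[OF c e U(1)] T(2) by (auto simp: trunc_def)
  ultimately show ?thesis unfolding openin_Euclidean_space_iff by blast
qed

lemma dc_inj:
  assumes c: "c \<in> charts M" and e: "e \<in> frames E"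
  shows "inj_on (snd (dc c e)) (fst (dc c e))"
proof (rule inj_onI)
  fix q q' assume q: "q \<in> fst (dc c e)" "q' \<in> fst (dc c e)" and eq: "snd (dc c e) q = snd (dc c e) q'"
  have "snd c (fst q) = snd c (fst q')"
    using trunc_dc[OF c, of q e] trunc_dc[OF c, of q' e] q eq by (simp add: fst_dc)
  then have x: "fst q = fst q'"
    using M.chart_inj[OF c] q by (auto simp: fst_dc inj_on_def)
  interpret b: basis r "\<lambda>a. snd e a (fst q)" "fib E (fst q)"
    by standard (rule E_basis[OF e], use q in \<open>simp add: fst_dc\<close>)
  have "snd q (snd e a (fst q)) = snd q' (snd e a (fst q))" if "a < r" for a
    using fun_cong[OF eq, of "n + a"] that x by (simp add: snd_dc)
  then have "snd q = snd q'"
    using q x by (intro b.dual_space_ext) (auto simp: fst_dc)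
  then show "q = q'" using x by (simp add: prod_eq_iff)
qed

lemma dc_in_chart:
  assumes c: "c \<in> charts M" and e: "e \<in> frames E" and q: "q \<in> fst (dc c e)"
  shows "in_chart (dc c e) f (snd (dc c e) q) = f q"
  using dc_inj[OF c e] q by (simp add: in_chart_def inv_into_f_f)

lemma dc_is_chart:
  assumes c: "c \<in> charts M" and e: "e \<in> frames E"
  shows "is_chart (n + r) (dc c e)"
proof -
  have "{q \<in> fst (dc c e). fst q \<in> fst c \<inter> fst e} = fst (dc c e)" by (auto simp: fst_dc)
  then show ?thesis
    unfolding is_chart_def
    using dc_inj[OF c e] dc_image_open[OF c e order_refl] M.openin_chart[OF c] E_open[OF e]
    by (simp add: openin_Int)
qed

text \<open>In bundle coordinates a function of the base point is its expression on M composed with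
  the truncation of coordinates.\<close>

lemma pullback_in_chart:
  assumes c: "c \<in> charts M" and e: "e \<in> frames E" and U: "U \<subseteq> fst c \<inter> fst e" "openin (mtop M) U"
    and u: "smooth_fun M U u"
  shows "smooth_on (n + r) (snd (dc c e) ` {q \<in> fst (dc c e). fst q \<in> U}) (in_chart (dc c e) (\<lambda>q. u (fst q)))"
proof -
  define S where "S = snd (dc c e) ` {q \<in> fst (dc c e). fst q \<in> U}"
  have S: "openin (Euclidean_space (n + r)) S" unfolding S_def by (rule dc_image_open[OF c e U])
  have T: "openin (Euclidean_space n) (snd c ` (U \<inter> fst c))" by (rule M.openin_image[OF U(2) c])
  have "smooth_on (n + r) S (\<lambda>y. in_chart c u (trunc y))"
  proof (rule smooth_on_compose[OF S T _ M.smooth_fun_in_chart[OF u c]])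
    show "trunc y \<in> snd c ` (U \<inter> fst c)" if yS: "y \<in> S" for y
    proof -
      obtain q where q: "q \<in> fst (dc c e)" "fst q \<in> U" "y = snd (dc c e) q" using yS unfolding S_def by blast
      then have "trunc y = snd c (fst q)" "fst q \<in> U \<inter> fst c" using trunc_dc[OF c] by (simp_all add: fst_dc)
      then show ?thesis by (simp only: image_eqI)
    qed
    show "smooth_on (n + r) S (\<lambda>y. trunc y j)" if "j < n" for j
      using that Ck_on_coordinate[OF S] by (simp add: smooth_on_def trunc_def)
  qed
  then show ?thesis
    unfolding S_def[symmetric]
  proof (rule smooth_on_cong[OF S, THEN iffD1, rotated])
    fix y assume "y \<in> S"
    then obtain q where q: "q \<in> fst (dc c e)" "y = snd (dc c e) q" unfolding S_def by blast
    then have qc: "fst q \<in> fst c" by (simp add: fst_dc)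
    show "in_chart c u (trunc y) = in_chart (dc c e) (\<lambda>q. u (fst q)) y"
      unfolding q(2) trunc_dc[OF c qc] dc_in_chart[OF c e q(1)] by (rule M.in_chart_eq[OF c qc])
  qed
qed

text \<open>The base coordinates change as in M. The fibre coordinates change linearly, with the
  transition functions of the frames, pulled back from M, as coefficients.\<close>

lemma dc_compat:
  assumes c: "c \<in> charts M" and e: "e \<in> frames E" and c': "c' \<in> charts M" and e': "e' \<in> frames E"
  shows "chart_compat (n + r) (dc c e) (dc c' e')"
proof -
  define U where "U = (fst c \<inter> fst e) \<inter> (fst c' \<inter> fst e')"
  have U: "U \<subseteq> fst c \<inter> fst e" "openin (mtop M) U"
    unfolding U_def by (blast, intro openin_Int M.openin_chart E_open c e c' e')
  have eq: "fst (dc c e) \<inter> fst (dc c' e') = {q \<in> fst (dc c e). fst q \<in> U}"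
    by (auto simp: fst_dc U_def)
  define S where "S = snd (dc c e) ` {q \<in> fst (dc c e). fst q \<in> U}"
  have S: "openin (Euclidean_space (n + r)) S" unfolding S_def by (rule dc_image_open[OF c e U])
  have pb: "smooth_on (n + r) S (in_chart (dc c e) (\<lambda>q. u (fst q)))" if "smooth_fun M U u" for u
    unfolding S_def by (rule pullback_in_chart[OF c e U that])
  have "smooth_on (n + r) S (in_chart (dc c e) (\<lambda>q. snd (dc c' e') q k))" if k: "k < n + r" for k
  proof (cases "k < n")
    case True
    have "smooth_fun M U (\<lambda>x. snd c' x k)"
      by (rule M.smooth_fun_subset[OF M.smooth_fun_coordinate[OF c']]) (auto simp: U_def)
    from pb[OF this] show ?thesis using True by (simp add: snd_dc)
  next
    case False
    define a where "a = k - n"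
    have a: "a < r" "k = n + a" using False k by (auto simp: a_def)
    define t where "t b x = dual_basis r (\<lambda>a. snd e a x) b (snd e' a x)" for b x
    have t: "smooth_fun M U (t b)" if "b < r" for b
    proof (rule M.smooth_fun_subset)
      show "smooth_fun M (fst e \<inter> fst e') (t b)"
        using E_compat[OF e e'] that a(1) unfolding frame_compat_def coframe_eq t_def[abs_def] by blast
    qed (auto simp: U_def)
    have "smooth_on (n + r) S (\<lambda>y. \<Sum>b<r. in_chart (dc c e) (\<lambda>q. t b (fst q)) y * y (n + b))"
      unfolding smooth_on_def
      by (intro allI Ck_on_sum Ck_on_mult Ck_on_coordinate S) (use pb[OF t] in \<open>auto simp: smooth_on_def\<close>)
    then show ?thesis
    proof (rule smooth_on_cong[OF S, THEN iffD1, rotated])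
      fix y assume "y \<in> S"
      then obtain q where q: "q \<in> fst (dc c e)" "fst q \<in> U" "y = snd (dc c e) q" unfolding S_def by blast
      interpret b: basis r "\<lambda>a. snd e a (fst q)" "fib E (fst q)"
        by standard (rule E_basis[OF e], use q in \<open>simp add: fst_dc\<close>)
      interpret b': basis r "\<lambda>a. snd e' a (fst q)" "fib E (fst q)"
        by standard (rule E_basis[OF e'], use q in \<open>simp add: U_def\<close>)
      have \<omega>: "snd q \<in> dual_space (fib E (fst q))" using q by (simp add: fst_dc)
      have "snd q (snd e' a (fst q)) = snd q (\<Sum>b<r. t b (fst q) *\<^sub>R snd e b (fst q))"
        using b.expand[OF b'.basis_mem[OF a(1)]] by (simp add: t_def)
      also have "\<dots> = (\<Sum>b<r. t b (fst q) * snd q (snd e b (fst q)))"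
        by (rule dual_space_sum[OF \<omega> b.subspace]) (simp add: b.basis_mem)
      finally show "(\<Sum>b<r. in_chart (dc c e) (\<lambda>q. t b (fst q)) y * y (n + b)) = in_chart (dc c e) (\<lambda>q. snd (dc c' e') q k) y"
        using a unfolding q(3) by (simp add: dc_in_chart[OF c e q(1)] snd_dc)
    qed
  qed
  then show ?thesis
    using S by (simp add: chart_compat_def eq S_def)
qed

sublocale Q: atlas Q
proof
  show "is_chart (mdim Q) C" if "C \<in> charts Q" for C
    using that dc_is_chart unfolding charts_Q by auto
  show "chart_compat (mdim Q) C C'" if "C \<in> charts Q" "C' \<in> charts Q" for C C'
    using that dc_compat unfolding charts_Q by auto
qed

lemma pts_Q: "q \<in> pts Q \<longleftrightarrow> fst q \<in> pts M \<and> snd q \<in> dual_space (fib E (fst q))"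
proof
  assume "q \<in> pts Q"
  then obtain C where C: "C \<in> charts Q" "q \<in> fst C" unfolding pts_def by blast
  then obtain c e where ce: "c \<in> charts M" "C = dc c e" unfolding charts_Q by blast
  then have "fst q \<in> fst c" "snd q \<in> dual_space (fib E (fst q))" using C(2) by (simp_all add: fst_dc)
  then show "fst q \<in> pts M \<and> snd q \<in> dual_space (fib E (fst q))"
    using M.chart_subset_pts[OF ce(1)] by blast
next
  assume q: "fst q \<in> pts M \<and> snd q \<in> dual_space (fib E (fst q))"
  then obtain c where c: "c \<in> charts M" "fst q \<in> fst c" unfolding pts_def by blast
  obtain e where e: "e \<in> frames E" "fst q \<in> fst e" using q E_cover by blast
  have "q \<in> fst (dc c e)" using q c e by (simp add: fst_dc)
  then show "q \<in> pts Q" using Q.chart_subset_pts[OF dc_charts[OF c(1) e(1)]] by blast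
qed

lemma pts_Q_chart:
  assumes "q \<in> pts Q"
  obtains c e where "c \<in> charts M" "e \<in> frames E" "q \<in> fst (dc c e)"
proof -
  obtain C where "C \<in> charts Q" "q \<in> fst C" using assms unfolding pts_def by blast
  then show ?thesis using that unfolding charts_Q by blast
qed

lemma dc_Int: "{q \<in> pts Q. fst q \<in> U} \<inter> fst (dc c e) = {q \<in> fst (dc c e). fst q \<in> U \<inter> (fst c \<inter> fst e)}"
  if "c \<in> charts M" "e \<in> frames E"
  using Q.chart_subset_pts[OF dc_charts[OF that]] by (auto simp: fst_dc)

lemma openin_pullback:
  assumes U: "openin (mtop M) U"
  shows "openin (mtop Q) {q \<in> pts Q. fst q \<in> U}"
  unfolding Q.openin_mtop
proof (intro conjI ballI)
  fix C assume "C \<in> charts Q"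
  then obtain c e where C: "c \<in> charts M" "e \<in> frames E" "C = dc c e" unfolding charts_Q by blast
  have "openin (mtop M) (U \<inter> (fst c \<inter> fst e))"
    using U M.openin_chart[OF C(1)] E_open[OF C(2)] by (intro openin_Int)
  then show "openin (Euclidean_space (mdim Q)) (snd C ` ({q \<in> pts Q. fst q \<in> U} \<inter> fst C))"
    unfolding C(3) dc_Int[OF C(1,2)] mdim_Q by (intro dc_image_open C) auto
qed auto

lemma smooth_fun_pullback:
  assumes U: "openin (mtop M) U" and u: "smooth_fun M U u"
  shows "smooth_fun Q {q \<in> pts Q. fst q \<in> U} (\<lambda>q. u (fst q))"
  unfolding smooth_fun_def
proof
  fix C assume "C \<in> charts Q"
  then obtain c e where C: "c \<in> charts M" "e \<in> frames E" "C = dc c e" unfolding charts_Q by blast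
  have o: "openin (mtop M) (U \<inter> (fst c \<inter> fst e))"
    using U M.openin_chart[OF C(1)] E_open[OF C(2)] by (intro openin_Int)
  show "smooth_on (mdim Q) (snd C ` ({q \<in> pts Q. fst q \<in> U} \<inter> fst C)) (in_chart C (\<lambda>q. u (fst q)))"
    unfolding C(3) dc_Int[OF C(1,2)] mdim_Q
    by (rule pullback_in_chart[OF C(1,2) _ o M.smooth_fun_subset[OF u]]) auto
qed

text \<open>Points over different base points are separated by preimages of open sets of M. Points
  over the same base point lie in a common bundle chart, because its domain contains whole fibres,
  and a coordinate in which they differ separates them.\<close>

lemma Q_hausdorff: "Hausdorff_space (mtop Q)"
  unfolding Hausdorff_space_def Q.topspace_mtop
proof (intro allI impI)
  fix q q' assume "q \<in> pts Q \<and> q' \<in> pts Q \<and> q \<noteq> q'"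
  then have q: "q \<in> pts Q" "q' \<in> pts Q" "q \<noteq> q'" by auto
  show "\<exists>U V. openin (mtop Q) U \<and> openin (mtop Q) V \<and> q \<in> U \<and> q' \<in> V \<and> disjnt U V"
  proof (cases "fst q = fst q'")
    case False
    moreover have "fst q \<in> topspace (mtop M)" "fst q' \<in> topspace (mtop M)"
      using q by (auto simp: pts_Q M.topspace_mtop)
    ultimately obtain U V where UV: "openin (mtop M) U" "openin (mtop M) V" "fst q \<in> U" "fst q' \<in> V" "disjnt U V"
      using M.hausdorff unfolding Hausdorff_space_def by blast
    show ?thesis
      using openin_pullback[OF UV(1)] openin_pullback[OF UV(2)] UV(3-5) q
      by (intro exI[of _ "{q \<in> pts Q. fst q \<in> U}"] exI[of _ "{q \<in> pts Q. fst q \<in> V}"])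
        (auto simp: disjnt_def)
  next
    case True
    obtain c e where ce: "c \<in> charts M" "e \<in> frames E" "q \<in> fst (dc c e)"
      using pts_Q_chart[OF q(1)] .
    have q': "q' \<in> fst (dc c e)" using ce(3) q(2) True by (simp add: fst_dc pts_Q)
    define f where "f = snd (dc c e)"
    have "f q \<noteq> f q'" using dc_inj[OF ce(1,2)] ce(3) q' q(3) unfolding f_def inj_on_def by blast
    then obtain k where k: "f q k \<noteq> f q' k" by (auto simp: fun_eq_iff)
    \<comment> \<open>Formulated for an ordered pair of coordinate values, to be applied to the two
      points in either order.\<close>
    have sep: "\<exists>U V. openin (mtop Q) U \<and> openin (mtop Q) V \<and> p \<in> U \<and> p' \<in> V \<and> disjnt U V"
      if p: "p \<in> fst (dc c e)" "p' \<in> fst (dc c e)" "f p k < f p' k" for p p'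
    proof -
      define s where "s = (f p k + f p' k) / 2"
      have s: "f p k < s" "s < f p' k" using p(3) by (auto simp: s_def)
      define A where "A = {y :: nat \<Rightarrow> real. y k < s} \<inter> {y. \<forall>i\<ge>mdim Q. y i = 0}"
      define B where "B = {y :: nat \<Rightarrow> real. s < y k} \<inter> {y. \<forall>i\<ge>mdim Q. y i = 0}"
      have "open {y :: nat \<Rightarrow> real. y k < s}" "open {y :: nat \<Rightarrow> real. s < y k}"
        by (intro open_Collect_less continuous_on_coordinate continuous_on_const)+
      then have AB: "openin (Euclidean_space (mdim Q)) A" "openin (Euclidean_space (mdim Q)) B"
        unfolding openin_Euclidean_space_iff A_def B_def by blast+
      have o: "openin (mtop Q) {z \<in> fst (dc c e). f z \<in> A}" "openin (mtop Q) {z \<in> fst (dc c e). f z \<in> B}"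
        unfolding f_def
        by (rule Q.openin_chart_preimage[OF dc_charts[OF ce(1,2)] AB(1)],
            rule Q.openin_chart_preimage[OF dc_charts[OF ce(1,2)] AB(2)])
      have "f p \<in> A" "f p' \<in> B"
        using s Q.chart_eq_0[OF dc_charts[OF ce(1,2)]] p unfolding A_def B_def f_def by auto
      moreover have "A \<inter> B = {}" by (auto simp: A_def B_def)
      ultimately show ?thesis
        using o p by (intro exI[of _ "{z \<in> fst (dc c e). f z \<in> A}"] exI[of _ "{z \<in> fst (dc c e). f z \<in> B}"])
          (auto simp: disjnt_def)
    qed
    show ?thesis
    proof (cases "f q k < f q' k")
      case True
      then show ?thesis by (rule sep[OF ce(3) q'])
    next
      case False
      then have "f q' k < f q k" using k by simp
      from sep[OF q' ce(3) this] obtain U V where "openin (mtop Q) U" "openin (mtop Q) V" "q' \<in> U" "q \<in> V" "disjnt U V"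
        by blast
      then show ?thesis by (intro exI[of _ V] exI[of _ U]) (simp add: disjnt_sym)
    qed
  qed
qed

sublocale Q: hausdorff_atlas Q
  by standard (rule Q_hausdorff)

section \<open>Tangent vectors of the total space and the projection to the base\<close>

lemma smooth_near_pullback:
  assumes q: "q \<in> pts Q" and u: "smooth_near M (fst q) u"
  shows "smooth_near Q q (\<lambda>z. u (fst z))"
proof -
  obtain U where U: "openin (mtop M) U" "fst q \<in> U" "smooth_fun M U u"
    using u unfolding smooth_near_def by blast
  show ?thesis
    unfolding smooth_near_def
    using openin_pullback[OF U(1)] smooth_fun_pullback[OF U(1,3)] U(2) q
    by (intro exI[of _ "{q \<in> pts Q. fst q \<in> U}"]) auto
qed

lemma eq_near_coordinate:
  assumes c: "c \<in> charts M" and e: "e \<in> frames E" and q: "q \<in> fst (dc c e)" and i: "i < n"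
  shows "eq_near Q q (\<lambda>z. snd (dc c e) z i) (\<lambda>z. snd c (fst z) i)"
  unfolding eq_near_def using Q.openin_chart[OF dc_charts[OF c e]] q i
  by (intro exI[of _ "fst (dc c e)"]) (auto simp: snd_dc)

text \<open>A function of the base point depends on the first n bundle coordinates only. So the
  vectors d/dp_a annihilate it, and the vectors d/dx^i act as on M.\<close>

lemma coord_vec_pullback:
  assumes c: "c \<in> charts M" and e: "e \<in> frames E" and q: "q \<in> fst (dc c e)" and i: "i < n + r"
    and u: "smooth_near M (fst q) u"
  shows "coord_vec Q (dc c e) i q (\<lambda>z. u (fst z)) = (if i < n then coord_vec M c i (fst q) u else 0)"
proof -
  obtain U where U: "openin (mtop M) U" "fst q \<in> U" "smooth_fun M U u"
    using u unfolding smooth_near_def by blast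
  note C = dc_charts[OF c e]
  have qp: "q \<in> pts Q" using Q.chart_subset_pts[OF C] q by blast
  have iQ: "i < mdim Q" using i by simp
  define W where "W = {z \<in> pts Q. fst z \<in> U \<inter> fst c}"
  have Uo: "openin (mtop M) (U \<inter> fst c)" using U(1) M.openin_chart[OF c] by (rule openin_Int)
  have W: "openin (mtop Q) W" "q \<in> W"
    unfolding W_def using openin_pullback[OF Uo] U(2) q qp by (auto simp: fst_dc)
  have "coord_vec Q (dc c e) i q (\<lambda>z. u (fst z)) =
      (\<Sum>j<n. partial_deriv j (in_chart c u) (snd c (fst q)) * coord_vec Q (dc c e) i q (\<lambda>z. snd c (fst z) j))"
  proof (rule Q.coord_vec_chain[OF C q iQ W M.openin_image[OF U(1) c] M.smooth_fun_in_chart[OF U(3) c]])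
    show "smooth_fun Q W (\<lambda>z. snd c (fst z) j)" for j
      unfolding W_def by (rule smooth_fun_pullback[OF Uo M.smooth_fun_subset[OF M.smooth_fun_coordinate[OF c]]]) auto
    show "snd c (fst z) \<in> snd c ` (U \<inter> fst c)" if "z \<in> W" for z using that by (auto simp: W_def)
    show "u (fst z) = in_chart c u (snd c (fst z))" if "z \<in> W" for z
      using that M.in_chart_eq[OF c] by (simp add: W_def)
  qed (rule smooth_near_pullback[OF qp u])
  also have "\<dots> = (\<Sum>j<n. partial_deriv j (in_chart c u) (snd c (fst q)) * (if i = j then 1 else 0))"
  proof (intro sum.cong refl arg_cong2[where f = "(*)"])
    fix j assume "j \<in> {..<n}"
    then have j: "j < n" by simp
    show "coord_vec Q (dc c e) i q (\<lambda>z. snd c (fst z) j) = (if i = j then 1 else 0)"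
      using Q.coord_vec_cong[OF eq_near_coordinate[OF c e q j] C q iQ] Q.coord_vec_coordinate[OF C q iQ, of j] by simp
  qed
  also have "\<dots> = (if i < n then partial_deriv i (in_chart c u) (snd c (fst q)) else 0)"
    by (simp add: if_distrib sum.delta cong: if_cong)
  also have "\<dots> = (if i < n then coord_vec M c i (fst q) u else 0)"
    using u by (simp add: coord_vec_def)
  finally show ?thesis .
qed

text \<open>The right-hand side is the image of w under the differential of the projection, in
  coordinates of M and applied to u.\<close>

lemma tspace_pullback:
  assumes c: "c \<in> charts M" and e: "e \<in> frames E" and q: "q \<in> fst (dc c e)" and w: "w \<in> tspace Q q"
    and u: "smooth_near M (fst q) u"
  shows "w (\<lambda>z. u (fst z)) = (\<Sum>i<n. w (\<lambda>z. snd c (fst z) i) * coord_vec M c i (fst q) u)"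
proof -
  note C = dc_charts[OF c e]
  have qp: "q \<in> pts Q" using Q.chart_subset_pts[OF C] q by blast
  have "w (\<lambda>z. u (fst z)) = (\<Sum>i<n + r. w (\<lambda>z. snd (dc c e) z i) * (if i < n then coord_vec M c i (fst q) u else 0))"
    unfolding Q.tspace_apply[OF C q w, of "\<lambda>z. u (fst z)"] mdim_Q
    by (intro sum.cong refl arg_cong2[where f = "(*)"] coord_vec_pullback[OF c e q _ u]) simp
  also have "\<dots> = (\<Sum>i<n. w (\<lambda>z. snd (dc c e) z i) * coord_vec M c i (fst q) u)"
    by (simp add: sum_lessThan_add)
  also have "\<dots> = (\<Sum>i<n. w (\<lambda>z. snd c (fst z) i) * coord_vec M c i (fst q) u)"
    by (intro sum.cong refl arg_cong2[where f = "(*)"] Q.tspace_cong[OF qp w eq_near_coordinate[OF c e q]]) simp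
  finally show ?thesis .
qed

subsection \<open>The classical case\<close>

text \<open>The two families of a natural base are the two halves of one coordinate frame.\<close>

lemma classical_nat_frame:
  "nat_frame (classical_tb M E) (classical_base M E c e) = (fst (dc c e), coord_vec Q (dc c e))"
  by (auto simp: nat_frame_def classical_tb_def classical_base_def ndom_def del_h_def del_v_def
    join_frame_def fun_eq_iff)

text \<open>For \<open>nat_vertical\<close>: the horizontal coordinates of a tangent vector are its
  values on the base coordinates, which are functions pulled back from M and are annihilated by
  every d/dp_b.\<close>

lemma classical_gen_tangent_bundle: "gen_tangent_bundle (classical_tb M E)"
proof
  let ?S = "classical_tb M E"
  have S: "base ?S = Q" "gbundle ?S = tangent_bundle Q" "hrank ?S = n" "vrank ?S = r"
    "anchor ?S = (\<lambda>w. w)" by (simp_all add: classical_tb_def)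
  have nb: "N \<in> nat_bases ?S \<longleftrightarrow> (\<exists>c\<in>charts M. \<exists>e\<in>frames E. N = classical_base M E c e)" for N
    by (auto simp: classical_tb_def)
  have nbI: "classical_base M E c e \<in> nat_bases ?S" if "c \<in> charts M" "e \<in> frames E" for c e
    unfolding nb by (rule bexI[OF bexI[OF HOL.refl that(2)] that(1)])
  have nd: "ndom (classical_base M E c e) = fst (dc c e)" for c e
    by (simp add: classical_base_def ndom_def)
  have R: "rank (tangent_bundle Q) = n + r" "fib (tangent_bundle Q) = tspace Q"
    by (simp_all add: tangent_bundle_def)
  show "is_chart (mdim (base ?S)) c" if "c \<in> charts (base ?S)" for c
    using that Q.is_chart by (simp add: S)
  show "chart_compat (mdim (base ?S)) c d" if "c \<in> charts (base ?S)" "d \<in> charts (base ?S)" for c d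
    using that Q.compat by (simp add: S)
  show "Hausdorff_space (mtop (base ?S))" using Q_hausdorff by (simp add: S)
  show "rank (gbundle ?S) = hrank ?S + vrank ?S" by (simp add: S R)
  have "nat_frame ?S ` nat_bases ?S = {(fst c, coord_vec Q c) |c. c \<in> charts Q}"
  proof (rule equalityI; rule subsetI)
    fix f assume "f \<in> nat_frame ?S ` nat_bases ?S"
    then obtain N where N: "f = nat_frame ?S N" "N \<in> nat_bases ?S" by (rule imageE)
    then obtain c e where ce: "c \<in> charts M" "e \<in> frames E" "N = classical_base M E c e"
      unfolding nb by (elim bexE)
    show "f \<in> {(fst c, coord_vec Q c) |c. c \<in> charts Q}"
      unfolding N(1) ce(3) classical_nat_frame
      by (intro CollectI exI[of _ "dc c e"] conjI refl dc_charts ce)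
  next
    fix f assume "f \<in> {(fst c, coord_vec Q c) |c. c \<in> charts Q}"
    then obtain C where C: "f = (fst C, coord_vec Q C)" "C \<in> charts Q" by (elim CollectE exE conjE)
    then obtain c e where ce: "c \<in> charts M" "e \<in> frames E" "C = dc c e"
      unfolding charts_Q by (elim bexE)
    show "f \<in> nat_frame ?S ` nat_bases ?S"
      by (rule image_eqI[of _ _ "classical_base M E c e"])
        (simp_all add: C(1) ce(3) classical_nat_frame nbI[OF ce(1,2)])
  qed
  then show "frames (gbundle ?S) = gen_frames (base ?S) (hrank ?S + vrank ?S) (fib (gbundle ?S)) (nat_frame ?S ` nat_bases ?S)"
    by (simp add: S tangent_bundle_def)
  show "local_frame (base ?S) (hrank ?S + vrank ?S) (fib (gbundle ?S)) (nat_frame ?S N)" if NS: "N \<in> nat_bases ?S" for N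
  proof -
    obtain c e where ce: "c \<in> charts M" "e \<in> frames E" "N = classical_base M E c e" 
      using NS unfolding nb by (elim bexE)
    show ?thesis
      using Q.tangent_local_frame[OF dc_charts[OF ce(1,2)]] by (simp add: ce(3) S R classical_nat_frame)
  qed
  show "frame_compat (base ?S) (hrank ?S + vrank ?S) (nat_frame ?S N) (nat_frame ?S N')"
    if N: "N \<in> nat_bases ?S" "N' \<in> nat_bases ?S" for N N'
  proof -
    obtain c e where ce: "c \<in> charts M" "e \<in> frames E" "N = classical_base M E c e" 
      using N unfolding nb by (elim bexE)
    obtain c' e' where ce': "c' \<in> charts M" "e' \<in> frames E" "N' = classical_base M E c' e'" 
      using N unfolding nb by (elim bexE)
    show ?thesis
      using Q.tangent_frame_compat[OF dc_charts[OF ce(1,2)] dc_charts[OF ce'(1,2)]]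
      by (simp add: ce(3) ce'(3) S R classical_nat_frame)
  qed
  show "coframe (hrank ?S + vrank ?S) (snd (nat_frame ?S N)) \<alpha> q (del_v N' b q) = 0"
    if N: "N \<in> nat_bases ?S" "N' \<in> nat_bases ?S" and q: "q \<in> ndom N" "q \<in> ndom N'"
      and \<alpha>: "\<alpha> < hrank ?S" and b: "b < vrank ?S" for N N' q \<alpha> b
  proof -
    obtain c e where ce: "c \<in> charts M" "e \<in> frames E" "N = classical_base M E c e" 
      using N unfolding nb by (elim bexE)
    obtain c' e' where ce': "c' \<in> charts M" "e' \<in> frames E" "N' = classical_base M E c' e'" 
      using N unfolding nb by (elim bexE)
    have q: "q \<in> fst (dc c e)" "q \<in> fst (dc c' e')" using q ce ce' nd by auto
    have \<alpha>: "\<alpha> < n" and b: "b < r" using \<alpha> b by (simp_all add: S)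
    have v: "del_v N' b q = coord_vec Q (dc c' e') (n + b) q"
      by (simp add: ce' classical_base_def del_v_def)
    have "coframe (n + r) (coord_vec Q (dc c e)) \<alpha> q (del_v N' b q) = coord_vec Q (dc c' e') (n + b) q (\<lambda>z. snd (dc c e) z \<alpha>)"
      unfolding v coframe_eq
      using Q.tspace_expand(2)[OF dc_charts[OF ce(1,2)] q(1) Q.coord_vec_mem[OF dc_charts[OF ce'(1,2)] q(2), of "n + b"], of \<alpha>] \<alpha> b
      by simp
    also have "\<dots> = coord_vec Q (dc c' e') (n + b) q (\<lambda>z. snd c (fst z) \<alpha>)"
      using b by (intro Q.coord_vec_cong[OF eq_near_coordinate[OF ce(1,2) q(1) \<alpha>] dc_charts[OF ce'(1,2)] q(2)]) simp
    also have "\<dots> = 0"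
      using coord_vec_pullback[OF ce'(1,2) q(2), of "n + b" "\<lambda>x. snd c x \<alpha>"] b q(1)
        M.smooth_near_coordinate[OF ce(1)] by (simp add: fst_dc)
    finally show ?thesis by (simp add: S ce(3) classical_nat_frame)
  qed
  show "\<exists>N\<in>nat_bases ?S. q \<in> ndom N" if qp: "q \<in> pts (base ?S)" for q
  proof -
    obtain c e where "c \<in> charts M" "e \<in> frames E" "q \<in> fst (dc c e)"
      by (rule pts_Q_chart[OF qp[unfolded S(1)]])
    then show ?thesis
      by (intro bexI[of _ "classical_base M E c e"]) (simp_all add: nd nbI)
  qed
  show "anchor ?S w u = anchor ?S w u'"
    if "q \<in> pts (base ?S)" "w \<in> fib (gbundle ?S) q" "eq_near (base ?S) q u u'" for q w u u'
    using Q.tspace_cong[of q w u u'] that by (simp add: S R)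
qed

end

subsection \<open>The generalized tangent bundle\<close>

text \<open>The fibrewise part of the structure. It is also applied to the tangent bundle of M with
  the identity as anchor, for the comparison with the classical case; smoothness of the frame
  changes and of the anchor enters in \<open>lie_algebroid_bundle\<close>.\<close>

locale anchored_bundle = dual_bundle M E for M :: "'m mfd" and E :: "('m, 'v::real_vector) vbundle" +
  fixes F :: "('m, 'f::real_vector) vbundle" and \<rho> :: "'m \<Rightarrow> 'f \<Rightarrow> 'm tvec"
  assumes F_frame: "t \<in> frames F \<Longrightarrow> local_frame M (rank F) (fib F) t"
    and F_cover: "\<Union> (fst ` frames F) = pts M"
    and \<rho>_mem: "x \<in> pts M \<Longrightarrow> v \<in> fib F x \<Longrightarrow> \<rho> x v \<in> tspace M x"
    and \<rho>_add: "x \<in> pts M \<Longrightarrow> v \<in> fib F x \<Longrightarrow> w \<in> fib F x \<Longrightarrow> \<rho> x (v + w) = \<rho> x v + \<rho> x w"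
    and \<rho>_scale: "x \<in> pts M \<Longrightarrow> v \<in> fib F x \<Longrightarrow> \<rho> x (k *\<^sub>R v) = k *\<^sub>R \<rho> x v"
begin

abbreviation "m \<equiv> rank F"
abbreviation "S \<equiv> gtb M E F \<rho>"
abbreviation "gb \<equiv> gtb_base M E \<rho>"

lemma F_basis: "t \<in> frames F \<Longrightarrow> x \<in> fst t \<Longrightarrow> is_basis m (\<lambda>a. snd t a x) (fib F x)"
  and F_open: "t \<in> frames F \<Longrightarrow> openin (mtop M) (fst t)"
  using F_frame[of t] by (simp_all add: local_frame_iff)

lemma S_simps: "base S = Q" "hrank S = m" "vrank S = r" "anchor S = snd" "nat_bases S = gtb_bases M E F \<rho>"
  "rank (gbundle S) = m + r" "fib (gbundle S) = gtb_fib M E F \<rho>"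
  by (simp_all add: gtb_def)

lemma gb_simps: "q \<in> ndom (gb c e t) \<longleftrightarrow> q \<in> fst (dc c e) \<and> fst q \<in> fst t"
  "del_h (gb c e t) \<alpha> q = (snd t \<alpha> (fst q), \<Sum>i<n. anchor_comp \<rho> c t \<alpha> i (fst q) *\<^sub>R coord_vec Q (dc c e) i q)"
  "del_v (gb c e t) a q = (0, coord_vec Q (dc c e) (n + a) q)"
  by (simp_all add: gtb_base_def ndom_def del_h_def del_v_def)

text \<open>Over q = (x, p), the fibre consists of the pairs (v, w) for which w projects to \<open>\<rho> v\<close>.\<close>

definition gfib :: "('m, 'v) copt \<Rightarrow> ('f \<times> ('m, 'v) copt tvec) set" where
  "gfib q = {z. fst z \<in> fib F (fst q) \<and> snd z \<in> tspace Q q \<and>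
     (\<forall>u. smooth_near M (fst q) u \<longrightarrow> snd z (\<lambda>p. u (fst p)) = \<rho> (fst q) (fst z) u)}"

lemma fib_F_subspace: "x \<in> pts M \<Longrightarrow> subspace (fib F x)"
proof -
  assume "x \<in> pts M"
  then obtain t where "t \<in> frames F" "x \<in> fst t" using F_cover by blast
  then show "subspace (fib F x)" using basis.subspace[OF basis.intro[OF F_basis]] by blast
qed

lemma \<rho>_sum:
  assumes x: "x \<in> pts M"
  shows "(\<And>a. a \<in> J \<Longrightarrow> f a \<in> fib F x) \<Longrightarrow> \<rho> x (\<Sum>a\<in>J. k a *\<^sub>R f a) = (\<Sum>a\<in>J. k a *\<^sub>R \<rho> x (f a))"
proof (induction J rule: infinite_finite_induct)
  case (insert a J)
  have "k a *\<^sub>R f a \<in> fib F x" "(\<Sum>a\<in>J. k a *\<^sub>R f a) \<in> fib F x"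
    using insert fib_F_subspace[OF x] by (auto intro!: subspace_scale subspace_sum)
  then show ?case using insert x by (simp add: \<rho>_add \<rho>_scale)
qed (use \<rho>_scale[OF x subspace_0[OF fib_F_subspace[OF x]], of 0] in auto)

lemma gfib_subspace:
  assumes q: "q \<in> pts Q"
  shows "subspace (gfib q)"
proof -
  have x: "fst q \<in> pts M" using q by (simp add: pts_Q)
  note F = fib_F_subspace[OF x]
  have \<rho>0: "\<rho> (fst q) 0 = 0" using \<rho>_scale[OF x subspace_0[OF F], of 0] by simp
  show ?thesis
    unfolding subspace_def
  proof (intro conjI ballI allI)
    show "0 \<in> gfib q"
      using subspace_0[OF F] subspace_0[OF Q.tspace_subspace] \<rho>0 by (simp add: gfib_def)
    show "z + z' \<in> gfib q" if "z \<in> gfib q" "z' \<in> gfib q" for z z'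
      using that subspace_add[OF F] subspace_add[OF Q.tspace_subspace] \<rho>_add[OF x] by (simp add: gfib_def)
    show "k *\<^sub>R z \<in> gfib q" if "z \<in> gfib q" for k z
      using that subspace_scale[OF F] subspace_scale[OF Q.tspace_subspace] \<rho>_scale[OF x]
      by (simp add: gfib_def scaleR_fun_def)
  qed
qed

text \<open>On a function of the base point, the second component is the combination of the d/dx^i
  with coefficients \<open>anchor_comp\<close>, which is the anchor of the first component in
  coordinates.\<close>

lemma del_h_gfib:
  assumes c: "c \<in> charts M" and e: "e \<in> frames E" and t: "t \<in> frames F"
    and q: "q \<in> ndom (gb c e t)" and \<alpha>: "\<alpha> < m"
  shows "del_h (gb c e t) \<alpha> q \<in> gfib q"
proof -
  have q': "q \<in> fst (dc c e)" "fst q \<in> fst t" using q by (simp_all add: gb_simps)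
  note C = dc_charts[OF c e]
  have xc: "fst q \<in> fst c" using q' by (simp add: fst_dc)
  have x: "fst q \<in> pts M" using M.chart_subset_pts[OF c] xc by blast
  have v: "snd t \<alpha> (fst q) \<in> fib F (fst q)"
    using basis.basis_mem[OF basis.intro[OF F_basis[OF t q'(2)]] \<alpha>] .
  define w where "w = (\<Sum>i<n. anchor_comp \<rho> c t \<alpha> i (fst q) *\<^sub>R coord_vec Q (dc c e) i q)"
  have w: "w \<in> tspace Q q"
    unfolding w_def by (intro subspace_sum subspace_scale Q.tspace_subspace Q.coord_vec_mem[OF C q'(1)]) simp
  have "w (\<lambda>p. u (fst p)) = \<rho> (fst q) (snd t \<alpha> (fst q)) u" if u: "smooth_near M (fst q) u" for u
  proof -
    have "w (\<lambda>p. u (fst p)) = (\<Sum>i<n. anchor_comp \<rho> c t \<alpha> i (fst q) * coord_vec M c i (fst q) u)"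
      unfolding w_def sum_apply_fun scaleR_fun_def real_scaleR_def
      by (intro sum.cong refl arg_cong2[where f = "(*)"]) (simp add: coord_vec_pullback[OF c e q'(1) _ u])
    also have "\<dots> = \<rho> (fst q) (snd t \<alpha> (fst q)) u"
      unfolding anchor_comp_def by (rule M.tspace_apply[OF c xc \<rho>_mem[OF x v], symmetric])
    finally show ?thesis .
  qed
  then show ?thesis using v w by (simp add: gfib_def gb_simps w_def)
qed

lemma del_v_gfib:
  assumes c: "c \<in> charts M" and e: "e \<in> frames E"
    and q: "q \<in> fst (dc c e)" and a: "a < r"
  shows "del_v (gb c e t) a q \<in> gfib q"
proof -
  have "fst q \<in> fst c" using q by (simp add: fst_dc)
  then have x: "fst q \<in> pts M" using M.chart_subset_pts[OF c] by blast
  have "\<rho> (fst q) 0 = 0" using \<rho>_scale[OF x subspace_0[OF fib_F_subspace[OF x]], of 0] by simp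
  then show ?thesis
    using a subspace_0[OF fib_F_subspace[OF x]] Q.coord_vec_mem[OF dc_charts[OF c e] q]
      coord_vec_pullback[OF c e q, of "n + a"]
    by (simp add: gfib_def gb_simps)
qed

text \<open>The projection condition forces the base coordinates of the second component, which are
  those of the anchor of the first. Free are only the coordinates of the first component in the
  frame of F and the p_a-coordinates of the second.\<close>

lemma gfib_expand:
  assumes c: "c \<in> charts M" and e: "e \<in> frames E" and t: "t \<in> frames F"
    and q: "q \<in> ndom (gb c e t)" and z: "z \<in> gfib q"
  shows "z = (\<Sum>\<alpha><m. dual_basis m (\<lambda>a. snd t a (fst q)) \<alpha> (fst z) *\<^sub>R del_h (gb c e t) \<alpha> q) +
    (\<Sum>a<r. snd z (\<lambda>p. snd (dc c e) p (n + a)) *\<^sub>R del_v (gb c e t) a q)"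
proof -
  have q': "q \<in> fst (dc c e)" "fst q \<in> fst t" using q by (simp_all add: gb_simps)
  note C = dc_charts[OF c e]
  have qp: "q \<in> pts Q" using Q.chart_subset_pts[OF C] q'(1) by blast
  have xc: "fst q \<in> fst c" using q' by (simp add: fst_dc)
  have x: "fst q \<in> pts M" using M.chart_subset_pts[OF c] xc by blast
  interpret t: basis m "\<lambda>a. snd t a (fst q)" "fib F (fst q)" by standard (rule F_basis[OF t q'(2)])
  have v: "fst z \<in> fib F (fst q)" and w: "snd z \<in> tspace Q q" using z by (auto simp: gfib_def)
  define k where "k \<alpha> = dual_basis m (\<lambda>a. snd t a (fst q)) \<alpha> (fst z)" for \<alpha>
  have coord: "snd z (\<lambda>p. snd (dc c e) p i) = (\<Sum>\<alpha><m. k \<alpha> * anchor_comp \<rho> c t \<alpha> i (fst q))" if i: "i < n" for i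
  proof -
    have "snd z (\<lambda>p. snd (dc c e) p i) = snd z (\<lambda>p. snd c (fst p) i)"
      by (rule Q.tspace_cong[OF qp w eq_near_coordinate[OF c e q'(1) i]])
    also have "\<dots> = \<rho> (fst q) (fst z) (\<lambda>x. snd c x i)"
      using z M.smooth_near_coordinate[OF c xc, of i] unfolding gfib_def by blast
    also have "fst z = (\<Sum>\<alpha><m. k \<alpha> *\<^sub>R snd t \<alpha> (fst q))" using t.expand[OF v] by (simp add: k_def)
    also have "\<rho> (fst q) \<dots> = (\<Sum>\<alpha><m. k \<alpha> *\<^sub>R \<rho> (fst q) (snd t \<alpha> (fst q)))"
      by (rule \<rho>_sum[OF x]) (simp add: t.basis_mem)
    finally show ?thesis by (simp add: sum_apply_fun scaleR_fun_def anchor_comp_def)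
  qed
  have "snd z = (\<Sum>i<n + r. snd z (\<lambda>p. snd (dc c e) p i) *\<^sub>R coord_vec Q (dc c e) i q)"
    using Q.tspace_expand(1)[OF C q'(1) w] by simp
  also have "\<dots> = (\<Sum>i<n. \<Sum>\<alpha><m. (k \<alpha> * anchor_comp \<rho> c t \<alpha> i (fst q)) *\<^sub>R coord_vec Q (dc c e) i q) +
      (\<Sum>a<r. snd z (\<lambda>p. snd (dc c e) p (n + a)) *\<^sub>R coord_vec Q (dc c e) (n + a) q)"
    by (simp add: sum_lessThan_add coord scaleR_sum_left)
  also have "(\<Sum>i<n. \<Sum>\<alpha><m. (k \<alpha> * anchor_comp \<rho> c t \<alpha> i (fst q)) *\<^sub>R coord_vec Q (dc c e) i q) =
      (\<Sum>\<alpha><m. k \<alpha> *\<^sub>R (\<Sum>i<n. anchor_comp \<rho> c t \<alpha> i (fst q) *\<^sub>R coord_vec Q (dc c e) i q))"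
    by (subst sum.swap) (simp add: scaleR_sum_right)
  finally have 2: "snd z = (\<Sum>\<alpha><m. k \<alpha> *\<^sub>R (\<Sum>i<n. anchor_comp \<rho> c t \<alpha> i (fst q) *\<^sub>R coord_vec Q (dc c e) i q)) +
      (\<Sum>a<r. snd z (\<lambda>p. snd (dc c e) p (n + a)) *\<^sub>R coord_vec Q (dc c e) (n + a) q)" .
  have 1: "fst z = (\<Sum>\<alpha><m. k \<alpha> *\<^sub>R snd t \<alpha> (fst q))" using t.expand[OF v] by (simp add: k_def)
  show ?thesis
    unfolding k_def[symmetric]
  proof (rule prod_eqI)
    show "fst z = fst ((\<Sum>\<alpha><m. k \<alpha> *\<^sub>R del_h (gb c e t) \<alpha> q) +
        (\<Sum>a<r. snd z (\<lambda>p. snd (dc c e) p (n + a)) *\<^sub>R del_v (gb c e t) a q))"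
      unfolding fst_add fst_sum by (simp add: gb_simps 1[symmetric])
    show "snd z = snd ((\<Sum>\<alpha><m. k \<alpha> *\<^sub>R del_h (gb c e t) \<alpha> q) +
        (\<Sum>a<r. snd z (\<lambda>p. snd (dc c e) p (n + a)) *\<^sub>R del_v (gb c e t) a q))"
      unfolding snd_add snd_sum by (simp add: gb_simps 2[symmetric])
  qed
qed

text \<open>Spanning is the expansion just obtained. For independence, the first components make the
  horizontal coefficients vanish; then the second components are combinations of the d/dp_a
  alone.\<close>

lemma gb_basis:
  assumes c: "c \<in> charts M" and e: "e \<in> frames E" and t: "t \<in> frames F" and q: "q \<in> ndom (gb c e t)"
  shows "is_basis (m + r) (\<lambda>k. join_frame m (del_h (gb c e t)) (del_v (gb c e t)) k q) (gfib q)"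
proof (rule is_basisI)
  let ?j = "\<lambda>k. join_frame m (del_h (gb c e t)) (del_v (gb c e t)) k q"
  have q': "q \<in> fst (dc c e)" "fst q \<in> fst t" using q by (simp_all add: gb_simps)
  note C = dc_charts[OF c e]
  have qp: "q \<in> pts Q" using Q.chart_subset_pts[OF C] q'(1) by blast
  have h: "del_h (gb c e t) \<alpha> q \<in> span (?j ` {..<m + r})" if "\<alpha> < m" for \<alpha>
    using that by (intro span_base image_eqI[of _ _ \<alpha>]) auto
  have v: "del_v (gb c e t) a q \<in> span (?j ` {..<m + r})" if "a < r" for a
    using that by (intro span_base image_eqI[of _ _ "m + a"]) auto
  have "?j k \<in> gfib q" if "k < m + r" for k
    using that del_h_gfib[OF c e t q] del_v_gfib[OF c e q'(1), of "k - m" t] by (simp add: join_frame_def)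
  then have "span (?j ` {..<m + r}) \<subseteq> gfib q"
    by (intro span_minimal gfib_subspace[OF qp]) blast
  moreover have "z \<in> span (?j ` {..<m + r})" if "z \<in> gfib q" for z
    by (subst gfib_expand[OF c e t q that]) (intro span_add span_sum span_scale h v, auto)
  ultimately show "gfib q = span (?j ` {..<m + r})" by blast
  fix k a assume 0: "(\<Sum>a<m + r. k a *\<^sub>R ?j a) = 0" and a: "a < m + r"
  interpret t: basis m "\<lambda>a. snd t a (fst q)" "fib F (fst q)" by standard (rule F_basis[OF t q'(2)])
  interpret w: basis "n + r" "\<lambda>i. coord_vec Q (dc c e) i q" "tspace Q q"
    by standard (use Q.coord_vec_basis[OF C q'(1)] in simp)
  have 1: "(\<Sum>\<alpha><m. k \<alpha> *\<^sub>R snd t \<alpha> (fst q)) = 0"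
    using arg_cong[OF 0, of fst] unfolding fst_sum by (simp add: sum_lessThan_add gb_simps)
  have kh: "k \<alpha> = 0" if "\<alpha> < m" for \<alpha>
    using t.dual_basis_unique[OF that, of k] dual_space_0[OF t.dual_basis_mem] unfolding 1 by simp
  have "(\<Sum>i<n + r. (if i < n then 0 else k (m + (i - n))) *\<^sub>R coord_vec Q (dc c e) i q) = 0"
    using arg_cong[OF 0, of snd] kh unfolding snd_sum by (simp add: sum_lessThan_add gb_simps)
  note 2 = this
  have kv: "k (m + b) = 0" if "b < r" for b
    using w.dual_basis_unique[of "n + b" "\<lambda>i. if i < n then 0 else k (m + (i - n))"] that
      dual_space_0[OF w.dual_basis_mem] unfolding 2 by simp
  show "k a = 0"
  proof (cases "a < m")
    case False
    then show ?thesis using kv[of "a - m"] a by simp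
  qed (rule kh)
qed

text \<open>Coordinates in a natural base are read off directly from the two components of an
  element. Applied to the vectors of another natural base, this makes the transition matrix
  explicit.\<close>

lemma gb_dual:
  assumes c: "c \<in> charts M" and e: "e \<in> frames E" and t: "t \<in> frames F" and q: "q \<in> ndom (gb c e t)"
    and z: "z \<in> gfib q"
  shows "\<alpha> < m \<Longrightarrow> dual_basis (m + r) (\<lambda>k. join_frame m (del_h (gb c e t)) (del_v (gb c e t)) k q) \<alpha> z =
      dual_basis m (\<lambda>a. snd t a (fst q)) \<alpha> (fst z)"
    "a < r \<Longrightarrow> dual_basis (m + r) (\<lambda>k. join_frame m (del_h (gb c e t)) (del_v (gb c e t)) k q) (m + a) z =
      snd z (\<lambda>p. snd (dc c e) p (n + a))"
proof -
  interpret j: basis "m + r" "\<lambda>k. join_frame m (del_h (gb c e t)) (del_v (gb c e t)) k q" "gfib q"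
    by standard (rule gb_basis[OF c e t q])
  define k where "k i = (if i < m then dual_basis m (\<lambda>a. snd t a (fst q)) i (fst z)
    else snd z (\<lambda>p. snd (dc c e) p (n + (i - m))))" for i
  have "z = (\<Sum>i<m + r. k i *\<^sub>R join_frame m (del_h (gb c e t)) (del_v (gb c e t)) i q)"
    using gfib_expand[OF c e t q z] by (simp add: sum_lessThan_add k_def)
  then have *: "dual_basis (m + r) (\<lambda>k. join_frame m (del_h (gb c e t)) (del_v (gb c e t)) k q) i z = k i"
    if "i < m + r" for i
    using j.dual_basis_unique[OF that, of k] by simp
  show "\<alpha> < m \<Longrightarrow> dual_basis (m + r) (\<lambda>k. join_frame m (del_h (gb c e t)) (del_v (gb c e t)) k q) \<alpha> z =
      dual_basis m (\<lambda>a. snd t a (fst q)) \<alpha> (fst z)"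
    using *[of \<alpha>] by (simp add: k_def)
  show "a < r \<Longrightarrow> dual_basis (m + r) (\<lambda>k. join_frame m (del_h (gb c e t)) (del_v (gb c e t)) k q) (m + a) z =
      snd z (\<lambda>p. snd (dc c e) p (n + a))"
    using *[of "m + a"] by (simp add: k_def)
qed

lemma gtb_basesE:
  assumes "N \<in> gtb_bases M E F \<rho>"
  obtains c e t where "c \<in> charts M" "e \<in> frames E" "t \<in> frames F" "N = gb c e t"
  using assms unfolding gtb_bases_def by (elim CollectE exE conjE)

lemma gtb_basesI: "c \<in> charts M \<Longrightarrow> e \<in> frames E \<Longrightarrow> t \<in> frames F \<Longrightarrow> gb c e t \<in> gtb_bases M E F \<rho>"
  unfolding gtb_bases_def by (intro CollectI exI conjI) (rule refl)

lemma gtb_base_at: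
  assumes q: "q \<in> pts Q"
  obtains c e t where "c \<in> charts M" "e \<in> frames E" "t \<in> frames F" "q \<in> ndom (gb c e t)"
proof -
  obtain c e where ce: "c \<in> charts M" "e \<in> frames E" "q \<in> fst (dc c e)" by (rule pts_Q_chart[OF q])
  have "fst q \<in> pts M" using q by (simp add: pts_Q)
  then obtain t where "t \<in> frames F" "fst q \<in> fst t" using F_cover by blast
  then show ?thesis using that ce by (simp add: gb_simps)
qed

text \<open>\<open>gtb_fib\<close> is a span over all choices of charts and frames, while
  \<open>gfib\<close> mentions none of them. As every natural base lies in \<open>gfib\<close> and a
  single one spans it, the two coincide.\<close>

lemma gtb_fib_eq:
  assumes q: "q \<in> pts Q"
  shows "gtb_fib M E F \<rho> q = gfib q"
proof
  show "gtb_fib M E F \<rho> q \<subseteq> gfib q"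
    unfolding gtb_fib_def
  proof (intro span_minimal gfib_subspace[OF q] Un_least; rule subsetI; elim CollectE exE conjE)
    fix z N \<alpha> assume z: "z = del_h N \<alpha> q" and N: "N \<in> gtb_bases M E F \<rho>" and qN: "q \<in> ndom N" and \<alpha>: "\<alpha> < m"
    obtain c e t where *: "c \<in> charts M" "e \<in> frames E" "t \<in> frames F" "N = gb c e t" by (rule gtb_basesE[OF N])
    show "z \<in> gfib q" unfolding z *(4) by (rule del_h_gfib[OF *(1-3) qN[unfolded *(4)] \<alpha>])
  next
    fix z N a assume z: "z = del_v N a q" and N: "N \<in> gtb_bases M E F \<rho>" and qN: "q \<in> ndom N" and a: "a < r"
    obtain c e t where *: "c \<in> charts M" "e \<in> frames E" "t \<in> frames F" "N = gb c e t" by (rule gtb_basesE[OF N])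
    have "q \<in> fst (dc c e)" using qN unfolding *(4) gb_simps(1) by blast
    then show "z \<in> gfib q" unfolding z *(4) by (rule del_v_gfib[OF *(1,2) _ a])
  qed
  obtain c e t where *: "c \<in> charts M" "e \<in> frames E" "t \<in> frames F" "q \<in> ndom (gb c e t)" by (rule gtb_base_at[OF q])
  note N = gtb_basesI[OF *(1-3)]
  show "gfib q \<subseteq> gtb_fib M E F \<rho> q"
  proof
    fix z assume z: "z \<in> gfib q"
    show "z \<in> gtb_fib M E F \<rho> q"
      unfolding gtb_fib_def
      by (subst gfib_expand[OF * z], intro span_add span_sum span_scale span_base)
        (use N *(4) in blast)+
  qed
qed

end

locale lie_algebroid_bundle = anchored_bundle M E F \<rho>
  for M :: "'m mfd" and E :: "('m, 'v::real_vector) vbundle"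
    and F :: "('m, 'f::real_vector) vbundle" and \<rho> :: "'m \<Rightarrow> 'f \<Rightarrow> 'm tvec" +
  assumes F_compat: "t \<in> frames F \<Longrightarrow> t' \<in> frames F \<Longrightarrow> frame_compat M (rank F) t t'"
    and \<rho>_smooth: "t \<in> frames F \<Longrightarrow> \<alpha> < rank F \<Longrightarrow>
      smooth_section M (tangent_bundle M) (fst t) (\<lambda>x. \<rho> x (snd t \<alpha> x))"
begin

lemma anchor_comp_smooth:
  assumes c: "c \<in> charts M" and t: "t \<in> frames F" and \<alpha>: "\<alpha> < m" and i: "i < n"
  shows "smooth_fun M (fst t \<inter> fst c) (anchor_comp \<rho> c t \<alpha> i)"
proof -
  have "smooth_fun M (fst t \<inter> fst c) (\<lambda>x. coframe n (coord_vec M c) i x (\<rho> x (snd t \<alpha> x)))"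
    using \<rho>_smooth[OF t \<alpha>] M.tangent_frame[OF c] i unfolding smooth_section_def
    by (fastforce simp: tangent_bundle_def)
  then show ?thesis
  proof (rule M.smooth_fun_eqI[rotated])
    show "openin (mtop M) (fst t \<inter> fst c)" using F_open[OF t] M.openin_chart[OF c] by (rule openin_Int)
    fix x assume x: "x \<in> fst t \<inter> fst c"
    then have xp: "x \<in> pts M" using M.chart_subset_pts[OF c] by blast
    have "snd t \<alpha> x \<in> fib F x"
      using basis.basis_mem[OF basis.intro[OF F_basis[OF t]] \<alpha>, of x] x by simp
    then show "anchor_comp \<rho> c t \<alpha> i x = coframe n (coord_vec M c) i x (\<rho> x (snd t \<alpha> x))"
      using M.tspace_expand(2)[OF c _ \<rho>_mem[OF xp] i] x by (simp add: anchor_comp_def coframe_eq)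
  qed
qed

text \<open>The transition matrix has four blocks: the frame change of F pulled back from M, the
  zero block for vertical vectors, sums of anchor components times Jacobian entries, and Jacobian
  entries of the fibre coordinates.\<close>

lemma gtb_frame_compat:
  assumes c: "c \<in> charts M" and e: "e \<in> frames E" and t: "t \<in> frames F"
    and c': "c' \<in> charts M" and e': "e' \<in> frames E" and t': "t' \<in> frames F"
    and kl: "k < m + r" "l < m + r"
  shows "smooth_fun Q (ndom (gb c e t) \<inter> ndom (gb c' e' t'))
    (\<lambda>q. dual_basis (m + r) (\<lambda>k. join_frame m (del_h (gb c e t)) (del_v (gb c e t)) k q) k
      (join_frame m (del_h (gb c' e' t')) (del_v (gb c' e' t')) l q))"
proof -
  let ?W = "ndom (gb c e t) \<inter> ndom (gb c' e' t')"
  let ?d = "\<lambda>q. dual_basis (m + r) (\<lambda>k. join_frame m (del_h (gb c e t)) (del_v (gb c e t)) k q)"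
  note C = dc_charts[OF c e] and C' = dc_charts[OF c' e']
  have ndom: "ndom (gb c e t) = fst (dc c e) \<inter> {q \<in> pts Q. fst q \<in> fst t}"
    if "c \<in> charts M" "e \<in> frames E" for c e and t :: "('m, 'f) frame"
    using Q.chart_subset_pts[OF dc_charts[OF that]] by (auto simp: gb_simps(1))
  have W: "openin (mtop Q) ?W"
    unfolding ndom[OF c e] ndom[OF c' e']
    by (intro openin_Int Q.openin_chart C C' openin_pullback F_open t t')
  have Wx: "q \<in> ndom (gb c e t)" "q \<in> ndom (gb c' e' t')" "q \<in> fst (dc c e)" "q \<in> fst (dc c' e')"
    "fst q \<in> fst t" "fst q \<in> fst t'" "fst q \<in> fst c'" "q \<in> pts Q" if "q \<in> ?W" for q
    using that Q.chart_subset_pts[OF C] by (auto simp: gb_simps(1) fst_dc)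
  have h: "del_h (gb c' e' t') \<beta> q \<in> gfib q" if "q \<in> ?W" "\<beta> < m" for q \<beta>
    by (rule del_h_gfib[OF c' e' t' Wx(2)[OF that(1)] that(2)])
  have v: "del_v (gb c' e' t') b q \<in> gfib q" if "q \<in> ?W" "b < r" for q b
    by (rule del_v_gfib[OF c' e' Wx(4)[OF that(1)] that(2)])
  have pull: "smooth_fun Q ?W (\<lambda>q. u (fst q))"
    if "smooth_fun M U u" "openin (mtop M) U" "\<And>q. q \<in> ?W \<Longrightarrow> fst q \<in> U" for u U
    by (rule Q.smooth_fun_subset[OF smooth_fun_pullback[OF that(2,1)]]) (use that(3) Wx(8) in blast)
  have jac: "smooth_fun Q ?W (\<lambda>q. coord_vec Q (dc c' e') i q (\<lambda>p. snd (dc c e) p j))" if "i < n + r" for i j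
    by (rule Q.smooth_fun_subset[OF Q.smooth_fun_coord_vec[OF C' Q.smooth_fun_coordinate[OF C] Q.openin_chart[OF C]]])
      (use that Wx in auto)
  show ?thesis
  proof (cases "k < m"; cases "l < m")
    assume k: "k < m" and l: "l < m"
    have "smooth_fun M (fst t \<inter> fst t') (\<lambda>x. dual_basis m (\<lambda>a. snd t a x) k (snd t' l x))"
      using F_compat[OF t t'] k l unfolding frame_compat_def coframe_eq by blast
    then have "smooth_fun Q ?W (\<lambda>q. dual_basis m (\<lambda>a. snd t a (fst q)) k (snd t' l (fst q)))"
      by (rule pull) (intro openin_Int F_open t t', use Wx in blast)
    then show ?thesis
    proof (rule Q.smooth_fun_eqI[OF W])
      fix q assume q: "q \<in> ?W"
      show "?d q k (join_frame m (del_h (gb c' e' t')) (del_v (gb c' e' t')) l q) =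
          dual_basis m (\<lambda>a. snd t a (fst q)) k (snd t' l (fst q))"
        using gb_dual(1)[OF c e t Wx(1)[OF q] h[OF q l] k] l by (simp add: gb_simps(2))
    qed
  next
    assume k: "k < m" and l: "\<not> l < m"
    define b where "b = l - m"
    have b: "b < r" "l = m + b" using l kl(2) by (auto simp: b_def)
    show ?thesis
    proof (rule Q.smooth_fun_eqI[OF W Q.smooth_fun_const[OF W, of 0]])
      fix q assume q: "q \<in> ?W"
      have "dual_basis m (\<lambda>a. snd t a (fst q)) k 0 = 0"
        by (rule dual_space_0[OF basis.dual_basis_mem[OF basis.intro[OF F_basis[OF t Wx(5)[OF q]]]]])
      then show "?d q k (join_frame m (del_h (gb c' e' t')) (del_v (gb c' e' t')) l q) = 0"
        using gb_dual(1)[OF c e t Wx(1)[OF q] v[OF q b(1)] k] b(2) by (simp add: gb_simps(3))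
    qed
  next
    assume k: "\<not> k < m" and l: "l < m"
    define a where "a = k - m"
    have a: "a < r" "k = m + a" using k kl(1) by (auto simp: a_def)
    have "smooth_fun Q ?W (\<lambda>q. \<Sum>i<n. anchor_comp \<rho> c' t' l i (fst q) * coord_vec Q (dc c' e') i q (\<lambda>p. snd (dc c e) p (n + a)))"
    proof (intro Q.smooth_fun_sum Q.smooth_fun_mult W jac)
      fix i assume "i \<in> {..<n}"
      then have i: "i < n" by simp
      show "smooth_fun Q ?W (\<lambda>q. anchor_comp \<rho> c' t' l i (fst q))"
        by (rule pull[OF anchor_comp_smooth[OF c' t' l i]])
          (intro openin_Int F_open t' M.openin_chart c', use Wx in blast)
      show "i < n + r" using i by simp
    qed
    then show ?thesis
    proof (rule Q.smooth_fun_eqI[OF W])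
      fix q assume q: "q \<in> ?W"
      show "?d q k (join_frame m (del_h (gb c' e' t')) (del_v (gb c' e' t')) l q) =
          (\<Sum>i<n. anchor_comp \<rho> c' t' l i (fst q) * coord_vec Q (dc c' e') i q (\<lambda>p. snd (dc c e) p (n + a)))"
        using gb_dual(2)[OF c e t Wx(1)[OF q] h[OF q l] a(1)] l a(2)
        by (simp add: gb_simps(2) sum_apply_fun scaleR_fun_def)
    qed
  next
    assume k: "\<not> k < m" and l: "\<not> l < m"
    define a where "a = k - m"
    have a: "a < r" "k = m + a" using k kl(1) by (auto simp: a_def)
    define b where "b = l - m"
    have b: "b < r" "l = m + b" using l kl(2) by (auto simp: b_def)
    have "n + b < n + r" using b by simp
    then show ?thesis
    proof (rule Q.smooth_fun_eqI[OF W jac])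
      fix q assume q: "q \<in> ?W"
      show "?d q k (join_frame m (del_h (gb c' e' t')) (del_v (gb c' e' t')) l q) =
          coord_vec Q (dc c' e') (n + b) q (\<lambda>p. snd (dc c e) p (n + a))"
        using gb_dual(2)[OF c e t Wx(1)[OF q] v[OF q b(1)] a(1)] a(2) b(2) by (simp add: gb_simps(3))
    qed
  qed
qed

lemma gtb_gen_tangent_bundle: "gen_tangent_bundle S"
proof
  have nf: "nat_frame S N = (ndom N, join_frame m (del_h N) (del_v N))" for N
    by (simp add: nat_frame_def S_simps)
  show "is_chart (mdim (base S)) c" if "c \<in> charts (base S)" for c
    using that Q.is_chart unfolding S_simps by blast
  show "chart_compat (mdim (base S)) c d" if "c \<in> charts (base S)" "d \<in> charts (base S)" for c d
    using that Q.compat unfolding S_simps by blast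
  show "Hausdorff_space (mtop (base S))" unfolding S_simps by (rule Q_hausdorff)
  show "rank (gbundle S) = hrank S + vrank S" by (simp add: S_simps)
  have "{(ndom N, join_frame m (del_h N) (del_v N)) |N. N \<in> gtb_bases M E F \<rho>} = nat_frame S ` nat_bases S"
    unfolding S_simps(5) image_def nf by blast
  then show "frames (gbundle S) = gen_frames (base S) (hrank S + vrank S) (fib (gbundle S)) (nat_frame S ` nat_bases S)"
    by (simp add: gtb_def)
  show "local_frame (base S) (hrank S + vrank S) (fib (gbundle S)) (nat_frame S N)" if NS: "N \<in> nat_bases S" for N
  proof -
    obtain c e t where *: "c \<in> charts M" "e \<in> frames E" "t \<in> frames F" "N = gb c e t"
      by (rule gtb_basesE[OF NS[unfolded S_simps]])
    have sub: "ndom (gb c e t) = fst (dc c e) \<inter> {q \<in> pts Q. fst q \<in> fst t}"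
      using Q.chart_subset_pts[OF dc_charts[OF *(1,2)]] by (auto simp: gb_simps(1))
    have "openin (mtop Q) (ndom N)"
      unfolding *(4) sub by (intro openin_Int Q.openin_chart dc_charts openin_pullback F_open *)
    moreover have "is_basis (m + r) (\<lambda>k. join_frame m (del_h N) (del_v N) k q) (gtb_fib M E F \<rho> q)" if q: "q \<in> ndom N" for q
    proof -
      have qp: "q \<in> pts Q" using q unfolding *(4) sub by blast
      show ?thesis
        unfolding gtb_fib_eq[OF qp] *(4) by (rule gb_basis[OF *(1-3) q[unfolded *(4)]])
    qed
    ultimately show ?thesis by (simp add: local_frame_iff nf S_simps)
  qed
  show "frame_compat (base S) (hrank S + vrank S) (nat_frame S N) (nat_frame S N')"
    if N: "N \<in> nat_bases S" "N' \<in> nat_bases S" for N N'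
  proof -
    obtain c e t where *: "c \<in> charts M" "e \<in> frames E" "t \<in> frames F" "N = gb c e t"
      by (rule gtb_basesE[OF N(1)[unfolded S_simps]])
    obtain c' e' t' where **: "c' \<in> charts M" "e' \<in> frames E" "t' \<in> frames F" "N' = gb c' e' t'"
      by (rule gtb_basesE[OF N(2)[unfolded S_simps]])
    show ?thesis
      unfolding frame_compat_def nf S_simps fst_conv snd_conv coframe_eq *(4) **(4)
      by (intro allI impI gtb_frame_compat[OF *(1-3) **(1-3)])
  qed
  show "coframe (hrank S + vrank S) (snd (nat_frame S N)) \<alpha> q (del_v N' b q) = 0"
    if N: "N \<in> nat_bases S" "N' \<in> nat_bases S" and q: "q \<in> ndom N" "q \<in> ndom N'"
      and \<alpha>: "\<alpha> < hrank S" and b: "b < vrank S" for N N' q \<alpha> b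
  proof -
    obtain c e t where *: "c \<in> charts M" "e \<in> frames E" "t \<in> frames F" "N = gb c e t"
      by (rule gtb_basesE[OF N(1)[unfolded S_simps]])
    obtain c' e' t' where **: "c' \<in> charts M" "e' \<in> frames E" "t' \<in> frames F" "N' = gb c' e' t'"
      by (rule gtb_basesE[OF N(2)[unfolded S_simps]])
    have q1: "q \<in> ndom (gb c e t)" and q2: "q \<in> fst (dc c' e')" and qt: "fst q \<in> fst t"
      using q unfolding *(4) **(4) gb_simps(1) by blast+
    note \<alpha> = \<alpha>[unfolded S_simps] and b = b[unfolded S_simps]
    have "dual_basis m (\<lambda>a. snd t a (fst q)) \<alpha> 0 = 0"
      by (rule dual_space_0[OF basis.dual_basis_mem[OF basis.intro[OF F_basis[OF *(3) qt]]]])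
    then show ?thesis
      using gb_dual(1)[OF *(1-3) q1 del_v_gfib[OF **(1,2) q2 b, of t'] \<alpha>]
      by (simp add: nf S_simps coframe_eq *(4) **(4) gb_simps(3))
  qed
  show "\<exists>N\<in>nat_bases S. q \<in> ndom N" if qp: "q \<in> pts (base S)" for q
  proof -
    obtain c e t where "c \<in> charts M" "e \<in> frames E" "t \<in> frames F" "q \<in> ndom (gb c e t)"
      by (rule gtb_base_at[OF qp[unfolded S_simps]])
    then show ?thesis unfolding S_simps by (intro bexI[OF _ gtb_basesI])
  qed
  show "anchor S w u = anchor S w u'"
    if "q \<in> pts (base S)" "w \<in> fib (gbundle S) q" "eq_near (base S) q u u'" for q w u u'
  proof -
    note * = that[unfolded S_simps]
    have "snd w \<in> tspace Q q" using *(2) unfolding gtb_fib_eq[OF *(1)] by (simp add: gfib_def)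
    then show ?thesis unfolding S_simps by (rule Q.tspace_cong[OF *(1) _ *(3)])
  qed
qed

end

lemma lie_algebroid_bundleI:
  assumes M: "smooth_manifold M" and E: "vector_bundle M E" and L: "lie_algebroid M F br \<rho>"
  shows "lie_algebroid_bundle M E F \<rho>"
proof -
  note L = L[unfolded lie_algebroid_def]
  note F = L[THEN conjunct1, unfolded vector_bundle_def]
    and \<rho> = L[THEN conjunct2, THEN conjunct1, unfolded vb_morphism_def]
  have T: "fib (tangent_bundle M) = tspace M" by (simp add: tangent_bundle_def)
  show ?thesis
  proof
    show "smooth_manifold M" "vector_bundle M E" by (rule M, rule E)
    show "local_frame M (rank F) (fib F) t" if "t \<in> frames F" for t
      using F that by blast
    show "\<Union> (fst ` frames F) = pts M" using F by blast
    show "\<rho> x v \<in> tspace M x" if "x \<in> pts M" "v \<in> fib F x" for x v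
      using \<rho>[THEN conjunct1, rule_format, OF that(1)] that(2) unfolding T by blast
    show "\<rho> x (v + w) = \<rho> x v + \<rho> x w" if "x \<in> pts M" "v \<in> fib F x" "w \<in> fib F x" for x v w
      using \<rho>[THEN conjunct1, rule_format, OF that(1)] that(2,3) by blast
    show "\<rho> x (k *\<^sub>R v) = k *\<^sub>R \<rho> x v" if "x \<in> pts M" "v \<in> fib F x" for x k v
      using \<rho>[THEN conjunct1, rule_format, OF that(1)] that(2) by blast
    show "frame_compat M (rank F) t t'" if "t \<in> frames F" "t' \<in> frames F" for t t'
      using F that by blast
    show "smooth_section M (tangent_bundle M) (fst t) (\<lambda>x. \<rho> x (snd t \<alpha> x))"
      if "t \<in> frames F" "\<alpha> < rank F" for t \<alpha>
      using \<rho>[THEN conjunct2, rule_format, OF that] .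
  qed
qed

lemma gtb_ranks: "hrank (gtb M E F \<rho>) = rank F" "vrank (gtb M E F \<rho>) = rank E"
  by (simp_all add: gtb_def)

lemma classical_ranks: "hrank (classical_tb M E) = mdim M" "vrank (classical_tb M E) = rank E"
  by (simp_all add: classical_tb_def)

section \<open>The case F = TM: identification with the tangent bundle of the total space\<close>

context dual_bundle
begin

lemma tangent_anchored_bundle: "anchored_bundle M E (tangent_bundle M) (\<lambda>x v. v)"
proof
  show "local_frame M (rank (tangent_bundle M)) (fib (tangent_bundle M)) t" if "t \<in> frames (tangent_bundle M)" for t
    using that by (simp add: tangent_bundle_def gen_frames_def)
  show "\<Union> (fst ` frames (tangent_bundle M)) = pts M"
  proof
    show "\<Union> (fst ` frames (tangent_bundle M)) \<subseteq> pts M"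
      using M.openin_subset_pts by (force simp: tangent_bundle_def gen_frames_def local_frame_def)
    show "pts M \<subseteq> \<Union> (fst ` frames (tangent_bundle M))"
    proof
      fix x assume "x \<in> pts M"
      then obtain c where c: "c \<in> charts M" "x \<in> fst c" unfolding pts_def by blast
      show "x \<in> \<Union> (fst ` frames (tangent_bundle M))"
        by (rule UN_I[OF M.tangent_frame[OF c(1)]]) (simp add: c(2))
    qed
  qed
qed (simp_all add: tangent_bundle_def)

text \<open>With the identity as anchor, the first component of a pair is the projection of the
  second to M. So it is determined by the second component and exists for every tangent
  vector.\<close>

lemma bij_betw_snd:
  assumes q: "q \<in> pts Q"
  shows "bij_betw snd (fib (gbundle (gtb M E (tangent_bundle M) (\<lambda>x v. v))) q) (fib (gbundle (classical_tb M E)) q)"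
proof -
  interpret T: anchored_bundle M E "tangent_bundle M" "\<lambda>x v. v" by (rule tangent_anchored_bundle)
  have fib: "fib (gbundle (gtb M E (tangent_bundle M) (\<lambda>x v. v))) q = T.gfib q"
    "fib (gbundle (classical_tb M E)) q = tspace Q q"
    unfolding T.S_simps using T.gtb_fib_eq[OF q] by (simp, simp add: classical_tb_def tangent_bundle_def)
  have x: "fst q \<in> pts M" using q by (simp add: pts_Q)
  obtain c e where ce: "c \<in> charts M" "e \<in> frames E" "q \<in> fst (dc c e)" by (rule pts_Q_chart[OF q])
  have xc: "fst q \<in> fst c" using ce(3) by (simp add: fst_dc)
  show ?thesis
    unfolding fib bij_betw_def
  proof
    show "inj_on snd (T.gfib q)"
    proof (rule inj_onI)
      fix z z' assume z: "z \<in> T.gfib q" "z' \<in> T.gfib q" and eq: "snd z = snd z'"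
      have "fst z u = fst z' u" for u
      proof (cases "smooth_near M (fst q) u")
        case True
        have "fst z u = snd z (\<lambda>p. u (fst p))" using z(1) True unfolding T.gfib_def by simp
        also have "\<dots> = fst z' u" using z(2) True unfolding T.gfib_def eq by simp
        finally show ?thesis .
      next
        \<comment> \<open>Tangent vectors are 0 on functions that are not smooth near the point, so
          such functions distinguish nothing.\<close>
        case False
        have t: "fst z \<in> tspace M (fst q)" "fst z' \<in> tspace M (fst q)"
          using z unfolding T.gfib_def by (simp_all add: tangent_bundle_def)
        show ?thesis
          unfolding M.tspace_not_smooth[OF x t(1) False] M.tspace_not_smooth[OF x t(2) False] ..
      qed
      then have "fst z = fst z'" by (rule ext)
      then show "z = z'" using eq by (rule prod_eqI)
    qed
    show "snd ` T.gfib q = tspace Q q"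
    proof
      show "snd ` T.gfib q \<subseteq> tspace Q q" unfolding T.gfib_def by blast
      show "tspace Q q \<subseteq> snd ` T.gfib q"
      proof
        fix w assume w: "w \<in> tspace Q q"
        \<comment> \<open>The differential of the projection applied to w.\<close>
        define v where "v = (\<Sum>i<n. w (\<lambda>z. snd c (fst z) i) *\<^sub>R coord_vec M c i (fst q))"
        have "v \<in> tspace M (fst q)"
          unfolding v_def by (intro subspace_sum subspace_scale M.tspace_subspace M.coord_vec_mem[OF ce(1) xc]) simp
        moreover have "w (\<lambda>p. u (fst p)) = v u" if "smooth_near M (fst q) u" for u
          using tspace_pullback[OF ce w that] by (simp add: v_def sum_apply_fun scaleR_fun_def)
        ultimately have "(v, w) \<in> T.gfib q"
          using w unfolding T.gfib_def by (simp add: tangent_bundle_def)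
        then show "w \<in> snd ` T.gfib q" by (rule image_eqI[rotated]) simp
      qed
    qed
  qed
qed

text \<open>In the coordinate frame of a chart the components of the identity anchor form the
  Kronecker delta.\<close>

lemma natural_bases_correspond:
  assumes c: "c \<in> charts M" and e: "e \<in> frames E"
  defines "N \<equiv> classical_base M E c e" and "N' \<equiv> gtb_base M E (\<lambda>x v. v) c e (fst c, coord_vec M c)"
  shows "N' \<in> nat_bases (gtb M E (tangent_bundle M) (\<lambda>x v. v))" "ndom N' = ndom N"
    "q \<in> ndom N \<Longrightarrow> i < n \<Longrightarrow> snd (del_h N' i q) = del_h N i q"
    "snd (del_v N' a q) = del_v N a q"
proof -
  interpret T: anchored_bundle M E "tangent_bundle M" "\<lambda>x v. v" by (rule tangent_anchored_bundle)
  show "N' \<in> nat_bases (gtb M E (tangent_bundle M) (\<lambda>x v. v))"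
    unfolding T.S_simps N'_def by (rule T.gtb_basesI[OF c e M.tangent_frame[OF c]])
  have nd: "ndom N = fst (dc c e)" by (simp add: N_def classical_base_def ndom_def)
  show "ndom N' = ndom N"
    unfolding nd
  proof (rule equalityI; rule subsetI)
    fix q
    show "q \<in> ndom N' \<Longrightarrow> q \<in> fst (dc c e)" unfolding N'_def T.gb_simps(1) by blast
    show "q \<in> fst (dc c e) \<Longrightarrow> q \<in> ndom N'" unfolding N'_def T.gb_simps(1) by (simp add: fst_dc)
  qed
  show "snd (del_v N' a q) = del_v N a q"
    unfolding N'_def T.gb_simps(3) by (simp add: N_def classical_base_def del_v_def)
  assume q: "q \<in> ndom N" and i: "i < n"
  have xc: "fst q \<in> fst c" using q unfolding nd by (simp add: fst_dc)
  have "anchor_comp (\<lambda>x v. v) c (fst c, coord_vec M c) i j (fst q) = (if i = j then 1 else 0)" for j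
    by (simp add: anchor_comp_def M.coord_vec_coordinate[OF c xc i])
  then have "snd (del_h N' i q) = (\<Sum>j<n. if i = j then coord_vec Q (dc c e) j q else 0)"
    unfolding N'_def T.gb_simps(2) snd_conv by (intro sum.cong refl) simp
  also have "\<dots> = coord_vec Q (dc c e) i q" using i by (simp add: sum.delta)
  finally show "snd (del_h N' i q) = del_h N i q" by (simp add: N_def classical_base_def del_h_def)
qed

end

text \<open>The quantifier over \<open>D\<close> precedes the one over natural bases, which
  expresses that one global connection has the stated components in every choice. The functions
  \<open>gh'\<close> and \<open>gv'\<close> are the inverse matrices, prescribed at each point. In
  the second part, \<open>snd\<close> makes precise the identification of the two bundles and of
  their natural bases.\<close>

theorem corollary5p3:
  fixes M :: "'m mfd"
    and E :: "('m, 'v::real_vector) vbundle"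
    and F :: "('m, 'f::real_vector) vbundle"
    and br :: "('m \<Rightarrow> 'f) \<Rightarrow> ('m \<Rightarrow> 'f) \<Rightarrow> 'm \<Rightarrow> 'f"
    and \<rho> :: "'m \<Rightarrow> 'f \<Rightarrow> 'm tvec"
  assumes "smooth_manifold M" and "vector_bundle M E"
  shows
    "(let S = gtb M E F \<rho>; m = rank F; r = rank E in
      lie_algebroid M F br \<rho> \<longrightarrow>
      (\<forall>\<Gamma> D0 G. rho_connection S \<Gamma> \<and> distinguished_connection S \<Gamma> D0 \<and>
         (pseudometrical S \<Gamma> G \<or> metrical S \<Gamma> G) \<longrightarrow>
         (\<exists>D. distinguished_connection S \<Gamma> D \<and>
            (\<forall>N\<in>nat_bases S. \<forall>Hh0 Hv0 Vh0 Vv0 gh gv gh' gv'.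
               components S \<Gamma> D0 N Hh0 Hv0 Vh0 Vv0 \<and>
               metric_comps S \<Gamma> G N gh gv \<and>
               (\<forall>q\<in>ndom N. mat_inverse m (\<lambda>\<alpha> \<beta>. gh \<alpha> \<beta> q) (\<lambda>\<alpha> \<beta>. gh' \<alpha> \<beta> q) \<and>
                           mat_inverse r (\<lambda>a b. gv a b q) (\<lambda>a b. gv' a b q)) \<longrightarrow>
               components S \<Gamma> D N
                 (\<lambda>\<alpha> \<beta> \<gamma> q. Hh0 \<alpha> \<beta> \<gamma> q + 1/2 * (\<Sum>\<epsilon><m. gh' \<alpha> \<epsilon> q *
                    cov_gh S (delta S \<Gamma> N \<gamma>) (\<lambda>\<theta> \<eta>. Hh0 \<theta> \<eta> \<gamma>) gh \<epsilon> \<beta> q))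
                 (\<lambda>a b \<gamma> q. Hv0 a b \<gamma> q + 1/2 * (\<Sum>e<r. gv' b e q *
                    cov_gv S (delta S \<Gamma> N \<gamma>) (\<lambda>d d'. Hv0 d d' \<gamma>) gv e a q))
                 (\<lambda>\<alpha> \<beta> c q. Vh0 \<alpha> \<beta> c q + 1/2 * (\<Sum>\<epsilon><m. gh' \<alpha> \<epsilon> q *
                    cov_gh S (del_v N c) (\<lambda>\<theta> \<eta>. Vh0 \<theta> \<eta> c) gh \<epsilon> \<beta> q))
                 (\<lambda>a b c q. Vv0 a b c q + 1/2 * (\<Sum>e<r. gv' b e q *
                    cov_gv S (del_v N c) (\<lambda>d d'. Vv0 d d' c) gv e a q))) \<and>
            (\<forall>X\<in>sections (base S) (gbundle S). D 0 2 X G = 0))))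
     \<and>
     (let S = classical_tb M E; S' = gtb M E (tangent_bundle M) (\<lambda>x v. v);
          n = mdim M; r = rank E in
      (\<forall>q\<in>pts (dual_mfd M E). bij_betw snd (fib (gbundle S') q) (fib (gbundle S) q)) \<and>
      (\<forall>c\<in>charts M. \<forall>e\<in>frames E.
         let N = classical_base M E c e;
             N' = gtb_base M E (\<lambda>x v. v) c e (fst c, coord_vec M c) in
         N' \<in> nat_bases S' \<and> ndom N' = ndom N \<and>
         (\<forall>q\<in>ndom N. (\<forall>i<n. snd (del_h N' i q) = del_h N i q) \<and>
                     (\<forall>a<r. snd (del_v N' a q) = del_v N a q))) \<and>
      (\<forall>\<Gamma> D0 G. rho_connection S \<Gamma> \<and> distinguished_connection S \<Gamma> D0 \<and>
         (pseudometrical S \<Gamma> G \<or> metrical S \<Gamma> G) \<longrightarrow>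
         (\<exists>D. distinguished_connection S \<Gamma> D \<and>
            (\<forall>N\<in>nat_bases S. \<forall>Hh0 Hv0 Vh0 Vv0 gh gv gh' gv'.
               components S \<Gamma> D0 N Hh0 Hv0 Vh0 Vv0 \<and>
               metric_comps S \<Gamma> G N gh gv \<and>
               (\<forall>q\<in>ndom N. mat_inverse n (\<lambda>i j. gh i j q) (\<lambda>i j. gh' i j q) \<and>
                           mat_inverse r (\<lambda>a b. gv a b q) (\<lambda>a b. gv' a b q)) \<longrightarrow>
               components S \<Gamma> D N
                 (\<lambda>i j k q. Hh0 i j k q + 1/2 * (\<Sum>l<n. gh' i l q *
                    cov_gh S (delta S \<Gamma> N k) (\<lambda>h h'. Hh0 h h' k) gh l j q))
                 (\<lambda>a b k q. Hv0 a b k q + 1/2 * (\<Sum>e<r. gv' b e q *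
                    cov_gv S (delta S \<Gamma> N k) (\<lambda>d d'. Hv0 d d' k) gv e a q))
                 (\<lambda>i j c q. Vh0 i j c q + 1/2 * (\<Sum>l<n. gh' i l q *
                    cov_gh S (del_v N c) (\<lambda>h h'. Vh0 h h' c) gh l j q))
                 (\<lambda>a b c q. Vv0 a b c q + 1/2 * (\<Sum>e<r. gv' b e q *
                    cov_gv S (del_v N c) (\<lambda>d d'. Vv0 d d' c) gv e a q))) \<and>
            (\<forall>X\<in>sections (base S) (gbundle S). D 0 2 X G = 0))))"
proof -
  interpret dual_bundle M E by standard (rule assms)+
  have gtb: "gen_tangent_bundle (gtb M E F \<rho>)" if "lie_algebroid M F br \<rho>"
    by (rule lie_algebroid_bundle.gtb_gen_tangent_bundle[OF lie_algebroid_bundleI[OF assms that]])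
  note metric = gen_tangent_bundle.metric_connection_exists
  show ?thesis
    unfolding Let_def
  proof (intro conjI impI allI ballI, goal_cases)
    case (1 \<Gamma> D0 G)
    then show ?case
      by (elim conjE) (rule metric[OF gtb, unfolded gtb_ranks])
  next
    case (2 q)
    then show ?case by (rule bij_betw_snd)
  next
    case (3 c e)
    then show ?case by (rule natural_bases_correspond(1))
  next
    case (4 c e)
    then show ?case by (rule natural_bases_correspond(2))
  next
    case (5 c e q i)
    then show ?case by (rule natural_bases_correspond(3))
  next
    case (6 c e q a)
    show ?case by (rule natural_bases_correspond(4)[OF 6(1,2)])
  next
    case (7 \<Gamma> D0 G)
    then show ?case
      by (elim conjE) (rule metric[OF classical_gen_tangent_bundle, unfolded classical_ranks])
  qed
qed

end
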